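(* Let $K$ be a field and $Q$ a rooted tree quiver. The rank functions on $Q$ give an isomorphism of rings $$R(Q)_{red}\xrightarrow{\ \sim\ }\prod_{M\in L_Q}\mathbb{Z},\qquad \overline{V}\mapsto\bigl(r_M(V)\bigr)_{M\in L_Q}.$$ In particular, $R(Q)_{red}$ is a finitely generated $\mathbb{Z}$-module.
   Context: Fix a field $K$. A quiver $Q=(Q_0,Q_1,t,h)$ is a finite directed graph with tail and head maps. A representation $V$ of $Q$ assigns a finite-dimensional $K$-vector space $V_x$ to each vertex $x$ and a $K$-linear map $V_a:V_{ta}\to V_{ha}$ to each arrow $a$. $\mathbf{1}_Q$ has $K$ at every vertex and the identity at every arrow. Tensor product is pointwise on vertices and arrows. The representation ring $R(Q)$ is the free abelian group on isomorphism classes of representations modulo $[V]+[W]-[V\oplus W]$, with product $[V][W]=[V\otimes W]$ and identity $[\mathbf1_Q]$. $R(Q)_{red}$ is $R(Q)$ modulo its ideal of nilpotent elements, and $\overline V$ is the class of $[V]$ there. A rooted tree quiver $(Q,\sigma)$ is a quiver whose underlying graph is a tree and which has a unique sink $\sigma$ (the root). For a vertex $x$, $Q^{\to x}$ is the maximal connected subquiver with sink $x$; its vertices are those having a path to $x$. For a map of directed graphs $c:Q'\to Q$ (compatible with heads and tails), the pullback is $(c^*W)_x=W_{c(x)}$, $(c^*W)_a=W_{c(a)}$. Lattices and reduced quivers. For a finite poset $A$, $J(A)$ is the lattice of order ideals (down-sets, including $\emptyset$ and $A$) ordered by inclusion, and $\max(I)$ is the set of maximal elements of an ideal $I$. For a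 rooted tree $(Q,\sigma)$ define finite lattices $L_{Q,x}$ ($x\in Q_0$) recursively: if $Q$ has one vertex, $L_{Q,\sigma}$ has one element. If $x\ne\sigma$, $L_{Q,x}:=L_{Q^{\to x},x}$. Otherwise, removing $\sigma$ and its adjacent arrows $\alpha_i:\sigma_i\to\sigma$ leaves rooted trees $(Q_i,\sigma_i)$, and $L_{Q,\sigma}:=\prod_i J(L_{Q_i,\sigma_i})$ with the product order. Put $L_Q:=\coprod_{x\in Q_0}L_{Q,x}$. For $M\in L_{Q,x}$ define recursively a rooted tree quiver $(Q_M,\sigma_M)$ and a map $c_M:Q_M\to Q$ with $c_M(\sigma_M)=x$: if $Q$ has one vertex, $c_M=\mathrm{id}_Q$; if $x\neq\sigma$, take the quiver over $Q^{\to x}$ already defined, composed with the inclusion $Q^{\to x}\subset Q$; if $x=\sigma$ and $M=(M_i)$ with $M_i\in J(L_{Q_i,\sigma_i})$, $Q_M$ is the disjoint union of the quivers $(Q_i)_S$ over all $i$ and all $S\in\max(M_i)$, together with one new vertex $\sigma_M\mapsto\sigma$ and, for each such $(i,S)$, one new arrow from the root of $(Q_i)_S$ to $\sigma_M$, mapped to $\alpha_i$; on $(Q_i)_S$ the map $c_M$ is the structure map to $Q_i\subset Q$. Rank functions. For a rooted tree $(Q,\sigma)$ and $V\in\mathrm{rep}(Q)$, let $E(V)\subseteq V$ be the unique maximal subrepresentation all of whose arrow maps are surjective; $\operatorname{rank}_QV=E(V)_\sigma\subseteq V_\sigma$. For $M\in L_{Q,x}$, $\operatorname{rank}_MV:=\operatorname{rank}_{Q_M}(c_M^*V)\subseteq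 V_x$ and $r_M(V):=\dim_K\operatorname{rank}_MV$. Each $\operatorname{rank}_M$ commutes with direct sums and tensor products, so $r_M$ extends to a ring homomorphism $R(Q)\to\mathbb Z$. *)

theory Defs
  imports
    "Graph_Theory.Digraph_Component"
    "Graph_Theory.Arc_Walk"
    "Jordan_Normal_Form.VS_Connect"
    "HOL-Algebra.Free_Abelian_Groups"
    "HOL-Algebra.QuotRing"
    "HOL-Algebra.IntRing"
    "HOL-Library.FSet"
begin

section \<open>Rooted tree quivers\<close>

text \<open>
  A quiver is a finite multi-digraph (locale \<^locale>\<open>fin_digraph\<close>).  The constant
  \<open>Digraph_Component.tree\<close> is not the right notion of tree here: it only forbids directed
  cycles, so it is meaningful for symmetric digraphs only.  We double every arrow \<open>a\<close> into
  \<open>(a, True)\<close> and its reverse \<open>(a, False)\<close>; a cycle of the underlying undirected multigraph is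
  then a cycle of the doubled digraph that uses no arrow of \<open>Q\<close> twice.
\<close>

definition doubled :: "('a, 'b) pre_digraph \<Rightarrow> ('a, 'b \<times> bool) pre_digraph" where
  "doubled Q =
    \<lparr> verts = verts Q,
      arcs = arcs Q \<times> UNIV,
      tail = (\<lambda>(a, fwd). if fwd then tail Q a else head Q a),
      head = (\<lambda>(a, fwd). if fwd then head Q a else tail Q a) \<rparr>"

definition underlying_tree :: "('a, 'b) pre_digraph \<Rightarrow> bool" where
  "underlying_tree Q \<longleftrightarrow>
    Digraph_Component.connected Q \<and>
    \<not> (\<exists>p. pre_digraph.cycle (doubled Q) p \<and> distinct (map fst p))"

definition sinks :: "('a, 'b) pre_digraph \<Rightarrow> 'a set" where
  "sinks Q = {x \<in> verts Q. out_arcs Q x = {}}"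

definition rooted_tree :: "('a, 'b) pre_digraph \<Rightarrow> 'a \<Rightarrow> bool" where
  "rooted_tree Q \<sigma> \<longleftrightarrow> fin_digraph Q \<and> underlying_tree Q \<and> sinks Q = {\<sigma>}"

definition subquiver_to :: "('a, 'b) pre_digraph \<Rightarrow> 'a \<Rightarrow> ('a, 'b) pre_digraph" where
  "subquiver_to Q x = Q \<restriction> {y \<in> verts Q. y \<rightarrow>\<^sup>*\<^bsub>Q\<^esub> x}"


section \<open>Representations\<close>

text \<open>
  Up to isomorphism, the finite-dimensional space at a vertex \<open>x\<close> is the coordinate space
  \<open>K ^ n\<close> with \<open>n = rdim V x\<close>, and the linear map at an arrow is given by its matrix.  So that
  the isomorphism classes form a set, only these representations are used.  Values of
  \<^term>\<open>rdim V\<close> and \<^term>\<open>rmap V\<close> outside the quiver are irrelevant and are not fixed.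
\<close>

record ('a, 'b, 'k) rep =
  rdim :: "'a \<Rightarrow> nat"
  rmap :: "'b \<Rightarrow> 'k mat"

definition is_rep :: "('a, 'b) pre_digraph \<Rightarrow> ('a, 'b, 'k :: field) rep \<Rightarrow> bool" where
  "is_rep Q V \<longleftrightarrow>
    (\<forall>a \<in> arcs Q. rmap V a \<in> carrier_mat (rdim V (head Q a)) (rdim V (tail Q a)))"

definition reps :: "'k :: field itself \<Rightarrow> ('a, 'b) pre_digraph \<Rightarrow> ('a, 'b, 'k) rep set" where
  "reps K Q = {V. is_rep Q V}"

definition rep_iso :: "('a, 'b) pre_digraph \<Rightarrow> (('a, 'b, 'k :: field) rep \<times> ('a, 'b, 'k) rep) set" where
  "rep_iso Q = {(V, W). is_rep Q V \<and> is_rep Q W \<and>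
    (\<exists>\<phi>. (\<forall>x \<in> verts Q. \<phi> x \<in> carrier_mat (rdim W x) (rdim V x) \<and> invertible_mat (\<phi> x)) \<and>
         (\<forall>a \<in> arcs Q. \<phi> (head Q a) * rmap V a = rmap W a * \<phi> (tail Q a)))}"

definition dsum_rep ::
    "('a, 'b, 'k :: field) rep \<Rightarrow> ('a, 'b, 'k) rep \<Rightarrow> ('a, 'b, 'k) rep" where
  "dsum_rep V W =
    \<lparr> rdim = (\<lambda>x. rdim V x + rdim W x),
      rmap = (\<lambda>a. four_block_mat
               (rmap V a) (0\<^sub>m (dim_row (rmap V a)) (dim_col (rmap W a)))
               (0\<^sub>m (dim_row (rmap W a)) (dim_col (rmap V a))) (rmap W a)) \<rparr>"

text \<open>
  The matrix of \<open>f \<otimes> g\<close> with respect to the lexicographically ordered bases \<open>e\<^sub>i \<otimes> e\<^sub>j\<close>.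
\<close>

definition kronecker :: "'k :: field mat \<Rightarrow> 'k mat \<Rightarrow> 'k mat" where
  "kronecker A B =
    mat (dim_row A * dim_row B) (dim_col A * dim_col B)
      (\<lambda>(i, j). A $$ (i div dim_row B, j div dim_col B) * B $$ (i mod dim_row B, j mod dim_col B))"

definition tensor_rep ::
    "('a, 'b, 'k :: field) rep \<Rightarrow> ('a, 'b, 'k) rep \<Rightarrow> ('a, 'b, 'k) rep" where
  "tensor_rep V W =
    \<lparr> rdim = (\<lambda>x. rdim V x * rdim W x), rmap = (\<lambda>a. kronecker (rmap V a) (rmap W a)) \<rparr>"

definition unit_rep :: "('a, 'b, 'k :: field) rep" where
  "unit_rep = \<lparr> rdim = (\<lambda>_. 1), rmap = (\<lambda>_. 1\<^sub>m 1) \<rparr>"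

definition pullback ::
    "('c \<Rightarrow> 'a) \<Rightarrow> ('d \<Rightarrow> 'b) \<Rightarrow> ('a, 'b, 'k) rep \<Rightarrow> ('c, 'd, 'k) rep" where
  "pullback c0 c1 W = \<lparr> rdim = rdim W \<circ> c0, rmap = rmap W \<circ> c1 \<rparr>"


section \<open>The representation ring\<close>

definition iso_class ::
    "('a, 'b) pre_digraph \<Rightarrow> ('a, 'b, 'k :: field) rep \<Rightarrow> ('a, 'b, 'k) rep set" where
  "iso_class Q V = rep_iso Q `` {V}"

definition iso_classes ::
    "'k :: field itself \<Rightarrow> ('a, 'b) pre_digraph \<Rightarrow> ('a, 'b, 'k) rep set set" where
  "iso_classes K Q = reps K Q // rep_iso Q"

definition tensor_class ::
    "('a, 'b) pre_digraph \<Rightarrow> ('a, 'b, 'k :: field) rep set \<Rightarrow> ('a, 'b, 'k) rep set \<Rightarrow>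
      ('a, 'b, 'k) rep set" where
  "tensor_class Q A B = (\<Union>V \<in> A. \<Union>W \<in> B. iso_class Q (tensor_rep V W))"

text \<open>
  The free abelian group on the isomorphism classes, with the tensor product extended
  bilinearly.
\<close>

definition free_rep_ring ::
    "'k :: field itself \<Rightarrow> ('a, 'b) pre_digraph \<Rightarrow> (('a, 'b, 'k) rep set \<Rightarrow>\<^sub>0 int) ring" where
  "free_rep_ring K Q =
    \<lparr> carrier = carrier (free_Abelian_group (iso_classes K Q)),
      monoid.mult = (\<lambda>f g. frag_extend (\<lambda>A. frag_extend (\<lambda>B. frag_of (tensor_class Q A B)) g) f),
      one = frag_of (iso_class Q unit_rep),
      ring.zero = 0,
      add = (+) \<rparr>"

definition dsum_relations ::
    "'k :: field itself \<Rightarrow> ('a, 'b) pre_digraph \<Rightarrow> (('a, 'b, 'k) rep set \<Rightarrow>\<^sub>0 int) set" where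
  "dsum_relations K Q =
    generate (free_Abelian_group (iso_classes K Q))
      {frag_of (iso_class Q V) + frag_of (iso_class Q W) - frag_of (iso_class Q (dsum_rep V W)) | V W.
        V \<in> reps K Q \<and> W \<in> reps K Q}"

definition rep_ring ::
    "'k :: field itself \<Rightarrow> ('a, 'b) pre_digraph \<Rightarrow> (('a, 'b, 'k) rep set \<Rightarrow>\<^sub>0 int) set ring" where
  "rep_ring K Q = free_rep_ring K Q Quot dsum_relations K Q"

text \<open>The class \<open>[V]\<close> in the representation ring.\<close>

definition rep_ring_class ::
    "'k :: field itself \<Rightarrow> ('a, 'b) pre_digraph \<Rightarrow> ('a, 'b, 'k) rep \<Rightarrow>
      (('a, 'b, 'k) rep set \<Rightarrow>\<^sub>0 int) set" where
  "rep_ring_class K Q V = dsum_relations K Q +>\<^bsub>free_rep_ring K Q\<^esub> frag_of (iso_class Q V)"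

definition nilpotents :: "('r, 'm) ring_scheme \<Rightarrow> 'r set" where
  "nilpotents R = {r \<in> carrier R. \<exists>n :: nat. r [^]\<^bsub>R\<^esub> n = \<zero>\<^bsub>R\<^esub>}"

definition rep_ring_red ::
    "'k :: field itself \<Rightarrow> ('a, 'b) pre_digraph \<Rightarrow> (('a, 'b, 'k) rep set \<Rightarrow>\<^sub>0 int) set set ring" where
  "rep_ring_red K Q = rep_ring K Q Quot nilpotents (rep_ring K Q)"

definition rep_ring_red_class ::
    "'k :: field itself \<Rightarrow> ('a, 'b) pre_digraph \<Rightarrow> ('a, 'b, 'k) rep \<Rightarrow>
      (('a, 'b, 'k) rep set \<Rightarrow>\<^sub>0 int) set set" where
  "rep_ring_red_class K Q V = nilpotents (rep_ring K Q) +>\<^bsub>rep_ring K Q\<^esub> rep_ring_class K Q V"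


section \<open>The lattices\<close>

definition order_ideals :: "('p \<Rightarrow> 'p \<Rightarrow> bool) \<Rightarrow> 'p set \<Rightarrow> 'p set set" where
  "order_ideals r A = {I. I \<subseteq> A \<and> (\<forall>s \<in> I. \<forall>t \<in> A. r t s \<longrightarrow> t \<in> I)}"

definition maximal_elements :: "('p \<Rightarrow> 'p \<Rightarrow> bool) \<Rightarrow> 'p set \<Rightarrow> 'p set" where
  "maximal_elements r I = {s \<in> I. \<forall>t \<in> I. r s t \<longrightarrow> t = s}"

text \<open>
  A family \<open>(M\<^sub>\<alpha>)\<close> of order ideals, indexed by the arrows \<open>\<alpha>\<close> into a vertex, whose members are
  again such families.  Components at all other arrows are empty, so that a family without
  indices is unique.
\<close>

datatype 'b lat_elem = Fam (component: "'b \<Rightarrow> 'b lat_elem fset")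

text \<open>Product of the inclusion orders on the components.\<close>

definition lat_le :: "'b lat_elem \<Rightarrow> 'b lat_elem \<Rightarrow> bool" where
  "lat_le M N \<longleftrightarrow> (\<forall>\<alpha>. component M \<alpha> |\<subseteq>| component N \<alpha>)"

lemma subquiver_to_smaller:
  assumes "rooted_tree Q x" "\<alpha> \<in> in_arcs Q x"
  shows "card (verts (subquiver_to Q (tail Q \<alpha>))) < card (verts Q)"
proof (rule psubset_card_mono)
  have fin: "fin_digraph Q" and sink: "x \<in> verts Q" "out_arcs Q x = {}"
    using assms(1) by (auto simp: rooted_tree_def sinks_def)
  show "finite (verts Q)" using fin by (rule fin_digraph.finite_verts)
  have "\<not> x \<rightarrow>\<^sup>*\<^bsub>Q\<^esub> tail Q \<alpha>"
  proof
    assume "x \<rightarrow>\<^sup>*\<^bsub>Q\<^esub> tail Q \<alpha>"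
    moreover have "tail Q \<alpha> \<noteq> x"
      using assms(2) sink(2) by (auto simp: in_arcs_def out_arcs_def)
    ultimately obtain z where "(x, z) \<in> arcs_ends Q"
      unfolding reachable_def by (metis converse_rtrancl_on_cases)
    then show False
      using sink(2) by (auto simp: arcs_ends_conv out_arcs_def)
  qed
  then show "verts (subquiver_to Q (tail Q \<alpha>)) \<subset> verts Q"
    using sink(1) by (auto simp: subquiver_to_def)
qed

text \<open>
  The lattice of a rooted tree at its root \<open>x\<close>.  Removing \<open>x\<close> and the arrows \<open>\<alpha>\<close> into \<open>x\<close>
  leaves the rooted trees \<^term>\<open>subquiver_to Q (tail Q \<alpha>)\<close> with roots \<^term>\<open>tail Q \<alpha>\<close>.
\<close>

function root_lattice :: "('a, 'b) pre_digraph \<Rightarrow> 'a \<Rightarrow> 'b lat_elem set" where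
  "root_lattice Q x =
    (if rooted_tree Q x then
       {Fam M | M. \<forall>\<alpha>.
         if \<alpha> \<in> in_arcs Q x
         then fset (M \<alpha>) \<in> order_ideals lat_le (root_lattice (subquiver_to Q (tail Q \<alpha>)) (tail Q \<alpha>))
         else M \<alpha> = {||}}
     else {})"
  by pat_completeness auto
termination
  by (relation "measure (\<lambda>(Q, x). card (verts Q))") (auto intro: subquiver_to_smaller)

declare root_lattice.simps [simp del]

definition vertex_lattice :: "('a, 'b) pre_digraph \<Rightarrow> 'a \<Rightarrow> 'b lat_elem set" where
  "vertex_lattice Q x = root_lattice (subquiver_to Q x) x"

definition lattice_coprod :: "('a, 'b) pre_digraph \<Rightarrow> ('a \<times> 'b lat_elem) set" where
  "lattice_coprod Q = Sigma (verts Q) (vertex_lattice Q)"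


section \<open>Reduced quivers\<close>

text \<open>
  The disjoint unions in the recursive construction of \<open>Q\<^sub>M\<close> are realised by tagging: the root
  is \<open>[]\<close>, and a vertex or arrow \<open>p\<close> of the summand belonging to \<open>(\<alpha>, S)\<close> becomes \<open>(\<alpha>, S) # p\<close>.
  The new arrow from the root of that summand to the new root is \<open>[(\<alpha>, S)]\<close>.  Hence every
  arrow carries the same name as its tail, and its head is obtained by dropping the last entry.
\<close>

type_synonym 'b red_path = "('b \<times> 'b lat_elem) list"

definition lat_sub :: "('b lat_elem \<times> 'b lat_elem) set" where
  "lat_sub = {(S, M). \<exists>\<alpha>. S |\<in>| component M \<alpha>}"

lemma wf_lat_sub: "wf lat_sub"
proof (rule wfUNIVI)
  fix P :: "'b lat_elem \<Rightarrow> bool" and M :: "'b lat_elem"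
  assume step: "\<forall>x. (\<forall>y. (y, x) \<in> lat_sub \<longrightarrow> P y) \<longrightarrow> P x"
  show "P M"
  proof (induction M)
    case (Fam f)
    then have "\<forall>y. (y, Fam f) \<in> lat_sub \<longrightarrow> P y"
      by (auto simp: lat_sub_def)
    with step show ?case by blast
  qed
qed

function red_quiver :: "'b lat_elem \<Rightarrow> ('b red_path, 'b red_path) pre_digraph" where
  "red_quiver M =
    (let I = {(\<alpha>, S). S \<in> maximal_elements lat_le (fset (component M \<alpha>))} in
      \<lparr> verts = insert [] (\<Union>(\<alpha>, S) \<in> I. Cons (\<alpha>, S) ` verts (red_quiver S)),
        arcs = (\<Union>(\<alpha>, S) \<in> I. insert [(\<alpha>, S)] (Cons (\<alpha>, S) ` arcs (red_quiver S))),
        tail = (\<lambda>p. p),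
        head = butlast \<rparr>)"
  by pat_completeness auto
termination
  by (relation lat_sub, rule wf_lat_sub) (auto simp: lat_sub_def maximal_elements_def)

declare red_quiver.simps [simp del]

text \<open>The structure map \<open>c\<^sub>M\<close> for \<open>M\<close> in the lattice at \<open>x\<close>.\<close>

definition struct_vert :: "('a, 'b) pre_digraph \<Rightarrow> 'a \<Rightarrow> 'b red_path \<Rightarrow> 'a" where
  "struct_vert Q x p = (if p = [] then x else tail Q (fst (last p)))"

definition struct_arc :: "'b red_path \<Rightarrow> 'b" where
  "struct_arc p = fst (last p)"


section \<open>Rank functions\<close>

definition subrep ::
    "('a, 'b) pre_digraph \<Rightarrow> ('a, 'b, 'k :: field) rep \<Rightarrow> ('a \<Rightarrow> 'k vec set) \<Rightarrow> bool" where
  "subrep Q V U \<longleftrightarrow>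
    U \<in> extensional (verts Q) \<and>
    (\<forall>x \<in> verts Q. VectorSpace.subspace class_ring (U x) (module_vec TYPE('k) (rdim V x))) \<and>
    (\<forall>a \<in> arcs Q. (\<lambda>v. rmap V a *\<^sub>v v) ` U (tail Q a) \<subseteq> U (head Q a))"

definition epi_subrep ::
    "('a, 'b) pre_digraph \<Rightarrow> ('a, 'b, 'k :: field) rep \<Rightarrow> ('a \<Rightarrow> 'k vec set) \<Rightarrow> bool" where
  "epi_subrep Q V U \<longleftrightarrow>
    subrep Q V U \<and> (\<forall>a \<in> arcs Q. (\<lambda>v. rmap V a *\<^sub>v v) ` U (tail Q a) = U (head Q a))"

text \<open>
  Families of subspaces are compared by pointwise inclusion.  Subrepresentations with surjective
  arrow maps are closed under sums, so the unique maximal one is the greatest one.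
\<close>

definition max_epi_subrep ::
    "('a, 'b) pre_digraph \<Rightarrow> ('a, 'b, 'k :: field) rep \<Rightarrow> 'a \<Rightarrow> 'k vec set" where
  "max_epi_subrep Q V = (GREATEST U. epi_subrep Q V U)"

definition rank_space ::
    "('a, 'b) pre_digraph \<Rightarrow> 'a \<Rightarrow> ('a, 'b, 'k :: field) rep \<Rightarrow> 'k vec set" where
  "rank_space Q \<sigma> V = max_epi_subrep Q V \<sigma>"

definition red_rank_space ::
    "('a, 'b) pre_digraph \<Rightarrow> 'a \<times> 'b lat_elem \<Rightarrow> ('a, 'b, 'k :: field) rep \<Rightarrow> 'k vec set" where
  "red_rank_space Q = (\<lambda>(x, M) V.
    rank_space (red_quiver M) [] (pullback (struct_vert Q x) struct_arc V))"

definition red_rank ::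
    "('a, 'b) pre_digraph \<Rightarrow> 'a \<times> 'b lat_elem \<Rightarrow> ('a, 'b, 'k :: field) rep \<Rightarrow> nat" where
  "red_rank Q = (\<lambda>(x, M) V.
    vectorspace.dim class_ring
      ((module_vec TYPE('k) (rdim V x)) \<lparr>carrier := red_rank_space Q (x, M) V\<rparr>))"


section \<open>The product ring\<close>

definition int_product_ring :: "'i set \<Rightarrow> ('i \<Rightarrow> int) ring" where
  "int_product_ring I =
    \<lparr> carrier = (\<Pi>\<^sub>E i \<in> I. carrier \<Z>),
      monoid.mult = (\<lambda>f g. \<lambda>i \<in> I. f i * g i),
      one = (\<lambda>i \<in> I. 1),
      ring.zero = (\<lambda>i \<in> I. 0),
      add = (\<lambda>f g. \<lambda>i \<in> I. f i + g i) \<rparr>"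

end

theory Submission
  imports Defs
begin

text \<open>
  Besides the rank spaces, consider the functionals on \<open>V\<close> at \<open>x\<close> that pair with the rank space of
  \<open>M\<close> through morphisms to and from one representation \<open>X\<close> with a line at \<open>x\<close> (\<open>cork\<close> below).
  The rank functions of these \<open>X\<close> form a unitriangular matrix, so every integer vector is a
  combination of their rank vectors.

  For injectivity modulo nilpotents, let \<open>D\<close> be the set of indices where rank spaces may be nonzero.
  Choose \<open>(x, M) \<in> D\<close> with \<open>x\<close> as close to the root as possible, and then \<open>M\<close> as large as possible.
  In a long enough tensor product of representations supported on \<open>D\<close>, every nonzero vector of the
  rank space of \<open>M\<close> is detected by a functional in \<open>cork\<close>, by a pigeonhole argument over the
  factors.  Such a product is \<open>X\<^sup>m \<oplus> Y\<close> for one fixed \<open>X\<close> and some \<open>Y\<close> supported on \<open>D - {(x, M)}\<close>.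
  Hence a power of an element on which all rank functions vanish is a multiple of \<open>[X]\<close> plus
  classes supported on \<open>D - {(x, M)}\<close>; its rank at \<open>(x, M)\<close> is \<open>0\<close>, so the multiple is \<open>0\<close>, and
  one inducts on \<open>D\<close>.
\<close>

text \<open>Everything rests on one computation: a vector \<open>u\<close> in the rank space of
  \<open>M\<close> on \<open>Y\<close> and a functional \<open>g\<close> in \<open>cork\<close> of
  \<open>M\<close> on \<open>X\<close> produce a morphism from \<open>X\<close> to \<open>Y\<close>
  whose component at \<open>x\<close> is \<open>u * g\<close>. Composites can then be evaluated at
  \<open>x\<close> alone, and a minimality argument on dimensions replaces Krull-Schmidt.

  Both choices in the selection of \<open>(x, M)\<close> remove an obstacle. The morphism is built
  on the branch of \<open>x\<close> and extended by zero, so it can fail to commute only with the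
  arrow out of \<open>x\<close>; nothing supported on \<open>D\<close> lives at the head of that
  arrow. Maximality of \<open>M\<close> makes the rank spaces of \<open>M\<close> and of any
  \<open>S\<close> not below \<open>M\<close> meet trivially on members supported on
  \<open>D\<close>, since the intersection is the rank space of the join. A projection can therefore
  fix the first and kill the second.

  A single representation may still have too few functionals in \<open>cork\<close>. Functionals
  that kill different rank spaces are combined across tensor factors, which is why powers appear and
  why the kernel is shown to be nilpotent instead of zero.\<close>

section \<open>Linear algebra with matrices\<close>

lemma mat_assoc:
  fixes A B C :: "'k::semiring_0 mat"
  assumes "dim_col A = dim_row B" "dim_col B = dim_row C"
  shows "A * B * C = A * (B * C)"
  by (rule assoc_mult_mat[of A "dim_row A" "dim_row B" B "dim_row C" C "dim_col C"])
     (use assms in \<open>auto intro!: carrier_matI\<close>)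

lemma mat_distrib_left:
  fixes A B C :: "'k::semiring_0 mat"
  assumes "dim_row B = dim_row C" "dim_col B = dim_col C" "dim_col A = dim_row B"
  shows "A * (B + C) = A * B + A * C"
  by (rule mult_add_distrib_mat[of A "dim_row A" "dim_row B" B "dim_col B" C])
     (use assms in \<open>auto intro!: carrier_matI\<close>)

lemma mat_distrib_right:
  fixes A B C :: "'k::semiring_0 mat"
  assumes "dim_row A = dim_row B" "dim_col A = dim_col B" "dim_col A = dim_row C"
  shows "(A + B) * C = A * C + B * C"
  by (rule add_mult_distrib_mat[of A "dim_row A" "dim_col A" B C "dim_col C"])
     (use assms in \<open>auto intro!: carrier_matI\<close>)

lemma mat_diff_left:
  fixes A B C :: "'k::ring mat"
  assumes "dim_row B = dim_row C" "dim_col B = dim_col C" "dim_col A = dim_row B"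
  shows "A * (B - C) = A * B - A * C"
  by (rule mult_minus_distrib_mat[of A "dim_row A" "dim_row B" B "dim_col B" C])
     (use assms in \<open>auto intro!: carrier_matI\<close>)

lemma mat_diff_right:
  fixes A B C :: "'k::ring mat"
  assumes "dim_row A = dim_row B" "dim_col A = dim_col B" "dim_col A = dim_row C"
  shows "(A - B) * C = A * C - B * C"
  by (rule minus_mult_distrib_mat[of A "dim_row A" "dim_col A" B C "dim_col C"])
     (use assms in \<open>auto intro!: carrier_matI\<close>)

lemma mat_one_left: "dim_row A = n \<Longrightarrow> 1\<^sub>m n * A = (A :: 'k::semiring_1 mat)"
  by (rule left_mult_one_mat[of A n "dim_col A"]) (auto intro!: carrier_matI)

lemma mat_one_right: "dim_col A = n \<Longrightarrow> A * 1\<^sub>m n = (A :: 'k::semiring_1 mat)"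
  by (rule right_mult_one_mat[of A "dim_row A" n]) (auto intro!: carrier_matI)

lemma mat_zero_left: "dim_row A = n \<Longrightarrow> 0\<^sub>m m n * A = (0\<^sub>m m (dim_col A) :: 'k::semiring_0 mat)"
  by (rule left_mult_zero_mat[of A n "dim_col A"]) (auto intro!: carrier_matI)

lemma mat_zero_right: "dim_col A = n \<Longrightarrow> A * 0\<^sub>m n m = (0\<^sub>m (dim_row A) m :: 'k::semiring_0 mat)"
  by (rule right_mult_zero_mat[of A "dim_row A" n]) (auto intro!: carrier_matI)

lemma mat_add_zero_left:
  "dim_row A = n \<Longrightarrow> dim_col A = m \<Longrightarrow> 0\<^sub>m n m + A = (A :: 'k::monoid_add mat)"
  by (auto intro!: eq_matI)

lemma mat_add_zero_right:
  "dim_row A = n \<Longrightarrow> dim_col A = m \<Longrightarrow> A + 0\<^sub>m n m = (A :: 'k::monoid_add mat)"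
  by (auto intro!: eq_matI)

lemma mat_smult_left:
  "dim_col A = dim_row B \<Longrightarrow> (c \<cdot>\<^sub>m A) * B = c \<cdot>\<^sub>m (A * B :: 'k::comm_semiring_0 mat)"
  by (rule mult_smult_assoc_mat[of A "dim_row A" "dim_col A" B "dim_col B"])
     (auto intro!: carrier_matI)

lemma mat_smult_right:
  "dim_col A = dim_row B \<Longrightarrow> A * (c \<cdot>\<^sub>m B) = c \<cdot>\<^sub>m (A * B :: 'k::comm_semiring_0 mat)"
  by (rule mult_smult_distrib[of A "dim_row A" "dim_col A" B "dim_col B"])
     (auto intro!: carrier_matI)

lemmas mat_ring_simps = mat_distrib_left mat_distrib_right mat_diff_left mat_diff_right
  mat_one_left mat_one_right mat_zero_left mat_zero_right mat_smult_left mat_smult_right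
  mat_add_zero_left mat_add_zero_right

lemma mult_index_sum:
  assumes "i < dim_row A" "j < dim_col B" "dim_col A = dim_row B"
  shows "(A * B) $$ (i, j) = (\<Sum>k<dim_row B. A $$ (i, k) * B $$ (k, j))"
  using assms by (auto simp: scalar_prod_def atLeast0LessThan)

text \<open>The \<open>j\<close>-th unit column reads off column \<open>j\<close>. Identities that
  are checked vector by vector thus become identities of matrices.\<close>

lemma mat_eq_by_columns:
  fixes A B :: "'k::field mat"
  assumes "A \<in> carrier_mat n m" "B \<in> carrier_mat n m"
    and eq: "\<And>z. z \<in> carrier_mat m 1 \<Longrightarrow> A * z = B * z"
  shows "A = B"
proof (rule eq_matI)
  fix i j assume ij: "i < dim_row B" "j < dim_col B"
  let ?z = "mat m 1 (\<lambda>(k, _). if k = j then 1 else 0) :: 'k mat"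
  have "(A * ?z) $$ (i, 0) = (B * ?z) $$ (i, 0)" by (subst eq) auto
  moreover have "(X * ?z) $$ (i, 0) = X $$ (i, j)" if "X \<in> carrier_mat n m" for X
    using that ij assms(2)
    by (subst mult_index_sum) (auto simp: if_distrib[of "\<lambda>z. _ * z"] cong: if_cong)
  ultimately show "A $$ (i, j) = B $$ (i, j)" using assms(1,2) by simp
qed (use assms(1,2) in auto)

subsection \<open>Kronecker products\<close>

lemma kronecker_dim [simp]:
  "dim_row (kronecker A B) = dim_row A * dim_row B"
  "dim_col (kronecker A B) = dim_col A * dim_col B"
  by (auto simp: kronecker_def)

lemma kronecker_carrier:
  "A \<in> carrier_mat n m \<Longrightarrow> B \<in> carrier_mat n' m' \<Longrightarrow> kronecker A B \<in> carrier_mat (n * n') (m * m')"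
  by (auto simp: kronecker_def)

lemma div_mod_less: "i < n * m \<Longrightarrow> i div m < n \<and> i mod m < (m::nat)"
  by (metis less_mult_imp_div_less mod_less_divisor mult_0_right not_gr_zero not_less_zero)

lemma div_less_mult: "i < n * m \<Longrightarrow> i div m < (n::nat)"
  and mod_less_mult: "i < n * m \<Longrightarrow> i mod m < m"
  using div_mod_less by blast+

lemma kronecker_index:
  "i < dim_row A * dim_row B \<Longrightarrow> j < dim_col A * dim_col B \<Longrightarrow>
   kronecker A B $$ (i, j) = A $$ (i div dim_row B, j div dim_col B) * B $$ (i mod dim_row B, j mod dim_col B)"
  by (auto simp: kronecker_def)

text \<open>The pair \<open>(i, j)\<close> with \<open>j < m\<close> corresponds to the number
  \<open>i * m + j\<close>, the lexicographic position used by \<open>kronecker\<close>.\<close>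

lemma sum_div_mod:
  fixes f :: "nat \<Rightarrow> nat \<Rightarrow> 'a::comm_monoid_add"
  shows "(\<Sum>k<n * m. f (k div m) (k mod m)) = (\<Sum>i<n. \<Sum>j<m. f i j)"
proof -
  have "(\<Sum>k<n * m. f (k div m) (k mod m)) = (\<Sum>p\<in>{..<n} \<times> {..<m}. f (fst p) (snd p))"
  proof (rule sum.reindex_bij_witness[where i = "\<lambda>p. fst p * m + snd p" and j = "\<lambda>k. (k div m, k mod m)"])
    fix p assume p: "p \<in> {..<n} \<times> {..<m}"
    then have "fst p * m + snd p < Suc (fst p) * m" by auto
    also have "\<dots> \<le> n * m" using p by (intro mult_right_mono) auto
    finally show "fst p * m + snd p \<in> {..<n * m}" by simp
  qed (auto dest: div_mod_less)
  then show ?thesis by (simp add: sum.cartesian_product split_def)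
qed

text \<open>By \<open>sum_div_mod\<close> the sum over the inner index becomes a double sum, which
  factors into the two matrix products.\<close>

lemma kronecker_mult:
  fixes A B C D :: "'k::field mat"
  assumes "dim_col A = dim_row C" "dim_col B = dim_row D"
  shows "kronecker A B * kronecker C D = kronecker (A * C) (B * D)"
proof (rule eq_matI)
  fix i j assume "i < dim_row (kronecker (A * C) (B * D))" "j < dim_col (kronecker (A * C) (B * D))"
  then have i: "i < dim_row A * dim_row B" and j: "j < dim_col C * dim_col D" by auto
  let ?f = "\<lambda>a b. A $$ (i div dim_row B, a) * C $$ (a, j div dim_col D) *
     (B $$ (i mod dim_row B, b) * D $$ (b, j mod dim_col D))"
  have "(kronecker A B * kronecker C D) $$ (i, j) =
      (\<Sum>k<dim_row C * dim_row D. kronecker A B $$ (i, k) * kronecker C D $$ (k, j))"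
    using i j assms by (subst mult_index_sum) auto
  also have "\<dots> = (\<Sum>k<dim_row C * dim_row D. ?f (k div dim_row D) (k mod dim_row D))"
    using i j assms by (intro sum.cong refl) (auto simp: kronecker_index ac_simps)
  also have "\<dots> = (\<Sum>a<dim_row C. \<Sum>b<dim_row D. ?f a b)" by (rule sum_div_mod)
  also have "\<dots> = kronecker (A * C) (B * D) $$ (i, j)"
    using i j assms div_mod_less[OF i] div_mod_less[OF j]
    by (simp add: kronecker_index mult_index_sum sum_product del: index_mult_mat(1))
  finally show "(kronecker A B * kronecker C D) $$ (i, j) = kronecker (A * C) (B * D) $$ (i, j)" .
qed auto

lemma kronecker_one: "kronecker (1\<^sub>m n) (1\<^sub>m m) = (1\<^sub>m (n * m) :: 'k::field mat)"
proof (rule eq_matI)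
  fix i j assume "i < dim_row (1\<^sub>m (n * m) :: 'k mat)" "j < dim_col (1\<^sub>m (n * m) :: 'k mat)"
  then have i: "i < n * m" and j: "j < n * m" by auto
  have "i = j" if "i div m = j div m" "i mod m = j mod m" using that by (metis div_mult_mod_eq)
  then show "kronecker (1\<^sub>m n) (1\<^sub>m m) $$ (i, j) = (1\<^sub>m (n * m) :: 'k mat) $$ (i, j)"
    using i j div_mod_less[OF i] div_mod_less[OF j] by (auto simp: kronecker_index)
qed auto

lemma kronecker_add_left:
  assumes "dim_row A = dim_row B" "dim_col A = dim_col B"
  shows "kronecker (A + B) C = kronecker A C + kronecker B C"
  using assms by (intro eq_matI) (auto simp: kronecker_index distrib_right div_less_mult mod_less_mult)

lemma kronecker_add_right:
  assumes "dim_row A = dim_row B" "dim_col A = dim_col B"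
  shows "kronecker C (A + B) = kronecker C A + kronecker C B"
  using assms by (intro eq_matI) (auto simp: kronecker_index distrib_left div_less_mult mod_less_mult)

lemma kronecker_zero_left: "kronecker (0\<^sub>m n m) C = 0\<^sub>m (n * dim_row C) (m * dim_col C)"
  by (intro eq_matI) (auto simp: kronecker_index div_less_mult mod_less_mult)

lemma kronecker_zero_right: "kronecker C (0\<^sub>m n m) = 0\<^sub>m (dim_row C * n) (dim_col C * m)"
  by (intro eq_matI) (auto simp: kronecker_index div_less_mult mod_less_mult)

lemma kronecker_one_right: "kronecker A (1\<^sub>m 1) = A"
  by (intro eq_matI) (auto simp: kronecker_index)

lemma kronecker_one_left: "kronecker (1\<^sub>m 1) A = A"
  by (intro eq_matI) (auto simp: kronecker_index)

lemma kronecker_assoc: "kronecker (kronecker A B) C = kronecker A (kronecker B C)"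
proof (rule eq_matI)
  have dm: "i div (m * k) = i div k div m" "i mod (m * k) div k = i div k mod m" "i mod (m * k) mod k = i mod k"
    for i m k :: nat
  proof -
    show "i div (m * k) = i div k div m" by (simp add: div_mult2_eq mult.commute)
    show "i mod (m * k) div k = i div k mod m"
      by (cases "k = 0") (simp_all add: mult.commute[of m k] mod_mult2_eq)
    show "i mod (m * k) mod k = i mod k" by (simp add: mod_mod_cancel)
  qed
  fix i j assume "i < dim_row (kronecker A (kronecker B C))" "j < dim_col (kronecker A (kronecker B C))"
  then have i: "i < dim_row A * dim_row B * dim_row C" "i < dim_row A * (dim_row B * dim_row C)"
    and j: "j < dim_col A * dim_col B * dim_col C" "j < dim_col A * (dim_col B * dim_col C)"
    by (auto simp: mult.assoc)
  show "kronecker (kronecker A B) C $$ (i, j) = kronecker A (kronecker B C) $$ (i, j)"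
    using i j div_mod_less[OF i(1)] div_mod_less[OF j(1)] div_mod_less[OF i(2)] div_mod_less[OF j(2)]
    by (simp add: kronecker_index dm mult.assoc)
qed (auto simp: mult.assoc)

text \<open>The flip of the two factors of a tensor product: the basis vector at position
  \<open>a * m + b\<close> goes to the one at position \<open>b * n + a\<close>.\<close>

definition swap_mat :: "nat \<Rightarrow> nat \<Rightarrow> 'k::field mat" where
  "swap_mat n m = mat (m * n) (n * m) (\<lambda>(i, j). if i div n = j mod m \<and> i mod n = j div m then 1 else 0)"

lemma swap_mat_dim [simp]: "dim_row (swap_mat n m) = m * n" "dim_col (swap_mat n m) = n * m"
  by (auto simp: swap_mat_def)

lemma if_mult_delta:
  "(if P then 1 else 0) * (x::'k::field) = (if P then x else 0)"
  "x * (if P then 1 else 0) = (if P then x else 0)"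
  by auto

lemma delta2_sum:
  fixes g :: "nat \<Rightarrow> nat \<Rightarrow> 'k::field"
  assumes "a0 < n" "b0 < m"
  shows "(\<Sum>a<n. \<Sum>b<m. (if a0 = a \<and> b0 = b then 1 else 0) * g a b) = g a0 b0"
proof -
  have "(\<Sum>a<n. \<Sum>b<m. (if a0 = a \<and> b0 = b then 1 else 0) * g a b) =
      (\<Sum>a<n. if a0 = a then (\<Sum>b<m. if b0 = b then g a b else 0) else 0)"
    by (intro sum.cong refl) (auto intro!: sum.cong simp: if_mult_delta)
  also have "\<dots> = g a0 b0" using assms by (simp add: sum.delta)
  finally show ?thesis .
qed

lemma delta_div_mod_sum:
  fixes g :: "nat \<Rightarrow> nat \<Rightarrow> 'k::field"
  assumes "a0 < n" "b0 < m"
  shows "(\<Sum>k<n * m. (if a0 = k div m \<and> b0 = k mod m then 1 else 0) * g (k div m) (k mod m)) = g a0 b0"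
  using sum_div_mod[of "\<lambda>a b. (if a0 = a \<and> b0 = b then 1 else 0) * g a b"] delta2_sum[OF assms] by simp

text \<open>Naturality of the flip: this is what makes it a morphism between the two tensor products
  of representations.\<close>

lemma swap_mat_kronecker:
  fixes A B :: "'k::field mat"
  shows "swap_mat (dim_row A) (dim_row B) * kronecker A B = kronecker B A * swap_mat (dim_col A) (dim_col B)"
proof (rule eq_matI)
  fix i j
  assume "i < dim_row (kronecker B A * swap_mat (dim_col A) (dim_col B))"
    "j < dim_col (kronecker B A * swap_mat (dim_col A) (dim_col B))"
  then have i: "i < dim_row B * dim_row A" and j: "j < dim_col A * dim_col B" by auto
  note di = div_mod_less[OF i] and dj = div_mod_less[OF j]
  have "(swap_mat (dim_row A) (dim_row B) * kronecker A B) $$ (i, j) =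
      (\<Sum>k<dim_row A * dim_row B. swap_mat (dim_row A) (dim_row B) $$ (i, k) * kronecker A B $$ (k, j))"
    using i j by (subst mult_index_sum) auto
  also have "\<dots> = (\<Sum>k<dim_row A * dim_row B. (if i mod dim_row A = k div dim_row B \<and> i div dim_row A = k mod dim_row B then 1 else 0)
      * (A $$ (k div dim_row B, j div dim_col B) * B $$ (k mod dim_row B, j mod dim_col B)))"
    using i j by (intro sum.cong refl) (auto simp: kronecker_index swap_mat_def)
  also have "\<dots> = A $$ (i mod dim_row A, j div dim_col B) * B $$ (i div dim_row A, j mod dim_col B)"
    using di by (intro delta_div_mod_sum[where g = "\<lambda>a b. A $$ (a, j div dim_col B) * B $$ (b, j mod dim_col B)"]) auto
  finally have l: "(swap_mat (dim_row A) (dim_row B) * kronecker A B) $$ (i, j) =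
     A $$ (i mod dim_row A, j div dim_col B) * B $$ (i div dim_row A, j mod dim_col B)" .
  have "(kronecker B A * swap_mat (dim_col A) (dim_col B)) $$ (i, j) =
      (\<Sum>k<dim_col B * dim_col A. kronecker B A $$ (i, k) * swap_mat (dim_col A) (dim_col B) $$ (k, j))"
    using i j by (subst mult_index_sum) auto
  also have "\<dots> = (\<Sum>k<dim_col B * dim_col A. (if j mod dim_col B = k div dim_col A \<and> j div dim_col B = k mod dim_col A then 1 else 0)
      * (A $$ (i mod dim_row A, k mod dim_col A) * B $$ (i div dim_row A, k div dim_col A)))"
    using i j by (intro sum.cong refl) (auto simp: kronecker_index swap_mat_def)
  also have "\<dots> = A $$ (i mod dim_row A, j div dim_col B) * B $$ (i div dim_row A, j mod dim_col B)"
    using dj by (intro delta_div_mod_sum[where g = "\<lambda>b a. A $$ (i mod dim_row A, a) * B $$ (i div dim_row A, b)"]) auto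
  finally show "(swap_mat (dim_row A) (dim_row B) * kronecker A B) $$ (i, j) =
     (kronecker B A * swap_mat (dim_col A) (dim_col B)) $$ (i, j)" using l by simp
qed (auto simp: mult.commute)

lemma swap_mat_inverse: "swap_mat m n * swap_mat n m = (1\<^sub>m (n * m) :: 'k::field mat)"
proof (rule eq_matI)
  fix i j assume "i < dim_row (1\<^sub>m (n * m) :: 'k mat)" "j < dim_col (1\<^sub>m (n * m) :: 'k mat)"
  then have i: "i < n * m" and j: "j < n * m" by auto
  note di = div_mod_less[OF i] and dj = div_mod_less[OF j]
  have "(swap_mat m n * swap_mat n m :: 'k mat) $$ (i, j) =
      (\<Sum>k<m * n. swap_mat m n $$ (i, k) * swap_mat n m $$ (k, j))"
    using i j by (subst mult_index_sum) auto
  also have "\<dots> = (\<Sum>k<m * n. (if j mod m = k div n \<and> j div m = k mod n then 1 else 0)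
      * (if i div m = k mod n \<and> i mod m = k div n then 1 else 0))"
    using i j by (intro sum.cong refl) (auto simp: swap_mat_def)
  also have "\<dots> = (if i div m = j div m \<and> i mod m = j mod m then 1 else 0)"
    using dj by (intro delta_div_mod_sum[where g = "\<lambda>b a. if i div m = a \<and> i mod m = b then 1 else 0"]) auto
  also have "\<dots> = (1\<^sub>m (n * m) :: 'k mat) $$ (i, j)"
    using i j by (auto, metis div_mult_mod_eq)
  finally show "(swap_mat m n * swap_mat n m :: 'k mat) $$ (i, j) = (1\<^sub>m (n * m)) $$ (i, j)" .
qed auto

subsection \<open>Subspaces of column vectors\<close>

text \<open>Once products are bracketed to the right, a known value of \<open>A * B\<close> no
  longer occurs as a subterm of a longer product. This form applies it there.\<close>

lemma mat_assoc_eq: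
  fixes A B D X :: "'k::semiring_0 mat"
  assumes "A * B = D" "dim_col A = dim_row B" "dim_col B = dim_row X"
  shows "A * (B * X) = D * X"
  using mat_assoc[OF assms(2,3)] assms(1) by simp

section \<open>Coordinate maps of a direct sum\<close>

definition inj1 :: "nat \<Rightarrow> nat \<Rightarrow> 'k::field mat" where
  "inj1 n m = mat (n + m) n (\<lambda>(i, j). if i = j then 1 else 0)"

definition inj2 :: "nat \<Rightarrow> nat \<Rightarrow> 'k::field mat" where
  "inj2 n m = mat (n + m) m (\<lambda>(i, j). if i = n + j then 1 else 0)"

definition prj1 :: "nat \<Rightarrow> nat \<Rightarrow> 'k::field mat" where
  "prj1 n m = mat n (n + m) (\<lambda>(i, j). if i = j then 1 else 0)"

definition prj2 :: "nat \<Rightarrow> nat \<Rightarrow> 'k::field mat" where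
  "prj2 n m = mat m (n + m) (\<lambda>(i, j). if n + i = j then 1 else 0)"

lemma inj_prj_dim [simp]:
  "dim_row (inj1 n m) = n + m" "dim_col (inj1 n m) = n"
  "dim_row (inj2 n m) = n + m" "dim_col (inj2 n m) = m"
  "dim_row (prj1 n m) = n" "dim_col (prj1 n m) = n + m"
  "dim_row (prj2 n m) = m" "dim_col (prj2 n m) = n + m"
  by (auto simp: inj1_def inj2_def prj1_def prj2_def)

lemma inj_prj_carrier [simp]:
  "inj1 n m \<in> carrier_mat (n + m) n" "inj2 n m \<in> carrier_mat (n + m) m"
  "prj1 n m \<in> carrier_mat n (n + m)" "prj2 n m \<in> carrier_mat m (n + m)"
  by (auto intro!: carrier_matI)

lemma prj_inj:
  "prj1 n m * inj1 n m = (1\<^sub>m n :: 'k::field mat)"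
  "prj2 n m * inj2 n m = (1\<^sub>m m :: 'k mat)"
  "prj1 n m * inj2 n m = (0\<^sub>m n m :: 'k mat)"
  "prj2 n m * inj1 n m = (0\<^sub>m m n :: 'k mat)"
proof -
  show "prj1 n m * inj1 n m = (1\<^sub>m n :: 'k mat)"
    by (intro eq_matI; (subst mult_index_sum)?) (auto simp: prj1_def inj1_def if_mult_delta sum.delta)
  show "prj1 n m * inj2 n m = (0\<^sub>m n m :: 'k mat)"
    by (intro eq_matI; (subst mult_index_sum)?) (auto simp: prj1_def inj2_def if_mult_delta sum.delta)
  show "prj2 n m * inj1 n m = (0\<^sub>m m n :: 'k mat)"
    by (intro eq_matI; (subst mult_index_sum)?) (auto simp: prj2_def inj1_def if_mult_delta sum.delta)
  show "prj2 n m * inj2 n m = (1\<^sub>m m :: 'k mat)"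
    by (intro eq_matI; (subst mult_index_sum)?) (auto simp: prj2_def inj2_def if_mult_delta)
qed

lemma inj_prj_sum: "inj1 n m * prj1 n m + inj2 n m * prj2 n m = (1\<^sub>m (n + m) :: 'k::field mat)"
proof (rule eq_matI)
  fix i j assume "i < dim_row (1\<^sub>m (n + m) :: 'k mat)" "j < dim_col (1\<^sub>m (n + m) :: 'k mat)"
  then have ij: "i < n + m" "j < n + m" by auto
  have "(inj1 n m * prj1 n m) $$ (i, j) = (if i = j \<and> i < n then 1 else (0::'k))"
    using ij by (subst mult_index_sum) (auto simp: inj1_def prj1_def if_mult_delta sum.delta)
  moreover have "(inj2 n m * prj2 n m) $$ (i, j) = (if i = j \<and> \<not> i < n then 1 else (0::'k))"
  proof -
    have e: "(if i = n + k then 1 else 0) * (if n + k = j then 1 else 0) =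
        (if k = i - n then if i = j \<and> \<not> i < n then 1 else 0 else (0::'k))" for k by auto
    have "(inj2 n m * prj2 n m :: 'k mat) $$ (i, j) = (\<Sum>k<m. if k = i - n then if i = j \<and> \<not> i < n then 1 else 0 else 0)"
      using ij by (subst mult_index_sum) (simp_all add: inj2_def prj2_def flip: e)
    then show ?thesis using ij by auto
  qed
  ultimately show "(inj1 n m * prj1 n m + inj2 n m * prj2 n m) $$ (i, j) = (1\<^sub>m (n + m) :: 'k mat) $$ (i, j)"
    using ij by simp
qed auto

text \<open>If \<open>n < r\<close>, padding with zeros gives square matrices \<open>B'\<close> and
  \<open>C'\<close> with \<open>C' * B' = 1\<close>. Then also \<open>B' * C' = 1\<close>, although
  row \<open>n\<close> of \<open>B'\<close> vanishes.\<close>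

lemma left_inverse_dim_le:
  fixes B C :: "'k::field mat"
  assumes "B \<in> carrier_mat n r" "C \<in> carrier_mat r n" "C * B = 1\<^sub>m r"
  shows "r \<le> n"
proof (rule ccontr)
  assume "\<not> r \<le> n"
  then have nr: "n < r" by simp
  define B' where "B' = mat r r (\<lambda>(i, j). if i < n then B $$ (i, j) else 0)"
  define C' where "C' = mat r r (\<lambda>(i, j). if j < n then C $$ (i, j) else 0)"
  have "C' * B' = 1\<^sub>m r"
  proof (rule eq_matI)
    fix i j assume "i < dim_row (1\<^sub>m r :: 'k mat)" "j < dim_col (1\<^sub>m r :: 'k mat)"
    then have ij: "i < r" "j < r" by auto
    have "(C' * B') $$ (i, j) = (\<Sum>k<r. if k < n then C $$ (i, k) * B $$ (k, j) else 0)"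
      using ij by (subst mult_index_sum) (auto simp: B'_def C'_def intro!: sum.cong)
    also have "\<dots> = (\<Sum>k<n. C $$ (i, k) * B $$ (k, j))"
      using nr by (intro sum.mono_neutral_cong_right) auto
    also have "\<dots> = (C * B) $$ (i, j)" using ij assms(1,2) by (subst mult_index_sum) auto
    finally show "(C' * B') $$ (i, j) = 1\<^sub>m r $$ (i, j)" by (simp add: assms(3))
  qed (auto simp: B'_def C'_def)
  then have "B' * C' = 1\<^sub>m r"
    by (rule mat_mult_left_right_inverse[rotated 2]) (auto simp: B'_def C'_def)
  then have "(B' * C') $$ (n, n) = 1" using nr by simp
  moreover have "(B' * C') $$ (n, n) = 0"
    using nr by (subst mult_index_sum) (auto simp: B'_def C'_def)
  ultimately show False by simp
qed

section \<open>Bases of subspaces together with coordinate maps\<close>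

definition mat_subspace :: "nat \<Rightarrow> 'k::field mat set \<Rightarrow> bool" where
  "mat_subspace n A \<longleftrightarrow> A \<subseteq> carrier_mat n 1 \<and> 0\<^sub>m n 1 \<in> A \<and>
    (\<forall>u\<in>A. \<forall>v\<in>A. u + v \<in> A) \<and> (\<forall>c. \<forall>u\<in>A. c \<cdot>\<^sub>m u \<in> A)"

text \<open>The columns of \<open>B\<close> are a basis of \<open>A\<close> and \<open>C\<close> is
  a linear choice of coordinates on the whole space, so \<open>r\<close> is the dimension. With
  \<open>C\<close> part of the data, statements about dimensions and projections become matrix
  identities.\<close>

definition frame :: "nat \<Rightarrow> 'k::field mat set \<Rightarrow> nat \<Rightarrow> 'k mat \<Rightarrow> 'k mat \<Rightarrow> bool" where
  "frame n A r B C \<longleftrightarrow> B \<in> carrier_mat n r \<and> C \<in> carrier_mat r n \<and> C * B = 1\<^sub>m r \<and>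
    A = (\<lambda>z. B * z) ` carrier_mat r 1"

lemma frameD:
  assumes "frame n A r B C"
  shows "B \<in> carrier_mat n r" "C \<in> carrier_mat r n" "C * B = 1\<^sub>m r" "A = (\<lambda>z. B * z) ` carrier_mat r 1"
  using assms by (auto simp: frame_def)

lemma frame_fixes:
  assumes "frame n A r B C" "v \<in> A"
  shows "B * (C * v) = v" "C * v \<in> carrier_mat r 1" "v \<in> carrier_mat n 1"
proof -
  note f = frameD[OF assms(1)]
  obtain z where z: "z \<in> carrier_mat r 1" "v = B * z" using assms(2) f(4) by auto
  have "C * v = z" using z f(1,2) by (simp add: mat_assoc_eq[OF f(3)] mat_one_left)
  then show "B * (C * v) = v" "C * v \<in> carrier_mat r 1" "v \<in> carrier_mat n 1" using z f(1) by auto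
qed

lemma nonzero_vector_functional:
  fixes u :: "'k::field mat"
  assumes "u \<in> carrier_mat n 1" "u \<noteq> 0\<^sub>m n 1"
  shows "\<exists>g \<in> carrier_mat 1 n. g * u = 1\<^sub>m 1"
proof -
  obtain i where i: "i < n" "u $$ (i, 0) \<noteq> 0"
    using assms by (metis carrier_matD(1) carrier_matD(2) eq_matI index_zero_mat less_one)
  let ?g = "mat 1 n (\<lambda>(_, j). if j = i then inverse (u $$ (i, 0)) else 0)"
  have "?g * u = 1\<^sub>m 1"
  proof (rule eq_matI)
    fix a b assume "a < dim_row (1\<^sub>m 1 :: 'k mat)" "b < dim_col (1\<^sub>m 1 :: 'k mat)"
    then have "a = 0" "b = 0" by auto
    then show "(?g * u) $$ (a, b) = 1\<^sub>m 1 $$ (a, b)" using i assms(1)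
      by (subst mult_index_sum) (auto simp: if_distrib[of "\<lambda>z. z * _"] cong: if_cong)
  qed (use assms in auto)
  then show ?thesis by (intro bexI[of _ ?g]) auto
qed

text \<open>Among injective \<open>B\<close> with a left inverse and image inside \<open>A\<close>,
  take one with the most columns, which is possible because there are at most \<open>n\<close>. A
  vector of \<open>A\<close> outside the image would allow one more column.\<close>

lemma frame_exists:
  fixes A :: "'k::field mat set"
  assumes A: "mat_subspace n A"
  shows "\<exists>r B C. frame n A r B C"
proof -
  let ?P = "\<lambda>r. \<exists>B \<in> carrier_mat n r. \<exists>C \<in> carrier_mat r n. C * B = 1\<^sub>m r \<and> (\<lambda>z. B * z) ` carrier_mat r 1 \<subseteq> A"
  have "?P 0"
    using A by (intro bexI[of _ "0\<^sub>m n 0"] bexI[of _ "0\<^sub>m 0 n"])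
      (auto simp: mat_subspace_def mat_zero_left intro!: eq_matI)
  moreover have bound: "?P r \<Longrightarrow> r \<le> n" for r using left_inverse_dim_le by blast
  ultimately have ex: "?P (Greatest ?P)" by (rule GreatestI_nat)
  then obtain B C where BC: "B \<in> carrier_mat n (Greatest ?P)" "C \<in> carrier_mat (Greatest ?P) n"
    "C * B = 1\<^sub>m (Greatest ?P)" "(\<lambda>z. B * z) ` carrier_mat (Greatest ?P) 1 \<subseteq> A" by blast
  define r where "r = Greatest ?P"
  note BC = BC[folded r_def]
  have "A \<subseteq> (\<lambda>z. B * z) ` carrier_mat r 1"
  proof (rule ccontr)
    assume "\<not> ?thesis"
    then obtain a where a: "a \<in> A" "a \<notin> (\<lambda>z. B * z) ` carrier_mat r 1" by blast
    have ac: "a \<in> carrier_mat n 1" using a A by (auto simp: mat_subspace_def)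
    \<comment> \<open>Subtracting the part already covered by \<open>B\<close> gives a vector of
      \<open>A\<close> with all coordinates \<open>C * a'\<close> equal to zero.\<close>
    define a' where "a' = a - B * (C * a)"
    have a'c: "a' \<in> carrier_mat n 1" using ac BC(1,2) by (auto simp: a'_def)
    have "B * (C * a) \<in> A" using BC(4) ac BC(2) by auto
    then have "(-1) \<cdot>\<^sub>m (B * (C * a)) \<in> A" using A by (auto simp: mat_subspace_def)
    then have "a + (-1) \<cdot>\<^sub>m (B * (C * a)) \<in> A" using A a by (auto simp: mat_subspace_def)
    moreover have "a + (-1) \<cdot>\<^sub>m (B * (C * a)) = a'"
    proof (rule eq_matI)
      fix i j assume "i < dim_row a'" "j < dim_col a'"
      then show "(a + (-1) \<cdot>\<^sub>m (B * (C * a))) $$ (i, j) = a' $$ (i, j)"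
        using ac BC(1,2) by (simp add: a'_def del: index_mult_mat(1))
    qed (use ac BC(1,2) in \<open>auto simp: a'_def\<close>)
    ultimately have a'A: "a' \<in> A" by simp
    have Ca': "C * a' = 0\<^sub>m r 1"
      using ac BC(1,2) by (simp add: a'_def mat_diff_left mat_assoc_eq[OF BC(3)] mat_one_left)
    have "a' \<noteq> 0\<^sub>m n 1"
    proof
      assume z: "a' = 0\<^sub>m n 1"
      have "a = B * (C * a)"
      proof (rule eq_matI)
        fix i j assume ij: "i < dim_row (B * (C * a))" "j < dim_col (B * (C * a))"
        have "a' $$ (i, j) = a $$ (i, j) - (B * (C * a)) $$ (i, j)"
          unfolding a'_def using ij by (intro index_minus_mat) auto
        moreover have "a' $$ (i, j) = 0" using z ij ac BC(1,2) by auto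
        ultimately show "a $$ (i, j) = (B * (C * a)) $$ (i, j)" by simp
      qed (use ac BC(1,2) in auto)
      then show False using a(2) ac BC(1,2) by auto
    qed
    then obtain g where g: "g \<in> carrier_mat 1 n" "g * a' = 1\<^sub>m 1"
      using nonzero_vector_functional a'c by blast
    \<comment> \<open>The functional \<open>g\<close> is corrected so that it vanishes on the
      columns of \<open>B\<close>; since \<open>C * a' = 0\<close>, its value on \<open>a'\<close>
      remains 1. It becomes the new row of \<open>C\<close>.\<close>
    define c where "c = g - g * B * C"
    have cc: "c \<in> carrier_mat 1 n" using g BC(1,2) by (auto simp: c_def)
    have cB: "c * B = 0\<^sub>m 1 r"
      using g BC(1,2) BC(3) by (simp add: c_def mat_diff_right mat_assoc mat_one_right)
    have ca: "c * a' = 1\<^sub>m 1"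
      using g BC(1,2) a'c Ca' by (simp add: c_def mat_diff_right mat_assoc mat_zero_right) (auto intro!: eq_matI)
    define B' where "B' = B * prj1 r 1 + a' * prj2 r 1"
    define C' where "C' = inj1 r 1 * C + inj2 r 1 * c"
    have B'c: "B' \<in> carrier_mat n (Suc r)" and C'c: "C' \<in> carrier_mat (Suc r) n"
      using BC(1,2) a'c cc by (auto simp: B'_def C'_def)
    have "C' * B' = inj1 r 1 * (C * B) * prj1 r 1 + inj2 r 1 * (c * B) * prj1 r 1 +
        (inj1 r 1 * (C * a') * prj2 r 1 + inj2 r 1 * (c * a') * prj2 r 1)"
      using BC(1,2) a'c cc by (simp add: B'_def C'_def mat_distrib_left mat_distrib_right mat_assoc)
    also have "\<dots> = inj1 r 1 * prj1 r 1 + inj2 r 1 * prj2 r 1"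
      unfolding BC(3) cB ca Ca' by (simp add: mat_ring_simps)
    also have "\<dots> = 1\<^sub>m (Suc r)" unfolding inj_prj_sum by simp
    finally have "C' * B' = 1\<^sub>m (Suc r)" .
    moreover have "(\<lambda>z. B' * z) ` carrier_mat (Suc r) 1 \<subseteq> A"
    proof clarify
      fix z :: "'k mat" assume z: "z \<in> carrier_mat (Suc r) 1"
      have "B' * z = B * (prj1 r 1 * z) + a' * (prj2 r 1 * z)"
        using z BC(1,2) a'c by (simp add: B'_def mat_distrib_right mat_assoc)
      moreover have "B * (prj1 r 1 * z) \<in> A" by (rule subsetD[OF BC(4)], rule imageI) (use z in auto)
      moreover have "a' * (prj2 r 1 * z) = ((prj2 r 1 * z) $$ (0, 0)) \<cdot>\<^sub>m a'"
      proof (rule eq_matI)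
        fix i j assume "i < dim_row ((prj2 r 1 * z) $$ (0, 0) \<cdot>\<^sub>m a')" "j < dim_col ((prj2 r 1 * z) $$ (0, 0) \<cdot>\<^sub>m a')"
        then have "i < n" "j = 0" using a'c by auto
        then show "(a' * (prj2 r 1 * z)) $$ (i, j) = ((prj2 r 1 * z) $$ (0, 0) \<cdot>\<^sub>m a') $$ (i, j)"
          using a'c z by (subst mult_index_sum) (auto simp del: index_mult_mat(1))
      qed (use a'c z in auto)
      ultimately show "B' * z \<in> A" using A a'A by (auto simp: mat_subspace_def)
    qed
    ultimately have "?P (Suc r)" using B'c C'c by blast
    then have "Suc r \<le> Greatest ?P" by (rule Greatest_le_nat) (use bound in blast)
    then show False by (simp add: r_def)
  qed
  then have "frame n A r B C" using BC by (auto simp: frame_def)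
  then show ?thesis by blast
qed

lemma mat_subspace_image:
  fixes N :: "'k::field mat"
  assumes N: "N \<in> carrier_mat m n" and A: "mat_subspace n A"
  shows "mat_subspace m ((\<lambda>z. N * z) ` A)"
  unfolding mat_subspace_def
proof (intro conjI ballI allI)
  have Ac: "u \<in> A \<Longrightarrow> u \<in> carrier_mat n 1" for u using A by (auto simp: mat_subspace_def)
  show "(\<lambda>z. N * z) ` A \<subseteq> carrier_mat m 1" using N Ac by auto
  have "N * 0\<^sub>m n 1 = 0\<^sub>m m 1" using N by (simp add: mat_zero_right)
  then show "0\<^sub>m m 1 \<in> (\<lambda>z. N * z) ` A" using A by (metis image_eqI mat_subspace_def)
  fix u assume "u \<in> (\<lambda>z. N * z) ` A"
  then obtain u' where u': "u' \<in> A" "u = N * u'" by auto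
  { fix c have "c \<cdot>\<^sub>m u = N * (c \<cdot>\<^sub>m u')" using N Ac[OF u'(1)] u' by (simp add: mat_smult_right)
    then show "c \<cdot>\<^sub>m u \<in> (\<lambda>z. N * z) ` A" using A u' by (auto simp: mat_subspace_def) }
  fix v assume "v \<in> (\<lambda>z. N * z) ` A"
  then obtain v' where v': "v' \<in> A" "v = N * v'" by auto
  have "u + v = N * (u' + v')" using N Ac[OF u'(1)] Ac[OF v'(1)] u' v' by (simp add: mat_distrib_left)
  then show "u + v \<in> (\<lambda>z. N * z) ` A" using A u' v' by (auto simp: mat_subspace_def)
qed

lemma mat_subspace_carrier: "mat_subspace n (carrier_mat n 1)"
  by (auto simp: mat_subspace_def)

text \<open>Lifts of the unit columns are collected as the columns of \<open>Z\<close>.\<close>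

lemma mat_lift:
  fixes B N :: "'k::field mat"
  assumes B: "B \<in> carrier_mat n r" and N: "N \<in> carrier_mat n s"
    and lift: "\<And>z. z \<in> carrier_mat r 1 \<Longrightarrow> \<exists>y \<in> carrier_mat s 1. B * z = N * y"
  shows "\<exists>Z \<in> carrier_mat s r. B = N * Z"
proof -
  let ?e = "\<lambda>j. mat r 1 (\<lambda>(i, _). if i = j then 1 else 0) :: 'k mat"
  have "\<forall>j. \<exists>y \<in> carrier_mat s 1. B * ?e j = N * y" using lift by auto
  then obtain y where y: "\<And>j. y j \<in> carrier_mat s 1" "\<And>j. B * ?e j = N * y j" by metis
  define Z where "Z = mat s r (\<lambda>(i, j). y j $$ (i, 0))"
  have "B = N * Z"
  proof (rule eq_matI)
    fix i j assume "i < dim_row (N * Z)" "j < dim_col (N * Z)"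
    then have ij: "i < n" "j < r" using N by (auto simp: Z_def)
    have "B $$ (i, j) = (B * ?e j) $$ (i, 0)"
      using ij B by (subst mult_index_sum) (auto simp: if_mult_delta)
    also have "\<dots> = (N * y j) $$ (i, 0)" by (simp only: y)
    also have "\<dots> = (N * Z) $$ (i, j)"
      using ij N y(1)[of j] by (subst (1 2) mult_index_sum) (auto simp: Z_def)
    finally show "B $$ (i, j) = (N * Z) $$ (i, j)" .
  qed (use B N in \<open>auto simp: Z_def\<close>)
  then show ?thesis by (intro bexI[of _ Z]) (auto simp: Z_def)
qed

text \<open>Factorization of \<open>E\<close> through its image: \<open>B\<close> is a basis of the
  image, \<open>C * E\<close> the map onto it in coordinates, and \<open>Y\<close> lifts the basis
  to the source.\<close>

lemma mat_image_factor:
  fixes E :: "'k::field mat"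
  assumes E: "E \<in> carrier_mat m n"
  shows "\<exists>r. \<exists>B \<in> carrier_mat m r. \<exists>C \<in> carrier_mat r m. \<exists>Y \<in> carrier_mat n r.
    C * B = 1\<^sub>m r \<and> B * (C * E) = E \<and> B = E * Y"
proof -
  have "mat_subspace m ((\<lambda>z. E * z) ` carrier_mat n 1)"
    by (rule mat_subspace_image[OF E mat_subspace_carrier])
  then obtain r B C where f: "frame m ((\<lambda>z. E * z) ` carrier_mat n 1) r B C"
    using frame_exists by blast
  note fd = frameD[OF f]
  have "\<exists>Y \<in> carrier_mat n r. B = E * Y"
    by (rule mat_lift[OF fd(1) E]) (use fd(4) in auto)
  moreover have "B * (C * E) = E"
  proof (rule mat_eq_by_columns)
    show "B * (C * E) \<in> carrier_mat m n" "E \<in> carrier_mat m n" using fd E by auto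
    fix z :: "'k mat" assume z: "z \<in> carrier_mat n 1"
    then have "B * (C * (E * z)) = E * z" using frame_fixes(1)[OF f] by auto
    then show "B * (C * E) * z = E * z" using fd(1,2) E z by (simp add: mat_assoc)
  qed
  ultimately show ?thesis using fd by blast
qed

text \<open>With the image factorization of \<open>N\<close>, the matrix \<open>Y * C\<close> sends
  \<open>N * z\<close> to a vector with the same image under \<open>N\<close>, hence back to
  \<open>z\<close>.\<close>

lemma injective_left_inverse:
  fixes N :: "'k::field mat"
  assumes N: "N \<in> carrier_mat n r" and inj: "\<And>z. z \<in> carrier_mat r 1 \<Longrightarrow> N * z = 0\<^sub>m n 1 \<Longrightarrow> z = 0\<^sub>m r 1"
  shows "\<exists>C \<in> carrier_mat r n. C * N = 1\<^sub>m r"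
proof -
  obtain s B C Y where *: "B \<in> carrier_mat n s" "C \<in> carrier_mat s n" "Y \<in> carrier_mat r s"
    "C * B = 1\<^sub>m s" "B * (C * N) = N" "B = N * Y"
    using mat_image_factor[OF N] by blast
  have "Y * (C * N) = 1\<^sub>m r"
  proof (rule mat_eq_by_columns)
    fix z :: "'k mat" assume z: "z \<in> carrier_mat r 1"
    let ?w = "Y * (C * N) * z - z"
    have w: "?w \<in> carrier_mat r 1" using z N * by auto
    have "N * (Y * (C * (N * z))) = B * (C * (N * z))"
      by (rule mat_assoc_eq) (use * z N in auto)
    also have "\<dots> = N * z" using *(1,2) z N mat_assoc[of B "C * N" z] mat_assoc[of C N z] *(5) by auto
    finally have "N * ?w = 0\<^sub>m n 1" using z N *(1-3) by (simp add: mat_diff_left mat_assoc)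
    then have w0: "?w = 0\<^sub>m r 1" using inj w by blast
    show "Y * (C * N) * z = 1\<^sub>m r * z"
    proof (rule eq_matI)
      fix i j assume "i < dim_row (1\<^sub>m r * z)" "j < dim_col (1\<^sub>m r * z)"
      then have ij: "i < r" "j < 1" using z by auto
      then have "?w $$ (i, j) = (Y * (C * N) * z) $$ (i, j) - z $$ (i, j)"
        using z by (intro index_minus_mat) auto
      then show "(Y * (C * N) * z) $$ (i, j) = (1\<^sub>m r * z) $$ (i, j)"
        using w0 ij z by (simp add: mat_one_left del: index_mult_mat(1))
    qed (use z N * in auto)
  qed (use N * in auto)
  then show ?thesis using * N by (intro bexI[of _ "Y * C"]) (auto simp: mat_assoc)
qed

text \<open>\<open>f\<close> restricted to \<open>A\<close> is the matrix \<open>f * B\<close> for a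
  basis \<open>B\<close> of \<open>A\<close>. A basis of its image is lifted through
  \<open>f * B\<close>, and the lifts lie in \<open>A\<close> by construction.\<close>

lemma subspace_section:
  fixes f :: "'k::field mat"
  assumes f: "f \<in> carrier_mat m n" and A: "mat_subspace n A"
  shows "\<exists>s \<in> carrier_mat n m. \<forall>v \<in> (\<lambda>u. f * u) ` A. s * v \<in> A \<and> f * (s * v) = v"
proof -
  obtain r B C where fr: "frame n A r B C" using frame_exists[OF A] by blast
  note fd = frameD[OF fr]
  have fB: "f * B \<in> carrier_mat m r" using f fd by auto
  obtain t B' C' Z where *: "B' \<in> carrier_mat m t" "C' \<in> carrier_mat t m" "Z \<in> carrier_mat r t"
    "C' * B' = 1\<^sub>m t" "B' * (C' * (f * B)) = f * B" "B' = f * B * Z"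
    using mat_image_factor[OF fB] by blast
  show ?thesis
  proof (intro bexI[of _ "B * Z * C'"] ballI conjI)
    fix v assume "v \<in> (\<lambda>u. f * u) ` A"
    then obtain z where z: "z \<in> carrier_mat r 1" "v = f * (B * z)" using fd(4) by auto
    have vv: "B' * (C' * v) = v"
    proof -
      have "B' * (C' * (f * B)) * z = B' * (C' * (f * (B * z)))"
        using z(1) f fd(1) *(1,2) by (simp add: mat_assoc)
      moreover have "f * B * z = f * (B * z)" using z(1) f fd(1) by (simp add: mat_assoc)
      ultimately show ?thesis unfolding z(2) using *(5) by simp
    qed
    have e: "B * Z * C' * v = B * (Z * (C' * v))" using fd(1) f *(1-3) z by (simp add: mat_assoc)
    show "B * Z * C' * v \<in> A" unfolding e fd(4) using f fd(1) *(1-3) z by (intro imageI) auto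
    have "f * (B * (Z * (C' * v))) = B' * (C' * v)"
      unfolding *(6) using fd(1) f *(2,3) z by (simp add: mat_assoc)
    then show "f * (B * Z * C' * v) = v" using vv e by simp
  qed (use fd(1) * in auto)
qed

text \<open>A basis of \<open>U\<close> followed by a basis of \<open>A\<close> forms an injective
  matrix \<open>N\<close>. A left inverse of \<open>N\<close> gives both sets of coordinates, and
  \<open>P\<close> keeps only those belonging to \<open>U\<close>.\<close>

lemma separating_projection:
  fixes U A :: "'k::field mat set"
  assumes U: "mat_subspace n U" and A: "mat_subspace n A" and UA: "U \<inter> A \<subseteq> {0\<^sub>m n 1}"
  shows "\<exists>P \<in> carrier_mat n n. (\<forall>u \<in> U. P * u = u) \<and> (\<forall>a \<in> A. P * a = 0\<^sub>m n 1)"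
proof -
  obtain r B C where fU: "frame n U r B C" using frame_exists[OF U] by blast
  obtain s B' C' where fA: "frame n A s B' C'" using frame_exists[OF A] by blast
  note u = frameD[OF fU] and a = frameD[OF fA]
  define N where "N = B * prj1 r s + B' * prj2 r s"
  have Nc: "N \<in> carrier_mat n (r + s)" using u a by (auto simp: N_def)
  have Nz: "N * z = B * (prj1 r s * z) + B' * (prj2 r s * z)" if "z \<in> carrier_mat (r + s) k" for z k
    using that u(1) a(1) by (simp add: N_def mat_distrib_right mat_assoc)
  have "\<exists>D \<in> carrier_mat (r + s) n. D * N = 1\<^sub>m (r + s)"
  proof (rule injective_left_inverse[OF Nc])
    fix z :: "'k mat" assume z: "z \<in> carrier_mat (r + s) 1" and N0: "N * z = 0\<^sub>m n 1"
    let ?x = "prj1 r s * z" and ?y = "prj2 r s * z"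
    have xc: "?x \<in> carrier_mat r 1" and yc: "?y \<in> carrier_mat s 1" using z by auto
    have BU: "B * ?x \<in> U" using u(4) xc by auto
    have BA: "B' * ?y \<in> A" using a(4) yc by auto
    then have "(-1) \<cdot>\<^sub>m (B' * ?y) \<in> A" using A by (auto simp: mat_subspace_def)
    moreover have "B * ?x = (-1) \<cdot>\<^sub>m (B' * ?y)"
    proof (rule eq_matI)
      fix i j assume "i < dim_row ((-1) \<cdot>\<^sub>m (B' * ?y))" "j < dim_col ((-1) \<cdot>\<^sub>m (B' * ?y))"
      then have ij: "i < n" "j < 1" using a(1) z by auto
      have "(B * ?x + B' * ?y) $$ (i, j) = 0" using N0 Nz[OF z] ij by auto
      then have "(B * ?x) $$ (i, j) + (B' * ?y) $$ (i, j) = 0"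
        using ij u(1) a(1) z by (simp del: index_mult_mat(1))
      then show "(B * ?x) $$ (i, j) = ((-1) \<cdot>\<^sub>m (B' * ?y)) $$ (i, j)"
        using ij u(1) a(1) z by (simp add: eq_neg_iff_add_eq_0 del: index_mult_mat(1))
    qed (use u(1) a(1) z in auto)
    ultimately have B0: "B * ?x = 0\<^sub>m n 1" using BU UA by auto
    then have "B' * ?y = 0\<^sub>m n 1" using N0 Nz[OF z] a(1) yc by (simp add: mat_add_zero_left)
    moreover have "?x = C * (B * ?x)" using u(1,2) xc by (simp add: mat_assoc_eq[OF u(3)] mat_one_left)
    moreover have "?y = C' * (B' * ?y)" using a(1,2) yc by (simp add: mat_assoc_eq[OF a(3)] mat_one_left)
    ultimately have "?x = 0\<^sub>m r 1" "?y = 0\<^sub>m s 1" using B0 u(2) a(2) by (simp_all add: mat_zero_right)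
    moreover have "z = inj1 r s * ?x + inj2 r s * ?y"
      using z mat_distrib_right[of "inj1 r s * prj1 r s" "inj2 r s * prj2 r s" z] inj_prj_sum[of r s, where 'k = 'k]
      by (simp add: mat_assoc mat_one_left)
    ultimately show "z = 0\<^sub>m (r + s) 1" by (simp add: mat_zero_right mat_add_zero_left)
  qed
  then obtain D where D: "D \<in> carrier_mat (r + s) n" "D * N = 1\<^sub>m (r + s)" by blast
  let ?P = "B * (prj1 r s * D)"
  show ?thesis
  proof (intro bexI[of _ ?P] conjI ballI)
    fix v assume "v \<in> U"
    then obtain z where z: "z \<in> carrier_mat r 1" "v = B * z" using u(4) by auto
    have "inj1 r s * z \<in> carrier_mat (r + s) 1" using z by auto
    note Ni = Nz[OF this]
    have "N * (inj1 r s * z) = v"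
      using z u(1) a(1) by (simp add: Ni mat_assoc_eq[OF prj_inj(1)] mat_assoc_eq[OF prj_inj(4)]
          mat_one_left mat_zero_left mat_zero_right mat_add_zero_right)
    then have "D * v = inj1 r s * z" using mat_assoc_eq[OF D(2), of "inj1 r s * z"] z Nc D(1) by (simp add: mat_one_left)
    then have "?P * v = B * (prj1 r s * (inj1 r s * z))" using z u(1) D(1) by (simp add: mat_assoc)
    then show "?P * v = v" using z by (simp add: mat_assoc_eq[OF prj_inj(1)] mat_one_left)
  next
    fix v assume "v \<in> A"
    then obtain z where z: "z \<in> carrier_mat s 1" "v = B' * z" using a(4) by auto
    have "inj2 r s * z \<in> carrier_mat (r + s) 1" using z by auto
    note Ni = Nz[OF this]
    have "N * (inj2 r s * z) = v"
      using z u(1) a(1) by (simp add: Ni mat_assoc_eq[OF prj_inj(2)] mat_assoc_eq[OF prj_inj(3)]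
          mat_one_left mat_zero_left mat_zero_right mat_add_zero_left)
    then have "D * v = inj2 r s * z" using mat_assoc_eq[OF D(2), of "inj2 r s * z"] z Nc D(1) by (simp add: mat_one_left)
    then have "?P * v = B * (prj1 r s * (inj2 r s * z))" using z u(1) a(1) D(1) by (simp add: mat_assoc)
    then show "?P * v = 0\<^sub>m n 1" using z u(1) by (simp add: mat_assoc_eq[OF prj_inj(3)] mat_zero_left mat_zero_right)
  qed (use u D in auto)
qed

section \<open>Functionals vanishing on an intersection of subspaces\<close>

lemma mat_diff_zero: "dim_row A = n \<Longrightarrow> dim_col A = m \<Longrightarrow> A - 0\<^sub>m n m = (A :: 'k::ab_group_add mat)"
  by (auto intro!: eq_matI)

lemma mat_diff_self: "A - A = 0\<^sub>m (dim_row A) (dim_col (A :: 'k::ab_group_add mat))"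
  by (auto intro!: eq_matI)

text \<open>Finite sums without scalar coefficients: in the applications \<open>G\<close> is a union
  of linear spaces and already absorbs scalars.\<close>

inductive_set mat_sums :: "nat \<Rightarrow> nat \<Rightarrow> 'k::field mat set \<Rightarrow> 'k mat set" for n m G where
  zero: "0\<^sub>m n m \<in> mat_sums n m G"
| add: "g \<in> G \<Longrightarrow> h \<in> mat_sums n m G \<Longrightarrow> g + h \<in> mat_sums n m G"

lemma mat_sums_mono: "h \<in> mat_sums n m G \<Longrightarrow> G \<subseteq> G' \<Longrightarrow> h \<in> mat_sums n m G'"
  by (induction rule: mat_sums.induct) (auto intro: mat_sums.intros)

text \<open>\<open>U\<close> is a complement of \<open>A \<inter> D\<close> inside \<open>D\<close>.
  If \<open>P\<close> fixes \<open>U\<close> and kills \<open>A\<close>, then \<open>g * P\<close>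
  kills \<open>A\<close>; on \<open>D\<close> it agrees with \<open>g\<close>, because
  \<open>g\<close> kills \<open>A \<inter> D\<close>.\<close>

lemma annihilator_inter:
  fixes g :: "'k::field mat"
  assumes A: "mat_subspace n A" and D: "mat_subspace n D" and g: "g \<in> carrier_mat 1 n"
    and kill: "\<And>u. u \<in> A \<Longrightarrow> u \<in> D \<Longrightarrow> g * u = 0\<^sub>m 1 1"
  shows "\<exists>g1 \<in> carrier_mat 1 n. \<exists>g2 \<in> carrier_mat 1 n. g = g1 + g2 \<and>
    (\<forall>u \<in> A. g1 * u = 0\<^sub>m 1 1) \<and> (\<forall>u \<in> D. g2 * u = 0\<^sub>m 1 1)"
proof -
  have AD: "mat_subspace n (A \<inter> D)" using A D by (auto simp: mat_subspace_def)
  obtain r B C where fr: "frame n (A \<inter> D) r B C" using frame_exists[OF AD] by blast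
  note fd = frameD[OF fr]
  define U where "U = {b \<in> D. C * b = 0\<^sub>m r 1}"
  have Dc: "b \<in> carrier_mat n 1" if "b \<in> D" for b using D that by (auto simp: mat_subspace_def)
  have U: "mat_subspace n U"
    unfolding mat_subspace_def
  proof (intro conjI ballI allI)
    show "U \<subseteq> carrier_mat n 1" using Dc by (auto simp: U_def)
    show "0\<^sub>m n 1 \<in> U" using D fd(2) by (simp add: U_def mat_subspace_def mat_zero_right)
    fix u assume u: "u \<in> U"
    then have uc: "u \<in> carrier_mat n 1" using Dc by (simp add: U_def)
    { fix c show "c \<cdot>\<^sub>m u \<in> U" using D u uc fd(2) by (simp add: U_def mat_subspace_def mat_smult_right) }
    fix v assume v: "v \<in> U"
    then have vc: "v \<in> carrier_mat n 1" using Dc by (simp add: U_def)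
    show "u + v \<in> U" using D u v uc vc fd(2)
      by (simp add: U_def mat_subspace_def mat_distrib_left mat_add_zero_left)
  qed
  have "U \<inter> A \<subseteq> {0\<^sub>m n 1}"
  proof
    fix v assume v: "v \<in> U \<inter> A"
    have "v = B * (C * v)" by (rule frame_fixes(1)[OF fr, symmetric]) (use v in \<open>auto simp: U_def\<close>)
    then show "v \<in> {0\<^sub>m n 1}" using v fd by (auto simp: U_def mat_zero_right)
  qed
  then obtain P where P: "P \<in> carrier_mat n n" "\<And>u. u \<in> U \<Longrightarrow> P * u = u" "\<And>a. a \<in> A \<Longrightarrow> P * a = 0\<^sub>m n 1"
    using separating_projection[OF U A] by blast
  have gP: "g * P * u = g * (P * u)" if "u \<in> carrier_mat n 1" for u
    using that g P(1) by (simp add: mat_assoc)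
  show ?thesis
  proof (rule bexI[of _ "g * P"], rule bexI[of _ "g - g * P"], intro conjI ballI)
    show "g = g * P + (g - g * P)" using g P(1) by (intro eq_matI) (auto simp del: index_mult_mat(1))
  next
    fix u assume u: "u \<in> A"
    then show "g * P * u = 0\<^sub>m 1 1" using gP P(3) g A by (auto simp: mat_subspace_def mat_zero_right)
  next
    fix u assume u: "u \<in> D"
    note uc = Dc[OF u]
    define c where "c = B * (C * u)"
    have cAD: "c \<in> A \<inter> D" unfolding c_def using fd uc by auto
    have cc: "c \<in> carrier_mat n 1" using cAD Dc by auto
    have "u + (-1) \<cdot>\<^sub>m c \<in> D" using D u cAD by (auto simp: mat_subspace_def)
    moreover have ue: "u + (-1) \<cdot>\<^sub>m c = u - c" using uc cc by (intro eq_matI) auto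
    moreover have "C * (u - c) = 0\<^sub>m r 1"
      using fd(1,2) uc by (simp add: c_def mat_diff_left mat_assoc_eq[OF fd(3)] mat_one_left)
    ultimately have "u - c \<in> U" by (simp add: U_def)
    then have Pu: "P * (u - c) = u - c" by (rule P(2))
    have "P * u - P * c = u - c" using Pu P(1) uc cc by (simp add: mat_diff_left)
    moreover have Pc: "P * c = 0\<^sub>m n 1" using P(3) cAD by auto
    ultimately have "P * u = u - c" using P(1) uc by (simp add: mat_diff_zero)
    then have "g * P * u = g * u - g * c" using gP uc g cc by (simp add: mat_diff_left)
    moreover have "g * c = 0\<^sub>m 1 1" using kill cAD by auto
    ultimately have "g * P * u = g * u" using g uc by (simp add: mat_diff_zero)
    then show "(g - g * P) * u = 0\<^sub>m 1 1" using g P(1) uc by (simp add: mat_diff_right mat_diff_self)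
  qed (use g P(1) in auto)
qed

text \<open>Iteration of the case of two subspaces. For empty \<open>J\<close> the intersection is
  the whole space, so \<open>g = 0\<close> and the empty sum suffices.\<close>

lemma annihilator_Inter:
  fixes g :: "'k::field mat"
  assumes "finite J" "\<And>j. j \<in> J \<Longrightarrow> mat_subspace n (A j)" "g \<in> carrier_mat 1 n"
    "\<And>u. u \<in> carrier_mat n 1 \<Longrightarrow> (\<And>j. j \<in> J \<Longrightarrow> u \<in> A j) \<Longrightarrow> g * u = 0\<^sub>m 1 1"
  shows "g \<in> mat_sums 1 n (\<Union>j\<in>J. {h \<in> carrier_mat 1 n. \<forall>u \<in> A j. h * u = 0\<^sub>m 1 1})"
  using assms
proof (induction J arbitrary: g rule: finite_induct)
  case empty
  have "g = 0\<^sub>m 1 n"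
    by (rule mat_eq_by_columns) (use empty in \<open>auto simp: mat_zero_left\<close>)
  then show ?case by (auto intro: mat_sums.zero)
next
  case (insert j J)
  let ?D = "{u \<in> carrier_mat n 1. \<forall>j\<in>J. u \<in> A j}"
  have D: "mat_subspace n ?D" using insert.prems(1) by (auto simp: mat_subspace_def)
  have Aj: "mat_subspace n (A j)" using insert.prems(1) by simp
  have kill: "g * u = 0\<^sub>m 1 1" if "u \<in> A j" "u \<in> ?D" for u
    by (rule insert.prems(3)) (use that in auto)
  obtain g1 g2 where g: "g1 \<in> carrier_mat 1 n" "g2 \<in> carrier_mat 1 n" "g = g1 + g2"
    "\<forall>u \<in> A j. g1 * u = 0\<^sub>m 1 1" "\<forall>u \<in> ?D. g2 * u = 0\<^sub>m 1 1"
  proof -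
    have "\<exists>g1 \<in> carrier_mat 1 n. \<exists>g2 \<in> carrier_mat 1 n. g = g1 + g2 \<and>
        (\<forall>u \<in> A j. g1 * u = 0\<^sub>m 1 1) \<and> (\<forall>u \<in> ?D. g2 * u = 0\<^sub>m 1 1)"
      by (rule annihilator_inter[OF Aj D insert.prems(2) kill])
    then show ?thesis by (elim bexE conjE) (rule that)
  qed
  have "g2 \<in> mat_sums 1 n (\<Union>j\<in>J. {h \<in> carrier_mat 1 n. \<forall>u \<in> A j. h * u = 0\<^sub>m 1 1})"
    by (rule insert.IH[OF _ g(2)]) (use insert.prems(1) g(5) in auto)
  then have "g2 \<in> mat_sums 1 n (\<Union>j\<in>insert j J. {h \<in> carrier_mat 1 n. \<forall>u \<in> A j. h * u = 0\<^sub>m 1 1})"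
    by (rule mat_sums_mono) blast
  then show ?case unfolding g(3) by (rule mat_sums.add[rotated]) (use g in blast)
qed

subsection \<open>Tensor products of subspaces\<close>

definition tensor_space :: "nat \<Rightarrow> nat \<Rightarrow> 'k::field mat set \<Rightarrow> 'k mat set \<Rightarrow> 'k mat set" where
  "tensor_space n m A B = {u \<in> carrier_mat (n * m) 1.
    (\<forall>h \<in> carrier_mat 1 m. kronecker (1\<^sub>m n) h * u \<in> A) \<and>
    (\<forall>g \<in> carrier_mat 1 n. kronecker g (1\<^sub>m m) * u \<in> B)}"

lemma kronecker_vector_eqI:
  fixes u v :: "'k::field mat"
  assumes u: "u \<in> carrier_mat (n * m) 1" "v \<in> carrier_mat (n * m) 1"
    and eq: "\<And>g h. g \<in> carrier_mat 1 n \<Longrightarrow> h \<in> carrier_mat 1 m \<Longrightarrow> kronecker g h * u = kronecker g h * v"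
  shows "u = v"
proof (rule eq_matI)
  fix i j assume "i < dim_row v" "j < dim_col v"
  then have i: "i < n * m" and j: "j = 0" using u by auto
  let ?g = "mat 1 n (\<lambda>(_, a). if i div m = a then 1 else 0) :: 'k mat"
  let ?h = "mat 1 m (\<lambda>(_, a). if i mod m = a then 1 else 0) :: 'k mat"
  have "(kronecker ?g ?h * w) $$ (0, 0) = w $$ (i, 0)" if w: "w \<in> carrier_mat (n * m) 1" for w
  proof -
    have "(kronecker ?g ?h * w) $$ (0, 0) = (\<Sum>k<n * m. kronecker ?g ?h $$ (0, k) * w $$ (k, 0))"
      using w by (subst mult_index_sum) auto
    also have "\<dots> = (\<Sum>k<n * m. if k = i then w $$ (k, 0) else 0)"
    proof (rule sum.cong)
      fix k assume k: "k \<in> {..<n * m}"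
      have "k = i" if "i div m = k div m" "i mod m = k mod m" using that by (metis div_mult_mod_eq)
      then show "kronecker ?g ?h $$ (0, k) * w $$ (k, 0) = (if k = i then w $$ (k, 0) else 0)"
        using k by (auto simp: kronecker_index div_less_mult mod_less_mult)
    qed simp
    finally show ?thesis using i by simp
  qed
  from this[OF u(1)] this[OF u(2)] show "u $$ (i, j) = v $$ (i, j)"
    using eq[of ?g ?h] j by simp
qed (use u in auto)

lemma kronecker_split:
  fixes g h :: "'k::field mat"
  assumes "g \<in> carrier_mat a n" "h \<in> carrier_mat b m" "u \<in> carrier_mat (n * m) 1"
  shows "kronecker g h * u = kronecker g (1\<^sub>m b) * (kronecker (1\<^sub>m n) h * u)"
    "kronecker g h * u = kronecker (1\<^sub>m a) h * (kronecker g (1\<^sub>m m) * u)"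
proof -
  have "kronecker g (1\<^sub>m b) * kronecker (1\<^sub>m n) h = kronecker g h"
    using assms by (simp add: kronecker_mult mat_one_left mat_one_right)
  from mat_assoc_eq[OF this, of u] show "kronecker g h * u = kronecker g (1\<^sub>m b) * (kronecker (1\<^sub>m n) h * u)"
    using assms by simp
  have "kronecker (1\<^sub>m a) h * kronecker g (1\<^sub>m m) = kronecker g h"
    using assms by (simp add: kronecker_mult mat_one_left mat_one_right)
  from mat_assoc_eq[OF this, of u] show "kronecker g h * u = kronecker (1\<^sub>m a) h * (kronecker g (1\<^sub>m m) * u)"
    using assms by simp
qed

text \<open>Tested on a product functional: contracting the second factor with \<open>h * P'\<close>
  gives a vector of \<open>A\<close>, on which \<open>P\<close> acts trivially; then contracting the
  first factor with \<open>g\<close> gives a vector of \<open>B\<close>, on which \<open>P'\<close>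
  acts trivially.\<close>

lemma tensor_space_fixed:
  fixes P P' :: "'k::field mat"
  assumes u: "u \<in> tensor_space n m A B" and P: "P \<in> carrier_mat n n" "P' \<in> carrier_mat m m"
    and fix1: "\<And>v. v \<in> A \<Longrightarrow> P * v = v" and fix2: "\<And>v. v \<in> B \<Longrightarrow> P' * v = v"
  shows "kronecker P P' * u = u"
proof (rule kronecker_vector_eqI[of _ n m])
  have uc: "u \<in> carrier_mat (n * m) 1" using u by (auto simp: tensor_space_def)
  show "kronecker P P' * u \<in> carrier_mat (n * m) 1" "u \<in> carrier_mat (n * m) 1"
    using uc P by (auto intro!: carrier_matI)
  fix g h :: "'k mat" assume gh: "g \<in> carrier_mat 1 n" "h \<in> carrier_mat 1 m"
  have gP: "g * P \<in> carrier_mat 1 n" using gh P by auto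
  have hP: "h * P' \<in> carrier_mat 1 m" using gh P by auto
  have uA: "kronecker (1\<^sub>m n) h * u \<in> A" if "h \<in> carrier_mat 1 m" for h
    using u that by (auto simp: tensor_space_def)
  have uB: "kronecker g (1\<^sub>m m) * u \<in> B" if "g \<in> carrier_mat 1 n" for g
    using u that by (auto simp: tensor_space_def)
  have "kronecker g h * (kronecker P P' * u) = kronecker (g * P) (h * P') * u"
    by (rule mat_assoc_eq) (use gh P uc in \<open>auto simp: kronecker_mult\<close>)
  also have "\<dots> = kronecker (g * P) (1\<^sub>m 1) * (kronecker (1\<^sub>m n) (h * P') * u)"
    by (rule kronecker_split(1)[OF gP hP uc])
  also have "\<dots> = g * (P * (kronecker (1\<^sub>m n) (h * P') * u))"
    unfolding kronecker_one_right using gh P uc by (simp add: mat_assoc)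
  also have "P * (kronecker (1\<^sub>m n) (h * P') * u) = kronecker (1\<^sub>m n) (h * P') * u"
    by (rule fix1[OF uA[OF hP]])
  also have "g * (kronecker (1\<^sub>m n) (h * P') * u) = kronecker g (h * P') * u"
    using kronecker_split(1)[OF gh(1) hP uc] unfolding kronecker_one_right by simp
  also have "\<dots> = kronecker (1\<^sub>m 1) (h * P') * (kronecker g (1\<^sub>m m) * u)"
    by (rule kronecker_split(2)[OF gh(1) hP uc])
  also have "\<dots> = h * (P' * (kronecker g (1\<^sub>m m) * u))"
    unfolding kronecker_one_left using gh P uc by (simp add: mat_assoc)
  also have "P' * (kronecker g (1\<^sub>m m) * u) = kronecker g (1\<^sub>m m) * u"
    by (rule fix2[OF uB[OF gh(1)]])
  also have "h * (kronecker g (1\<^sub>m m) * u) = kronecker g h * u"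
    using kronecker_split(2)[OF gh uc] unfolding kronecker_one_left by simp
  finally show "kronecker g h * (kronecker P P' * u) = kronecker g h * u" .
qed

lemma tensor_space_map:
  fixes f f' :: "'k::field mat"
  assumes u: "u \<in> tensor_space n m A B" and f: "f \<in> carrier_mat n' n" "f' \<in> carrier_mat m' m"
    and A: "\<And>v. v \<in> A \<Longrightarrow> f * v \<in> A'" and B: "\<And>v. v \<in> B \<Longrightarrow> f' * v \<in> B'"
  shows "kronecker f f' * u \<in> tensor_space n' m' A' B'"
  unfolding tensor_space_def
proof (intro CollectI conjI ballI)
  have uc: "u \<in> carrier_mat (n * m) 1" using u by (auto simp: tensor_space_def)
  show "kronecker f f' * u \<in> carrier_mat (n' * m') 1"
    using uc f by (auto intro!: carrier_matI)
  fix h :: "'k mat" assume h: "h \<in> carrier_mat 1 m'"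
  have hf: "h * f' \<in> carrier_mat 1 m" using h f by auto
  have "kronecker (1\<^sub>m n') h * (kronecker f f' * u) = kronecker f (h * f') * u"
    by (rule mat_assoc_eq) (use h f uc in \<open>auto simp: kronecker_mult mat_one_left\<close>)
  also have "\<dots> = f * (kronecker (1\<^sub>m n) (h * f') * u)"
    using kronecker_split(1)[OF f(1) hf uc] unfolding kronecker_one_right .
  also have "\<dots> \<in> A'" using A u hf by (auto simp: tensor_space_def)
  finally show "kronecker (1\<^sub>m n') h * (kronecker f f' * u) \<in> A'" .
next
  have uc: "u \<in> carrier_mat (n * m) 1" using u by (auto simp: tensor_space_def)
  fix h :: "'k mat" assume h: "h \<in> carrier_mat 1 n'"
  have hf: "h * f \<in> carrier_mat 1 n" using h f by auto
  have "kronecker h (1\<^sub>m m') * (kronecker f f' * u) = kronecker (h * f) f' * u"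
    by (rule mat_assoc_eq) (use h f uc in \<open>auto simp: kronecker_mult mat_one_left\<close>)
  also have "\<dots> = f' * (kronecker (h * f) (1\<^sub>m m) * u)"
    using kronecker_split(2)[OF hf f(2) uc] unfolding kronecker_one_left .
  also have "\<dots> \<in> B'" using B u hf by (auto simp: tensor_space_def)
  finally show "kronecker h (1\<^sub>m m') * (kronecker f f' * u) \<in> B'" .
qed

text \<open>Preimages come from the Kronecker product of two linear sections; the composite with
  \<open>kronecker f f'\<close> is the identity on the target by
  \<open>tensor_space_fixed\<close>.\<close>

lemma tensor_space_image:
  fixes f f' :: "'k::field mat"
  assumes f: "f \<in> carrier_mat n' n" "f' \<in> carrier_mat m' m"
    and A: "mat_subspace n A" and B: "mat_subspace m B"
  shows "(\<lambda>u. kronecker f f' * u) ` tensor_space n m A B =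
    tensor_space n' m' ((\<lambda>u. f * u) ` A) ((\<lambda>u. f' * u) ` B)"
proof
  show "(\<lambda>u. kronecker f f' * u) ` tensor_space n m A B
    \<subseteq> tensor_space n' m' ((\<lambda>u. f * u) ` A) ((\<lambda>u. f' * u) ` B)"
    using tensor_space_map[OF _ f] by auto
  show "tensor_space n' m' ((\<lambda>u. f * u) ` A) ((\<lambda>u. f' * u) ` B)
    \<subseteq> (\<lambda>u. kronecker f f' * u) ` tensor_space n m A B"
  proof
    fix w assume w: "w \<in> tensor_space n' m' ((\<lambda>u. f * u) ` A) ((\<lambda>u. f' * u) ` B)"
    have wc: "w \<in> carrier_mat (n' * m') 1" using w by (auto simp: tensor_space_def)
    obtain s where s: "s \<in> carrier_mat n n'" "\<And>v. v \<in> (\<lambda>u. f * u) ` A \<Longrightarrow> s * v \<in> A \<and> f * (s * v) = v"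
      using subspace_section[OF f(1) A] by blast
    obtain t where t: "t \<in> carrier_mat m m'" "\<And>v. v \<in> (\<lambda>u. f' * u) ` B \<Longrightarrow> t * v \<in> B \<and> f' * (t * v) = v"
      using subspace_section[OF f(2) B] by blast
    have sw: "kronecker s t * w \<in> tensor_space n m A B"
      by (rule tensor_space_map[OF w s(1) t(1)]) (use s t in auto)
    have Ac: "v \<in> A \<Longrightarrow> v \<in> carrier_mat n 1" and Bc: "v' \<in> B \<Longrightarrow> v' \<in> carrier_mat m 1" for v v'
      using A B by (auto simp: mat_subspace_def)
    have "kronecker f f' * (kronecker s t * w) = kronecker (f * s) (f' * t) * w"
      by (rule mat_assoc_eq) (use f s(1) t(1) wc in \<open>auto simp: kronecker_mult\<close>)
    also have "\<dots> = w"
    proof (rule tensor_space_fixed[OF w])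
      fix v assume v: "v \<in> (\<lambda>u. f * u) ` A"
      have "v \<in> carrier_mat n' 1" using v f(1) Ac by auto
      then show "f * s * v = v" using s(2)[OF v] f(1) s(1) by (simp add: mat_assoc)
    next
      fix v assume v: "v \<in> (\<lambda>u. f' * u) ` B"
      have "v \<in> carrier_mat m' 1" using v f(2) Bc by auto
      then show "f' * t * v = v" using t(2)[OF v] f(2) t(1) by (simp add: mat_assoc)
    qed (use f s t in auto)
    finally show "w \<in> (\<lambda>u. kronecker f f' * u) ` tensor_space n m A B"
      using sw by (metis image_eqI)
  qed
qed

text \<open>Kronecker products of bases and of coordinate maps again match up, so dimensions
  multiply.\<close>

lemma tensor_space_frame:
  fixes B C :: "'k::field mat"
  assumes fA: "frame n A r B C" and fA': "frame m A' s B' C'"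
  shows "frame (n * m) (tensor_space n m A A') (r * s) (kronecker B B') (kronecker C C')"
  unfolding frame_def
proof (intro conjI)
  note a = frameD[OF fA] and a' = frameD[OF fA']
  show "kronecker B B' \<in> carrier_mat (n * m) (r * s)" "kronecker C C' \<in> carrier_mat (r * s) (n * m)"
    using a a' by (auto intro!: carrier_matI)
  show cb: "kronecker C C' * kronecker B B' = 1\<^sub>m (r * s)"
    using a(1-3) a'(1-3) by (simp add: kronecker_mult kronecker_one)
  show "tensor_space n m A A' = (\<lambda>z. kronecker B B' * z) ` carrier_mat (r * s) 1"
  proof
    show "tensor_space n m A A' \<subseteq> (\<lambda>z. kronecker B B' * z) ` carrier_mat (r * s) 1"
    proof
      fix u assume u: "u \<in> tensor_space n m A A'"
      then have uc: "u \<in> carrier_mat (n * m) 1" by (auto simp: tensor_space_def)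
      have "kronecker B B' * (kronecker C C' * u) = kronecker (B * C) (B' * C') * u"
        by (rule mat_assoc_eq) (use a a' uc in \<open>auto simp: kronecker_mult\<close>)
      also have "\<dots> = u"
      proof (rule tensor_space_fixed[OF u])
        fix v assume "v \<in> A"
        from frame_fixes[OF fA this] show "B * C * v = v" using a(1,2) by (simp add: mat_assoc)
      next
        fix v assume "v \<in> A'"
        from frame_fixes[OF fA' this] show "B' * C' * v = v" using a'(1,2) by (simp add: mat_assoc)
      qed (use a a' in auto)
      finally show "u \<in> (\<lambda>z. kronecker B B' * z) ` carrier_mat (r * s) 1"
        by (intro image_eqI[of _ _ "kronecker C C' * u"]) (use a a' uc in \<open>auto intro!: carrier_matI\<close>)
    qed
    show "(\<lambda>z. kronecker B B' * z) ` carrier_mat (r * s) 1 \<subseteq> tensor_space n m A A'"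
    proof clarify
      fix z :: "'k mat" assume z: "z \<in> carrier_mat (r * s) 1"
      have "z \<in> tensor_space r s (carrier_mat r 1) (carrier_mat s 1)"
        unfolding tensor_space_def using z by (auto intro!: carrier_matI)
      then show "kronecker B B' * z \<in> tensor_space n m A A'"
        by (rule tensor_space_map) (use a a' in auto)
    qed
  qed
qed

section \<open>Morphisms of representations\<close>

lemma rdim_tensor_rep [simp]: "rdim (tensor_rep V W) x = rdim V x * rdim W x"
  and rmap_tensor_rep [simp]: "rmap (tensor_rep V W) a = kronecker (rmap V a) (rmap W a)"
  by (auto simp: tensor_rep_def)

locale quiver =
  fixes Q :: "('a, 'b) pre_digraph"
  assumes tail_in_verts: "a \<in> arcs Q \<Longrightarrow> tail Q a \<in> verts Q"
    and head_in_verts: "a \<in> arcs Q \<Longrightarrow> head Q a \<in> verts Q"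

definition rep_hom ::
    "('a, 'b) pre_digraph \<Rightarrow> ('a, 'b, 'k :: field) rep \<Rightarrow> ('a, 'b, 'k) rep \<Rightarrow> ('a \<Rightarrow> 'k mat) \<Rightarrow> bool" where
  "rep_hom Q V W \<phi> \<longleftrightarrow> (\<forall>x \<in> verts Q. \<phi> x \<in> carrier_mat (rdim W x) (rdim V x)) \<and>
    (\<forall>a \<in> arcs Q. \<phi> (head Q a) * rmap V a = rmap W a * \<phi> (tail Q a))"

lemma rep_homD:
  assumes "rep_hom Q V W \<phi>"
  shows "x \<in> verts Q \<Longrightarrow> \<phi> x \<in> carrier_mat (rdim W x) (rdim V x)"
    "a \<in> arcs Q \<Longrightarrow> \<phi> (head Q a) * rmap V a = rmap W a * \<phi> (tail Q a)"
  using assms by (auto simp: rep_hom_def)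

lemma is_repD:
  "is_rep Q V \<Longrightarrow> a \<in> arcs Q \<Longrightarrow> rmap V a \<in> carrier_mat (rdim V (head Q a)) (rdim V (tail Q a))"
  by (auto simp: is_rep_def)

text \<open>A direct sum decomposition expressed by morphisms instead of block form, so that it
  applies to representations that are only isomorphic to a \<open>dsum_rep\<close>.\<close>

definition biproduct ::
    "('a, 'b) pre_digraph \<Rightarrow> ('a, 'b, 'k :: field) rep \<Rightarrow> ('a, 'b, 'k) rep \<Rightarrow> ('a, 'b, 'k) rep \<Rightarrow>
     ('a \<Rightarrow> 'k mat) \<Rightarrow> ('a \<Rightarrow> 'k mat) \<Rightarrow> ('a \<Rightarrow> 'k mat) \<Rightarrow> ('a \<Rightarrow> 'k mat) \<Rightarrow> bool" where
  "biproduct Q V V1 V2 i1 p1 i2 p2 \<longleftrightarrow>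
    rep_hom Q V1 V i1 \<and> rep_hom Q V V1 p1 \<and> rep_hom Q V2 V i2 \<and> rep_hom Q V V2 p2 \<and>
    (\<forall>x \<in> verts Q. p1 x * i1 x = 1\<^sub>m (rdim V1 x) \<and> p2 x * i2 x = 1\<^sub>m (rdim V2 x) \<and>
      p1 x * i2 x = 0\<^sub>m (rdim V1 x) (rdim V2 x) \<and> p2 x * i1 x = 0\<^sub>m (rdim V2 x) (rdim V1 x) \<and>
      i1 x * p1 x + i2 x * p2 x = 1\<^sub>m (rdim V x))"

lemma inj_mult_index:
  fixes X :: "'k::field mat"
  shows "X \<in> carrier_mat n c \<Longrightarrow> i < n + m \<Longrightarrow> j < c \<Longrightarrow>
      (inj1 n m * X) $$ (i, j) = (if i < n then X $$ (i, j) else 0)"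
    "X \<in> carrier_mat m c \<Longrightarrow> i < n + m \<Longrightarrow> j < c \<Longrightarrow>
      (inj2 n m * X) $$ (i, j) = (if n \<le> i then X $$ (i - n, j) else 0)"
proof -
  assume X: "X \<in> carrier_mat n c" and ij: "i < n + m" "j < c"
  show "(inj1 n m * X) $$ (i, j) = (if i < n then X $$ (i, j) else 0)"
    using X ij by (subst mult_index_sum) (auto simp: inj1_def if_mult_delta)
next
  assume X: "X \<in> carrier_mat m c" and ij: "i < n + m" "j < c"
  have e: "(if i = n + k then 1 else 0) * X $$ (k, j) = (if k = i - n then if n \<le> i then X $$ (k, j) else 0 else 0)" for k
    by auto
  show "(inj2 n m * X) $$ (i, j) = (if n \<le> i then X $$ (i - n, j) else 0)"
    using X ij by (subst mult_index_sum) (auto simp: inj2_def e)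
qed

lemma mult_prj_index:
  fixes X :: "'k::field mat"
  shows "X \<in> carrier_mat c n \<Longrightarrow> j < n + m \<Longrightarrow> i < c \<Longrightarrow>
      (X * prj1 n m) $$ (i, j) = (if j < n then X $$ (i, j) else 0)"
    "X \<in> carrier_mat c m \<Longrightarrow> j < n + m \<Longrightarrow> i < c \<Longrightarrow>
      (X * prj2 n m) $$ (i, j) = (if n \<le> j then X $$ (i, j - n) else 0)"
proof -
  assume X: "X \<in> carrier_mat c n" and ij: "j < n + m" "i < c"
  show "(X * prj1 n m) $$ (i, j) = (if j < n then X $$ (i, j) else 0)"
    using X ij by (subst mult_index_sum) (auto simp: prj1_def if_mult_delta)
next
  assume X: "X \<in> carrier_mat c m" and ij: "j < n + m" "i < c"
  have e: "X $$ (i, k) * (if n + k = j then 1 else 0) = (if k = j - n then if n \<le> j then X $$ (i, k) else 0 else 0)" for k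
    by auto
  show "(X * prj2 n m) $$ (i, j) = (if n \<le> j then X $$ (i, j - n) else 0)"
    using X ij by (subst mult_index_sum) (auto simp: prj2_def e)
qed

text \<open>Translates the block form of \<open>dsum_rep\<close> into coordinate maps, after which
  entries of block matrices no longer have to be inspected.\<close>

lemma four_block_diag_eq:
  fixes A D :: "'k::field mat"
  assumes A: "A \<in> carrier_mat n' n" and D: "D \<in> carrier_mat m' m"
  shows "four_block_mat A (0\<^sub>m n' m) (0\<^sub>m m' n) D = inj1 n' m' * (A * prj1 n m) + inj2 n' m' * (D * prj2 n m)"
    (is "?l = ?r")
proof (rule eq_matI)
  have Ac: "A * prj1 n m \<in> carrier_mat n' (n + m)" and Dc: "D * prj2 n m \<in> carrier_mat m' (n + m)"
    using A D by (auto intro!: carrier_matI)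
  fix i j assume "i < dim_row ?r" "j < dim_col ?r"
  then have ij: "i < n' + m'" "j < n + m" by auto
  have r: "?r $$ (i, j) = (inj1 n' m' * (A * prj1 n m)) $$ (i, j) + (inj2 n' m' * (D * prj2 n m)) $$ (i, j)"
    using ij by (simp del: index_mult_mat(1))
  have A1: "i < n' \<Longrightarrow> (A * prj1 n m) $$ (i, j) = (if j < n then A $$ (i, j) else 0)"
    by (rule mult_prj_index(1)[OF A ij(2)])
  have D1: "\<not> i < n' \<Longrightarrow> (D * prj2 n m) $$ (i - n', j) = (if n \<le> j then D $$ (i - n', j - n) else 0)"
    using ij by (intro mult_prj_index(2)[OF D ij(2)]) auto
  show "?l $$ (i, j) = ?r $$ (i, j)"
    unfolding r inj_mult_index(1)[OF Ac ij] inj_mult_index(2)[OF Dc ij]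
    using A D ij A1 D1 by auto
qed (use A D in auto)

section \<open>Isomorphisms and biproducts of representations\<close>

context quiver
begin

lemmas ends_in_verts = tail_in_verts head_in_verts

lemma rep_hom_comp:
  assumes "is_rep Q V" "is_rep Q W" "is_rep Q U" "rep_hom Q V W \<phi>" "rep_hom Q W U \<psi>"
  shows "rep_hom Q V U (\<lambda>x. \<psi> x * \<phi> x)"
  unfolding rep_hom_def
proof (intro conjI ballI)
  fix x assume "x \<in> verts Q"
  then show "\<psi> x * \<phi> x \<in> carrier_mat (rdim U x) (rdim V x)"
    by (intro mult_carrier_mat[OF rep_homD(1)[OF assms(5)] rep_homD(1)[OF assms(4)]])
next
  fix a assume a: "a \<in> arcs Q"
  note d = rep_homD(1)[OF assms(4) tail_in_verts[OF a]] rep_homD(1)[OF assms(4) head_in_verts[OF a]]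
    rep_homD(1)[OF assms(5) tail_in_verts[OF a]] rep_homD(1)[OF assms(5) head_in_verts[OF a]]
    is_repD[OF assms(1) a] is_repD[OF assms(2) a] is_repD[OF assms(3) a]
  have "\<psi> (head Q a) * \<phi> (head Q a) * rmap V a = \<psi> (head Q a) * (rmap W a * \<phi> (tail Q a))"
    using d rep_homD(2)[OF assms(4) a] by (simp add: mat_assoc)
  also have "\<dots> = rmap U a * \<psi> (tail Q a) * \<phi> (tail Q a)"
    by (rule mat_assoc_eq[OF rep_homD(2)[OF assms(5) a]]) (use d in auto)
  also have "\<dots> = rmap U a * (\<psi> (tail Q a) * \<phi> (tail Q a))" using d by (simp add: mat_assoc)
  finally show "\<psi> (head Q a) * \<phi> (head Q a) * rmap V a = rmap U a * (\<psi> (tail Q a) * \<phi> (tail Q a))" .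
qed

lemma rep_hom_add:
  assumes "is_rep Q V" "is_rep Q W" "rep_hom Q V W \<phi>" "rep_hom Q V W \<psi>"
  shows "rep_hom Q V W (\<lambda>x. \<phi> x + \<psi> x)"
  unfolding rep_hom_def
proof (intro conjI ballI)
  fix a assume a: "a \<in> arcs Q"
  note d = rep_homD(1)[OF assms(3) tail_in_verts[OF a]] rep_homD(1)[OF assms(3) head_in_verts[OF a]]
    rep_homD(1)[OF assms(4) tail_in_verts[OF a]] rep_homD(1)[OF assms(4) head_in_verts[OF a]]
    is_repD[OF assms(1) a] is_repD[OF assms(2) a]
  show "(\<phi> (head Q a) + \<psi> (head Q a)) * rmap V a = rmap W a * (\<phi> (tail Q a) + \<psi> (tail Q a))"
    using d rep_homD(2)[OF assms(3) a] rep_homD(2)[OF assms(4) a]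
    by (simp add: mat_distrib_left mat_distrib_right)
qed (use rep_homD(1)[OF assms(3)] rep_homD(1)[OF assms(4)] in auto)

lemma rep_hom_id: "is_rep Q V \<Longrightarrow> rep_hom Q V V (\<lambda>x. 1\<^sub>m (rdim V x))"
  unfolding rep_hom_def by (auto simp: mat_one_left[OF carrier_matD(1)[OF is_repD]] mat_one_right[OF carrier_matD(2)[OF is_repD]])

text \<open>\<open>invertible_mat\<close> speaks of square matrices only, so equality of the
  dimensions is first derived from the two one-sided inverses.\<close>

lemma rep_isoI:
  assumes V: "is_rep Q V" "is_rep Q W" and h: "rep_hom Q V W \<phi>" "rep_hom Q W V \<psi>"
    and inv: "\<And>x. x \<in> verts Q \<Longrightarrow> \<phi> x * \<psi> x = 1\<^sub>m (rdim W x)" "\<And>x. x \<in> verts Q \<Longrightarrow> \<psi> x * \<phi> x = 1\<^sub>m (rdim V x)"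
  shows "(V, W) \<in> rep_iso Q"
proof -
  have "\<phi> x \<in> carrier_mat (rdim W x) (rdim V x) \<and> invertible_mat (\<phi> x)" if x: "x \<in> verts Q" for x
  proof -
    note c = rep_homD(1)[OF h(1) x] rep_homD(1)[OF h(2) x]
    have "rdim V x \<le> rdim W x" by (rule left_inverse_dim_le[OF c inv(2)[OF x]])
    moreover have "rdim W x \<le> rdim V x" by (rule left_inverse_dim_le[OF c(2,1) inv(1)[OF x]])
    ultimately have "rdim V x = rdim W x" by simp
    then show ?thesis using c inv[OF x] by (auto simp: invertible_mat_def inverts_mat_def)
  qed
  then show ?thesis using V rep_homD(2)[OF h(1)] by (auto simp: rep_iso_def)
qed

lemma rep_isoD:
  assumes "(V, W) \<in> rep_iso Q"
  shows "is_rep Q V" "is_rep Q W"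
    "\<exists>\<phi> \<psi>. rep_hom Q V W \<phi> \<and> rep_hom Q W V \<psi> \<and>
      (\<forall>x \<in> verts Q. \<phi> x * \<psi> x = 1\<^sub>m (rdim W x) \<and> \<psi> x * \<phi> x = 1\<^sub>m (rdim V x))"
proof -
  show V: "is_rep Q V" and W: "is_rep Q W" using assms by (auto simp: rep_iso_def)
  obtain \<phi> where \<phi>: "\<forall>x \<in> verts Q. \<phi> x \<in> carrier_mat (rdim W x) (rdim V x) \<and> invertible_mat (\<phi> x)"
    "\<forall>a \<in> arcs Q. \<phi> (head Q a) * rmap V a = rmap W a * \<phi> (tail Q a)"
    using assms by (auto simp: rep_iso_def)
  have "\<exists>B. B \<in> carrier_mat (rdim V x) (rdim W x) \<and> \<phi> x * B = 1\<^sub>m (rdim W x) \<and> B * \<phi> x = 1\<^sub>m (rdim V x)"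
    if x: "x \<in> verts Q" for x
  proof -
    have c: "\<phi> x \<in> carrier_mat (rdim W x) (rdim V x)" and i: "invertible_mat (\<phi> x)" using \<phi>(1) x by auto
    then have sq: "rdim W x = rdim V x" by (auto simp: invertible_mat_def)
    obtain B where B: "inverts_mat (\<phi> x) B" "inverts_mat B (\<phi> x)" using i by (auto simp: invertible_mat_def)
    have 1: "\<phi> x * B = 1\<^sub>m (rdim W x)" and 2: "B * \<phi> x = 1\<^sub>m (dim_row B)" using B c by (auto simp: inverts_mat_def)
    have "dim_col B = rdim W x" "dim_row B = rdim V x"
      using arg_cong[OF 1, of dim_col] arg_cong[OF 2, of dim_col] c by auto
    then show ?thesis using 1 2 by (intro exI[of _ B]) auto
  qed
  then obtain \<psi> where \<psi>: "\<And>x. x \<in> verts Q \<Longrightarrow> \<psi> x \<in> carrier_mat (rdim V x) (rdim W x)"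
    "\<And>x. x \<in> verts Q \<Longrightarrow> \<phi> x * \<psi> x = 1\<^sub>m (rdim W x)" "\<And>x. x \<in> verts Q \<Longrightarrow> \<psi> x * \<phi> x = 1\<^sub>m (rdim V x)"
    by metis
  have "rep_hom Q W V \<psi>" unfolding rep_hom_def
  proof (intro conjI ballI)
    fix a assume a: "a \<in> arcs Q"
    note t = tail_in_verts[OF a] and h = head_in_verts[OF a]
    have c: "\<phi> (tail Q a) \<in> carrier_mat (rdim W (tail Q a)) (rdim V (tail Q a))"
      "\<phi> (head Q a) \<in> carrier_mat (rdim W (head Q a)) (rdim V (head Q a))" using \<phi>(1) t h by auto
    note d = c \<psi>(1)[OF t] \<psi>(1)[OF h] is_repD[OF V a] is_repD[OF W a]
    have "\<psi> (head Q a) * rmap W a = \<psi> (head Q a) * (rmap W a * (\<phi> (tail Q a) * \<psi> (tail Q a)))"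
      using d by (simp add: \<psi>(2)[OF t] mat_one_right)
    also have "rmap W a * (\<phi> (tail Q a) * \<psi> (tail Q a)) = \<phi> (head Q a) * rmap V a * \<psi> (tail Q a)"
      by (rule mat_assoc_eq) (use \<phi>(2) a d in auto)
    also have "\<psi> (head Q a) * (\<phi> (head Q a) * rmap V a * \<psi> (tail Q a)) = rmap V a * \<psi> (tail Q a)"
      using d by (simp add: mat_assoc mat_assoc_eq[OF \<psi>(3)[OF h]] mat_one_left)
    finally show "\<psi> (head Q a) * rmap W a = rmap V a * \<psi> (tail Q a)" .
  qed (use \<psi> in auto)
  moreover have "rep_hom Q V W \<phi>" using \<phi> by (auto simp: rep_hom_def)
  ultimately show "\<exists>\<phi> \<psi>. rep_hom Q V W \<phi> \<and> rep_hom Q W V \<psi> \<and>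
      (\<forall>x \<in> verts Q. \<phi> x * \<psi> x = 1\<^sub>m (rdim W x) \<and> \<psi> x * \<phi> x = 1\<^sub>m (rdim V x))"
    using \<psi> by blast
qed

lemma rep_iso_refl: "is_rep Q V \<Longrightarrow> (V, V) \<in> rep_iso Q"
  by (rule rep_isoI[OF _ _ rep_hom_id rep_hom_id]) (auto simp: mat_one_left)

lemma rep_iso_sym: "(V, W) \<in> rep_iso Q \<Longrightarrow> (W, V) \<in> rep_iso Q"
  using rep_isoD(3)[of V W] rep_isoD(1,2)[of V W] rep_isoI[of W V] by blast

lemma rep_iso_trans:
  assumes "(V, W) \<in> rep_iso Q" "(W, U) \<in> rep_iso Q"
  shows "(V, U) \<in> rep_iso Q"
proof -
  note r = rep_isoD(1,2)[OF assms(1)] rep_isoD(2)[OF assms(2)]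
  obtain \<phi> \<psi> where 1: "rep_hom Q V W \<phi>" "rep_hom Q W V \<psi>"
    "\<And>x. x \<in> verts Q \<Longrightarrow> \<phi> x * \<psi> x = 1\<^sub>m (rdim W x)" "\<And>x. x \<in> verts Q \<Longrightarrow> \<psi> x * \<phi> x = 1\<^sub>m (rdim V x)"
    using rep_isoD(3)[OF assms(1)] by blast
  obtain \<phi>' \<psi>' where 2: "rep_hom Q W U \<phi>'" "rep_hom Q U W \<psi>'"
    "\<And>x. x \<in> verts Q \<Longrightarrow> \<phi>' x * \<psi>' x = 1\<^sub>m (rdim U x)" "\<And>x. x \<in> verts Q \<Longrightarrow> \<psi>' x * \<phi>' x = 1\<^sub>m (rdim W x)"
    using rep_isoD(3)[OF assms(2)] by blast
  show ?thesis
  proof (rule rep_isoI[OF r(1,3) rep_hom_comp[OF r(1,2,3) 1(1) 2(1)] rep_hom_comp[OF r(3,2,1) 2(2) 1(2)]])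
    fix x assume x: "x \<in> verts Q"
    note d = rep_homD(1)[OF 1(1) x] rep_homD(1)[OF 1(2) x] rep_homD(1)[OF 2(1) x] rep_homD(1)[OF 2(2) x]
    show "\<phi>' x * \<phi> x * (\<psi> x * \<psi>' x) = 1\<^sub>m (rdim U x)"
      using d by (simp add: mat_assoc mat_assoc_eq[OF 1(3)[OF x]] mat_one_left 2(3)[OF x])
    show "\<psi> x * \<psi>' x * (\<phi>' x * \<phi> x) = 1\<^sub>m (rdim V x)"
      using d by (simp add: mat_assoc mat_assoc_eq[OF 2(4)[OF x]] mat_one_left 1(4)[OF x])
  qed
qed

lemma rep_iso_equiv: "equiv (reps K Q) (rep_iso Q)"
  by (rule equivI) (auto simp: reps_def refl_on_def sym_def trans_def
      intro: rep_iso_refl rep_iso_sym rep_iso_trans dest: rep_isoD)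

lemma is_rep_dsum: "is_rep Q V \<Longrightarrow> is_rep Q W \<Longrightarrow> is_rep Q (dsum_rep V W)"
  by (auto simp: is_rep_def dsum_rep_def)

lemma dsum_rmap:
  assumes "is_rep Q V" "is_rep Q W" "a \<in> arcs Q"
  shows "rmap (dsum_rep V W) a =
    inj1 (rdim V (head Q a)) (rdim W (head Q a)) * (rmap V a * prj1 (rdim V (tail Q a)) (rdim W (tail Q a))) +
    inj2 (rdim V (head Q a)) (rdim W (head Q a)) * (rmap W a * prj2 (rdim V (tail Q a)) (rdim W (tail Q a)))"
  using four_block_diag_eq[OF is_repD[OF assms(1,3)] is_repD[OF assms(2,3)]]
    is_repD[OF assms(1,3)] is_repD[OF assms(2,3)] by (simp add: dsum_rep_def)

lemma dsum_biproduct: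
  assumes V: "is_rep Q V" and W: "is_rep Q W"
  shows "biproduct Q (dsum_rep V W) V W (\<lambda>x. inj1 (rdim V x) (rdim W x)) (\<lambda>x. prj1 (rdim V x) (rdim W x))
    (\<lambda>x. inj2 (rdim V x) (rdim W x)) (\<lambda>x. prj2 (rdim V x) (rdim W x))"
proof -
  have d: "rdim (dsum_rep V W) x = rdim V x + rdim W x" for x by (simp add: dsum_rep_def)
  have homs: "rep_hom Q V (dsum_rep V W) (\<lambda>x. inj1 (rdim V x) (rdim W x))"
    "rep_hom Q W (dsum_rep V W) (\<lambda>x. inj2 (rdim V x) (rdim W x))"
    "rep_hom Q (dsum_rep V W) V (\<lambda>x. prj1 (rdim V x) (rdim W x))"
    "rep_hom Q (dsum_rep V W) W (\<lambda>x. prj2 (rdim V x) (rdim W x))"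
    unfolding rep_hom_def d
  proof (safe)
    fix a assume a: "a \<in> arcs Q"
    note r = is_repD[OF V a] is_repD[OF W a]
    let ?h = "head Q a" and ?t = "tail Q a"
    note s = dsum_rmap[OF V W a] mat_distrib_left mat_distrib_right mat_assoc prj_inj mat_assoc_eq[OF prj_inj(1)]
      mat_assoc_eq[OF prj_inj(2)] mat_assoc_eq[OF prj_inj(3)] mat_assoc_eq[OF prj_inj(4)] mat_ring_simps
    show "inj1 (rdim V ?h) (rdim W ?h) * rmap V a = rmap (dsum_rep V W) a * inj1 (rdim V ?t) (rdim W ?t)"
      "inj2 (rdim V ?h) (rdim W ?h) * rmap W a = rmap (dsum_rep V W) a * inj2 (rdim V ?t) (rdim W ?t)"
      "prj1 (rdim V ?h) (rdim W ?h) * rmap (dsum_rep V W) a = rmap V a * prj1 (rdim V ?t) (rdim W ?t)"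
      "prj2 (rdim V ?h) (rdim W ?h) * rmap (dsum_rep V W) a = rmap W a * prj2 (rdim V ?t) (rdim W ?t)"
      using r by (simp_all add: s)
  qed (auto intro!: carrier_matI)
  then show ?thesis unfolding biproduct_def d by (simp add: prj_inj inj_prj_sum)
qed

lemma biproduct_iso:
  assumes V: "is_rep Q V" "is_rep Q V1" "is_rep Q V2" and b: "biproduct Q V V1 V2 i1 p1 i2 p2"
  shows "(V, dsum_rep V1 V2) \<in> rep_iso Q"
proof -
  let ?D = "dsum_rep V1 V2"
  let ?j1 = "\<lambda>x. inj1 (rdim V1 x) (rdim V2 x)" and ?j2 = "\<lambda>x. inj2 (rdim V1 x) (rdim V2 x)"
    and ?q1 = "\<lambda>x. prj1 (rdim V1 x) (rdim V2 x)" and ?q2 = "\<lambda>x. prj2 (rdim V1 x) (rdim V2 x)"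
  have D: "is_rep Q ?D" using V by (simp add: is_rep_dsum)
  have db: "biproduct Q ?D V1 V2 ?j1 ?q1 ?j2 ?q2" by (rule dsum_biproduct[OF V(2,3)])
  note b' = b[unfolded biproduct_def] and d' = db[unfolded biproduct_def]
  have h1: "rep_hom Q V ?D (\<lambda>x. ?j1 x * p1 x + ?j2 x * p2 x)"
    using rep_hom_add[OF V(1) D rep_hom_comp[OF V(1,2) D] rep_hom_comp[OF V(1,3) D]] b' d' by blast
  have h2: "rep_hom Q ?D V (\<lambda>x. i1 x * ?q1 x + i2 x * ?q2 x)"
    using rep_hom_add[OF D V(1) rep_hom_comp[OF D V(2,1)] rep_hom_comp[OF D V(3,1)]] b' d' by blast
  have rd: "rdim ?D x = rdim V1 x + rdim V2 x" for x by (simp add: dsum_rep_def)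
  show ?thesis
  proof (rule rep_isoI[OF V(1) D h1 h2])
    fix x assume x: "x \<in> verts Q"
    have c: "i1 x \<in> carrier_mat (rdim V x) (rdim V1 x)" "i2 x \<in> carrier_mat (rdim V x) (rdim V2 x)"
      "p1 x \<in> carrier_mat (rdim V1 x) (rdim V x)" "p2 x \<in> carrier_mat (rdim V2 x) (rdim V x)"
      using b' x by (auto dest: rep_homD(1))
    have e: "p1 x * i1 x = 1\<^sub>m (rdim V1 x)" "p2 x * i2 x = 1\<^sub>m (rdim V2 x)"
      "p1 x * i2 x = 0\<^sub>m (rdim V1 x) (rdim V2 x)" "p2 x * i1 x = 0\<^sub>m (rdim V2 x) (rdim V1 x)"
      "i1 x * p1 x + i2 x * p2 x = 1\<^sub>m (rdim V x)" using b' x by auto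
    have "(?j1 x * p1 x + ?j2 x * p2 x) * (i1 x * ?q1 x + i2 x * ?q2 x) = ?j1 x * ?q1 x + ?j2 x * ?q2 x"
      using c by (simp add: mat_assoc mat_ring_simps mat_assoc_eq[OF e(1)] mat_assoc_eq[OF e(2)] mat_assoc_eq[OF e(3)] mat_assoc_eq[OF e(4)])
    then show "(?j1 x * p1 x + ?j2 x * p2 x) * (i1 x * ?q1 x + i2 x * ?q2 x) = 1\<^sub>m (rdim ?D x)"
      by (simp add: inj_prj_sum rd)
    have "(i1 x * ?q1 x + i2 x * ?q2 x) * (?j1 x * p1 x + ?j2 x * p2 x) = i1 x * p1 x + i2 x * p2 x"
      using c by (simp add: mat_assoc mat_ring_simps mat_assoc_eq[OF prj_inj(1)] mat_assoc_eq[OF prj_inj(2)]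
        mat_assoc_eq[OF prj_inj(3)] mat_assoc_eq[OF prj_inj(4)])
    then show "(i1 x * ?q1 x + i2 x * ?q2 x) * (?j1 x * p1 x + ?j2 x * p2 x) = 1\<^sub>m (rdim V x)"
      by (simp add: e(5))
  qed
qed

subsection \<open>Tensor products\<close>

lemma is_rep_tensor: "is_rep Q V \<Longrightarrow> is_rep Q W \<Longrightarrow> is_rep Q (tensor_rep V W)"
  by (auto simp: is_rep_def intro!: kronecker_carrier)

lemma is_rep_unit: "is_rep Q unit_rep"
  by (auto simp: is_rep_def unit_rep_def)

text \<open>An equality and not just an isomorphism: both bracketings order the basis
  lexicographically. Commutativity, in contrast, needs the flip.\<close>

lemma tensor_assoc: "tensor_rep (tensor_rep U V) W = tensor_rep U (tensor_rep V W)"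
  by (simp add: tensor_rep_def kronecker_assoc mult.assoc)

lemma tensor_unit: "tensor_rep V unit_rep = V"
  by (simp add: tensor_rep_def unit_rep_def kronecker_one_right del: One_nat_def)

lemma rep_hom_tensor:
  assumes r: "is_rep Q V" "is_rep Q W" "is_rep Q V'" "is_rep Q W'" and h: "rep_hom Q V V' \<phi>" "rep_hom Q W W' \<psi>"
  shows "rep_hom Q (tensor_rep V W) (tensor_rep V' W') (\<lambda>x. kronecker (\<phi> x) (\<psi> x))"
  unfolding rep_hom_def
proof (intro conjI ballI)
  fix a assume a: "a \<in> arcs Q"
  note d = rep_homD(1)[OF h(1) tail_in_verts[OF a]] rep_homD(1)[OF h(1) head_in_verts[OF a]]
    rep_homD(1)[OF h(2) tail_in_verts[OF a]] rep_homD(1)[OF h(2) head_in_verts[OF a]]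
    is_repD[OF r(1) a] is_repD[OF r(2) a] is_repD[OF r(3) a] is_repD[OF r(4) a]
  show "kronecker (\<phi> (head Q a)) (\<psi> (head Q a)) * rmap (tensor_rep V W) a =
      rmap (tensor_rep V' W') a * kronecker (\<phi> (tail Q a)) (\<psi> (tail Q a))"
    using d rep_homD(2)[OF h(1) a] rep_homD(2)[OF h(2) a] by (simp add: kronecker_mult)
qed (use rep_homD(1)[OF h(1)] rep_homD(1)[OF h(2)] in \<open>auto intro!: kronecker_carrier\<close>)

lemma tensor_iso:
  assumes "(V, V') \<in> rep_iso Q" "(W, W') \<in> rep_iso Q"
  shows "(tensor_rep V W, tensor_rep V' W') \<in> rep_iso Q"
proof -
  note r = rep_isoD(1,2)[OF assms(1)] rep_isoD(1,2)[OF assms(2)]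
  obtain \<phi> \<psi> where 1: "rep_hom Q V V' \<phi>" "rep_hom Q V' V \<psi>"
    "\<And>x. x \<in> verts Q \<Longrightarrow> \<phi> x * \<psi> x = 1\<^sub>m (rdim V' x)" "\<And>x. x \<in> verts Q \<Longrightarrow> \<psi> x * \<phi> x = 1\<^sub>m (rdim V x)"
    using rep_isoD(3)[OF assms(1)] by blast
  obtain \<phi>' \<psi>' where 2: "rep_hom Q W W' \<phi>'" "rep_hom Q W' W \<psi>'"
    "\<And>x. x \<in> verts Q \<Longrightarrow> \<phi>' x * \<psi>' x = 1\<^sub>m (rdim W' x)" "\<And>x. x \<in> verts Q \<Longrightarrow> \<psi>' x * \<phi>' x = 1\<^sub>m (rdim W x)"
    using rep_isoD(3)[OF assms(2)] by blast
  show ?thesis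
  proof (rule rep_isoI[OF is_rep_tensor[OF r(1,3)] is_rep_tensor[OF r(2,4)]
        rep_hom_tensor[OF r(1,3,2,4) 1(1) 2(1)] rep_hom_tensor[OF r(2,4,1,3) 1(2) 2(2)]])
    fix x assume x: "x \<in> verts Q"
    note d = rep_homD(1)[OF 1(1) x] rep_homD(1)[OF 1(2) x] rep_homD(1)[OF 2(1) x] rep_homD(1)[OF 2(2) x]
    show "kronecker (\<phi> x) (\<phi>' x) * kronecker (\<psi> x) (\<psi>' x) = 1\<^sub>m (rdim (tensor_rep V' W') x)"
      "kronecker (\<psi> x) (\<psi>' x) * kronecker (\<phi> x) (\<phi>' x) = 1\<^sub>m (rdim (tensor_rep V W) x)"
      using d by (simp_all add: kronecker_mult 1(3,4)[OF x] 2(3,4)[OF x] kronecker_one)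
  qed
qed

lemma tensor_comm_iso:
  assumes "is_rep Q V" "is_rep Q W"
  shows "(tensor_rep V W, tensor_rep W V) \<in> rep_iso Q"
proof (rule rep_isoI)
  have "rep_hom Q (tensor_rep V W) (tensor_rep W V) (\<lambda>x. swap_mat (rdim V x) (rdim W x))"
    if "is_rep Q V" "is_rep Q W" for V W :: "('a, 'b, 'k::field) rep"
    unfolding rep_hom_def
  proof (intro conjI ballI)
    fix a assume a: "a \<in> arcs Q"
    show "swap_mat (rdim V (head Q a)) (rdim W (head Q a)) * rmap (tensor_rep V W) a =
        rmap (tensor_rep W V) a * swap_mat (rdim V (tail Q a)) (rdim W (tail Q a))"
      using swap_mat_kronecker[of "rmap V a" "rmap W a"] is_repD[OF that(1) a] is_repD[OF that(2) a] by simp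
  qed (auto intro!: carrier_matI)
  then show "rep_hom Q (tensor_rep V W) (tensor_rep W V) (\<lambda>x. swap_mat (rdim V x) (rdim W x))"
    "rep_hom Q (tensor_rep W V) (tensor_rep V W) (\<lambda>x. swap_mat (rdim W x) (rdim V x))"
    using assms by blast+
qed (use assms in \<open>auto simp: is_rep_tensor swap_mat_inverse\<close>)

text \<open>Distributivity of the tensor product over direct sums, needed for the relations to form
  an ideal.\<close>

lemma biproduct_tensor:
  assumes r: "is_rep Q U" "is_rep Q V" "is_rep Q V1" "is_rep Q V2" and b: "biproduct Q V V1 V2 i1 p1 i2 p2"
  shows "biproduct Q (tensor_rep U V) (tensor_rep U V1) (tensor_rep U V2)
    (\<lambda>x. kronecker (1\<^sub>m (rdim U x)) (i1 x)) (\<lambda>x. kronecker (1\<^sub>m (rdim U x)) (p1 x))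
    (\<lambda>x. kronecker (1\<^sub>m (rdim U x)) (i2 x)) (\<lambda>x. kronecker (1\<^sub>m (rdim U x)) (p2 x))"
proof -
  note b' = b[unfolded biproduct_def] and I = rep_hom_id[OF r(1)]
  have h: "rep_hom Q (tensor_rep U V1) (tensor_rep U V) (\<lambda>x. kronecker (1\<^sub>m (rdim U x)) (i1 x))"
    "rep_hom Q (tensor_rep U V) (tensor_rep U V1) (\<lambda>x. kronecker (1\<^sub>m (rdim U x)) (p1 x))"
    "rep_hom Q (tensor_rep U V2) (tensor_rep U V) (\<lambda>x. kronecker (1\<^sub>m (rdim U x)) (i2 x))"
    "rep_hom Q (tensor_rep U V) (tensor_rep U V2) (\<lambda>x. kronecker (1\<^sub>m (rdim U x)) (p2 x))"
    using rep_hom_tensor[OF r(1,3,1,2) I] rep_hom_tensor[OF r(1,2,1,3) I]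
      rep_hom_tensor[OF r(1,4,1,2) I] rep_hom_tensor[OF r(1,2,1,4) I] b' by blast+
  have "kronecker (1\<^sub>m (rdim U x)) (p1 x) * kronecker (1\<^sub>m (rdim U x)) (i1 x) = 1\<^sub>m (rdim (tensor_rep U V1) x) \<and>
    kronecker (1\<^sub>m (rdim U x)) (p2 x) * kronecker (1\<^sub>m (rdim U x)) (i2 x) = 1\<^sub>m (rdim (tensor_rep U V2) x) \<and>
    kronecker (1\<^sub>m (rdim U x)) (p1 x) * kronecker (1\<^sub>m (rdim U x)) (i2 x) = 0\<^sub>m (rdim (tensor_rep U V1) x) (rdim (tensor_rep U V2) x) \<and>
    kronecker (1\<^sub>m (rdim U x)) (p2 x) * kronecker (1\<^sub>m (rdim U x)) (i1 x) = 0\<^sub>m (rdim (tensor_rep U V2) x) (rdim (tensor_rep U V1) x) \<and>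
    kronecker (1\<^sub>m (rdim U x)) (i1 x) * kronecker (1\<^sub>m (rdim U x)) (p1 x) +
    kronecker (1\<^sub>m (rdim U x)) (i2 x) * kronecker (1\<^sub>m (rdim U x)) (p2 x) = 1\<^sub>m (rdim (tensor_rep U V) x)"
    if x: "x \<in> verts Q" for x
  proof -
    have c: "i1 x \<in> carrier_mat (rdim V x) (rdim V1 x)" "i2 x \<in> carrier_mat (rdim V x) (rdim V2 x)"
      "p1 x \<in> carrier_mat (rdim V1 x) (rdim V x)" "p2 x \<in> carrier_mat (rdim V2 x) (rdim V x)"
      using b' x by (auto dest: rep_homD(1))
    have e: "p1 x * i1 x = 1\<^sub>m (rdim V1 x)" "p2 x * i2 x = 1\<^sub>m (rdim V2 x)"
      "p1 x * i2 x = 0\<^sub>m (rdim V1 x) (rdim V2 x)" "p2 x * i1 x = 0\<^sub>m (rdim V2 x) (rdim V1 x)"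
      "i1 x * p1 x + i2 x * p2 x = 1\<^sub>m (rdim V x)" using b' x by auto
    have k: "kronecker (1\<^sub>m (rdim U x)) (i1 x * p1 x) + kronecker (1\<^sub>m (rdim U x)) (i2 x * p2 x) = kronecker (1\<^sub>m (rdim U x)) (1\<^sub>m (rdim V x))"
      using c by (simp flip: e(5) kronecker_add_right)
    show ?thesis using c k by (simp add: kronecker_mult e(1-4) kronecker_one kronecker_zero_right mat_one_left)
  qed
  then show ?thesis using h unfolding biproduct_def by blast
qed

lemma iso_class_eqI: "(V, W) \<in> rep_iso Q \<Longrightarrow> iso_class Q V = iso_class Q W"
  unfolding iso_class_def by (rule equiv_class_eq[OF rep_iso_equiv])

lemma tensor_class_eq:
  assumes "is_rep Q V" "is_rep Q W"
  shows "tensor_class Q (iso_class Q V) (iso_class Q W) = iso_class Q (tensor_rep V W)"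
proof -
  have "iso_class Q (tensor_rep V' W') = iso_class Q (tensor_rep V W)"
    if "V' \<in> iso_class Q V" "W' \<in> iso_class Q W" for V' W'
  proof -
    have "(V', V) \<in> rep_iso Q" "(W', W) \<in> rep_iso Q"
      using that by (simp_all add: iso_class_def rep_iso_sym)
    then show ?thesis by (rule iso_class_eqI[OF tensor_iso])
  qed
  then have "tensor_class Q (iso_class Q V) (iso_class Q W) =
      (\<Union>V' \<in> iso_class Q V. \<Union>W' \<in> iso_class Q W. iso_class Q (tensor_rep V W))"
    unfolding tensor_class_def by (intro SUP_cong refl)
  moreover have "V \<in> iso_class Q V" "W \<in> iso_class Q W"
    using assms rep_iso_refl by (auto simp: iso_class_def)
  ultimately show ?thesis by (auto simp del: UN_simps)
qed

end

section \<open>The representation ring\<close>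

locale quiver_over = quiver Q for Q :: "('a, 'b) pre_digraph" +
  fixes K :: "'k :: field itself"
begin

abbreviation F where "F \<equiv> free_rep_ring K Q"
abbreviation cls :: "('a, 'b, 'k) rep \<Rightarrow> ('a, 'b, 'k) rep set \<Rightarrow>\<^sub>0 int" where
  "cls V \<equiv> frag_of (iso_class Q V)"
abbreviation Rel where "Rel \<equiv> dsum_relations K Q"

lemma F_carrier: "f \<in> carrier F \<longleftrightarrow> Poly_Mapping.keys f \<subseteq> iso_classes K Q"
  by (simp add: free_rep_ring_def)

lemma F_simps: "\<zero>\<^bsub>F\<^esub> = 0" "f \<oplus>\<^bsub>F\<^esub> g = f + g" "\<one>\<^bsub>F\<^esub> = cls unit_rep"
  by (simp_all add: free_rep_ring_def)

lemma iso_class_in: "is_rep Q V \<Longrightarrow> iso_class Q V \<in> iso_classes K Q"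
  by (auto simp: iso_classes_def iso_class_def reps_def quotientI)

lemma iso_classesE:
  assumes "A \<in> iso_classes K Q"
  obtains V where "is_rep Q V" "A = iso_class Q V"
  using assms by (auto simp: iso_classes_def iso_class_def reps_def quotient_def)

lemma cls_closed: "is_rep Q V \<Longrightarrow> cls V \<in> carrier F"
  by (simp add: F_carrier iso_class_in)

lemma F_closed: "f \<in> carrier F \<Longrightarrow> g \<in> carrier F \<Longrightarrow> f + g \<in> carrier F"
  "f \<in> carrier F \<Longrightarrow> g \<in> carrier F \<Longrightarrow> f - g \<in> carrier F" "0 \<in> carrier F"
  "f \<in> carrier F \<Longrightarrow> - f \<in> carrier F"
  using keys_add[of f g] keys_diff[of f g] by (auto simp: F_carrier)

text \<open>Closure under differences covers sums and negatives at once, which halves the cases in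
  the bilinear inductions.\<close>

lemma F_induct [consumes 1, case_names zero cls diff]:
  assumes "f \<in> carrier F" "P 0" "\<And>V. is_rep Q V \<Longrightarrow> P (cls V)"
    "\<And>a b. a \<in> carrier F \<Longrightarrow> b \<in> carrier F \<Longrightarrow> P a \<Longrightarrow> P b \<Longrightarrow> P (a - b)"
  shows "P f"
proof (rule free_Abelian_group_induct[of f "iso_classes K Q" P])
  fix A assume "A \<in> iso_classes K Q"
  then show "P (frag_of A)" using assms(3) by (auto elim: iso_classesE)
qed (use assms F_carrier in auto)

lemma F_mult: "f \<otimes>\<^bsub>F\<^esub> g = frag_extend (\<lambda>A. frag_extend (\<lambda>B. frag_of (tensor_class Q A B)) g) f"
  by (simp add: free_rep_ring_def)

lemma F_mult_cls: "is_rep Q V \<Longrightarrow> is_rep Q W \<Longrightarrow> cls V \<otimes>\<^bsub>F\<^esub> cls W = cls (tensor_rep V W)"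
  by (simp add: F_mult tensor_class_eq)

lemma F_mult_diff_left: "(f - f') \<otimes>\<^bsub>F\<^esub> g = f \<otimes>\<^bsub>F\<^esub> g - f' \<otimes>\<^bsub>F\<^esub> g"
  by (simp add: F_mult frag_extend_diff)

lemma frag_extend_diff_fun: "frag_extend (\<lambda>A. s A - t A) f = frag_extend s f - frag_extend t f"
  unfolding frag_extend_def sum_subtractf[symmetric]
  by (rule sum.cong) (auto intro!: poly_mapping_eqI simp: lookup_minus right_diff_distrib)

lemma F_mult_diff_right: "f \<otimes>\<^bsub>F\<^esub> (g - g') = f \<otimes>\<^bsub>F\<^esub> g - f \<otimes>\<^bsub>F\<^esub> g'"
  by (simp add: F_mult frag_extend_diff frag_extend_diff_fun)

lemma F_mult_zero: "0 \<otimes>\<^bsub>F\<^esub> g = 0" "f \<otimes>\<^bsub>F\<^esub> 0 = 0"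
  by (simp_all add: F_mult frag_extend_eq_0)

lemma F_mult_add_left: "(f + f') \<otimes>\<^bsub>F\<^esub> g = f \<otimes>\<^bsub>F\<^esub> g + f' \<otimes>\<^bsub>F\<^esub> g"
  by (simp add: F_mult frag_extend_add)

text \<open>Here and for the ring laws below, bilinearity reduces the claim to classes of
  representations, one argument at a time.\<close>

lemma F_mult_closed:
  assumes "f \<in> carrier F" "g \<in> carrier F"
  shows "f \<otimes>\<^bsub>F\<^esub> g \<in> carrier F"
  using assms(1)
proof (induction f rule: F_induct)
  case (cls V)
  show ?case using assms(2)
    by (induction g rule: F_induct)
      (simp_all add: F_mult_zero F_closed F_mult_cls cls F_mult_diff_right cls_closed is_rep_tensor)
qed (simp_all add: F_mult_zero F_closed F_mult_diff_left)

lemma F_mult_comm: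
  assumes "f \<in> carrier F" "g \<in> carrier F"
  shows "f \<otimes>\<^bsub>F\<^esub> g = g \<otimes>\<^bsub>F\<^esub> f"
  using assms(1)
proof (induction f rule: F_induct)
  case (cls V)
  show ?case using assms(2)
  proof (induction g rule: F_induct)
    case (cls W)
    then show ?case using \<open>is_rep Q V\<close> by (simp add: F_mult_cls iso_class_eqI[OF tensor_comm_iso])
  qed (simp_all add: F_mult_zero F_mult_diff_right F_mult_diff_left)
qed (simp_all add: F_mult_zero F_mult_diff_right F_mult_diff_left)

lemma F_mult_assoc:
  assumes "f \<in> carrier F" "g \<in> carrier F" "h \<in> carrier F"
  shows "f \<otimes>\<^bsub>F\<^esub> g \<otimes>\<^bsub>F\<^esub> h = f \<otimes>\<^bsub>F\<^esub> (g \<otimes>\<^bsub>F\<^esub> h)"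
  using assms(1)
proof (induction f rule: F_induct)
  case (cls U)
  show ?case using assms(2)
  proof (induction g rule: F_induct)
    case (cls V)
    show ?case using assms(3)
    proof (induction h rule: F_induct)
      case (cls W)
      then show ?case using \<open>is_rep Q U\<close> \<open>is_rep Q V\<close> by (simp add: F_mult_cls is_rep_tensor tensor_assoc)
    qed (simp_all add: F_mult_zero F_mult_diff_right F_mult_diff_left)
  qed (simp_all add: F_mult_zero F_mult_diff_right F_mult_diff_left)
qed (simp_all add: F_mult_zero F_mult_diff_right F_mult_diff_left)

lemma F_mult_one: "f \<in> carrier F \<Longrightarrow> f \<otimes>\<^bsub>F\<^esub> cls unit_rep = f"
  by (induction f rule: F_induct)
    (simp_all add: F_mult_zero F_mult_diff_left F_mult_cls is_rep_unit tensor_unit)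

lemma F_cring: "cring F"
proof (rule cringI)
  show "abelian_group F"
  proof (rule abelian_groupI)
    fix x assume "x \<in> carrier F"
    then show "\<exists>y\<in>carrier F. y \<oplus>\<^bsub>F\<^esub> x = \<zero>\<^bsub>F\<^esub>"
      by (intro bexI[of _ "- x"]) (auto simp: F_simps F_closed)
  qed (auto simp: F_simps F_closed)
  show "comm_monoid F"
  proof (rule comm_monoidI)
    fix x y z assume "x \<in> carrier F" "y \<in> carrier F" "z \<in> carrier F"
    then show "x \<otimes>\<^bsub>F\<^esub> y \<otimes>\<^bsub>F\<^esub> z = x \<otimes>\<^bsub>F\<^esub> (y \<otimes>\<^bsub>F\<^esub> z)" by (rule F_mult_assoc)
  next
    fix x y assume "x \<in> carrier F" "y \<in> carrier F"
    then show "x \<otimes>\<^bsub>F\<^esub> y = y \<otimes>\<^bsub>F\<^esub> x" by (rule F_mult_comm)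
  next
    fix x y assume "x \<in> carrier F" "y \<in> carrier F"
    then show "x \<otimes>\<^bsub>F\<^esub> y \<in> carrier F" by (rule F_mult_closed)
  next
    fix x assume "x \<in> carrier F"
    then show "\<one>\<^bsub>F\<^esub> \<otimes>\<^bsub>F\<^esub> x = x"
      by (simp add: F_simps F_mult_comm[of "cls unit_rep"] cls_closed is_rep_unit F_mult_one)
  qed (simp add: F_simps cls_closed is_rep_unit)
qed (simp add: F_simps F_mult_add_left)

sublocale F: cring F by (rule F_cring)

lemma F_pow_Suc: "f [^]\<^bsub>F\<^esub> Suc n = f [^]\<^bsub>F\<^esub> n \<otimes>\<^bsub>F\<^esub> f"
  by simp

section \<open>The ideal of direct sum relations\<close>

abbreviation relator :: "('a, 'b, 'k) rep \<Rightarrow> ('a, 'b, 'k) rep \<Rightarrow> ('a, 'b, 'k) rep set \<Rightarrow>\<^sub>0 int" where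
  "relator V W \<equiv> cls V + cls W - cls (dsum_rep V W)"

lemma relator_closed: "is_rep Q V \<Longrightarrow> is_rep Q W \<Longrightarrow> relator V W \<in> carrier F"
  by (intro F_closed cls_closed is_rep_dsum)

lemma Rel_subgroup: "subgroup Rel (free_Abelian_group (iso_classes K Q))"
  unfolding dsum_relations_def
proof (rule group.generate_is_subgroup[OF group_free_Abelian_group], safe)
  fix V W :: "('a, 'b, 'k) rep" assume "V \<in> reps K Q" "W \<in> reps K Q"
  then show "relator V W \<in> carrier (free_Abelian_group (iso_classes K Q))"
    using relator_closed[of V W] by (simp add: reps_def F_carrier)
qed

lemma Rel_closed:
  shows "f \<in> Rel \<Longrightarrow> g \<in> Rel \<Longrightarrow> f + g \<in> Rel" "0 \<in> Rel"
    "f \<in> Rel \<Longrightarrow> - f \<in> Rel" "f \<in> Rel \<Longrightarrow> f \<in> carrier F"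
proof -
  show car: "f \<in> Rel \<Longrightarrow> f \<in> carrier F" for f
    using subsetD[OF subgroup.subset[OF Rel_subgroup]] by (simp add: F_carrier)
  show "f \<in> Rel \<Longrightarrow> g \<in> Rel \<Longrightarrow> f + g \<in> Rel" "0 \<in> Rel"
    using subgroup.m_closed[OF Rel_subgroup] subgroup.one_closed[OF Rel_subgroup] by auto
  show "f \<in> Rel \<Longrightarrow> - f \<in> Rel"
    using subgroup.m_inv_closed[OF Rel_subgroup, of f] car[of f] by (simp add: F_carrier)
qed

lemma Rel_diff: "f \<in> Rel \<Longrightarrow> g \<in> Rel \<Longrightarrow> f - g \<in> Rel"
  using Rel_closed(1)[of f "- g"] Rel_closed(3)[of g] by simp

lemma relator_in: "is_rep Q V \<Longrightarrow> is_rep Q W \<Longrightarrow> relator V W \<in> Rel"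
  unfolding dsum_relations_def reps_def by (intro generate.incl) auto

lemma Rel_induct [consumes 1, case_names zero relator add uminus]:
  assumes "f \<in> Rel" "P 0" "\<And>V W. is_rep Q V \<Longrightarrow> is_rep Q W \<Longrightarrow> P (relator V W)"
    "\<And>f g. f \<in> Rel \<Longrightarrow> g \<in> Rel \<Longrightarrow> P f \<Longrightarrow> P g \<Longrightarrow> P (f + g)" "\<And>f. f \<in> Rel \<Longrightarrow> P f \<Longrightarrow> P (- f)"
  shows "P f"
  using assms(1) unfolding dsum_relations_def
proof (induction rule: generate.induct)
  case one
  then show ?case using assms(2) by simp
next
  case (incl h)
  then show ?case using assms(3) by (auto simp: reps_def)
next
  case (inv h)
  then obtain V W where h: "h = relator V W" "is_rep Q V" "is_rep Q W" by (auto simp: reps_def)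
  have "h \<in> Rel" unfolding h(1) using h(2,3) by (rule relator_in)
  then show ?case using assms(5)[of h] assms(3)[OF h(2,3)] h(1) Rel_closed(4)[of h] by (simp add: F_carrier)
next
  case (eng h1 h2)
  then show ?case using assms(4) by (simp add: dsum_relations_def)
qed

lemma biproduct_Rel:
  assumes "is_rep Q V" "is_rep Q V1" "is_rep Q V2" "biproduct Q V V1 V2 i1 p1 i2 p2"
  shows "cls V1 + cls V2 - cls V \<in> Rel"
  using relator_in[OF assms(2,3)] iso_class_eqI[OF biproduct_iso[OF assms]] by simp

text \<open>The product of \<open>cls U\<close> with a relator is the relator of the tensored
  biproduct.\<close>

lemma Rel_mult:
  assumes "f \<in> Rel" "g \<in> carrier F"
  shows "g \<otimes>\<^bsub>F\<^esub> f \<in> Rel"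
  using assms(2)
proof (induction g rule: F_induct)
  case (cls U)
  show ?case using assms(1)
  proof (induction f rule: Rel_induct)
    case (relator V W)
    have D: "is_rep Q (dsum_rep V W)" using relator by (rule is_rep_dsum)
    have "cls U \<otimes>\<^bsub>F\<^esub> relator V W =
        cls (tensor_rep U V) + cls (tensor_rep U W) - cls (tensor_rep U (dsum_rep V W))"
      using F_mult_diff_right[of "cls U" "cls V" "- cls W"] F_mult_diff_right[of "cls U" 0 "cls W"]
      by (simp add: F_mult_diff_right F_mult_cls cls relator D F_mult_zero)
    also have "\<dots> \<in> Rel"
      by (rule biproduct_Rel[OF _ _ _ biproduct_tensor[OF cls D relator dsum_biproduct[OF relator]]])
        (use cls relator D in \<open>auto simp: is_rep_tensor\<close>)
    finally show ?case .
  next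
    case (add f g)
    then show ?case using F_mult_diff_right[of "cls U" f "- g"] F_mult_diff_right[of "cls U" 0 g]
      by (simp add: F_mult_zero Rel_closed)
  next
    case (uminus f)
    then show ?case using F_mult_diff_right[of "cls U" 0 f] by (simp add: F_mult_zero Rel_closed)
  qed (simp add: F_mult_zero Rel_closed)
qed (simp_all add: F_mult_zero F_mult_diff_left Rel_closed Rel_diff)

lemma Rel_ideal: "ideal Rel F"
proof (rule idealI[OF F.ring_axioms])
  have e: "add_monoid F = free_Abelian_group (iso_classes K Q)"
    by (simp add: free_rep_ring_def free_Abelian_group_def)
  show "subgroup Rel (add_monoid F)" unfolding e by (rule Rel_subgroup)
next
  fix a x assume "a \<in> Rel" "x \<in> carrier F"
  then show "x \<otimes>\<^bsub>F\<^esub> a \<in> Rel" "a \<otimes>\<^bsub>F\<^esub> x \<in> Rel"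
    using Rel_mult Rel_closed(4) F_mult_comm[of a x] by auto
qed

text \<open>A zero representation \<open>V\<close> is a biproduct of \<open>V\<close> with itself,
  so \<open>cls V + cls V - cls V\<close> is a relation.\<close>

lemma zero_rep_Rel:
  assumes "is_rep Q V" "\<And>x. x \<in> verts Q \<Longrightarrow> rdim V x = 0"
  shows "cls V \<in> Rel"
proof -
  have z: "rep_hom Q V W (\<lambda>x. 0\<^sub>m (rdim W x) 0)" "rep_hom Q W V (\<lambda>x. 0\<^sub>m 0 (rdim W x))"
    if "is_rep Q W" for W :: "('a, 'b, 'k) rep"
    unfolding rep_hom_def using assms that
    by (auto simp: ends_in_verts mat_zero_left mat_zero_right intro!: eq_matI dest!: is_repD)
  have "biproduct Q V V V (\<lambda>x. 0\<^sub>m (rdim V x) 0) (\<lambda>x. 0\<^sub>m 0 (rdim V x)) (\<lambda>x. 0\<^sub>m (rdim V x) 0) (\<lambda>x. 0\<^sub>m 0 (rdim V x))"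
    unfolding biproduct_def using z[OF assms(1)] assms(2) by (auto intro!: eq_matI)
  from biproduct_Rel[OF assms(1) assms(1) assms(1) this] show ?thesis by simp
qed

text \<open>The additive extension of an invariant to the free group. The integers appear as the
  free group on one generator \<open>()\<close>, so that \<open>frag_extend\<close> applies.
  \<open>SOME\<close> picks a representative of the class, which is harmless for invariants constant
  on isomorphism classes.\<close>

definition ev :: "(('a, 'b, 'k) rep \<Rightarrow> nat) \<Rightarrow> (('a, 'b, 'k) rep set \<Rightarrow>\<^sub>0 int) \<Rightarrow> int" where
  "ev \<rho> f = Poly_Mapping.lookup (frag_extend (\<lambda>A. frag_cmul (int (\<rho> (SOME V. V \<in> A))) (frag_of ())) f) ()"

lemma ev_diff: "ev \<rho> (f - g) = ev \<rho> f - ev \<rho> g"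
  and ev_add: "ev \<rho> (f + g) = ev \<rho> f + ev \<rho> g"
  and ev_zero: "ev \<rho> 0 = 0"
  and ev_uminus: "ev \<rho> (- f) = - ev \<rho> f"
  by (simp_all add: ev_def frag_extend_diff frag_extend_add frag_extend_minus lookup_minus lookup_add)

lemma ev_cls:
  assumes "\<And>V W. (V, W) \<in> rep_iso Q \<Longrightarrow> \<rho> V = \<rho> W" "is_rep Q V"
  shows "ev \<rho> (cls V) = int (\<rho> V)"
proof -
  have "V \<in> iso_class Q V" using assms(2) rep_iso_refl by (auto simp: iso_class_def)
  then have "(SOME W. W \<in> iso_class Q V) \<in> iso_class Q V" by (rule someI)
  then have "(V, SOME W. W \<in> iso_class Q V) \<in> rep_iso Q" by (simp add: iso_class_def)
  from assms(1)[OF this] show ?thesis by (simp add: ev_def)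
qed

end

section \<open>The product ring and the passage to quotients\<close>

lemma int_product_ring_simps:
  "carrier (int_product_ring I) = (\<Pi>\<^sub>E i \<in> I. UNIV)"
  "f \<otimes>\<^bsub>int_product_ring I\<^esub> g = (\<lambda>i \<in> I. f i * g i)"
  "f \<oplus>\<^bsub>int_product_ring I\<^esub> g = (\<lambda>i \<in> I. f i + g i)"
  "\<one>\<^bsub>int_product_ring I\<^esub> = (\<lambda>i \<in> I. 1)" "\<zero>\<^bsub>int_product_ring I\<^esub> = (\<lambda>i \<in> I. 0)"
  by (simp_all add: int_product_ring_def)

lemma cring_int_product_ring: "cring (int_product_ring I)"
proof (rule cringI)
  show "abelian_group (int_product_ring I)"
  proof (rule abelian_groupI)
    fix x assume "x \<in> carrier (int_product_ring I)"
    then show "\<exists>y\<in>carrier (int_product_ring I). y \<oplus>\<^bsub>int_product_ring I\<^esub> x = \<zero>\<^bsub>int_product_ring I\<^esub>"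
      by (intro bexI[of _ "\<lambda>i \<in> I. - x i"]) (auto simp: int_product_ring_simps)
  qed (auto simp: int_product_ring_simps ac_simps fun_eq_iff PiE_def extensional_def)
  show "comm_monoid (int_product_ring I)"
    by (rule comm_monoidI) (auto simp: int_product_ring_simps ac_simps fun_eq_iff PiE_def extensional_def)
qed (auto simp: int_product_ring_simps fun_eq_iff distrib_right)

lemma int_product_ring_pow:
  "f [^]\<^bsub>int_product_ring I\<^esub> (n::nat) = (\<lambda>i \<in> I. f i ^ n)"
  by (induction n) (auto simp: int_product_ring_simps nat_pow_def fun_eq_iff)

text \<open>Integer multiples of indicator functions arise from repeated addition and negation;
  finiteness of \<open>I\<close> then allows every function to be assembled by finitely many
  sums.\<close>

lemma int_product_ring_generated:
  assumes "finite I"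
  shows "generate (add_monoid (int_product_ring I)) ((\<lambda>j. \<lambda>i \<in> I. if i = j then 1 else 0) ` I) =
    carrier (int_product_ring I)" (is "generate ?G ?B = _")
proof
  interpret P: cring "int_product_ring I" by (rule cring_int_product_ring)
  have B: "?B \<subseteq> carrier (int_product_ring I)" by (auto simp: int_product_ring_simps)
  have sg: "subgroup (generate ?G ?B) ?G" by (rule P.add.generate_is_subgroup[OF B])
  show "generate ?G ?B \<subseteq> carrier (int_product_ring I)" using subgroup.subset[OF sg] by simp
  have z: "(\<lambda>i \<in> I. 0) \<in> generate ?G ?B" using subgroup.one_closed[OF sg] by (simp add: int_product_ring_simps)
  have add: "(\<lambda>i \<in> I. f i + g i) \<in> generate ?G ?B" if "f \<in> generate ?G ?B" "g \<in> generate ?G ?B" for f g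
    using subgroup.m_closed[OF sg that] by (simp add: int_product_ring_simps)
  have inv: "(\<lambda>i \<in> I. - f i) \<in> generate ?G ?B" if f: "f \<in> generate ?G ?B" for f
  proof -
    have fc: "f \<in> carrier (int_product_ring I)" using f subgroup.subset[OF sg] by auto
    have "\<ominus>\<^bsub>int_product_ring I\<^esub> f = (\<lambda>i \<in> I. - f i)"
      by (rule P.minus_equality) (use fc in \<open>auto simp: int_product_ring_simps\<close>)
    then show ?thesis using subgroup.m_inv_closed[OF sg f] by (simp add: a_inv_def)
  qed
  have single: "(\<lambda>i \<in> I. if i = j then m else 0) \<in> generate ?G ?B" if j: "j \<in> I" for j m
  proof -
    have b: "(\<lambda>i \<in> I. if i = j then 1 else 0) \<in> generate ?G ?B" using j by (intro generate.incl) auto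
    have nat: "(\<lambda>i \<in> I. if i = j then int n else 0) \<in> generate ?G ?B" for n
    proof (induction n)
      case 0
      have e: "(\<lambda>i \<in> I. if i = j then int 0 else 0) = (\<lambda>i \<in> I. 0)" by auto
      show ?case unfolding e by (rule z)
    next
      case (Suc n)
      have e: "(\<lambda>i \<in> I. if i = j then int (Suc n) else 0) =
          (\<lambda>i \<in> I. (\<lambda>i \<in> I. if i = j then int n else 0) i + (\<lambda>i \<in> I. if i = j then 1 else 0) i)"
        by (auto simp: fun_eq_iff)
      show ?case unfolding e by (rule add[OF Suc b])
    qed
    show ?thesis
    proof (cases m)
      case (nonneg n)
      show ?thesis unfolding nonneg by (rule nat)
    next
      case (neg n)
      have e: "(\<lambda>i \<in> I. if i = j then m else 0) = (\<lambda>i \<in> I. - (\<lambda>i \<in> I. if i = j then int (Suc n) else 0) i)"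
        using neg by (auto simp: fun_eq_iff)
      show ?thesis unfolding e by (rule inv[OF nat])
    qed
  qed
  show "carrier (int_product_ring I) \<subseteq> generate ?G ?B"
  proof
    fix h assume h: "h \<in> carrier (int_product_ring I)"
    have "(\<lambda>i \<in> I. if i \<in> J then h i else 0) \<in> generate ?G ?B" if "finite J" "J \<subseteq> I" for J
      using that
    proof (induction J rule: finite_induct)
      case empty
      show ?case unfolding empty_iff if_False by (rule z)
    next
      case (insert j J)
      then have J: "J \<subseteq> I" and j: "j \<in> I" by auto
      note 1 = insert.IH[OF J]
      have e: "(\<lambda>i \<in> I. if i \<in> insert j J then h i else 0) =
          (\<lambda>i \<in> I. (\<lambda>i \<in> I. if i \<in> J then h i else 0) i + (\<lambda>i \<in> I. if i = j then h j else 0) i)"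
        using insert by (auto simp: fun_eq_iff)
      show ?case unfolding e by (rule add[OF 1 single[OF j]])
    qed
    note this[OF assms subset_refl]
    moreover have "(\<lambda>i \<in> I. if i \<in> I then h i else 0) = h"
      using h by (auto simp: int_product_ring_simps PiE_def extensional_def fun_eq_iff)
    ultimately show "h \<in> generate ?G ?B" by metis
  qed
qed

text \<open>A homomorphism that vanishes on the ideal is constant on each coset. The form with
  \<open>the_elem\<close> is the induced map as it occurs in
  \<open>FactRing_iso_set\<close>.\<close>

lemma the_elem_coset_image:
  assumes "ideal I R" "ring S" "h \<in> Ring.ring_hom R S" "\<And>y. y \<in> I \<Longrightarrow> h y = \<zero>\<^bsub>S\<^esub>" "x \<in> carrier R"
  shows "the_elem (h ` (I +>\<^bsub>R\<^esub> x)) = h x"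
proof -
  interpret I: ideal I R by fact
  interpret S: ring S by fact
  have "h z = h x" if "z \<in> I +>\<^bsub>R\<^esub> x" for z
  proof -
    obtain y where y: "y \<in> I" "z = y \<oplus>\<^bsub>R\<^esub> x" using \<open>z \<in> I +>\<^bsub>R\<^esub> x\<close> by (auto simp: a_r_coset_def')
    have yc: "y \<in> carrier R" using I.a_subset y(1) by (rule subsetD)
    have "h z = h y \<oplus>\<^bsub>S\<^esub> h x" unfolding y(2) by (rule ring_hom_add[OF assms(3) yc assms(5)])
    then show ?thesis using assms(4)[OF y(1)] ring_hom_closed[OF assms(3) assms(5)] by (simp add: S.l_zero)
  qed
  moreover have "x \<in> I +>\<^bsub>R\<^esub> x" by (rule I.a_rcos_self[OF assms(5)])
  ultimately have "h ` (I +>\<^bsub>R\<^esub> x) = {h x}" by blast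
  then show ?thesis by simp
qed

context quiver_over
begin

text \<open>The purely algebraic part: apart from additivity and multiplicativity of the invariants,
  the theorem comes down to \<open>nilp\<close> and \<open>surj\<close>, both stated in the free
  ring so that no cosets are needed in their proofs.\<close>

lemma rep_ring_red_iso:
  fixes r :: "'i \<Rightarrow> ('a, 'b, 'k) rep \<Rightarrow> nat"
  assumes fin: "finite I"
    and iso: "\<And>i V W. i \<in> I \<Longrightarrow> (V, W) \<in> rep_iso Q \<Longrightarrow> r i V = r i W"
    and dsum: "\<And>i V W. i \<in> I \<Longrightarrow> is_rep Q V \<Longrightarrow> is_rep Q W \<Longrightarrow> r i (dsum_rep V W) = r i V + r i W"
    and tensor: "\<And>i V W. i \<in> I \<Longrightarrow> is_rep Q V \<Longrightarrow> is_rep Q W \<Longrightarrow> r i (tensor_rep V W) = r i V * r i W"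
    and unit: "\<And>i. i \<in> I \<Longrightarrow> r i unit_rep = 1"
    and nilp: "\<And>f. f \<in> carrier F \<Longrightarrow> (\<And>i. i \<in> I \<Longrightarrow> ev (r i) f = 0) \<Longrightarrow> \<exists>n::nat. f [^]\<^bsub>F\<^esub> n \<in> Rel"
    and surj: "\<And>h :: 'i \<Rightarrow> int. \<exists>f \<in> carrier F. \<forall>i \<in> I. ev (r i) f = h i"
  shows "cring (rep_ring_red K Q) \<and>
    (\<exists>\<Phi> \<in> ring_iso (rep_ring_red K Q) (int_product_ring I).
      \<forall>V \<in> reps K Q. \<Phi> (rep_ring_red_class K Q V) = (\<lambda>i \<in> I. int (r i V))) \<and>
    (\<exists>B. finite B \<and> B \<subseteq> carrier (rep_ring_red K Q) \<and>
      generate (add_monoid (rep_ring_red K Q)) B = carrier (rep_ring_red K Q))"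
proof -
  let ?P = "int_product_ring I" and ?R = "rep_ring K Q"
  interpret P: cring ?P by (rule cring_int_product_ring)
  interpret Rel: ideal Rel F by (rule Rel_ideal)
  have Rdef: "?R = F Quot Rel" by (simp add: rep_ring_def)
  interpret R: cring ?R unfolding Rdef by (rule Rel.quotient_is_cring[OF F_cring])
  define h where "h = (\<lambda>f. \<lambda>i \<in> I. ev (r i) f)"
  have ec: "ev (r i) (cls V) = int (r i V)" if "i \<in> I" "is_rep Q V" for i V
    by (rule ev_cls) (use iso that in auto)
  have em: "ev (r i) (f \<otimes>\<^bsub>F\<^esub> g) = ev (r i) f * ev (r i) g" if i: "i \<in> I" and fg: "f \<in> carrier F" "g \<in> carrier F" for i f g
    using fg(1)
  proof (induction f rule: F_induct)
    case (cls V)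
    show ?case using fg(2)
      by (induction g rule: F_induct)
        (simp_all add: F_mult_zero ev_zero F_mult_cls ec i cls tensor is_rep_tensor F_mult_diff_right ev_diff right_diff_distrib)
  qed (simp_all add: F_mult_zero ev_zero F_mult_diff_left ev_diff left_diff_distrib)
  have hh: "h \<in> Ring.ring_hom F ?P"
    by (rule ring_hom_memI)
      (auto simp: h_def int_product_ring_simps em F_simps ev_add ec is_rep_unit unit fun_eq_iff)
  have evRel: "ev (r i) f = 0" if "f \<in> Rel" "i \<in> I" for f i
    using that(1)
  proof (induction f rule: Rel_induct)
    case (relator V W)
    then show ?case using that(2) by (simp add: ev_diff ev_add ec is_rep_dsum dsum)
  qed (simp_all add: ev_zero ev_add ev_uminus)
  have hRel: "h f = \<zero>\<^bsub>?P\<^esub>" if "f \<in> Rel" for f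
    using evRel[OF that] by (auto simp: h_def int_product_ring_simps fun_eq_iff)
  define h' where "h' = (\<lambda>X. the_elem (h ` X))"
  have h': "h' (Rel +>\<^bsub>F\<^esub> f) = h f" if "f \<in> carrier F" for f
    unfolding h'_def by (rule the_elem_coset_image[OF Rel_ideal P.ring_axioms hh hRel that])
  have Rcar: "\<exists>f \<in> carrier F. X = Rel +>\<^bsub>F\<^esub> f" if "X \<in> carrier ?R" for X
    using that by (auto simp: Rdef FactRing_simps A_RCOSETS_defs a_r_coset_def)
  have q: "(+>\<^bsub>F\<^esub>) Rel \<in> Ring.ring_hom F ?R" unfolding Rdef by (rule Rel.rcos_ring_hom)
  have qc: "Rel +>\<^bsub>F\<^esub> f \<in> carrier ?R" if "f \<in> carrier F" for f using ring_hom_closed[OF q that] .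
  have h'h: "h' \<in> Ring.ring_hom ?R ?P"
  proof (rule ring_hom_memI)
    fix X Y assume "X \<in> carrier ?R" "Y \<in> carrier ?R"
    then obtain f g where f: "f \<in> carrier F" "X = Rel +>\<^bsub>F\<^esub> f" and g: "g \<in> carrier F" "Y = Rel +>\<^bsub>F\<^esub> g"
      using Rcar by blast
    show "h' X \<in> carrier ?P" using f h' ring_hom_closed[OF hh f(1)] by simp
    have "X \<otimes>\<^bsub>?R\<^esub> Y = Rel +>\<^bsub>F\<^esub> (f \<otimes>\<^bsub>F\<^esub> g)" using ring_hom_mult[OF q f(1) g(1)] f g by simp
    then show "h' (X \<otimes>\<^bsub>?R\<^esub> Y) = h' X \<otimes>\<^bsub>?P\<^esub> h' Y"
      using f g h' F.m_closed[OF f(1) g(1)] ring_hom_mult[OF hh f(1) g(1)] by simp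
    have "X \<oplus>\<^bsub>?R\<^esub> Y = Rel +>\<^bsub>F\<^esub> (f \<oplus>\<^bsub>F\<^esub> g)" using ring_hom_add[OF q f(1) g(1)] f g by simp
    then show "h' (X \<oplus>\<^bsub>?R\<^esub> Y) = h' X \<oplus>\<^bsub>?P\<^esub> h' Y"
      using f g h' F.a_closed[OF f(1) g(1)] ring_hom_add[OF hh f(1) g(1)] by simp
  next
    show "h' \<one>\<^bsub>?R\<^esub> = \<one>\<^bsub>?P\<^esub>"
      using ring_hom_one[OF q] h'[OF F.one_closed] ring_hom_one[OF hh] by simp
  qed
  interpret H: ring_hom_ring ?R ?P h' by (rule ring_hom_ringI2[OF R.ring_axioms P.ring_axioms h'h])
  have surj': "h' ` carrier ?R = carrier ?P"
  proof
    show "h' ` carrier ?R \<subseteq> carrier ?P" using H.hom_closed by auto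
    show "carrier ?P \<subseteq> h' ` carrier ?R"
    proof
      fix p assume p: "p \<in> carrier ?P"
      obtain f where f: "f \<in> carrier F" "\<forall>i \<in> I. ev (r i) f = p i" using surj[of p] by blast
      have "h f = p" using f p by (auto simp: h_def int_product_ring_simps PiE_def extensional_def fun_eq_iff)
      then show "p \<in> h' ` carrier ?R" using h'[OF f(1)] qc[OF f(1)] by (metis image_eqI)
    qed
  qed
  have powq: "(Rel +>\<^bsub>F\<^esub> f) [^]\<^bsub>?R\<^esub> (n::nat) = Rel +>\<^bsub>F\<^esub> (f [^]\<^bsub>F\<^esub> n)" if f: "f \<in> carrier F" for f n
  proof (induction n)
    case 0
    show ?case using ring_hom_one[OF q] by simp
  next
    case (Suc n)
    then show ?case using ring_hom_mult[OF q F.nat_pow_closed[OF f] f] by simp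
  qed
  have zero_iff: "Rel +>\<^bsub>F\<^esub> f = \<zero>\<^bsub>?R\<^esub> \<longleftrightarrow> f \<in> Rel" if f: "f \<in> carrier F" for f
    using Rel.a_rcos_const[of f] Rel.a_rcos_self[OF f] by (auto simp: Rdef FactRing_def)
  \<comment> \<open>One inclusion is \<open>nilp\<close>. The other holds because a product of
    copies of the integers has no nonzero nilpotents.\<close>
  have ker: "a_kernel ?R ?P h' = nilpotents ?R"
  proof
    show "a_kernel ?R ?P h' \<subseteq> nilpotents ?R"
    proof
      fix X assume "X \<in> a_kernel ?R ?P h'"
      then have X: "X \<in> carrier ?R" "h' X = \<zero>\<^bsub>?P\<^esub>" unfolding a_kernel_def' by blast+
      then obtain f where f: "f \<in> carrier F" "X = Rel +>\<^bsub>F\<^esub> f" using Rcar by blast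
      have hf: "h f = (\<lambda>i \<in> I. 0)" using X(2) h'[OF f(1)] unfolding f(2) int_product_ring_simps by metis
      have "ev (r i) f = 0" if "i \<in> I" for i using fun_cong[OF hf, of i] that by (simp add: h_def)
      then obtain n :: nat where "f [^]\<^bsub>F\<^esub> n \<in> Rel" using nilp[OF f(1)] by blast
      then have "X [^]\<^bsub>?R\<^esub> n = \<zero>\<^bsub>?R\<^esub>" using powq[OF f(1)] f zero_iff[OF F.nat_pow_closed[OF f(1)]] by simp
      then show "X \<in> nilpotents ?R" using X(1) unfolding nilpotents_def by blast
    qed
    show "nilpotents ?R \<subseteq> a_kernel ?R ?P h'"
    proof
      fix X assume "X \<in> nilpotents ?R"
      then obtain n :: nat where X: "X \<in> carrier ?R" "X [^]\<^bsub>?R\<^esub> n = \<zero>\<^bsub>?R\<^esub>"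
        unfolding nilpotents_def by blast
      have "h' X [^]\<^bsub>?P\<^esub> n = \<zero>\<^bsub>?P\<^esub>" using H.hom_nat_pow[OF X(1), of n] X(2) H.hom_zero by simp
      then have e: "(\<lambda>i \<in> I. h' X i ^ n) = (\<lambda>i \<in> I. 0)" by (simp add: int_product_ring_pow int_product_ring_simps)
      have "h' X i = 0" if "i \<in> I" for i using fun_cong[OF e, of i] that by simp
      moreover have "h' X \<in> carrier ?P" using X(1) H.hom_closed by simp
      ultimately have "h' X = \<zero>\<^bsub>?P\<^esub>" by (auto simp: int_product_ring_simps PiE_def extensional_def fun_eq_iff)
      then show "X \<in> a_kernel ?R ?P h'" using X(1) unfolding a_kernel_def' by blast
    qed
  qed
  have id: "ideal (nilpotents ?R) ?R" using H.kernel_is_ideal ker by simp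
  have Rr: "rep_ring_red K Q = ?R Quot nilpotents ?R" by (simp add: rep_ring_red_def)
  define \<Phi> where "\<Phi> = (\<lambda>X. the_elem (h' ` X))"
  have \<Phi>: "\<Phi> \<in> ring_iso (rep_ring_red K Q) ?P"
    unfolding \<Phi>_def Rr using H.FactRing_iso_set[OF surj'] by (simp add: ker)
  have cr: "cring (rep_ring_red K Q)" unfolding Rr by (rule ideal.quotient_is_cring[OF id R.cring_axioms])
  interpret RR: cring "rep_ring_red K Q" by (rule cr)
  have val: "\<Phi> (rep_ring_red_class K Q V) = (\<lambda>i \<in> I. int (r i V))" if "V \<in> reps K Q" for V
  proof -
    have V: "is_rep Q V" using that by (simp add: reps_def)
    have c: "rep_ring_class K Q V \<in> carrier ?R" unfolding rep_ring_class_def by (rule qc[OF cls_closed[OF V]])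
    have "\<Phi> (rep_ring_red_class K Q V) = h' (rep_ring_class K Q V)"
      unfolding \<Phi>_def rep_ring_red_class_def
      by (rule the_elem_coset_image[OF id P.ring_axioms h'h _ c]) (unfold ker[symmetric] a_kernel_def', blast)
    also have "\<dots> = h (cls V)" unfolding rep_ring_class_def by (rule h'[OF cls_closed[OF V]])
    finally show ?thesis by (simp add: h_def ec V cong: restrict_cong)
  qed
  let ?D = "(\<lambda>j. \<lambda>i \<in> I. if i = j then 1 else 0) ` I :: ('i \<Rightarrow> int) set"
  \<comment> \<open>Finite generation is transported from the product ring along the inverse
    isomorphism.\<close>
  define \<Psi> where "\<Psi> = inv_into (carrier (rep_ring_red K Q)) \<Phi>"
  have \<Psi>: "\<Psi> \<in> ring_iso ?P (rep_ring_red K Q)"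
    unfolding \<Psi>_def by (rule ring_iso_set_sym[OF RR.ring_axioms \<Phi>])
  have \<Psi>b: "\<Psi> ` carrier ?P = carrier (rep_ring_red K Q)" and \<Psi>h: "\<Psi> \<in> Ring.ring_hom ?P (rep_ring_red K Q)"
    using \<Psi> by (auto simp: ring_iso_def bij_betw_def)
  interpret G: group_hom "add_monoid ?P" "add_monoid (rep_ring_red K Q)" \<Psi>
    by (intro group_hom.intro P.add.group_axioms RR.add.group_axioms group_hom_axioms.intro)
      (simp add: hom_def ring_hom_closed[OF \<Psi>h] ring_hom_add[OF \<Psi>h])
  have D: "?D \<subseteq> carrier ?P" by (auto simp: int_product_ring_simps)
  have "generate (add_monoid (rep_ring_red K Q)) (\<Psi> ` ?D) = \<Psi> ` generate (add_monoid ?P) ?D"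
    using G.generate_img[of ?D] D by simp
  also have "\<dots> = carrier (rep_ring_red K Q)" by (simp only: int_product_ring_generated[OF fin] \<Psi>b)
  finally have "generate (add_monoid (rep_ring_red K Q)) (\<Psi> ` ?D) = carrier (rep_ring_red K Q)" .
  moreover have "finite (\<Psi> ` ?D)" "\<Psi> ` ?D \<subseteq> carrier (rep_ring_red K Q)" using fin D \<Psi>b by auto
  ultimately show ?thesis using cr \<Phi> val by blast
qed

end

lemma mat_subspace_Inter:
  assumes "\<And>j. j \<in> J \<Longrightarrow> mat_subspace n (A j)"
  shows "mat_subspace n {u \<in> carrier_mat n 1. \<forall>j\<in>J. u \<in> A j}"
  using assms by (auto simp: mat_subspace_def)

section \<open>Rank spaces by recursion on the lattice\<close>

text \<open>Only the indexing of lattice elements by arrows is recorded here, not the order ideals.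
  This suffices for the linear algebra of rank spaces and supplies an induction over
  \<open>M\<close> together with its vertex.\<close>

inductive lat_at :: "('a, 'b) pre_digraph \<Rightarrow> 'a \<Rightarrow> 'b lat_elem \<Rightarrow> bool" for Q where
  lat_atI: "(\<And>\<alpha> S. S |\<in>| component M \<alpha> \<Longrightarrow> \<alpha> \<in> in_arcs Q x) \<Longrightarrow>
    (\<And>\<alpha> S. S |\<in>| component M \<alpha> \<Longrightarrow> lat_at Q (tail Q \<alpha>) S) \<Longrightarrow> lat_at Q x M"

text \<open>The rank space of \<open>M\<close> as an intersection, over all \<open>S\<close> in the
  ideals of \<open>M\<close>, of images of rank spaces of \<open>S\<close>. All \<open>S\<close> are
  used instead of the maximal ones: a smaller \<open>S\<close> has a larger rank space
  (\<open>rk_antimono\<close>), so the intersection is the same. The agreement with the greatest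
  subrepresentation of the reduced quiver is proved at the end.\<close>

inductive rk :: "('a, 'b) pre_digraph \<Rightarrow> ('a, 'b, 'k :: field) rep \<Rightarrow> 'a \<Rightarrow> 'b lat_elem \<Rightarrow> 'k mat \<Rightarrow> bool" for Q V where
  rkI: "u \<in> carrier_mat (rdim V x) 1 \<Longrightarrow>
    (\<forall>\<alpha> S. S |\<in>| component M \<alpha> \<longrightarrow> (\<exists>v. rk Q V (tail Q \<alpha>) S v \<and> u = rmap V \<alpha> * v)) \<Longrightarrow> rk Q V x M u"

lemma rk_iff: "rk Q V x M u \<longleftrightarrow> u \<in> carrier_mat (rdim V x) 1 \<and>
    (\<forall>\<alpha> S. S |\<in>| component M \<alpha> \<longrightarrow> (\<exists>v. rk Q V (tail Q \<alpha>) S v \<and> u = rmap V \<alpha> * v))"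
proof
  assume "rk Q V x M u"
  then show "u \<in> carrier_mat (rdim V x) 1 \<and>
    (\<forall>\<alpha> S. S |\<in>| component M \<alpha> \<longrightarrow> (\<exists>v. rk Q V (tail Q \<alpha>) S v \<and> u = rmap V \<alpha> * v))"
    by (cases rule: rk.cases) blast
qed (elim conjE, rule rkI)

lemma rk_carrier: "rk Q V x M u \<Longrightarrow> u \<in> carrier_mat (rdim V x) 1"
  by (erule rk.cases) blast

lemma rkD: "rk Q V x M u \<Longrightarrow> S |\<in>| component M \<alpha> \<Longrightarrow> \<exists>v. rk Q V (tail Q \<alpha>) S v \<and> u = rmap V \<alpha> * v"
  by (erule rk.cases) blast

lemma rk_antimono:
  assumes "lat_le S M" "rk Q V x M u"
  shows "rk Q V x S u"
proof (rule rkI[OF rk_carrier[OF assms(2)]], intro allI impI)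
  fix \<alpha> S' assume "S' |\<in>| component S \<alpha>"
  then have "S' |\<in>| component M \<alpha>" using assms(1) unfolding lat_le_def by (metis fsubsetD)
  then show "\<exists>v. rk Q V (tail Q \<alpha>) S' v \<and> u = rmap V \<alpha> * v" by (rule rkD[OF assms(2)])
qed

lemma rk_bot: "rk Q V x (Fam (\<lambda>_. {||})) u \<longleftrightarrow> u \<in> carrier_mat (rdim V x) 1"
  by (subst rk_iff) simp

definition lat_join :: "'b lat_elem \<Rightarrow> 'b lat_elem \<Rightarrow> 'b lat_elem" where
  "lat_join M N = Fam (\<lambda>\<alpha>. component M \<alpha> |\<union>| component N \<alpha>)"

text \<open>Unions of order ideals give intersections of rank spaces. Through this, maximality of
  \<open>M\<close> in a support will become triviality of an intersection.\<close>

lemma rk_join: "rk Q V x (lat_join M N) u \<longleftrightarrow> rk Q V x M u \<and> rk Q V x N u"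
proof
  assume u: "rk Q V x (lat_join M N) u"
  show "rk Q V x M u \<and> rk Q V x N u"
    by (intro conjI rk_antimono[OF _ u]) (auto simp: lat_le_def lat_join_def)
next
  assume u: "rk Q V x M u \<and> rk Q V x N u"
  then show "rk Q V x (lat_join M N) u"
  proof (intro rkI allI impI)
    fix \<alpha> S assume "S |\<in>| component (lat_join M N) \<alpha>"
    then have "S |\<in>| component M \<alpha> \<or> S |\<in>| component N \<alpha>" by (auto simp: lat_join_def)
    then show "\<exists>v. rk Q V (tail Q \<alpha>) S v \<and> u = rmap V \<alpha> * v" using rkD u by metis
  qed (rule rk_carrier[OF conjunct1[OF u]])
qed

text \<open>The change of coordinates \<open>C' * B\<close> has the left inverse
  \<open>C * B'\<close>, so \<open>left_inverse_dim_le\<close> applies in both directions.\<close>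

lemma frame_unique:
  assumes "frame n A r B C" "frame n A s B' C'"
  shows "r = s"
proof -
  have le: "r \<le> s" if f1: "frame n A r B C" and f2: "frame n A s B' C'" for r s B C B' C'
  proof -
    note a = frameD[OF f1] and b = frameD[OF f2]
    have "C * (B' * (C' * B)) = 1\<^sub>m r"
    proof (rule mat_eq_by_columns)
      fix z :: "'a mat" assume z: "z \<in> carrier_mat r 1"
      then have "B' * (C' * (B * z)) = B * z" using frame_fixes(1)[OF f2, of "B * z"] a(4) by auto
      then have "C * (B' * (C' * (B * z))) = z" using a(1,2) z by (simp add: mat_assoc_eq[OF a(3)] mat_one_left)
      then show "C * (B' * (C' * B)) * z = 1\<^sub>m r * z" using a(1,2) b(1,2) z by (simp add: mat_assoc mat_one_left)
    qed (use a b in auto)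
    then have "C * B' * (C' * B) = 1\<^sub>m r" using a(1,2) b(1,2) by (simp add: mat_assoc)
    then show "r \<le> s" using a(1,2) b(1,2) by (intro left_inverse_dim_le[of "C' * B" s r "C * B'"]) auto
  qed
  show ?thesis using le[OF assms] le[OF assms(2,1)] by simp
qed

definition rkdim :: "('a, 'b) pre_digraph \<Rightarrow> ('a, 'b, 'k :: field) rep \<Rightarrow> 'a \<Rightarrow> 'b lat_elem \<Rightarrow> nat" where
  "rkdim Q V x M = (THE r. \<exists>B C. frame (rdim V x) {u. rk Q V x M u} r B C)"

lemma rkdim_eqI: "frame (rdim V x) {u. rk Q V x M u} r B C \<Longrightarrow> rkdim Q V x M = r"
  unfolding rkdim_def by (rule the_equality) (auto dest: frame_unique)

context quiver
begin

lemma in_arcsD: "\<alpha> \<in> in_arcs Q x \<Longrightarrow> \<alpha> \<in> arcs Q \<and> head Q \<alpha> = x \<and> tail Q \<alpha> \<in> verts Q"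
  by (auto simp: in_arcs_def tail_in_verts)

lemma rk_subspace:
  assumes V: "is_rep Q V" and "lat_at Q x M"
  shows "mat_subspace (rdim V x) {u. rk Q V x M u}"
  using assms(2)
proof (induction rule: lat_at.induct)
  case (lat_atI M x)
  let ?A = "\<lambda>\<alpha> S. (\<lambda>v. rmap V \<alpha> * v) ` {v. rk Q V (tail Q \<alpha>) S v}"
  have "mat_subspace (rdim V x) (?A \<alpha> S)" if "S |\<in>| component M \<alpha>" for \<alpha> S
    using mat_subspace_image[OF is_repD[OF V] lat_atI.IH[OF that]] in_arcsD[OF lat_atI.hyps(1)[OF that]] by auto
  then have sub: "mat_subspace (rdim V x) {u \<in> carrier_mat (rdim V x) 1.
      \<forall>p \<in> {(\<alpha>, S). S |\<in>| component M \<alpha>}. u \<in> ?A (fst p) (snd p)}"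
    by (intro mat_subspace_Inter) auto
  have "{u. rk Q V x M u} = {u \<in> carrier_mat (rdim V x) 1.
      \<forall>p \<in> {(\<alpha>, S). S |\<in>| component M \<alpha>}. u \<in> ?A (fst p) (snd p)}"
    by (subst rk_iff) force
  then show ?case using sub by simp
qed

lemma rkdim_frame:
  assumes "is_rep Q V" "lat_at Q x M"
  obtains B C where "frame (rdim V x) {u. rk Q V x M u} (rkdim Q V x M) B C"
  using frame_exists[OF rk_subspace[OF assms]] rkdim_eqI by metis

lemma rk_hom:
  assumes V: "is_rep Q V" "is_rep Q W" and h: "rep_hom Q V W \<phi>"
    and "lat_at Q x M" "x \<in> verts Q" "rk Q V x M u"
  shows "rk Q W x M (\<phi> x * u)"
  using assms(4-6)
proof (induction arbitrary: u rule: lat_at.induct)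
  case (lat_atI M x)
  have u: "u \<in> carrier_mat (rdim V x) 1" using lat_atI.prems(2) by (rule rk_carrier)
  show ?case
  proof (rule rkI, goal_cases)
    case 1
    show ?case using rep_homD(1)[OF h lat_atI.prems(1)] u by auto
  next
    case 2
    show ?case
    proof (intro allI impI)
      fix \<alpha> S assume S: "S |\<in>| component M \<alpha>"
      then obtain v where v: "rk Q V (tail Q \<alpha>) S v" "u = rmap V \<alpha> * v"
        using rkD[OF lat_atI.prems(2) S] by blast
      have a: "\<alpha> \<in> arcs Q" "head Q \<alpha> = x" "tail Q \<alpha> \<in> verts Q" using in_arcsD[OF lat_atI.hyps(1)[OF S]] by auto
      note d = rep_homD(1)[OF h lat_atI.prems(1)] rep_homD(1)[OF h a(3)] is_repD[OF V(1) a(1)] is_repD[OF V(2) a(1)] rk_carrier[OF v(1)]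
      have "\<phi> x * (rmap V \<alpha> * v) = rmap W \<alpha> * \<phi> (tail Q \<alpha>) * v"
        by (rule mat_assoc_eq) (use rep_homD(2)[OF h a(1)] a(2) d in auto)
      then have "\<phi> x * u = rmap W \<alpha> * (\<phi> (tail Q \<alpha>) * v)" using v(2) d by (simp add: mat_assoc)
      then show "\<exists>v. rk Q W (tail Q \<alpha>) S v \<and> \<phi> x * u = rmap W \<alpha> * v"
        using lat_atI.IH[OF S a(3) v(1)] by blast
    qed
  qed
qed

lemma rk_add: "is_rep Q V \<Longrightarrow> lat_at Q x M \<Longrightarrow> rk Q V x M u \<Longrightarrow> rk Q V x M v \<Longrightarrow> rk Q V x M (u + v)"
  using rk_subspace[of V x M] by (auto simp: mat_subspace_def)

text \<open>All four structure maps are morphisms and preserve rank spaces, so the rank space of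
  \<open>V\<close> is the sum of the two images, and frames can be put side by side.\<close>

lemma rkdim_biproduct:
  assumes V: "is_rep Q V" "is_rep Q V1" "is_rep Q V2" and b: "biproduct Q V V1 V2 i1 p1 i2 p2"
    and M: "lat_at Q x M" and x: "x \<in> verts Q"
  shows "rkdim Q V x M = rkdim Q V1 x M + rkdim Q V2 x M"
proof -
  note b' = b[unfolded biproduct_def]
  have h: "rep_hom Q V1 V i1" "rep_hom Q V V1 p1" "rep_hom Q V2 V i2" "rep_hom Q V V2 p2" using b' by auto
  have c: "i1 x \<in> carrier_mat (rdim V x) (rdim V1 x)" "i2 x \<in> carrier_mat (rdim V x) (rdim V2 x)"
    "p1 x \<in> carrier_mat (rdim V1 x) (rdim V x)" "p2 x \<in> carrier_mat (rdim V2 x) (rdim V x)"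
    using h x by (auto dest: rep_homD(1))
  have e: "p1 x * i1 x = 1\<^sub>m (rdim V1 x)" "p2 x * i2 x = 1\<^sub>m (rdim V2 x)"
    "p1 x * i2 x = 0\<^sub>m (rdim V1 x) (rdim V2 x)" "p2 x * i1 x = 0\<^sub>m (rdim V2 x) (rdim V1 x)"
    "i1 x * p1 x + i2 x * p2 x = 1\<^sub>m (rdim V x)" using b' x by auto
  obtain B1 C1 where f1: "frame (rdim V1 x) {u. rk Q V1 x M u} (rkdim Q V1 x M) B1 C1" by (rule rkdim_frame[OF V(2) M])
  obtain B2 C2 where f2: "frame (rdim V2 x) {u. rk Q V2 x M u} (rkdim Q V2 x M) B2 C2" by (rule rkdim_frame[OF V(3) M])
  note g1 = frameD[OF f1] and g2 = frameD[OF f2]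
  let ?r = "rkdim Q V1 x M" and ?s = "rkdim Q V2 x M"
  let ?B = "i1 x * (B1 * prj1 ?r ?s) + i2 x * (B2 * prj2 ?r ?s)"
  let ?C = "inj1 ?r ?s * (C1 * p1 x) + inj2 ?r ?s * (C2 * p2 x)"
  have "frame (rdim V x) {u. rk Q V x M u} (?r + ?s) ?B ?C"
    unfolding frame_def
  proof (intro conjI)
    show Bc: "?B \<in> carrier_mat (rdim V x) (?r + ?s)" "?C \<in> carrier_mat (?r + ?s) (rdim V x)"
      using c g1(1,2) g2(1,2) by auto
    have "?C * ?B = inj1 ?r ?s * prj1 ?r ?s + inj2 ?r ?s * prj2 ?r ?s"
      using c g1(1,2) g2(1,2) by (simp add: mat_assoc mat_ring_simps mat_assoc_eq[OF e(1)] mat_assoc_eq[OF e(2)]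
        mat_assoc_eq[OF e(3)] mat_assoc_eq[OF e(4)] mat_assoc_eq[OF g1(3)] mat_assoc_eq[OF g2(3)])
    then show "?C * ?B = 1\<^sub>m (?r + ?s)" by (simp add: inj_prj_sum)
    have Bz: "?B * z = i1 x * (B1 * (prj1 ?r ?s * z)) + i2 x * (B2 * (prj2 ?r ?s * z))" if "z \<in> carrier_mat (?r + ?s) 1" for z
      using c g1(1) g2(1) that by (simp add: mat_assoc mat_ring_simps)
    show "{u. rk Q V x M u} = (\<lambda>z. ?B * z) ` carrier_mat (?r + ?s) 1"
    proof (intro equalityI subsetI)
      fix u assume "u \<in> {u. rk Q V x M u}"
      then have u: "rk Q V x M u" by simp
      have uc: "u \<in> carrier_mat (rdim V x) 1" using u by (rule rk_carrier)
      have "B1 * (C1 * (p1 x * u)) = p1 x * u"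
        by (rule frame_fixes(1)[OF f1]) (use rk_hom[OF V(1,2) h(2) M x u] in simp)
      moreover have "B2 * (C2 * (p2 x * u)) = p2 x * u"
        by (rule frame_fixes(1)[OF f2]) (use rk_hom[OF V(1,3) h(4) M x u] in simp)
      moreover have "u = i1 x * (p1 x * u) + i2 x * (p2 x * u)"
        using arg_cong[OF e(5), of "\<lambda>X. X * u"] c uc by (simp add: mat_assoc mat_ring_simps)
      ultimately have "?B * (?C * u) = u"
        using c g1(1,2) g2(1,2) uc
        by (simp add: mat_assoc mat_ring_simps mat_assoc_eq[OF prj_inj(1)] mat_assoc_eq[OF prj_inj(2)]
            mat_assoc_eq[OF prj_inj(3)] mat_assoc_eq[OF prj_inj(4)])
      then show "u \<in> (\<lambda>z. ?B * z) ` carrier_mat (?r + ?s) 1"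
        by (intro image_eqI[of _ _ "?C * u"]) (use Bc uc in auto)
    next
      fix u assume "u \<in> (\<lambda>z. ?B * z) ` carrier_mat (?r + ?s) 1"
      then obtain z where z: "z \<in> carrier_mat (?r + ?s) 1" "u = ?B * z" by auto
      have "B1 * (prj1 ?r ?s * z) \<in> {u. rk Q V1 x M u}" unfolding g1(4) by (rule imageI) (use z in auto)
      moreover have "B2 * (prj2 ?r ?s * z) \<in> {u. rk Q V2 x M u}" unfolding g2(4) by (rule imageI) (use z in auto)
      ultimately show "u \<in> {u. rk Q V x M u}"
        unfolding z(2) Bz[OF z(1)] using rk_add[OF V(1) M rk_hom[OF V(2,1) h(1) M x] rk_hom[OF V(3,1) h(3) M x]] by simp
    qed
  qed
  then show ?thesis by (rule rkdim_eqI)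
qed

lemma rkdim_dsum:
  assumes V: "is_rep Q V" "is_rep Q W" and M: "lat_at Q x M" "x \<in> verts Q"
  shows "rkdim Q (dsum_rep V W) x M = rkdim Q V x M + rkdim Q W x M"
  by (rule rkdim_biproduct[OF is_rep_dsum[OF V] V dsum_biproduct[OF V] M])

lemma rkdim_iso:
  assumes "(V, W) \<in> rep_iso Q" and M: "lat_at Q x M" "x \<in> verts Q"
  shows "rkdim Q V x M = rkdim Q W x M"
proof -
  note V = rep_isoD(1,2)[OF assms(1)]
  obtain \<phi> \<psi> where h: "rep_hom Q V W \<phi>" "rep_hom Q W V \<psi>"
    "\<And>x. x \<in> verts Q \<Longrightarrow> \<phi> x * \<psi> x = 1\<^sub>m (rdim W x)" "\<And>x. x \<in> verts Q \<Longrightarrow> \<psi> x * \<phi> x = 1\<^sub>m (rdim V x)"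
    using rep_isoD(3)[OF assms(1)] by blast
  note c = rep_homD(1)[OF h(1) M(2)] rep_homD(1)[OF h(2) M(2)] and e = h(3,4)[OF M(2)]
  obtain B C where f: "frame (rdim V x) {u. rk Q V x M u} (rkdim Q V x M) B C" by (rule rkdim_frame[OF V(1) M(1)])
  note g = frameD[OF f]
  let ?r = "rkdim Q V x M"
  have "frame (rdim W x) {u. rk Q W x M u} ?r (\<phi> x * B) (C * \<psi> x)"
    unfolding frame_def
  proof (intro conjI)
    show "\<phi> x * B \<in> carrier_mat (rdim W x) ?r" "C * \<psi> x \<in> carrier_mat ?r (rdim W x)" using c g by auto
    show "C * \<psi> x * (\<phi> x * B) = 1\<^sub>m ?r" using c g by (simp add: mat_assoc mat_assoc_eq[OF e(2)] mat_one_left)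
    show "{u. rk Q W x M u} = (\<lambda>z. \<phi> x * B * z) ` carrier_mat ?r 1"
    proof (intro equalityI subsetI)
      fix u assume "u \<in> {u. rk Q W x M u}"
      then have u: "rk Q W x M u" by simp
      note uc = rk_carrier[OF u]
      have "\<psi> x * u \<in> {u. rk Q V x M u}" using rk_hom[OF V(2,1) h(2) M u] by simp
      then obtain z where z: "z \<in> carrier_mat ?r 1" "\<psi> x * u = B * z" using g(4) by auto
      have "u = \<phi> x * (\<psi> x * u)" using c uc by (simp add: mat_assoc_eq[OF e(1)] mat_one_left)
      then have "u = \<phi> x * B * z" using z c g(1) by (simp add: mat_assoc)
      then show "u \<in> (\<lambda>z. \<phi> x * B * z) ` carrier_mat ?r 1" using z(1) by blast
    next
      fix u assume "u \<in> (\<lambda>z. \<phi> x * B * z) ` carrier_mat ?r 1"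
      then obtain z where z: "z \<in> carrier_mat ?r 1" "u = \<phi> x * B * z" by auto
      have "B * z \<in> {u. rk Q V x M u}" unfolding g(4) by (rule imageI[OF z(1)])
      then have "rk Q W x M (\<phi> x * (B * z))" using rk_hom[OF V h(1) M] by simp
      then show "u \<in> {u. rk Q W x M u}" using z c g(1) by (simp add: mat_assoc)
    qed
  qed
  then show ?thesis by (rule rkdim_eqI[symmetric])
qed

text \<open>Both operations in the recursion are compatible with tensor products: images by
  \<open>tensor_space_image\<close>, and intersections because \<open>tensor_space\<close> is
  defined by membership conditions.\<close>

lemma rk_tensor:
  assumes V: "is_rep Q V" "is_rep Q W" and "lat_at Q x M"
  shows "{u. rk Q (tensor_rep V W) x M u} =
    tensor_space (rdim V x) (rdim W x) {u. rk Q V x M u} {u. rk Q W x M u}"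
  using assms(3)
proof (induction rule: lat_at.induct)
  case (lat_atI M x)
  let ?A = "\<lambda>V \<alpha> S. (\<lambda>v. rmap V \<alpha> * v) ` {v. rk Q V (tail Q \<alpha>) S v}"
  have im: "?A (tensor_rep V W) \<alpha> S = tensor_space (rdim V x) (rdim W x) (?A V \<alpha> S) (?A W \<alpha> S)"
    if S: "S |\<in>| component M \<alpha>" for \<alpha> S
  proof -
    have a: "\<alpha> \<in> arcs Q" "head Q \<alpha> = x" using in_arcsD[OF lat_atI.hyps(1)[OF S]] by auto
    show ?thesis unfolding lat_atI.IH[OF S] rmap_tensor_rep
      using tensor_space_image[OF is_repD[OF V(1) a(1)] is_repD[OF V(2) a(1)] rk_subspace[OF V(1)] rk_subspace[OF V(2)]]
        lat_atI.hyps(2)[OF S] a(2) by simp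
  qed
  have rk': "{u. rk Q U x M u} = {u \<in> carrier_mat (rdim U x) 1. \<forall>\<alpha> S. S |\<in>| component M \<alpha> \<longrightarrow> u \<in> ?A U \<alpha> S}" for U :: "('a, 'b, 'k::field) rep"
    by (subst rk_iff) blast
  have "{u. rk Q (tensor_rep V W) x M u} = {u \<in> carrier_mat (rdim V x * rdim W x) 1. \<forall>\<alpha> S. S |\<in>| component M \<alpha> \<longrightarrow>
      u \<in> tensor_space (rdim V x) (rdim W x) (?A V \<alpha> S) (?A W \<alpha> S)}"
    unfolding rk' using im by auto
  also have "\<dots> = tensor_space (rdim V x) (rdim W x) {u. rk Q V x M u} {u. rk Q W x M u}"
    unfolding rk' tensor_space_def by (auto intro!: carrier_matI)
  finally show ?case .
qed

lemma rkdim_tensor: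
  assumes V: "is_rep Q V" "is_rep Q W" and M: "lat_at Q x M"
  shows "rkdim Q (tensor_rep V W) x M = rkdim Q V x M * rkdim Q W x M"
proof -
  obtain B C where f: "frame (rdim V x) {u. rk Q V x M u} (rkdim Q V x M) B C" by (rule rkdim_frame[OF V(1) M])
  obtain B' C' where f': "frame (rdim W x) {u. rk Q W x M u} (rkdim Q W x M) B' C'" by (rule rkdim_frame[OF V(2) M])
  show ?thesis
    by (rule rkdim_eqI[of _ _ _ _ _ "kronecker B B'" "kronecker C C'"])
      (use tensor_space_frame[OF f f'] rk_tensor[OF V M] in simp)
qed

lemma rkdim_unit:
  assumes M: "lat_at Q x M"
  shows "rkdim Q (unit_rep :: ('a, 'b, 'k::field) rep) x M = 1"
proof -
  have "rk Q (unit_rep :: ('a, 'b, 'k) rep) x M u \<longleftrightarrow> u \<in> carrier_mat 1 1" for u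
    using M
  proof (induction arbitrary: u rule: lat_at.induct)
    case (lat_atI M x)
    show ?case
    proof
      assume "rk Q unit_rep x M u"
      then show "u \<in> carrier_mat 1 1" using rk_carrier by (force simp: unit_rep_def)
    next
      assume u: "u \<in> carrier_mat 1 1"
      then have "u = rmap unit_rep \<alpha> * u" for \<alpha> by (simp add: unit_rep_def mat_one_left)
      then show "rk Q unit_rep x M u"
        using u lat_atI.IH by (intro rkI) (auto simp: unit_rep_def)
    qed
  qed
  then have e: "{u. rk Q (unit_rep :: ('a, 'b, 'k) rep) x M u} = carrier_mat 1 1" by blast
  have "(*) (1\<^sub>m 1 :: 'k mat) ` carrier_mat 1 1 = id ` carrier_mat 1 1"
    by (rule image_cong) (auto simp: mat_one_left)
  then have "frame 1 (carrier_mat 1 1) 1 (1\<^sub>m 1) (1\<^sub>m 1 :: 'k mat)"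
    unfolding frame_def by (simp add: mat_one_left)
  then have "frame (rdim (unit_rep :: ('a, 'b, 'k) rep) x) {u. rk Q (unit_rep :: ('a, 'b, 'k) rep) x M u} 1 (1\<^sub>m 1) (1\<^sub>m 1)"
    unfolding e by (simp add: unit_rep_def)
  then show ?thesis by (rule rkdim_eqI)
qed

lemma rkdim_eq_0_iff:
  fixes V :: "('a, 'b, 'k::field) rep"
  assumes V: "is_rep Q V" and M: "lat_at Q x M"
  shows "rkdim Q V x M = 0 \<longleftrightarrow> (\<forall>u. rk Q V x M u \<longrightarrow> u = 0\<^sub>m (rdim V x) 1)"
proof -
  obtain B C where f: "frame (rdim V x) {u. rk Q V x M u} (rkdim Q V x M) B C" by (rule rkdim_frame[OF V M])
  note g = frameD[OF f]
  show ?thesis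
  proof
    assume z: "rkdim Q V x M = 0"
    show "\<forall>u. rk Q V x M u \<longrightarrow> u = 0\<^sub>m (rdim V x) 1"
    proof (intro allI impI)
      fix u assume "rk Q V x M u"
      then have u: "u \<in> {u. rk Q V x M u}" by simp
      have "C * u = 0\<^sub>m 0 1" using frame_fixes(2)[OF f u] z by (intro eq_matI) auto
      then show "u = 0\<^sub>m (rdim V x) 1" using frame_fixes(1)[OF f u] g(1) z by (simp add: mat_zero_right)
    qed
  next
    assume z: "\<forall>u. rk Q V x M u \<longrightarrow> u = 0\<^sub>m (rdim V x) 1"
    show "rkdim Q V x M = 0"
    proof (rule ccontr)
      assume n: "rkdim Q V x M \<noteq> 0"
      let ?z = "mat (rkdim Q V x M) 1 (\<lambda>_. 1) :: 'k mat"
      have "B * ?z \<in> {u. rk Q V x M u}" unfolding g(4) by (rule imageI) auto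
      then have "B * ?z = 0\<^sub>m (rdim V x) 1" using z by simp
      then have "C * (B * ?z) = 0\<^sub>m (rkdim Q V x M) 1" using g(2) by (simp add: mat_zero_right)
      then have "?z = 0\<^sub>m (rkdim Q V x M) 1" using g(1,2) by (simp add: mat_assoc_eq[OF g(3)] mat_one_left)
      then have "?z $$ (0, 0) = 0\<^sub>m (rkdim Q V x M) 1 $$ (0, 0)" by (rule arg_cong)
      then show False using n by simp
    qed
  qed
qed

end

section \<open>Corank functionals\<close>

text \<open>
  The functionals dual to the rank spaces: \<open>u \<in> rk M\<close> and \<open>g \<in> cork M\<close> with \<open>g u = 1\<close> are the
  data of maps from and to the indecomposable attached to \<open>M\<close>, without mentioning that
  representation.
\<close>

inductive cork :: "('a, 'b) pre_digraph \<Rightarrow> ('a, 'b, 'k :: field) rep \<Rightarrow> 'a \<Rightarrow> 'b lat_elem \<Rightarrow> 'k mat \<Rightarrow> bool"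
  and sumcork :: "('a, 'b) pre_digraph \<Rightarrow> ('a, 'b, 'k :: field) rep \<Rightarrow> 'a \<Rightarrow> 'b lat_elem set \<Rightarrow> 'k mat \<Rightarrow> bool"
  for Q V where
  corkI: "g \<in> carrier_mat 1 (rdim V x) \<Longrightarrow>
    (\<forall>\<alpha> \<in> in_arcs Q x. sumcork Q V (tail Q \<alpha>) (fset (component M \<alpha>)) (g * rmap V \<alpha>)) \<Longrightarrow> cork Q V x M g"
| sumcork_zero: "sumcork Q V y A (0\<^sub>m 1 (rdim V y))"
| sumcork_add: "S \<in> A \<Longrightarrow> cork Q V y S h \<Longrightarrow> sumcork Q V y A k \<Longrightarrow> sumcork Q V y A (h + k)"

lemma corkD:
  assumes "cork Q V x M g"
  shows "g \<in> carrier_mat 1 (rdim V x)"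
    "\<alpha> \<in> in_arcs Q x \<Longrightarrow> sumcork Q V (tail Q \<alpha>) (fset (component M \<alpha>)) (g * rmap V \<alpha>)"
  using assms by (auto elim: cork.cases)

text \<open>The mutual induction with a trivial predicate for \<open>cork\<close>, so that sums can
  be treated with their summands as black boxes.\<close>

lemma sumcork_induct [consumes 1, case_names zero add]:
  assumes "sumcork Q V y A g" "P (0\<^sub>m 1 (rdim V y))"
    "\<And>S h k. S \<in> A \<Longrightarrow> cork Q V y S h \<Longrightarrow> sumcork Q V y A k \<Longrightarrow> P k \<Longrightarrow> P (h + k)"
  shows "P g"
proof -
  have "sumcork Q V y A g \<Longrightarrow> (P (0\<^sub>m 1 (rdim V y))) \<Longrightarrow>
    (\<forall>S h k. S \<in> A \<longrightarrow> cork Q V y S h \<longrightarrow> sumcork Q V y A k \<longrightarrow> P k \<longrightarrow> P (h + k)) \<Longrightarrow> P g"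
    by (induction rule: cork_sumcork.inducts(2)[where ?P1.0 = "\<lambda>_ _ _. True"]) auto
  then show ?thesis using assms by blast
qed

lemma sumcork_carrier: "sumcork Q V y A g \<Longrightarrow> g \<in> carrier_mat 1 (rdim V y)"
  by (induction rule: sumcork_induct) (auto dest: corkD)

lemma sumcork_plus:
  assumes "sumcork Q V y A g" "sumcork Q V y A g'"
  shows "sumcork Q V y A (g + g')"
  using assms(1)
proof (induction rule: sumcork_induct)
  case zero
  then show ?case using sumcork_carrier[OF assms(2)] assms(2) by (simp add: mat_add_zero_left)
next
  case (add S h k)
  have "h + k + g' = h + (k + g')"
    by (rule assoc_add_mat[OF corkD(1)[OF add(2)] sumcork_carrier[OF add(3)] sumcork_carrier[OF assms(2)]])
  then show ?case using sumcork_add[OF add(1,2,4)] by simp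
qed

lemma sumcork_single: "S \<in> A \<Longrightarrow> cork Q V y S h \<Longrightarrow> sumcork Q V y A h"
  using sumcork_add[OF _ _ sumcork_zero, of S A Q V y h] corkD(1)[of Q V y S h] by (simp add: mat_add_zero_right)

lemma sumcork_mono:
  assumes "sumcork Q V y A g" "A \<subseteq> A'"
  shows "sumcork Q V y A' g"
  using assms(1)
proof (induction rule: sumcork_induct)
  case (add S h k)
  then show ?case using assms(2) by (intro sumcork_add) auto
qed (rule sumcork_zero)

text \<open>The variance is opposite to that of \<open>rk_antimono\<close>: larger ideals allow more
  summands.\<close>

lemma cork_mono:
  assumes "lat_le S M" "cork Q V x S g"
  shows "cork Q V x M g"
proof (rule corkI)
  show "\<forall>\<alpha> \<in> in_arcs Q x. sumcork Q V (tail Q \<alpha>) (fset (component M \<alpha>)) (g * rmap V \<alpha>)"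
    using sumcork_mono[OF corkD(2)[OF assms(2)]] assms(1) by (auto simp: lat_le_def less_eq_fset.rep_eq)
qed (rule corkD(1)[OF assms(2)])

lemma sumcork_pairing:
  assumes "sumcork Q V y A g" "u \<in> carrier_mat (rdim V y) 1" "g * u \<noteq> 0\<^sub>m 1 1"
  shows "\<exists>S \<in> A. \<exists>h. cork Q V y S h \<and> h * u \<noteq> 0\<^sub>m 1 1"
  using assms(1,3)
proof (induction rule: sumcork_induct)
  case zero
  then show ?case using assms(2) by (simp add: mat_zero_left)
next
  case (add S h k)
  show ?case
  proof (cases "h * u = 0\<^sub>m 1 1")
    case True
    have "(h + k) * u = h * u + k * u"
      using corkD(1)[OF add(2)] sumcork_carrier[OF add(3)] assms(2) by (simp add: mat_distrib_right)
    then have "k * u \<noteq> 0\<^sub>m 1 1" using True add.prems by (auto simp: mat_add_zero_left)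
    then show ?thesis using add.IH by blast
  next
    case False
    then show ?thesis using add by blast
  qed
qed

context quiver
begin

lemma cork_zero:
  assumes V: "is_rep Q V"
  shows "cork Q V x M (0\<^sub>m 1 (rdim V x))"
proof (rule corkI, goal_cases)
  case 2
  show ?case
  proof
    fix \<alpha> assume a: "\<alpha> \<in> in_arcs Q x"
    have "rmap V \<alpha> \<in> carrier_mat (rdim V x) (rdim V (tail Q \<alpha>))"
      using in_arcsD[OF a] is_repD[OF V, of \<alpha>] by auto
    then have "0\<^sub>m 1 (rdim V x) * rmap V \<alpha> = 0\<^sub>m 1 (rdim V (tail Q \<alpha>))" by (simp add: mat_zero_left)
    then show "sumcork Q V (tail Q \<alpha>) (fset (component M \<alpha>)) (0\<^sub>m 1 (rdim V x) * rmap V \<alpha>)"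
      by (metis sumcork_zero)
  qed
qed auto

lemma cork_plus:
  assumes V: "is_rep Q V" and "cork Q V x M g" "cork Q V x M g'"
  shows "cork Q V x M (g + g')"
proof (rule corkI, goal_cases)
  case 1
  show ?case using corkD(1)[OF assms(2)] corkD(1)[OF assms(3)] by auto
next
  case 2
  show ?case
  proof
    fix \<alpha> assume a: "\<alpha> \<in> in_arcs Q x"
    have "rmap V \<alpha> \<in> carrier_mat (rdim V x) (rdim V (tail Q \<alpha>))"
      using in_arcsD[OF a] is_repD[OF V, of \<alpha>] by auto
    then have "(g + g') * rmap V \<alpha> = g * rmap V \<alpha> + g' * rmap V \<alpha>"
      using corkD(1)[OF assms(2)] corkD(1)[OF assms(3)] by (simp add: mat_distrib_right)
    then show "sumcork Q V (tail Q \<alpha>) (fset (component M \<alpha>)) ((g + g') * rmap V \<alpha>)"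
      using sumcork_plus[OF corkD(2)[OF assms(2) a] corkD(2)[OF assms(3) a]] by simp
  qed
qed

lemma sumcork_imp_cork:
  assumes V: "is_rep Q V" and "sumcork Q V x A g" "\<And>S. S \<in> A \<Longrightarrow> lat_le S M"
  shows "cork Q V x M g"
  using assms(2)
proof (induction rule: sumcork_induct)
  case (add S h k)
  show ?case by (rule cork_plus[OF V cork_mono[OF assms(3)[OF add(1)] add(2)] add(4)])
qed (rule cork_zero[OF V])

text \<open>Functionals pull back along morphisms, whereas vectors in rank spaces push forward
  (\<open>rk_hom\<close>).\<close>

lemma cork_hom:
  assumes V: "is_rep Q V" "is_rep Q W" and h: "rep_hom Q V W \<phi>"
  shows "cork Q W x M g \<Longrightarrow> x \<in> verts Q \<Longrightarrow> cork Q V x M (g * \<phi> x)"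
    and "sumcork Q W x A g \<Longrightarrow> x \<in> verts Q \<Longrightarrow> sumcork Q V x A (g * \<phi> x)"
proof (induction rule: cork_sumcork.inducts)
  case (corkI g x M)
  note c = rep_homD(1)[OF h corkI.prems]
  show ?case
  proof (rule cork_sumcork.corkI, goal_cases)
    case 1
    show ?case using corkI.IH(1) c by auto
  next
    case 2
    show ?case
    proof
      fix \<alpha> assume "\<alpha> \<in> in_arcs Q x"
      then have a: "\<alpha> \<in> in_arcs Q x" "\<alpha> \<in> arcs Q" "head Q \<alpha> = x" "tail Q \<alpha> \<in> verts Q"
        using in_arcsD[of \<alpha> x] by blast+
      have e: "\<phi> x * rmap V \<alpha> = rmap W \<alpha> * \<phi> (tail Q \<alpha>)" using rep_homD(2)[OF h a(2)] a(3) by simp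
      have r: "rmap V \<alpha> \<in> carrier_mat (rdim V x) (rdim V (tail Q \<alpha>))"
        "rmap W \<alpha> \<in> carrier_mat (rdim W x) (rdim W (tail Q \<alpha>))"
        using is_repD[OF V(1) a(2)] is_repD[OF V(2) a(2)] a(3) by simp_all
      note d = c rep_homD(1)[OF h a(4)] r corkI.IH(1)
      have "g * \<phi> x * rmap V \<alpha> = g * (rmap W \<alpha> * \<phi> (tail Q \<alpha>))"
        using d by (simp add: mat_assoc e)
      also have "\<dots> = g * rmap W \<alpha> * \<phi> (tail Q \<alpha>)" using d by (simp add: mat_assoc)
      finally show "sumcork Q V (tail Q \<alpha>) (fset (component M \<alpha>)) (g * \<phi> x * rmap V \<alpha>)"
        using conjunct2[OF bspec[OF corkI.IH(2) a(1)], THEN mp, OF a(4)] by simp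
    qed
  qed
next
  case (sumcork_zero y A)
  have "0\<^sub>m 1 (rdim W y) * \<phi> y = 0\<^sub>m 1 (rdim V y)"
    using rep_homD(1)[OF h sumcork_zero] by (simp add: mat_zero_left)
  then show ?case using cork_sumcork.sumcork_zero[of Q V y A] by simp
next
  case (sumcork_add S A y l k)
  have "(l + k) * \<phi> y = l * \<phi> y + k * \<phi> y"
    using rep_homD(1)[OF h sumcork_add.prems] corkD(1)[OF sumcork_add.IH(1)] sumcork_carrier[OF sumcork_add.IH(3)]
    by (simp add: mat_distrib_right)
  then show ?case using cork_sumcork.sumcork_add[OF sumcork_add.hyps(1) sumcork_add.IH(2)[OF sumcork_add.prems] sumcork_add.IH(4)[OF sumcork_add.prems]]
    by simp
qed

end

section \<open>Trees\<close>

text \<open>The combinatorics used below: at most one arrow leaves each vertex, there are no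
  directed cycles, and \<open>L\<close> satisfies the recursion of the lattices. The section on
  rooted trees derives this from \<open>rooted_tree\<close>.\<close>

locale rtree = quiver Q for Q :: "('a, 'b) pre_digraph" +
  fixes L :: "'a \<Rightarrow> 'b lat_elem set"
  assumes fin_verts: "finite (verts Q)" and fin_arcs: "finite (arcs Q)"
    and unique_out: "a \<in> arcs Q \<Longrightarrow> b \<in> arcs Q \<Longrightarrow> tail Q a = tail Q b \<Longrightarrow> a = b"
    and acyc: "acyclic {(tail Q a, head Q a) |a. a \<in> arcs Q}"
    and L_rec: "x \<in> verts Q \<Longrightarrow> L x = {Fam M | M. \<forall>\<alpha>. if \<alpha> \<in> in_arcs Q x
      then fset (M \<alpha>) \<in> order_ideals lat_le (L (tail Q \<alpha>)) else M \<alpha> = {||}}"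
begin

text \<open>Leads from a vertex to its neighbour in the direction of the root. Its well-foundedness
  is induction starting at the leaves.\<close>

definition par where "par = {(tail Q a, head Q a) |a. a \<in> arcs Q}"

lemma parI: "a \<in> arcs Q \<Longrightarrow> (tail Q a, head Q a) \<in> par"
  by (auto simp: par_def)

lemma par_single_valued: "single_valued par"
  unfolding single_valued_def par_def using unique_out by blast

lemma par_acyclic: "(x, x) \<notin> par\<^sup>+"
  using acyc by (auto simp: par_def acyclic_def)

lemma par_wf: "wf par"
proof (rule finite_acyclic_wf)
  have "par = (\<lambda>a. (tail Q a, head Q a)) ` arcs Q" by (auto simp: par_def)
  then show "finite par" using fin_arcs by simp
  show "acyclic par" using acyc by (simp add: par_def)
qed

lemma vertex_induct [case_names step]:
  assumes "\<And>x. (\<And>\<alpha>. \<alpha> \<in> in_arcs Q x \<Longrightarrow> P (tail Q \<alpha>)) \<Longrightarrow> P x"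
  shows "P x"
  using par_wf
proof (induction x rule: wf_induct_rule)
  case (less x)
  show ?case by (rule assms) (use less parI in_arcsD in metis)
qed

lemma below_step:
  assumes "(y, x) \<in> par\<^sup>*" "y \<noteq> x" "a \<in> arcs Q" "tail Q a = y"
  shows "(head Q a, x) \<in> par\<^sup>*"
proof -
  obtain z where z: "(y, z) \<in> par" "(z, x) \<in> par\<^sup>*" using assms(1,2) by (meson converse_rtranclE)
  then have "z = head Q a" using assms(3,4) unique_out by (auto simp: par_def)
  then show ?thesis using z by simp
qed

lemma not_below_head:
  assumes "a \<in> arcs Q"
  shows "(head Q a, tail Q a) \<notin> par\<^sup>*"
  using rtrancl_into_trancl2[OF parI[OF assms]] par_acyclic by blast

text \<open>As \<open>par\<close> is single-valued, the vertices reachable from \<open>y\<close>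
  form a chain, and two different tails of arrows into \<open>x\<close> are never
  comparable.\<close>

lemma branch_unique:
  assumes "\<alpha> \<in> in_arcs Q x" "\<beta> \<in> in_arcs Q x" "(y, tail Q \<alpha>) \<in> par\<^sup>*" "(y, tail Q \<beta>) \<in> par\<^sup>*"
  shows "\<alpha> = \<beta>"
proof -
  have *: "\<alpha> = \<beta>" if a: "\<alpha> \<in> in_arcs Q x" "\<beta> \<in> in_arcs Q x" "(tail Q \<alpha>, tail Q \<beta>) \<in> par\<^sup>*" for \<alpha> \<beta>
  proof (rule ccontr)
    assume n: "\<alpha> \<noteq> \<beta>"
    have aa: "\<alpha> \<in> arcs Q" "head Q \<alpha> = x" "\<beta> \<in> arcs Q" "head Q \<beta> = x" using in_arcsD[OF a(1)] in_arcsD[OF a(2)] by auto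
    then have "tail Q \<alpha> \<noteq> tail Q \<beta>" using n unique_out by blast
    then have "(x, tail Q \<beta>) \<in> par\<^sup>*" using below_step[OF a(3) _ aa(1)] aa(2) by auto
    then show False using not_below_head[OF aa(3)] aa(4) by simp
  qed
  have "(tail Q \<alpha>, tail Q \<beta>) \<in> par\<^sup>* \<or> (tail Q \<beta>, tail Q \<alpha>) \<in> par\<^sup>*"
    by (rule single_valued_confluent[OF par_single_valued assms(3,4)])
  then show ?thesis using *[OF assms(1,2)] *[OF assms(2,1)] by blast
qed

section \<open>Morphisms supported on one branch\<close>

text \<open>Families that vanish off the branch of \<open>x\<close> and commute with every arrow
  except possibly the one leaving \<open>x\<close>. Leaving that square open is what permits a
  recursive construction from the leaves towards \<open>x\<close>.\<close>

definition homto :: "('a, 'b, 'k::field) rep \<Rightarrow> ('a, 'b, 'k) rep \<Rightarrow> 'a \<Rightarrow> ('a \<Rightarrow> 'k mat) \<Rightarrow> bool" where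
  "homto X Y x \<phi> \<longleftrightarrow> (\<forall>y \<in> verts Q. \<phi> y \<in> carrier_mat (rdim Y y) (rdim X y)) \<and>
    (\<forall>a \<in> arcs Q. tail Q a \<noteq> x \<longrightarrow> \<phi> (head Q a) * rmap X a = rmap Y a * \<phi> (tail Q a)) \<and>
    (\<forall>y \<in> verts Q. (y, x) \<notin> par\<^sup>* \<longrightarrow> \<phi> y = 0\<^sub>m (rdim Y y) (rdim X y))"

lemma homto_zero:
  assumes "is_rep Q X" "is_rep Q Y"
  shows "homto X Y x (\<lambda>y. 0\<^sub>m (rdim Y y) (rdim X y))"
  unfolding homto_def
proof (intro conjI ballI impI)
  fix a assume a: "a \<in> arcs Q"
  show "0\<^sub>m (rdim Y (head Q a)) (rdim X (head Q a)) * rmap X a = rmap Y a * 0\<^sub>m (rdim Y (tail Q a)) (rdim X (tail Q a))"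
    using is_repD[OF assms(1) a] is_repD[OF assms(2) a] by (simp add: mat_zero_left mat_zero_right)
qed auto

lemma homto_add:
  assumes V: "is_rep Q X" "is_rep Q Y" and h: "homto X Y x \<phi>" "homto X Y x \<psi>"
  shows "homto X Y x (\<lambda>y. \<phi> y + \<psi> y)"
  unfolding homto_def
proof (intro conjI ballI impI)
  fix a assume a: "a \<in> arcs Q" and t: "tail Q a \<noteq> x"
  have "\<phi> (tail Q a) \<in> carrier_mat (rdim Y (tail Q a)) (rdim X (tail Q a))"
    "\<phi> (head Q a) \<in> carrier_mat (rdim Y (head Q a)) (rdim X (head Q a))"
    "\<psi> (tail Q a) \<in> carrier_mat (rdim Y (tail Q a)) (rdim X (tail Q a))"
    "\<psi> (head Q a) \<in> carrier_mat (rdim Y (head Q a)) (rdim X (head Q a))"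
    using h tail_in_verts[OF a] head_in_verts[OF a] by (auto simp: homto_def)
  moreover have "\<phi> (head Q a) * rmap X a = rmap Y a * \<phi> (tail Q a)" "\<psi> (head Q a) * rmap X a = rmap Y a * \<psi> (tail Q a)"
    using h a t by (auto simp: homto_def)
  ultimately show "(\<phi> (head Q a) + \<psi> (head Q a)) * rmap X a = rmap Y a * (\<phi> (tail Q a) + \<psi> (tail Q a))"
    using is_repD[OF V(1) a] is_repD[OF V(2) a] by (simp add: mat_distrib_left mat_distrib_right)
qed (use h in \<open>auto simp: homto_def mat_add_zero_left\<close>)

text \<open>Branches into a vertex are disjoint, so morphisms on them can be glued.\<close>

lemma homto_glue:
  assumes X: "is_rep Q X" and Y: "is_rep Q Y" and x: "x \<in> verts Q"
    and u: "u \<in> carrier_mat (rdim Y x) 1" and g: "g \<in> carrier_mat 1 (rdim X x)"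
    and br: "\<And>\<alpha>. \<alpha> \<in> in_arcs Q x \<Longrightarrow> homto X Y (tail Q \<alpha>) (\<Phi> \<alpha>) \<and>
      rmap Y \<alpha> * \<Phi> \<alpha> (tail Q \<alpha>) = u * (g * rmap X \<alpha>)"
  shows "\<exists>\<phi>. homto X Y x \<phi> \<and> \<phi> x = u * g"
proof -
  \<comment> \<open>By \<open>branch_unique\<close> the arrow chosen by \<open>SOME\<close> is the
    only candidate.\<close>
  define \<phi> where "\<phi> y = (if y = x then u * g
    else if \<exists>\<alpha>. \<alpha> \<in> in_arcs Q x \<and> (y, tail Q \<alpha>) \<in> par\<^sup>* then \<Phi> (SOME \<alpha>. \<alpha> \<in> in_arcs Q x \<and> (y, tail Q \<alpha>) \<in> par\<^sup>*) y
    else 0\<^sub>m (rdim Y y) (rdim X y))" for y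
  have nx: "(x, tail Q \<alpha>) \<notin> par\<^sup>*" if "\<alpha> \<in> in_arcs Q x" for \<alpha>
    using in_arcsD[OF that] not_below_head[of \<alpha>] by auto
  have \<phi>b: "\<phi> y = \<Phi> \<alpha> y" if a: "\<alpha> \<in> in_arcs Q x" "(y, tail Q \<alpha>) \<in> par\<^sup>*" for y \<alpha>
  proof -
    have "(SOME \<alpha>. \<alpha> \<in> in_arcs Q x \<and> (y, tail Q \<alpha>) \<in> par\<^sup>*) = \<alpha>"
      by (rule some_equality) (use a branch_unique in auto)
    moreover have "y \<noteq> x" using nx a by blast
    ultimately show ?thesis using a by (auto simp: \<phi>_def)
  qed
  have "homto X Y x \<phi>"
    unfolding homto_def
  proof (intro conjI ballI impI)
    fix y assume y: "y \<in> verts Q"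
    show "\<phi> y \<in> carrier_mat (rdim Y y) (rdim X y)"
    proof (cases "\<exists>\<alpha>. \<alpha> \<in> in_arcs Q x \<and> (y, tail Q \<alpha>) \<in> par\<^sup>*")
      case True
      then obtain \<alpha> where a: "\<alpha> \<in> in_arcs Q x" "(y, tail Q \<alpha>) \<in> par\<^sup>*" by blast
      then show ?thesis using \<phi>b[OF a] br[OF a(1)] y by (auto simp: homto_def)
    next
      case False
      then show ?thesis using u g by (auto simp: \<phi>_def)
    qed
  next
    fix y assume y: "y \<in> verts Q" "(y, x) \<notin> par\<^sup>*"
    have "\<not> (\<exists>\<alpha>. \<alpha> \<in> in_arcs Q x \<and> (y, tail Q \<alpha>) \<in> par\<^sup>*)"
    proof
      assume "\<exists>\<alpha>. \<alpha> \<in> in_arcs Q x \<and> (y, tail Q \<alpha>) \<in> par\<^sup>*"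
      then obtain \<alpha> where a: "\<alpha> \<in> in_arcs Q x" "(y, tail Q \<alpha>) \<in> par\<^sup>*" by blast
      then have "(tail Q \<alpha>, x) \<in> par" using in_arcsD[OF a(1)] parI[of \<alpha>] by auto
      then show False using a(2) y(2) by (meson rtrancl.rtrancl_into_rtrancl)
    qed
    moreover have "y \<noteq> x" using y by auto
    ultimately show "\<phi> y = 0\<^sub>m (rdim Y y) (rdim X y)" unfolding \<phi>_def by (simp only: if_False)
  next
    fix a assume a: "a \<in> arcs Q" and t: "tail Q a \<noteq> x"
    note r = is_repD[OF X a] is_repD[OF Y a]
    \<comment> \<open>An arrow into \<open>x\<close> is where the compatibility assumption on
      \<open>\<Phi>\<close> is used; within a branch the family \<open>\<Phi> \<alpha>\<close>
      already commutes; off the branches both sides are zero.\<close>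
    consider (root) "head Q a = x" | (br) \<alpha> where "head Q a \<noteq> x" "\<alpha> \<in> in_arcs Q x" "(tail Q a, tail Q \<alpha>) \<in> par\<^sup>*"
      | (off) "head Q a \<noteq> x" "\<not> (\<exists>\<alpha>. \<alpha> \<in> in_arcs Q x \<and> (tail Q a, tail Q \<alpha>) \<in> par\<^sup>*)" by blast
    then show "\<phi> (head Q a) * rmap X a = rmap Y a * \<phi> (tail Q a)"
    proof cases
      case root
      then have ia: "a \<in> in_arcs Q x" using a by (auto simp: in_arcs_def)
      have "\<phi> (tail Q a) = \<Phi> a (tail Q a)" by (rule \<phi>b[OF ia]) simp
      moreover have "\<phi> (head Q a) = u * g" using root by (simp add: \<phi>_def)
      ultimately show ?thesis using br[OF ia] u g r root by (simp add: mat_assoc)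
    next
      case (br \<alpha>)
      have ne: "tail Q a \<noteq> tail Q \<alpha>"
      proof
        assume "tail Q a = tail Q \<alpha>"
        then have "a = \<alpha>" using unique_out a in_arcsD[OF br(2)] by blast
        then show False using br(1) in_arcsD[OF br(2)] by simp
      qed
      have "(head Q a, tail Q \<alpha>) \<in> par\<^sup>*" by (rule below_step[OF br(3) ne a refl])
      then have "\<phi> (head Q a) = \<Phi> \<alpha> (head Q a)" "\<phi> (tail Q a) = \<Phi> \<alpha> (tail Q a)"
        using \<phi>b[OF br(2)] br(3) by auto
      moreover have "\<Phi> \<alpha> (head Q a) * rmap X a = rmap Y a * \<Phi> \<alpha> (tail Q a)"
        using assms(6)[OF br(2)] a ne by (auto simp: homto_def)
      ultimately show ?thesis by simp
    next
      case off
      have "\<not> (\<exists>\<alpha>. \<alpha> \<in> in_arcs Q x \<and> (head Q a, tail Q \<alpha>) \<in> par\<^sup>*)"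
        using off(2) parI[OF a] by (meson converse_rtrancl_into_rtrancl)
      then have "\<phi> (head Q a) = 0\<^sub>m (rdim Y (head Q a)) (rdim X (head Q a))"
        "\<phi> (tail Q a) = 0\<^sub>m (rdim Y (tail Q a)) (rdim X (tail Q a))"
        using off t by (auto simp: \<phi>_def)
      then show ?thesis using r by (simp add: mat_zero_left mat_zero_right)
    qed
  qed
  moreover have "\<phi> x = u * g" by (simp add: \<phi>_def)
  ultimately show ?thesis by blast
qed

text \<open>For an arrow \<open>\<alpha>\<close> into \<open>x\<close>, the functional
  \<open>g * rmap X \<alpha>\<close> is a sum of functionals \<open>h\<close> in \<open>cork\<close>
  of elements \<open>S\<close> of the ideal, while \<open>u\<close> is the image of some
  \<open>v\<close> in the rank space of \<open>S\<close>. The maps obtained recursively with value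
  \<open>v * h\<close> at the tail add up to one whose composite with \<open>rmap Y \<alpha>\<close>
  is \<open>u * (g * rmap X \<alpha>)\<close>, as gluing at \<open>x\<close> requires.\<close>

lemma cork_rk_homto:
  assumes X: "is_rep Q X" and Y: "is_rep Q Y"
  shows "cork Q X x M g \<Longrightarrow> x \<in> verts Q \<Longrightarrow> lat_at Q x M \<Longrightarrow> rk Q Y x M u \<Longrightarrow> \<exists>\<phi>. homto X Y x \<phi> \<and> \<phi> x = u * g"
    and "sumcork Q X x A h \<Longrightarrow> \<alpha> \<in> arcs Q \<Longrightarrow> tail Q \<alpha> = x \<Longrightarrow> (\<forall>S \<in> A. lat_at Q x S) \<Longrightarrow>
      u \<in> carrier_mat (rdim Y (head Q \<alpha>)) 1 \<Longrightarrow> (\<forall>S \<in> A. \<exists>v. rk Q Y x S v \<and> u = rmap Y \<alpha> * v) \<Longrightarrow>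
      \<exists>\<phi>. homto X Y x \<phi> \<and> rmap Y \<alpha> * \<phi> x = u * h"
proof (induction arbitrary: u and \<alpha> u rule: cork_sumcork.inducts)
  case (corkI g x M)
  note u = rk_carrier[OF corkI.prems(3)]
  have "\<exists>\<Phi>. homto X Y (tail Q \<alpha>) \<Phi> \<and> rmap Y \<alpha> * \<Phi> (tail Q \<alpha>) = u * (g * rmap X \<alpha>)" if a: "\<alpha> \<in> in_arcs Q x" for \<alpha>
  proof (rule corkI.IH(2)[rule_format, OF a, THEN conjunct2, rule_format])
    show "\<alpha> \<in> arcs Q" "u \<in> carrier_mat (rdim Y (head Q \<alpha>)) 1" using in_arcsD[OF a] u by auto
    show "lat_at Q (tail Q \<alpha>) S" if "S \<in> fset (component M \<alpha>)" for S
      using corkI.prems(2) that by (cases rule: lat_at.cases) auto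
    show "\<exists>v. rk Q Y (tail Q \<alpha>) S v \<and> u = rmap Y \<alpha> * v" if "S \<in> fset (component M \<alpha>)" for S
      using rkD[OF corkI.prems(3)] that by auto
  qed auto
  then obtain \<Phi> where "\<And>\<alpha>. \<alpha> \<in> in_arcs Q x \<Longrightarrow> homto X Y (tail Q \<alpha>) (\<Phi> \<alpha>) \<and>
      rmap Y \<alpha> * \<Phi> \<alpha> (tail Q \<alpha>) = u * (g * rmap X \<alpha>)" by metis
  then show ?case by (rule homto_glue[OF X Y corkI.prems(1) u corkI.IH(1)])
next
  case (sumcork_zero y A)
  then show ?case using homto_zero[OF X Y, of y] is_repD[OF Y, of \<alpha>]
    by (intro exI[of _ "\<lambda>y. 0\<^sub>m (rdim Y y) (rdim X y)"]) (auto simp: mat_zero_right)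
next
  case (sumcork_add S A y h k)
  have y: "y \<in> verts Q" using sumcork_add.prems tail_in_verts by blast
  \<comment> \<open>The preimages \<open>v\<close> of \<open>u\<close> for different
    \<open>S\<close> are unrelated. For this reason the statement for \<open>sumcork\<close>
    controls the sum only after composition with \<open>rmap Y \<alpha>\<close>.\<close>
  obtain v where v: "rk Q Y y S v" "u = rmap Y \<alpha> * v" using sumcork_add.prems sumcork_add.hyps by blast
  obtain \<phi> where \<phi>: "homto X Y y \<phi>" "\<phi> y = v * h"
    using sumcork_add.IH(2)[OF y _ v(1)] sumcork_add.prems sumcork_add.hyps by blast
  obtain \<psi> where \<psi>: "homto X Y y \<psi>" "rmap Y \<alpha> * \<psi> y = u * k"
    using sumcork_add.IH(4)[OF sumcork_add.prems] by blast
  note c = is_repD[OF Y sumcork_add.prems(1)] rk_carrier[OF v(1)] corkD(1)[OF sumcork_add.IH(1)] sumcork_carrier[OF sumcork_add.IH(3)]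
  have "\<psi> y \<in> carrier_mat (rdim Y y) (rdim X y)" using \<psi> y by (auto simp: homto_def)
  then have "rmap Y \<alpha> * (\<phi> y + \<psi> y) = u * (h + k)"
    using c \<psi>(2) v(2) sumcork_add.prems(2) unfolding \<phi>(2) by (simp add: mat_distrib_left mat_assoc)
  then show ?case using homto_add[OF X Y \<phi>(1) \<psi>(1)] by (intro exI[of _ "\<lambda>y. \<phi> y + \<psi> y"]) auto
qed

text \<open>The one open square, at the arrow leaving \<open>x\<close>, commutes because its target
  space at the head is zero.\<close>

lemma homto_rep_hom:
  assumes X: "is_rep Q X" and Y: "is_rep Q Y" and h: "homto X Y x \<phi>" and x: "x \<in> verts Q"
    and out: "\<And>a. a \<in> arcs Q \<Longrightarrow> tail Q a = x \<Longrightarrow> rdim Y (head Q a) = 0"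
  shows "rep_hom Q X Y \<phi>"
  unfolding rep_hom_def
proof (intro conjI ballI)
  fix a assume a: "a \<in> arcs Q"
  show "\<phi> (head Q a) * rmap X a = rmap Y a * \<phi> (tail Q a)"
  proof (cases "tail Q a = x")
    case True
    have "\<phi> (head Q a) \<in> carrier_mat (rdim Y (head Q a)) (rdim X (head Q a))"
      using h head_in_verts[OF a] by (auto simp: homto_def)
    moreover have "\<phi> x \<in> carrier_mat (rdim Y x) (rdim X x)" using h x by (auto simp: homto_def)
    ultimately show ?thesis using out[OF a True] is_repD[OF X a] is_repD[OF Y a] True by (intro eq_matI) auto
  qed (use h a in \<open>auto simp: homto_def\<close>)
qed (use h in \<open>auto simp: homto_def\<close>)

lemma cork_rk_hom:
  assumes X: "is_rep Q X" and Y: "is_rep Q Y" and x: "x \<in> verts Q" and M: "lat_at Q x M"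
    and g: "cork Q X x M g" and u: "rk Q Y x M u"
    and out: "\<And>a. a \<in> arcs Q \<Longrightarrow> tail Q a = x \<Longrightarrow> rdim Y (head Q a) = 0"
  shows "\<exists>\<phi>. rep_hom Q X Y \<phi> \<and> \<phi> x = u * g"
  using cork_rk_homto(1)[OF X Y g x M u] homto_rep_hom[OF X Y _ x out] by blast

end

section \<open>Lifting product functionals\<close>

lemma lat_le_refl: "lat_le M M"
  by (simp add: lat_le_def)

lemma lat_le_trans: "lat_le M N \<Longrightarrow> lat_le N P \<Longrightarrow> lat_le M P"
  unfolding lat_le_def by (metis order_trans)

lemma lat_le_antisym:
  assumes "lat_le M N" "lat_le N M"
  shows "M = N"
proof -
  have "component M = component N" using assms unfolding lat_le_def by (intro ext) (metis order_antisym)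
  then show ?thesis by (rule lat_elem.expand)
qed

context rtree
begin

lemma L_component:
  assumes "x \<in> verts Q" "M \<in> L x"
  shows "\<alpha> \<in> in_arcs Q x \<Longrightarrow> fset (component M \<alpha>) \<in> order_ideals lat_le (L (tail Q \<alpha>))"
    "\<alpha> \<notin> in_arcs Q x \<Longrightarrow> component M \<alpha> = {||}"
proof -
  obtain m where m: "M = Fam m" "\<forall>\<alpha>. if \<alpha> \<in> in_arcs Q x
      then fset (m \<alpha>) \<in> order_ideals lat_le (L (tail Q \<alpha>)) else m \<alpha> = {||}"
    using assms L_rec by blast
  show "\<alpha> \<in> in_arcs Q x \<Longrightarrow> fset (component M \<alpha>) \<in> order_ideals lat_le (L (tail Q \<alpha>))"
    "\<alpha> \<notin> in_arcs Q x \<Longrightarrow> component M \<alpha> = {||}" using m(2)[rule_format, of \<alpha>] by (simp_all add: m(1))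
qed

lemma L_component_mem:
  assumes "x \<in> verts Q" "M \<in> L x" "S |\<in>| component M \<alpha>"
  shows "\<alpha> \<in> in_arcs Q x" "S \<in> L (tail Q \<alpha>)" "tail Q \<alpha> \<in> verts Q"
proof -
  show a: "\<alpha> \<in> in_arcs Q x" using L_component(2)[OF assms(1,2), of \<alpha>] assms(3) by auto
  show "S \<in> L (tail Q \<alpha>)" using L_component(1)[OF assms(1,2) a] assms(3) by (auto simp: order_ideals_def)
  show "tail Q \<alpha> \<in> verts Q" using in_arcsD[OF a] by simp
qed

lemma L_intro:
  assumes "x \<in> verts Q" "\<And>\<alpha>. \<alpha> \<in> in_arcs Q x \<Longrightarrow> fset (component M \<alpha>) \<in> order_ideals lat_le (L (tail Q \<alpha>))"
    "\<And>\<alpha>. \<alpha> \<notin> in_arcs Q x \<Longrightarrow> component M \<alpha> = {||}"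
  shows "M \<in> L x"
  unfolding L_rec[OF assms(1)] using assms(2,3) by (intro CollectI exI[of _ "component M"]) auto

lemma L_lat_at: "x \<in> verts Q \<Longrightarrow> M \<in> L x \<Longrightarrow> lat_at Q x M"
proof (induction x arbitrary: M rule: vertex_induct)
  case (step x)
  show ?case
  proof (rule lat_atI)
    fix \<alpha> S assume "S |\<in>| component M \<alpha>"
    note a = L_component_mem[OF step.prems this]
    show "\<alpha> \<in> in_arcs Q x" by (rule a(1))
    show "lat_at Q (tail Q \<alpha>) S" by (rule step.IH[OF a(1,3,2)])
  qed
qed

lemma finite_in_arcs: "finite (in_arcs Q x)"
  by (rule finite_subset[OF _ fin_arcs]) (auto simp: in_arcs_def)

lemma L_finite: "x \<in> verts Q \<Longrightarrow> finite (L x)"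
proof (induction x rule: vertex_induct)
  case (step x)
  let ?f = "\<lambda>M. \<lambda>\<alpha> \<in> in_arcs Q x. fset (component M \<alpha>)"
  have "?f ` L x \<subseteq> (\<Pi>\<^sub>E \<alpha> \<in> in_arcs Q x. Pow (L (tail Q \<alpha>)))"
  proof (rule image_subsetI, rule restrict_PiE_iff[THEN iffD2], rule ballI)
    fix M \<alpha> assume "M \<in> L x" "\<alpha> \<in> in_arcs Q x"
    then show "fset (component M \<alpha>) \<in> Pow (L (tail Q \<alpha>))"
      using L_component(1)[OF step.prems] unfolding order_ideals_def by blast
  qed
  moreover have "finite (\<Pi>\<^sub>E \<alpha> \<in> in_arcs Q x. Pow (L (tail Q \<alpha>)))"
  proof (rule finite_PiE[OF finite_in_arcs])
    fix \<alpha> assume a: "\<alpha> \<in> in_arcs Q x"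
    have "finite (L (tail Q \<alpha>))" by (rule step.IH[OF a]) (use in_arcsD[OF a] in blast)
    then show "finite (Pow (L (tail Q \<alpha>)))" by simp
  qed
  ultimately have "finite (?f ` L x)" by (rule finite_subset)
  moreover have "inj_on ?f (L x)"
  proof (rule inj_onI)
    fix M N assume MN: "M \<in> L x" "N \<in> L x" and e: "?f M = ?f N"
    have "component M \<alpha> = component N \<alpha>" for \<alpha>
    proof (cases "\<alpha> \<in> in_arcs Q x")
      case True
      then show ?thesis using fun_cong[OF e, of \<alpha>] by (simp add: fset_inject)
    next
      case False
      then show ?thesis using L_component(2)[OF step.prems] MN by simp
    qed
    then show "M = N" by (intro lat_elem.expand ext)
  qed
  ultimately show ?case by (rule finite_imageD)
qed

lemma L_bot: "x \<in> verts Q \<Longrightarrow> Fam (\<lambda>_. {||}) \<in> L x"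
  by (rule L_intro) (auto simp: order_ideals_def)

lemma L_join:
  assumes x: "x \<in> verts Q" and M: "M \<in> L x" "N \<in> L x"
  shows "lat_join M N \<in> L x"
proof (rule L_intro[OF x])
  fix \<alpha> assume a: "\<alpha> \<in> in_arcs Q x"
  show "fset (component (lat_join M N) \<alpha>) \<in> order_ideals lat_le (L (tail Q \<alpha>))"
    using L_component(1)[OF x M(1) a] L_component(1)[OF x M(2) a] by (auto simp: lat_join_def order_ideals_def)
next
  fix \<alpha> assume a: "\<alpha> \<notin> in_arcs Q x"
  show "component (lat_join M N) \<alpha> = {||}"
    using L_component(2)[OF x M(1) a] L_component(2)[OF x M(2) a] by (simp add: lat_join_def)
qed

text \<open>The components are finite sets by type, so finiteness of the lattices is needed to turn
  order ideals into components.\<close>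

lemma L_family:
  assumes x: "x \<in> verts Q" and I: "\<And>\<alpha>. \<alpha> \<in> in_arcs Q x \<Longrightarrow> I \<alpha> \<in> order_ideals lat_le (L (tail Q \<alpha>))"
  obtains M where "M \<in> L x" "\<And>\<alpha>. \<alpha> \<in> in_arcs Q x \<Longrightarrow> fset (component M \<alpha>) = I \<alpha>"
proof -
  let ?M = "Fam (\<lambda>\<alpha>. if \<alpha> \<in> in_arcs Q x then Abs_fset (I \<alpha>) else {||})"
  have f: "fset (component ?M \<alpha>) = I \<alpha>" if a: "\<alpha> \<in> in_arcs Q x" for \<alpha>
  proof -
    have "I \<alpha> \<subseteq> L (tail Q \<alpha>)" using I[OF a] unfolding order_ideals_def by blast
    moreover have "finite (L (tail Q \<alpha>))" using L_finite in_arcsD[OF a] by blast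
    ultimately have "finite (I \<alpha>)" by (rule finite_subset)
    then show ?thesis using a by (simp add: Abs_fset_inverse)
  qed
  have "?M \<in> L x"
  proof (rule L_intro[OF x])
    fix \<alpha> assume "\<alpha> \<in> in_arcs Q x"
    then show "fset (component ?M \<alpha>) \<in> order_ideals lat_le (L (tail Q \<alpha>))" using I f by metis
  qed auto
  then show ?thesis using that f by blast
qed

end

section \<open>Tensor products of lists of factors\<close>

definition tensors :: "('a, 'b, 'k :: field) rep list \<Rightarrow> ('a, 'b, 'k) rep" where
  "tensors Vs = foldr tensor_rep Vs unit_rep"

definition krons :: "'k :: field mat list \<Rightarrow> 'k mat" where
  "krons gs = foldr kronecker gs (1\<^sub>m 1)"

lemma tensors_simps [simp]: "tensors [] = unit_rep" "tensors (V # Vs) = tensor_rep V (tensors Vs)"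
  by (simp_all add: tensors_def)

lemma krons_simps [simp]: "krons [] = 1\<^sub>m 1" "krons (g # gs) = kronecker g (krons gs)"
  by (simp_all add: krons_def)

lemma rdim_tensors: "rdim (tensors Vs) x = prod_list (map (\<lambda>V. rdim V x) Vs)"
  by (induction Vs) (auto simp: unit_rep_def)

lemma krons_dim:
  "dim_row (krons gs) = prod_list (map dim_row gs)" "dim_col (krons gs) = prod_list (map dim_col gs)"
  by (induction gs) auto

lemma krons_mult:
  "list_all2 (\<lambda>A B. dim_col A = dim_row B) As Bs \<Longrightarrow> krons As * krons Bs = krons (map2 (*) As Bs)"
proof (induction rule: list_all2_induct)
  case Nil
  then show ?case by (simp add: mat_one_left)
next
  case (Cons A As B Bs)
  have "map dim_col As = map dim_row Bs" using Cons(2) by (induction rule: list_all2_induct) auto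
  then show ?case using Cons by (simp add: kronecker_mult krons_dim)
qed

lemma rmap_tensors: "rmap (tensors Vs) a = krons (map (\<lambda>V. rmap V a) Vs)"
  by (induction Vs) (auto simp: unit_rep_def)

lemma mat_sums_carrier:
  assumes "g \<in> mat_sums n m G" "G \<subseteq> carrier_mat n m"
  shows "g \<in> carrier_mat n m"
  using assms(1)
proof (induction rule: mat_sums.induct)
  case (add g h)
  then show ?case using assms(2) by (intro add_carrier_mat) auto
qed simp

lemma krons_carrier: "list_all2 (\<lambda>g n. g \<in> carrier_mat 1 n) gs ns \<Longrightarrow> krons gs \<in> carrier_mat 1 (prod_list ns)"
proof (induction rule: list_all2_induct)
  case (Cons g gs n ns)
  then show ?case using kronecker_carrier[of g 1 n "krons gs" 1] by simp
qed simp

text \<open>Multilinear expansion: to place a product of sums into a set closed under addition, it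
  is enough to place the products of generators.\<close>

lemma krons_expand:
  assumes "list_all2 (\<lambda>g (n, G). g \<in> mat_sums 1 n G) gs nGs" "\<And>n G. (n, G) \<in> set nGs \<Longrightarrow> G \<subseteq> carrier_mat 1 n"
    "\<And>g h. g \<in> T \<Longrightarrow> h \<in> T \<Longrightarrow> g + h \<in> T" "0\<^sub>m 1 (prod_list (map fst nGs)) \<in> T"
    "\<And>hs. list_all2 (\<lambda>h (n, G). h \<in> G) hs nGs \<Longrightarrow> krons hs \<in> T"
  shows "krons gs \<in> T"
  using assms
proof (induction nGs arbitrary: gs T rule: list.induct)
  case (Nil gs T)
  show ?case by (rule Nil.prems(5)) (use Nil.prems(1) in simp)
next
  case (Cons nG nGs gs T)
  obtain n G where nG: "nG = (n, G)" by (cases nG)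
  obtain g gs' where gs: "gs = g # gs'" "g \<in> mat_sums 1 n G" "list_all2 (\<lambda>g (n, G). g \<in> mat_sums 1 n G) gs' nGs"
    using Cons.prems(1) by (auto simp: nG list_all2_Cons2)
  let ?N = "prod_list (map fst nGs)"
  have Gc: "G \<subseteq> carrier_mat 1 n" using Cons.prems(2) by (auto simp: nG)
  have kc: "krons gs' \<in> carrier_mat 1 ?N"
  proof (rule krons_carrier)
    show "list_all2 (\<lambda>g n. g \<in> carrier_mat 1 n) gs' (map fst nGs)"
      unfolding list_all2_map2 using gs(3)
    proof (rule list.rel_mono_strong)
      fix g p assume "p \<in> set nGs" "case p of (n, G) \<Rightarrow> g \<in> mat_sums 1 n G"
      then show "g \<in> carrier_mat 1 (fst p)"
        using Cons.prems(2)[of "fst p" "snd p"] mat_sums_carrier[of g 1 "fst p" "snd p"] by (simp add: split_def)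
    qed
  qed
  have h: "kronecker h (krons gs') \<in> T" if h: "h \<in> G" for h
  proof -
    have hc: "h \<in> carrier_mat 1 n" using h Gc by auto
    \<comment> \<open>With the first factor fixed to a generator \<open>h\<close>, the remaining
      factors are expanded inside the functionals whose product with \<open>h\<close> lies in
      \<open>T\<close>; this set is again closed under addition.\<close>
    let ?T = "{k \<in> carrier_mat 1 ?N. kronecker h k \<in> T}"
    have "krons gs' \<in> ?T"
    proof (rule Cons.IH[OF gs(3)])
      show "\<And>n G. (n, G) \<in> set nGs \<Longrightarrow> G \<subseteq> carrier_mat 1 n" using Cons.prems(2) by auto
      show "g + k \<in> ?T" if "g \<in> ?T" "k \<in> ?T" for g k
        using that Cons.prems(3)[of "kronecker h g" "kronecker h k"] by (auto simp: kronecker_add_right)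
      show "0\<^sub>m 1 ?N \<in> ?T" using Cons.prems(4) hc by (auto simp: kronecker_zero_right nG)
      fix hs assume hs: "list_all2 (\<lambda>h (n, G). h \<in> G) hs nGs"
      have "krons hs \<in> carrier_mat 1 ?N"
      proof (rule krons_carrier)
        show "list_all2 (\<lambda>g n. g \<in> carrier_mat 1 n) hs (map fst nGs)"
          unfolding list_all2_map2 using hs
        proof (rule list.rel_mono_strong)
          fix g p assume "p \<in> set nGs" "case p of (n, G) \<Rightarrow> g \<in> G"
          then show "g \<in> carrier_mat 1 (fst p)"
            using Cons.prems(2)[of "fst p" "snd p"] by (auto simp: split_def)
        qed
      qed
      moreover have "kronecker h (krons hs) \<in> T"
        using Cons.prems(5)[of "h # hs"] h hs by (simp add: nG)
      ultimately show "krons hs \<in> ?T" by simp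
    qed
    then show ?thesis by simp
  qed
  have "kronecker g (krons gs') \<in> T" using gs(2)
  proof (induction rule: mat_sums.induct)
    case zero
    then show ?case using Cons.prems(4) kc by (simp add: kronecker_zero_left nG)
  next
    case (add g k)
    have "kronecker (g + k) (krons gs') = kronecker g (krons gs') + kronecker k (krons gs')"
      by (rule kronecker_add_left) (use mat_sums_carrier[OF add(2) Gc] Gc add(1) in auto)
    then show ?case using Cons.prems(3)[OF h[OF add(1)] add.IH] by simp
  qed
  then show ?case by (simp add: gs(1))
qed

section \<open>The pigeonhole argument\<close>

context rtree
begin

text \<open>
  A slot \<open>(V, g, l)\<close> is a functional \<open>g\<close> on \<open>V\<close> at \<open>x\<close>, together with a lattice element \<open>l\<close> (if any)
  whose rank space \<open>g\<close> annihilates.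
\<close>

definition slot :: "'a \<Rightarrow> ('a, 'b, 'k::field) rep \<times> 'k mat \<times> 'b lat_elem option \<Rightarrow> bool" where
  "slot x t \<longleftrightarrow> (case t of (V, g, l) \<Rightarrow> is_rep Q V \<and> g \<in> carrier_mat 1 (rdim V x) \<and>
    (\<forall>S. l = Some S \<longrightarrow> S \<in> L x \<and> (\<forall>u. rk Q V x S u \<longrightarrow> g * u = 0\<^sub>m 1 1)))"

text \<open>The rank space of \<open>S0\<close> is an intersection of images along arrows. A
  refinement replaces \<open>g\<close> by a functional that kills one single image, and the tag
  \<open>(\<alpha>, S)\<close> records which one; slots without a label stay without one.\<close>

definition refines :: "'a \<Rightarrow> ('a, 'b, 'k::field) rep \<times> 'k mat \<times> 'b lat_elem option \<Rightarrow>
    ('a, 'b, 'k) rep \<times> 'k mat \<times> ('b \<times> 'b lat_elem) option \<Rightarrow> bool" where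
  "refines x t e \<longleftrightarrow> (case (t, e) of ((V, g, l), (V', g', c)) \<Rightarrow> V' = V \<and> g' \<in> carrier_mat 1 (rdim V x) \<and>
    (case l of None \<Rightarrow> c = None | Some S0 \<Rightarrow> \<exists>\<alpha> S. c = Some (\<alpha>, S) \<and> S |\<in>| component S0 \<alpha> \<and>
      (\<forall>v. rk Q V (tail Q \<alpha>) S v \<longrightarrow> g' * (rmap V \<alpha> * v) = 0\<^sub>m 1 1)))"

text \<open>\<open>annihilator_Inter\<close> applied to the intersection of images that defines the
  rank space of \<open>S0\<close>.\<close>

lemma slot_refine:
  assumes x: "x \<in> verts Q" and s: "slot x (V, g, l)"
  shows "g \<in> mat_sums 1 (rdim V x) {g'. \<exists>c. refines x (V, g, l) (V, g', c)}"
proof (cases l)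
  case None
  have g: "g \<in> carrier_mat 1 (rdim V x)" using s by (simp add: slot_def)
  have "refines x (V, g, l) (V, g, None)" using g by (simp add: refines_def None)
  then have "g + 0\<^sub>m 1 (rdim V x) \<in> mat_sums 1 (rdim V x) {g'. \<exists>c. refines x (V, g, l) (V, g', c)}"
    by (intro mat_sums.intros) blast
  then show ?thesis using g by (simp add: mat_add_zero_right)
next
  case (Some S0)
  have V: "is_rep Q V" and g: "g \<in> carrier_mat 1 (rdim V x)" and S0: "S0 \<in> L x"
    and kill: "\<And>u. rk Q V x S0 u \<Longrightarrow> g * u = 0\<^sub>m 1 1" using s by (auto simp: slot_def Some)
  let ?J = "{(\<alpha>, S). S |\<in>| component S0 \<alpha>}"
  let ?A = "\<lambda>p. (\<lambda>v. rmap V (fst p) * v) ` {v. rk Q V (tail Q (fst p)) (snd p) v}"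
  have "g \<in> mat_sums 1 (rdim V x) (\<Union>p\<in>?J. {h \<in> carrier_mat 1 (rdim V x). \<forall>u \<in> ?A p. h * u = 0\<^sub>m 1 1})"
  proof (rule annihilator_Inter[OF _ _ g])
    have "?J \<subseteq> Sigma (in_arcs Q x) (\<lambda>\<alpha>. fset (component S0 \<alpha>))"
      using L_component_mem(1)[OF x S0] by auto
    then show "finite ?J" using finite_in_arcs by (rule finite_subset[OF _ finite_SigmaI]) auto
    fix p assume "p \<in> ?J"
    then have S: "snd p |\<in>| component S0 (fst p)" by auto
    note m = L_component_mem[OF x S0 S]
    have "mat_subspace (rdim V (head Q (fst p))) (?A p)"
      by (rule mat_subspace_image[OF is_repD[OF V] rk_subspace[OF V L_lat_at[OF m(3,2)]]]) (use in_arcsD[OF m(1)] in simp)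
    then show "mat_subspace (rdim V x) (?A p)" using in_arcsD[OF m(1)] by simp
  next
    fix u assume u: "u \<in> carrier_mat (rdim V x) 1" "\<And>p. p \<in> ?J \<Longrightarrow> u \<in> ?A p"
    show "g * u = 0\<^sub>m 1 1"
    proof (rule kill[OF rkI[OF u(1)]], intro allI impI)
      fix \<alpha> S assume "S |\<in>| component S0 \<alpha>"
      then have "u \<in> ?A (\<alpha>, S)" by (intro u(2)) simp
      then show "\<exists>v. rk Q V (tail Q \<alpha>) S v \<and> u = rmap V \<alpha> * v" by auto
    qed
  qed
  then show ?thesis
  proof (rule mat_sums_mono, safe)
    fix \<alpha> S h assume "S |\<in>| component S0 \<alpha>" "h \<in> carrier_mat 1 (rdim V x)" "\<forall>u\<in>?A (\<alpha>, S). h * u = 0\<^sub>m 1 1"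
    then have "refines x (V, g, l) (V, h, Some (\<alpha>, S))" by (auto simp: refines_def Some)
    then show "\<exists>c. refines x (V, g, l) (V, h, c)" by blast
  qed
qed

text \<open>In this case a functional that kills the rank space of \<open>S0\<close> also kills that
  of \<open>S\<close>, since rank spaces are antitone.\<close>

definition hits :: "'b lat_elem \<Rightarrow> 'b lat_elem option \<Rightarrow> bool" where
  "hits S l \<longleftrightarrow> (\<exists>S0. l = Some S0 \<and> lat_le S0 S)"

text \<open>If enough slots kill each \<open>S\<close> outside the ideal \<open>A\<close>, then the
  product functional is a sum of corank functionals for elements of \<open>A\<close> alone. The
  bound \<open>N\<close> depends neither on the representations nor on the number of slots.\<close>

definition lift_bound :: "'k::field itself \<Rightarrow> 'a \<Rightarrow> nat \<Rightarrow> bool" where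
  "lift_bound K x N \<longleftrightarrow> (\<forall>(ts :: (('a, 'b, 'k) rep \<times> 'k mat \<times> 'b lat_elem option) list) A.
    list_all (slot x) ts \<longrightarrow> A \<in> order_ideals lat_le (L x) \<longrightarrow>
    (\<forall>S \<in> L x - A. N \<le> length (filter (\<lambda>t. hits S (snd (snd t))) ts)) \<longrightarrow>
    sumcork Q (tensors (map fst ts)) x A (krons (map (fst \<circ> snd) ts)))"

lemma is_rep_tensors: "list_all (is_rep Q) Vs \<Longrightarrow> is_rep Q (tensors Vs)"
  by (induction Vs) (auto simp: is_rep_unit is_rep_tensor)

text \<open>
  The pigeonhole step: each slot is refined to a functional that annihilates the image of one rank
  space of one branch; a branch element \<open>S\<close> is put into the family \<open>P\<close> if few refined slots lie
  below it.  If \<open>P\<close> were outside \<open>A\<close>, too many slots would be refined to elements of \<open>P\<close>.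
\<close>

lemma lift_refined:
  fixes ts :: "(('a, 'b, 'k::field) rep \<times> 'k mat \<times> 'b lat_elem option) list"
  assumes x: "x \<in> verts Q" and N': "\<And>\<alpha>. \<alpha> \<in> in_arcs Q x \<Longrightarrow> lift_bound TYPE('k) (tail Q \<alpha>) (N' \<alpha>)"
    and ts: "list_all (slot x) ts" and A: "A \<in> order_ideals lat_le (L x)"
    and count: "\<And>S. S \<in> L x - A \<Longrightarrow> (\<Sum>\<alpha>\<in>in_arcs Q x. card (L (tail Q \<alpha>)) * N' \<alpha>) < length (filter (\<lambda>t. hits S (snd (snd t))) ts)"
    and es: "list_all2 (refines x) ts es"
  shows "sumcork Q (tensors (map fst ts)) x A (krons (map (fst \<circ> snd) es))"
proof -
  have len: "length es = length ts" using es by (simp add: list_all2_lengthD)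
  have ref: "refines x (ts ! i) (es ! i)" if "i < length ts" for i using es that by (simp add: list_all2_nthD)
  have sl: "slot x (ts ! i)" if "i < length ts" for i using ts that by (simp add: list_all_length)
  have Vs: "map fst es = map fst ts"
    using es by (induction rule: list_all2_induct) (auto simp: refines_def split: prod.splits)
  \<comment> \<open>After restriction along \<open>\<alpha>\<close>, only the slots refined at this
    very arrow still kill a known rank space at its tail; all others lose their label.\<close>
  define part where "part \<alpha> c = (case c of Some (\<beta>, S) \<Rightarrow> if \<beta> = \<alpha> then Some S else None | None \<Rightarrow> None)"
    for \<alpha> and c :: "('b \<times> 'b lat_elem) option"
  define cnt where "cnt \<alpha> S = length (filter (\<lambda>e. hits S (part \<alpha> (snd (snd e)))) es)" for \<alpha> S
  define I where "I \<alpha> = {S \<in> L (tail Q \<alpha>). cnt \<alpha> S < N' \<alpha>}" for \<alpha>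
  have cnt_mono: "cnt \<alpha> T \<le> cnt \<alpha> S" if "lat_le T S" for \<alpha> S T
    unfolding cnt_def length_filter_conv_card
    by (rule card_mono) (use lat_le_trans[OF _ that] in \<open>auto simp: hits_def\<close>)
  have I: "I \<alpha> \<in> order_ideals lat_le (L (tail Q \<alpha>))" for \<alpha>
    unfolding order_ideals_def
  proof (intro CollectI conjI ballI impI)
    show "I \<alpha> \<subseteq> L (tail Q \<alpha>)" by (auto simp: I_def)
    fix S T assume "S \<in> I \<alpha>" "T \<in> L (tail Q \<alpha>)" "lat_le T S"
    then show "T \<in> I \<alpha>" using cnt_mono[of T S \<alpha>] by (simp add: I_def)
  qed
  obtain P where P: "P \<in> L x" "\<And>\<alpha>. \<alpha> \<in> in_arcs Q x \<Longrightarrow> fset (component P \<alpha>) = I \<alpha>"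
    using L_family[OF x I] by blast
  have "P \<in> A"
  proof (rule ccontr)
    assume "P \<notin> A"
    let ?H = "{i. i < length ts \<and> hits P (snd (snd (ts ! i)))}"
    let ?pairs = "Sigma (in_arcs Q x) I"
    have c: "(\<Sum>\<alpha>\<in>in_arcs Q x. card (L (tail Q \<alpha>)) * N' \<alpha>) < card ?H"
      using count[of P] P(1) \<open>P \<notin> A\<close> by (simp add: length_filter_conv_card)
    have fI: "finite (I \<alpha>)" "card (I \<alpha>) \<le> card (L (tail Q \<alpha>))" if "\<alpha> \<in> in_arcs Q x" for \<alpha>
    proof -
      have f: "finite (L (tail Q \<alpha>))" using L_finite in_arcsD[OF that] by blast
      show "finite (I \<alpha>)" "card (I \<alpha>) \<le> card (L (tail Q \<alpha>))"
        using f by (auto simp: I_def intro: card_mono)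
    qed
    have fp: "finite ?pairs" using finite_in_arcs fI by (intro finite_SigmaI) auto
    \<comment> \<open>A slot that hits \<open>P\<close> is refined to some
      \<open>(\<alpha>, S)\<close> with \<open>S\<close> in the component of \<open>P\<close> at
      \<open>\<alpha>\<close>, that is, in \<open>I \<alpha>\<close>. By the choice of
      \<open>I\<close>, each such tag occurs fewer than \<open>N' \<alpha>\<close> times, so too few
      slots can hit \<open>P\<close>.\<close>
    have "?H \<subseteq> (\<Union>p\<in>?pairs. {i. i < length es \<and> snd (snd (es ! i)) = Some p})"
    proof
      fix i assume i: "i \<in> ?H"
      then obtain S0 where S0: "snd (snd (ts ! i)) = Some S0" "lat_le S0 P" by (auto simp: hits_def)
      then obtain \<alpha> S where S: "snd (snd (es ! i)) = Some (\<alpha>, S)" "S |\<in>| component S0 \<alpha>"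
        using ref[of i] i by (auto simp: refines_def split: prod.splits)
      have SP: "S |\<in>| component P \<alpha>" using S(2) S0(2) unfolding lat_le_def by (metis fsubsetD)
      have a: "\<alpha> \<in> in_arcs Q x" by (rule L_component_mem(1)[OF x P(1) SP])
      have "S \<in> I \<alpha>" using SP P(2)[OF a] by auto
      then show "i \<in> (\<Union>p\<in>?pairs. {i. i < length es \<and> snd (snd (es ! i)) = Some p})"
        using i S(1) a len by auto
    qed
    then have "card ?H \<le> card (\<Union>p\<in>?pairs. {i. i < length es \<and> snd (snd (es ! i)) = Some p})"
      using fp by (intro card_mono) auto
    also have "\<dots> \<le> (\<Sum>p\<in>?pairs. card {i. i < length es \<and> snd (snd (es ! i)) = Some p})"
      by (rule card_UN_le[OF fp])
    also have "\<dots> \<le> (\<Sum>p\<in>?pairs. N' (fst p))"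
    proof (rule sum_mono)
      fix p assume p: "p \<in> ?pairs"
      have "card {i. i < length es \<and> snd (snd (es ! i)) = Some p} \<le> cnt (fst p) (snd p)"
        unfolding cnt_def length_filter_conv_card
        by (rule card_mono) (auto simp: hits_def part_def lat_le_refl split: prod.splits)
      then show "card {i. i < length es \<and> snd (snd (es ! i)) = Some p} \<le> N' (fst p)"
        using p by (auto simp: I_def)
    qed
    also have "\<dots> = (\<Sum>\<alpha>\<in>in_arcs Q x. \<Sum>S\<in>I \<alpha>. N' \<alpha>)"
      using finite_in_arcs fI(1) by (subst sum.Sigma) (auto simp: split_def)
    also have "\<dots> \<le> (\<Sum>\<alpha>\<in>in_arcs Q x. card (L (tail Q \<alpha>)) * N' \<alpha>)"
      using fI(2) by (intro sum_mono) simp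
    finally show False using c by simp
  qed
  \<comment> \<open>Restriction along \<open>\<alpha>\<close> acts on each factor separately and
    yields slots at the tail. Every \<open>S\<close> outside \<open>I \<alpha>\<close> is hit at
    least \<open>N' \<alpha>\<close> times there, so the bound at the tail applies with the ideal
    \<open>I \<alpha>\<close>, which is the component of \<open>P\<close>.\<close>
  moreover have "cork Q (tensors (map fst ts)) x P (krons (map (fst \<circ> snd) es))"
  proof (rule corkI)
    have el: "list_all (\<lambda>e. is_rep Q (fst e) \<and> fst (snd e) \<in> carrier_mat 1 (rdim (fst e) x)) es"
      unfolding list_all_length
    proof (intro allI impI)
      fix i assume "i < length es"
      then show "is_rep Q (fst (es ! i)) \<and> fst (snd (es ! i)) \<in> carrier_mat 1 (rdim (fst (es ! i)) x)"
        using ref[of i] sl[of i] len by (auto simp: refines_def slot_def split: prod.splits)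
    qed
    then have "krons (map (fst \<circ> snd) es) \<in> carrier_mat 1 (rdim (tensors (map fst es)) x)"
    proof (induction es)
      case (Cons e es)
      then show ?case using kronecker_carrier[of "fst (snd e)" 1 _ "krons (map (fst \<circ> snd) es)" 1]
        by (simp add: comp_def)
    qed (simp add: unit_rep_def)
    then show "krons (map (fst \<circ> snd) es) \<in> carrier_mat 1 (rdim (tensors (map fst ts)) x)" by (simp add: Vs)
    show "\<forall>\<alpha>\<in>in_arcs Q x. sumcork Q (tensors (map fst ts)) (tail Q \<alpha>) (fset (component P \<alpha>))
        (krons (map (fst \<circ> snd) es) * rmap (tensors (map fst ts)) \<alpha>)"
    proof
      fix \<alpha> assume a: "\<alpha> \<in> in_arcs Q x"
      note aa = in_arcsD[OF a]
      let ?ts = "map (\<lambda>e. (fst e, fst (snd e) * rmap (fst e) \<alpha>, part \<alpha> (snd (snd e)))) es"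
      have "krons (map (fst \<circ> snd) es) * rmap (tensors (map fst es)) \<alpha> =
          krons (map2 (*) (map (fst \<circ> snd) es) (map (\<lambda>e. rmap (fst e) \<alpha>) es))"
        unfolding rmap_tensors map_map comp_def
      proof (rule krons_mult)
        show "list_all2 (\<lambda>A B. dim_col A = dim_row B) (map (\<lambda>x. fst (snd x)) es) (map (\<lambda>e. rmap (fst e) \<alpha>) es)"
          using el
        proof (induction es)
          case (Cons e es)
          then have "fst (snd e) \<in> carrier_mat 1 (rdim (fst e) x)"
            "rmap (fst e) \<alpha> \<in> carrier_mat (rdim (fst e) x) (rdim (fst e) (tail Q \<alpha>))"
            using is_repD[of Q "fst e" \<alpha>] aa by auto
          then show ?case using Cons by auto
        qed simp
      qed
      also have "map2 (*) (map (fst \<circ> snd) es) (map (\<lambda>e. rmap (fst e) \<alpha>) es) = map (fst \<circ> snd) ?ts"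
        by (induction es) auto
      finally have e1: "krons (map (fst \<circ> snd) es) * rmap (tensors (map fst ts)) \<alpha> = krons (map (fst \<circ> snd) ?ts)"
        by (simp only: Vs)
      have e2: "map fst ?ts = map fst ts" using Vs by (simp add: comp_def)
      have "list_all (slot (tail Q \<alpha>)) ?ts"
        unfolding list_all_length
      proof (intro allI impI)
        fix i assume "i < length ?ts"
        then have i: "i < length ts" "i < length es" using len by auto
        obtain V g l where t: "ts ! i = (V, g, l)" by (cases "ts ! i")
        obtain V' g' c where e: "es ! i = (V', g', c)" by (cases "es ! i")
        have r: "V' = V" "g' \<in> carrier_mat 1 (rdim V x)" using ref[OF i(1)] t e by (auto simp: refines_def)
        have V: "is_rep Q V" using sl[OF i(1)] t by (simp add: slot_def)
        have rc: "rmap V \<alpha> \<in> carrier_mat (rdim V x) (rdim V (tail Q \<alpha>))" using is_repD[OF V, of \<alpha>] aa by simp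
        have "S \<in> L (tail Q \<alpha>) \<and> (\<forall>v. rk Q V (tail Q \<alpha>) S v \<longrightarrow> g' * rmap V \<alpha> * v = 0\<^sub>m 1 1)"
          if p: "part \<alpha> c = Some S" for S
        proof -
          have c: "c = Some (\<alpha>, S)" using p by (auto simp: part_def split: option.splits prod.splits if_splits)
          then obtain S0 where S0: "l = Some S0" "S |\<in>| component S0 \<alpha>"
            "\<And>v. rk Q V (tail Q \<alpha>) S v \<Longrightarrow> g' * (rmap V \<alpha> * v) = 0\<^sub>m 1 1"
            using ref[OF i(1)] t e by (auto simp: refines_def split: option.splits)
          have "S0 \<in> L x" using sl[OF i(1)] t S0(1) by (simp add: slot_def)
          then have "S \<in> L (tail Q \<alpha>)" by (rule L_component_mem(2)[OF x _ S0(2)])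
          moreover have "g' * rmap V \<alpha> * v = 0\<^sub>m 1 1" if v: "rk Q V (tail Q \<alpha>) S v" for v
            using S0(3)[OF v] r(2) rc rk_carrier[OF v] by (simp add: mat_assoc)
          ultimately show ?thesis by blast
        qed
        then have "slot (tail Q \<alpha>) (V, g' * rmap V \<alpha>, part \<alpha> c)"
          using V r(2) rc unfolding slot_def by auto
        then show "slot (tail Q \<alpha>) (?ts ! i)" using i e r(1) by simp
      qed
      moreover have "\<forall>S \<in> L (tail Q \<alpha>) - I \<alpha>. N' \<alpha> \<le> length (filter (\<lambda>t. hits S (snd (snd t))) ?ts)"
        by (auto simp: I_def cnt_def filter_map comp_def not_less)
      ultimately have "sumcork Q (tensors (map fst ?ts)) (tail Q \<alpha>) (I \<alpha>) (krons (map (fst \<circ> snd) ?ts))"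
        using N'[OF a] I unfolding lift_bound_def by blast
      then show "sumcork Q (tensors (map fst ts)) (tail Q \<alpha>) (fset (component P \<alpha>))
          (krons (map (fst \<circ> snd) es) * rmap (tensors (map fst ts)) \<alpha>)"
        unfolding e1 e2 P(2)[OF a] .
    qed
  qed
  ultimately show ?thesis by (rule sumcork_single)
qed

lemma lift_bound_exists: "x \<in> verts Q \<Longrightarrow> \<exists>N. lift_bound TYPE('k::field) x N"
proof (induction x rule: vertex_induct)
  case (step x)
  have "\<forall>\<alpha>. \<exists>N. \<alpha> \<in> in_arcs Q x \<longrightarrow> lift_bound TYPE('k) (tail Q \<alpha>) N"
  proof
    fix \<alpha> show "\<exists>N. \<alpha> \<in> in_arcs Q x \<longrightarrow> lift_bound TYPE('k) (tail Q \<alpha>) N"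
      using step.IH[of \<alpha>] in_arcsD[of \<alpha> x] by blast
  qed
  then obtain N' where N': "\<And>\<alpha>. \<alpha> \<in> in_arcs Q x \<Longrightarrow> lift_bound TYPE('k) (tail Q \<alpha>) (N' \<alpha>)" by metis
  \<comment> \<open>The sum bounds the number of slots whose refinement tag can lie in
    \<open>P\<close>; one more slot gives the contradiction.\<close>
  let ?N = "Suc (\<Sum>\<alpha>\<in>in_arcs Q x. card (L (tail Q \<alpha>)) * N' \<alpha>)"
  have "lift_bound TYPE('k) x ?N"
    unfolding lift_bound_def
  proof (intro allI impI)
    fix ts :: "(('a, 'b, 'k) rep \<times> 'k mat \<times> 'b lat_elem option) list" and A
    assume ts: "list_all (slot x) ts" and A: "A \<in> order_ideals lat_le (L x)"
      and count: "\<forall>S \<in> L x - A. ?N \<le> length (filter (\<lambda>t. hits S (snd (snd t))) ts)"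
    let ?W = "tensors (map fst ts)"
    let ?nG = "map (\<lambda>t. (rdim (fst t) x, {g'. \<exists>c. refines x t (fst t, g', c)})) ts"
    \<comment> \<open>Each slot is written as a sum of refinements, and \<open>krons_expand\<close>
      reduces the claim to one choice of refinement per slot.\<close>
    have "krons (map (fst \<circ> snd) ts) \<in> {k. sumcork Q ?W x A k}"
    proof (rule krons_expand[of _ ?nG])
      show "list_all2 (\<lambda>g (n, G). g \<in> mat_sums 1 n G) (map (fst \<circ> snd) ts) ?nG"
        using ts
      proof (induction ts)
        case (Cons t ts)
        obtain V g l where t: "t = (V, g, l)" by (cases t)
        show ?case using Cons slot_refine[OF step.prems, of V g l] by (simp add: t)
      qed simp
      show "\<And>n G. (n, G) \<in> set ?nG \<Longrightarrow> G \<subseteq> carrier_mat 1 n"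
        by (auto simp: refines_def split: prod.splits)
      show "\<And>g h. g \<in> {k. sumcork Q ?W x A k} \<Longrightarrow> h \<in> {k. sumcork Q ?W x A k} \<Longrightarrow> g + h \<in> {k. sumcork Q ?W x A k}"
        unfolding mem_Collect_eq by (rule sumcork_plus)
      have "rdim ?W x = prod_list (map fst ?nG)" by (simp add: rdim_tensors comp_def)
      then show "0\<^sub>m 1 (prod_list (map fst ?nG)) \<in> {k. sumcork Q ?W x A k}"
        using sumcork_zero[of Q ?W x A] by simp
      fix hs assume hs: "list_all2 (\<lambda>h (n, G). h \<in> G) hs ?nG"
      have "\<exists>es. list_all2 (refines x) ts es \<and> hs = map (fst \<circ> snd) es"
        using hs
      proof (induction ts arbitrary: hs rule: list.induct)
        case (Cons t ts)
        then obtain h hs' where h: "hs = h # hs'" "\<exists>c. refines x t (fst t, h, c)"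
          "list_all2 (\<lambda>h (n, G). h \<in> G) hs' (map (\<lambda>t. (rdim (fst t) x, {g'. \<exists>c. refines x t (fst t, g', c)})) ts)"
          by (auto simp: list_all2_Cons2)
        obtain c where c: "refines x t (fst t, h, c)" using h(2) by blast
        obtain es where es: "list_all2 (refines x) ts es" "hs' = map (fst \<circ> snd) es" using Cons.IH[OF h(3)] by blast
        show ?case by (rule exI[of _ "(fst t, h, c) # es"]) (use c es h(1) in simp)
      qed simp
      then obtain es where es: "list_all2 (refines x) ts es" "hs = map (fst \<circ> snd) es" by blast
      have "sumcork Q ?W x A (krons (map (fst \<circ> snd) es))"
      proof (rule lift_refined[OF step.prems N' ts A _ es(1)])
        fix S assume "S \<in> L x - A"
        from bspec[OF count this]
        show "(\<Sum>\<alpha>\<in>in_arcs Q x. card (L (tail Q \<alpha>)) * N' \<alpha>) < length (filter (\<lambda>t. hits S (snd (snd t))) ts)"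
          by (rule Suc_le_lessD)
      qed
      then show "krons hs \<in> {k. sumcork Q ?W x A k}" by (simp add: es(2))
    qed
    then show "sumcork Q ?W x A (krons (map (fst \<circ> snd) ts))" by simp
  qed
  then show ?case by blast
qed

end

section \<open>Detecting vectors in long tensor products\<close>

text \<open>Contracting the first factor with an arbitrary \<open>g\<close> leaves a vector of the
  remaining product, which is zero by induction; product functionals of two factors then separate
  points.\<close>

lemma krons_separate:
  fixes w :: "'k::field mat"
  assumes "w \<in> carrier_mat (prod_list ns) 1"
    "\<And>es. list_all2 (\<lambda>e n. e \<in> carrier_mat 1 n) es ns \<Longrightarrow> krons es * w = 0\<^sub>m 1 1"
  shows "w = 0\<^sub>m (prod_list ns) 1"
  using assms
proof (induction ns arbitrary: w rule: list.induct)
  case Nil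
  have "krons [] * w = 0\<^sub>m 1 1" by (rule Nil.prems(2)) simp
  then show ?case using Nil.prems(1) by (simp add: mat_one_left)
next
  case (Cons n ns)
  let ?N = "prod_list ns"
  have wc: "w \<in> carrier_mat (n * ?N) 1" using Cons.prems(1) by simp
  have "w = 0\<^sub>m (n * ?N) 1"
  proof (rule kronecker_vector_eqI[OF wc])
    fix g h :: "'k mat" assume g: "g \<in> carrier_mat 1 n" and h: "h \<in> carrier_mat 1 ?N"
    have vc: "kronecker g (1\<^sub>m ?N) * w \<in> carrier_mat ?N 1" using g wc by (auto intro!: carrier_matI)
    have sp: "kronecker g k * w = k * (kronecker g (1\<^sub>m ?N) * w)" if "k \<in> carrier_mat 1 ?N" for k
      using kronecker_split(2)[OF g that wc] unfolding kronecker_one_left .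
    have "kronecker g (1\<^sub>m ?N) * w = 0\<^sub>m ?N 1"
    proof (rule Cons.IH[OF vc])
      fix es :: "'k mat list" assume es: "list_all2 (\<lambda>e n. e \<in> carrier_mat 1 n) es ns"
      have "krons (g # es) * w = 0\<^sub>m 1 1" by (rule Cons.prems(2)) (use g es in simp)
      then show "krons es * (kronecker g (1\<^sub>m ?N) * w) = 0\<^sub>m 1 1"
        using sp[OF krons_carrier[OF es]] by simp
    qed
    then have "kronecker g h * w = 0\<^sub>m 1 1" using sp[OF h] h by (simp add: mat_zero_right)
    then show "kronecker g h * w = kronecker g h * 0\<^sub>m (n * ?N) 1" using g h by (simp add: mat_zero_right)
  qed simp
  then show ?case by simp
qed

lemma scale_to_one:
  fixes g u :: "'k::field mat"
  assumes "g \<in> carrier_mat 1 n" "u \<in> carrier_mat n 1" "g * u \<noteq> 0\<^sub>m 1 1"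
  shows "\<exists>c. g * (c \<cdot>\<^sub>m u) = 1\<^sub>m 1"
proof -
  have nz: "(g * u) $$ (0, 0) \<noteq> 0"
  proof
    assume "(g * u) $$ (0, 0) = 0"
    then have "g * u = 0\<^sub>m 1 1" using assms(1,2) by (intro eq_matI) (auto simp del: index_mult_mat(1))
    then show False using assms(3) by simp
  qed
  have "g * (inverse ((g * u) $$ (0, 0)) \<cdot>\<^sub>m u) = inverse ((g * u) $$ (0, 0)) \<cdot>\<^sub>m (g * u)"
    using assms(1,2) by (simp add: mat_smult_right)
  also have "\<dots> = 1\<^sub>m 1"
  proof (rule eq_matI)
    fix i j assume "i < dim_row (1\<^sub>m 1 :: 'k mat)" "j < dim_col (1\<^sub>m 1 :: 'k mat)"
    then have "i = 0" "j = 0" by auto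
    then show "(inverse ((g * u) $$ (0, 0)) \<cdot>\<^sub>m (g * u)) $$ (i, j) = 1\<^sub>m 1 $$ (i, j)"
      using nz assms(1,2) by (simp del: index_mult_mat(1))
  qed (use assms(1,2) in auto)
  finally show ?thesis by blast
qed

context rtree
begin

text \<open>The rank space of the product is the tensor product of the rank spaces, on which
  \<open>tensor_space_fixed\<close> applies factor by factor.\<close>

lemma rk_tensors_fixed:
  assumes "list_all2 (\<lambda>V P. is_rep Q V \<and> P \<in> carrier_mat (rdim V x) (rdim V x) \<and> (\<forall>u. rk Q V x M u \<longrightarrow> P * u = u)) Vs Ps"
    and M: "lat_at Q x M" and "rk Q (tensors Vs) x M u"
  shows "krons Ps * u = u"
  using assms(1,3)
proof (induction arbitrary: u rule: list_all2_induct)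
  case Nil
  have "u \<in> carrier_mat 1 1" using rk_carrier[OF Nil] by (simp add: unit_rep_def)
  then show ?case by (simp add: mat_one_left)
next
  case (Cons V Vs P Ps)
  have V: "is_rep Q V" and P: "P \<in> carrier_mat (rdim V x) (rdim V x)" "\<And>u. rk Q V x M u \<Longrightarrow> P * u = u"
    using Cons(1) by blast+
  have W: "list_all (is_rep Q) Vs"
    using Cons(2) by (induction rule: list_all2_induct) auto
  have "map dim_row Ps = map (\<lambda>V. rdim V x) Vs" "map dim_col Ps = map (\<lambda>V. rdim V x) Vs"
    using Cons(2) by (induction rule: list_all2_induct) auto
  then have Pc: "krons Ps \<in> carrier_mat (rdim (tensors Vs) x) (rdim (tensors Vs) x)"
    by (intro carrier_matI) (simp_all add: krons_dim rdim_tensors)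
  have u: "u \<in> tensor_space (rdim V x) (rdim (tensors Vs) x) {u. rk Q V x M u} {u. rk Q (tensors Vs) x M u}"
    using rk_tensor[OF V is_rep_tensors[OF W] M] Cons.prems by auto
  have "kronecker P (krons Ps) * u = u"
    by (rule tensor_space_fixed[OF u P(1) Pc]) (use P(2) Cons.IH in simp_all)
  then show ?case by simp
qed

lemma L_order_ideal_below: "{S \<in> L x. lat_le S M} \<in> order_ideals lat_le (L x)"
  unfolding order_ideals_def using lat_le_trans by blast

text \<open>Nondegeneracy, on the side of the rank space, of the pairing between \<open>rk\<close>
  and \<open>cork\<close>. It ensures that a nonzero rank at \<open>(x, M)\<close> produces a vector
  and a functional with value 1.\<close>

definition paired :: "'a \<Rightarrow> 'b lat_elem \<Rightarrow> ('a, 'b, 'k::field) rep \<Rightarrow> bool" where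
  "paired x M Y \<longleftrightarrow> (\<forall>u. rk Q Y x M u \<longrightarrow> u \<noteq> 0\<^sub>m (rdim Y x) 1 \<longrightarrow> (\<exists>g. cork Q Y x M g \<and> g * u \<noteq> 0\<^sub>m 1 1))"

text \<open>The number of factors is the number of labels, chosen so that each \<open>S\<close> not
  below \<open>M\<close> labels at least \<open>N\<close> of them. On a factor labelled
  \<open>S\<close>, a projection \<open>P i\<close> fixes the rank space of \<open>M\<close> and
  kills that of \<open>S\<close>. The product of the projections fixes \<open>u\<close>, so any
  product functional that is nonzero on \<open>u\<close> may be composed with them. The resulting
  slots satisfy the bound for the ideal of elements below \<open>M\<close>.\<close>

lemma tensors_paired:
  assumes x: "x \<in> verts Q" and M: "M \<in> L x"
  shows "\<exists>n. 0 < n \<and> (\<forall>Vs :: ('a, 'b, 'k::field) rep list. length Vs = n \<longrightarrow> list_all (is_rep Q) Vs \<longrightarrow>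
    (\<forall>V \<in> set Vs. \<forall>S \<in> L x. \<not> lat_le S M \<longrightarrow> (\<forall>u. rk Q V x S u \<longrightarrow> rk Q V x M u \<longrightarrow> u = 0\<^sub>m (rdim V x) 1)) \<longrightarrow>
    paired x M (tensors Vs))"
proof -
  obtain N where N: "lift_bound TYPE('k) x N" using lift_bound_exists[OF x] by blast
  obtain xs where xs: "set xs = L x" using finite_list[OF L_finite[OF x]] by blast
  define bl where "bl = map (\<lambda>S. if lat_le S M then None else Some S) xs"
  \<comment> \<open>The leading \<open>None\<close> keeps the number of factors positive even when
    no other labels arise.\<close>
  define labs where "labs = None # concat (replicate N bl)"
  have lab_mem: "S \<in> L x \<and> \<not> lat_le S M" if "Some S \<in> set labs" for S
  proof -
    have "Some S \<in> set bl" using that by (auto simp: labs_def split: if_splits)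
    then show ?thesis using xs by (auto simp: bl_def split: if_splits)
  qed
  have cnt: "N \<le> length (filter (hits S) labs)" if S: "S \<in> L x" "\<not> lat_le S M" for S
  proof -
    have "Some S \<in> set bl" using S xs unfolding bl_def by (auto intro!: image_eqI[of _ _ S])
    then have "filter (hits S) bl \<noteq> []" unfolding filter_empty_conv
      by (auto simp: hits_def intro!: bexI[of _ "Some S"] exI[of _ S] lat_le_refl)
    then have "1 \<le> length (filter (hits S) bl)" by (cases "filter (hits S) bl") auto
    then have "k \<le> length (filter (hits S) (concat (replicate k bl)))" for k
      by (induction k) auto
    then have "N \<le> length (filter (hits S) (concat (replicate N bl)))" .
    then show ?thesis unfolding labs_def by simp
  qed
  show ?thesis
  proof (intro exI[of _ "length labs"] conjI allI impI)
    show "0 < length labs" by (simp add: labs_def)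
    fix Vs :: "('a, 'b, 'k) rep list"
    assume len: "length Vs = length labs" and reps: "list_all (is_rep Q) Vs"
      and disj: "\<forall>V \<in> set Vs. \<forall>S \<in> L x. \<not> lat_le S M \<longrightarrow> (\<forall>u. rk Q V x S u \<longrightarrow> rk Q V x M u \<longrightarrow> u = 0\<^sub>m (rdim V x) 1)"
    let ?n = "length Vs"
    have repi: "is_rep Q (Vs ! i)" if "i < ?n" for i using reps that by (simp add: list_all_length)
    have "\<exists>P. P \<in> carrier_mat (rdim (Vs ! i) x) (rdim (Vs ! i) x) \<and> (\<forall>u. rk Q (Vs ! i) x M u \<longrightarrow> P * u = u) \<and>
        (\<forall>S. labs ! i = Some S \<longrightarrow> (\<forall>u. rk Q (Vs ! i) x S u \<longrightarrow> P * u = 0\<^sub>m (rdim (Vs ! i) x) 1))" if i: "i < ?n" for i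
    proof (cases "labs ! i")
      case None
      then show ?thesis by (intro exI[of _ "1\<^sub>m (rdim (Vs ! i) x)"]) (auto dest: rk_carrier simp: mat_one_left)
    next
      case (Some S)
      have "Some S \<in> set labs" using nth_mem[of i labs] Some i len by simp
      then have S: "S \<in> L x" "\<not> lat_le S M" using lab_mem by blast+
      have d: "{u. rk Q (Vs ! i) x M u} \<inter> {u. rk Q (Vs ! i) x S u} \<subseteq> {0\<^sub>m (rdim (Vs ! i) x) 1}"
        using disj[rule_format, OF nth_mem[OF i] S] by blast
      show ?thesis
        using separating_projection[OF rk_subspace[OF repi[OF i] L_lat_at[OF x M]] rk_subspace[OF repi[OF i] L_lat_at[OF x S(1)]] d] Some
        by auto
    qed
    then obtain P where P: "\<And>i. i < ?n \<Longrightarrow> P i \<in> carrier_mat (rdim (Vs ! i) x) (rdim (Vs ! i) x)"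
      "\<And>i u. i < ?n \<Longrightarrow> rk Q (Vs ! i) x M u \<Longrightarrow> P i * u = u"
      "\<And>i S u. i < ?n \<Longrightarrow> labs ! i = Some S \<Longrightarrow> rk Q (Vs ! i) x S u \<Longrightarrow> P i * u = 0\<^sub>m (rdim (Vs ! i) x) 1"
      by metis
    let ?Ps = "map P [0..<?n]"
    show "paired x M (tensors Vs)"
      unfolding paired_def
    proof (intro allI impI)
      fix u assume u: "rk Q (tensors Vs) x M u" and u0: "u \<noteq> 0\<^sub>m (rdim (tensors Vs) x) 1"
      note uc = rk_carrier[OF u]
      have fixed: "krons ?Ps * u = u"
        by (rule rk_tensors_fixed[OF _ L_lat_at[OF x M] u]) (use P repi in \<open>simp add: list_all2_conv_all_nth\<close>)
      let ?ns = "map (\<lambda>V. rdim V x) Vs"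
      have "\<exists>es. list_all2 (\<lambda>e n. e \<in> carrier_mat 1 n) es ?ns \<and> krons es * u \<noteq> 0\<^sub>m 1 1"
      proof (rule ccontr)
        assume n: "\<not> ?thesis"
        have "u = 0\<^sub>m (prod_list ?ns) 1"
          by (rule krons_separate) (use uc n in \<open>auto simp: rdim_tensors\<close>)
        then show False using u0 by (simp add: rdim_tensors)
      qed
      then obtain es where es: "list_all2 (\<lambda>e n. e \<in> carrier_mat 1 n) es ?ns" "krons es * u \<noteq> 0\<^sub>m 1 1" by blast
      have le: "length es = ?n" using list_all2_lengthD[OF es(1)] by simp
      have ei: "es ! i \<in> carrier_mat 1 (rdim (Vs ! i) x)" if "i < ?n" for i
        using list_all2_nthD[OF es(1), of i] that le by simp
      let ?ts = "map (\<lambda>i. (Vs ! i, es ! i * P i, labs ! i)) [0..<?n]"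
      have t1: "map fst ?ts = Vs" by (simp add: comp_def map_nth)
      have t2: "map (\<lambda>t. snd (snd t)) ?ts = labs" by (simp add: comp_def len map_nth)
      have t3: "map (fst \<circ> snd) ?ts = map2 (*) es ?Ps"
        by (rule nth_equalityI) (auto simp: le)
      have "krons es * krons ?Ps = krons (map (fst \<circ> snd) ?ts)"
        unfolding t3
      proof (rule krons_mult)
        show "list_all2 (\<lambda>A B. dim_col A = dim_row B) es ?Ps"
          unfolding list_all2_conv_all_nth
        proof (intro conjI allI impI)
          fix i assume "i < length es"
          then have i: "i < ?n" using le by simp
          show "dim_col (es ! i) = dim_row (?Ps ! i)" using ei[OF i] P(1)[OF i] i by auto
        qed (simp add: le)
      qed
      moreover have "krons es \<in> carrier_mat 1 (rdim (tensors Vs) x)"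
        using krons_carrier[OF es(1)] by (simp add: rdim_tensors)
      moreover have "krons ?Ps \<in> carrier_mat (rdim (tensors Vs) x) (rdim (tensors Vs) x)"
      proof -
        have "map dim_row ?Ps = ?ns" "map dim_col ?Ps = ?ns"
          by (rule nth_equalityI; use P(1) in auto)+
        then show ?thesis by (intro carrier_matI) (simp_all only: krons_dim rdim_tensors)
      qed
      ultimately have "krons (map (fst \<circ> snd) ?ts) * u = krons es * (krons ?Ps * u)"
        using uc by (metis carrier_matD mat_assoc)
      then have nz: "krons (map (fst \<circ> snd) ?ts) * u \<noteq> 0\<^sub>m 1 1" using es(2) fixed by simp
      have "list_all (slot x) ?ts"
        unfolding list_all_length
      proof (intro allI impI)
        fix i assume "i < length ?ts"
        then have i: "i < ?n" by simp
        have "slot x (Vs ! i, es ! i * P i, labs ! i)"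
          unfolding slot_def prod.case
        proof (intro conjI allI impI)
          show "is_rep Q (Vs ! i)" by (rule repi[OF i])
          show "es ! i * P i \<in> carrier_mat 1 (rdim (Vs ! i) x)" using ei[OF i] P(1)[OF i] by auto
          fix S assume S: "labs ! i = Some S"
          have "Some S \<in> set labs" using nth_mem[of i labs] S i len by simp
          then show "S \<in> L x" using lab_mem by blast
          fix v assume v: "rk Q (Vs ! i) x S v"
          show "es ! i * P i * v = 0\<^sub>m 1 1"
            using P(3)[OF i S v] ei[OF i] P(1)[OF i] rk_carrier[OF v] by (simp add: mat_assoc mat_zero_right)
        qed
        then show "slot x (?ts ! i)" using i by simp
      qed
      moreover have "\<forall>S \<in> L x - {S \<in> L x. lat_le S M}. N \<le> length (filter (\<lambda>t. hits S (snd (snd t))) ?ts)"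
      proof
        fix S assume S: "S \<in> L x - {S \<in> L x. lat_le S M}"
        have "length (filter (\<lambda>t. hits S (snd (snd t))) ?ts) = length (filter (hits S) (map (\<lambda>t. snd (snd t)) ?ts))"
          by (simp only: filter_map comp_def length_map)
        also have "\<dots> = length (filter (hits S) labs)" by (simp only: t2)
        finally show "N \<le> length (filter (\<lambda>t. hits S (snd (snd t))) ?ts)" using cnt[of S] S by simp
      qed
      ultimately have "sumcork Q (tensors (map fst ?ts)) x {S \<in> L x. lat_le S M} (krons (map (fst \<circ> snd) ?ts))"
        using N L_order_ideal_below[of x M] unfolding lift_bound_def by blast
      then have "sumcork Q (tensors Vs) x {S \<in> L x. lat_le S M} (krons (map (fst \<circ> snd) ?ts))" unfolding t1 .
      then have "cork Q (tensors Vs) x M (krons (map (fst \<circ> snd) ?ts))"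
        by (rule sumcork_imp_cork[OF is_rep_tensors[OF reps]]) simp
      then show "\<exists>g. cork Q (tensors Vs) x M g \<and> g * u \<noteq> 0\<^sub>m 1 1" using nz by blast
    qed
  qed
qed

end

section \<open>Splitting off summands\<close>

context quiver
begin

text \<open>The image of an endomorphism, with bases chosen vertex by vertex through
  \<open>mat_image_factor\<close>. The left inverse \<open>C\<close> and the lift \<open>Y\<close>
  are kept because they need not be morphisms and cannot be recovered from \<open>p\<close> and
  \<open>q\<close>.\<close>

lemma rep_image:
  assumes V: "is_rep Q V" and e: "rep_hom Q V V e"
  obtains V' p q C Y where "is_rep Q V'" "rep_hom Q V V' p" "rep_hom Q V' V q"
    "\<And>x. x \<in> verts Q \<Longrightarrow> q x * p x = e x" "\<And>x. x \<in> verts Q \<Longrightarrow> p x = C x * e x"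
    "\<And>x. x \<in> verts Q \<Longrightarrow> C x \<in> carrier_mat (rdim V' x) (rdim V x)"
    "\<And>x. x \<in> verts Q \<Longrightarrow> C x * q x = 1\<^sub>m (rdim V' x)"
    "\<And>x. x \<in> verts Q \<Longrightarrow> Y x \<in> carrier_mat (rdim V x) (rdim V' x)" "\<And>x. x \<in> verts Q \<Longrightarrow> q x = e x * Y x"
proof -
  let ?P = "\<lambda>x t. x \<in> verts Q \<longrightarrow> (case t of (r, B, C, Y) \<Rightarrow> B \<in> carrier_mat (rdim V x) r \<and>
      C \<in> carrier_mat r (rdim V x) \<and> Y \<in> carrier_mat (rdim V x) r \<and> C * B = 1\<^sub>m r \<and> B * (C * e x) = e x \<and> B = e x * Y)"
  have "\<exists>t. ?P x t" for x
  proof (cases "x \<in> verts Q")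
    case True
    obtain r B C Y where "B \<in> carrier_mat (rdim V x) r" "C \<in> carrier_mat r (rdim V x)" "Y \<in> carrier_mat (rdim V x) r"
      "C * B = 1\<^sub>m r" "B * (C * e x) = e x" "B = e x * Y"
      using mat_image_factor[OF rep_homD(1)[OF e True]] by blast
    then show ?thesis by (intro exI[of _ "(r, B, C, Y)"]) simp
  qed simp
  then have "\<exists>t. \<forall>x. ?P x (t x)" by (intro choice allI)
  then obtain t where t: "\<And>x. ?P x (t x)" by blast
  define r B C Y where "r = (\<lambda>x. fst (t x))" "B = (\<lambda>x. fst (snd (t x)))"
    "C = (\<lambda>x. fst (snd (snd (t x))))" "Y = (\<lambda>x. snd (snd (snd (t x))))"
  have t': "x \<in> verts Q \<Longrightarrow> B x \<in> carrier_mat (rdim V x) (r x) \<and> C x \<in> carrier_mat (r x) (rdim V x) \<and>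
      Y x \<in> carrier_mat (rdim V x) (r x) \<and> C x * B x = 1\<^sub>m (r x) \<and> B x * (C x * e x) = e x \<and> B x = e x * Y x" for x
    using t[of x] unfolding r_B_C_Y_def split_def by blast
  have B: "\<And>x. x \<in> verts Q \<Longrightarrow> B x \<in> carrier_mat (rdim V x) (r x)"
    and C: "\<And>x. x \<in> verts Q \<Longrightarrow> C x \<in> carrier_mat (r x) (rdim V x)"
    and Y: "\<And>x. x \<in> verts Q \<Longrightarrow> Y x \<in> carrier_mat (rdim V x) (r x)"
    and CB: "\<And>x. x \<in> verts Q \<Longrightarrow> C x * B x = 1\<^sub>m (r x)" and BCe: "\<And>x. x \<in> verts Q \<Longrightarrow> B x * (C x * e x) = e x"
    and BeY: "\<And>x. x \<in> verts Q \<Longrightarrow> B x = e x * Y x"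
    using t' by blast+
  \<comment> \<open>The arrow maps of \<open>V\<close>, which preserve the images of
    \<open>e\<close>, written in the chosen bases.\<close>
  define V' where "V' = \<lparr> rdim = r, rmap = (\<lambda>a. C (head Q a) * (rmap V a * B (tail Q a))) \<rparr>"
  have sV': "rdim V' x = r x" "rmap V' a = C (head Q a) * (rmap V a * B (tail Q a))" for x a by (simp_all add: V'_def)
  have repV': "is_rep Q V'"
    unfolding is_rep_def sV'
  proof
    fix a assume a: "a \<in> arcs Q"
    show "C (head Q a) * (rmap V a * B (tail Q a)) \<in> carrier_mat (r (head Q a)) (r (tail Q a))"
      using C[OF head_in_verts[OF a]] B[OF tail_in_verts[OF a]] is_repD[OF V a] by auto
  qed
  have hp: "rep_hom Q V V' (\<lambda>x. C x * e x)"
    unfolding rep_hom_def sV'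
  proof (intro conjI ballI)
    fix x assume x: "x \<in> verts Q"
    show "C x * e x \<in> carrier_mat (r x) (rdim V x)" using C[OF x] rep_homD(1)[OF e x] by auto
  next
    fix a assume a: "a \<in> arcs Q"
    note t = tail_in_verts[OF a] and h = head_in_verts[OF a]
    note d = C[OF h] C[OF t] B[OF t] rep_homD(1)[OF e h] rep_homD(1)[OF e t] is_repD[OF V a]
    have "C (head Q a) * e (head Q a) * rmap V a = C (head Q a) * (rmap V a * e (tail Q a))"
      using d rep_homD(2)[OF e a] by (simp add: mat_assoc)
    also have "\<dots> = C (head Q a) * (rmap V a * (B (tail Q a) * (C (tail Q a) * e (tail Q a))))" by (simp only: BCe[OF t])
    also have "\<dots> = C (head Q a) * (rmap V a * B (tail Q a)) * (C (tail Q a) * e (tail Q a))"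
      using d by (simp add: mat_assoc)
    finally show "C (head Q a) * e (head Q a) * rmap V a =
      C (head Q a) * (rmap V a * B (tail Q a)) * (C (tail Q a) * e (tail Q a))" .
  qed
  have hq: "rep_hom Q V' V B"
    unfolding rep_hom_def sV'
  proof (intro conjI ballI)
    fix a assume a: "a \<in> arcs Q"
    note t = tail_in_verts[OF a] and h = head_in_verts[OF a]
    note d = C[OF h] B[OF h] B[OF t] Y[OF t] rep_homD(1)[OF e h] rep_homD(1)[OF e t] is_repD[OF V a]
    have e1: "rmap V a * B (tail Q a) = e (head Q a) * (rmap V a * Y (tail Q a))"
    proof -
      have "rmap V a * (e (tail Q a) * Y (tail Q a)) = e (head Q a) * rmap V a * Y (tail Q a)"
        by (rule mat_assoc_eq) (use d rep_homD(2)[OF e a] in auto)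
      then show ?thesis unfolding BeY[OF t] using d by (simp add: mat_assoc)
    qed
    have "B (head Q a) * (C (head Q a) * (e (head Q a) * (rmap V a * Y (tail Q a)))) =
      B (head Q a) * (C (head Q a) * e (head Q a)) * (rmap V a * Y (tail Q a))"
      using d by (simp add: mat_assoc)
    also have "\<dots> = e (head Q a) * (rmap V a * Y (tail Q a))" by (simp only: BCe[OF h])
    finally show "B (head Q a) * (C (head Q a) * (rmap V a * B (tail Q a))) = rmap V a * B (tail Q a)"
      unfolding e1 .
  qed (use B in blast)
  show ?thesis
    by (rule that[OF repV' hp hq, of C Y]) (use BCe C CB Y BeY in \<open>simp_all add: sV'\<close>)
qed

lemma rep_hom_inverse:
  assumes V: "is_rep Q V" "is_rep Q W" and h: "rep_hom Q V W \<phi>"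
    and \<psi>: "\<And>x. x \<in> verts Q \<Longrightarrow> \<psi> x \<in> carrier_mat (rdim V x) (rdim W x)"
    "\<And>x. x \<in> verts Q \<Longrightarrow> \<phi> x * \<psi> x = 1\<^sub>m (rdim W x)" "\<And>x. x \<in> verts Q \<Longrightarrow> \<psi> x * \<phi> x = 1\<^sub>m (rdim V x)"
  shows "rep_hom Q W V \<psi>"
  unfolding rep_hom_def
proof (intro conjI ballI)
  fix a assume a: "a \<in> arcs Q"
  note t = tail_in_verts[OF a] and hd = head_in_verts[OF a]
  note d = rep_homD(1)[OF h t] rep_homD(1)[OF h hd] \<psi>(1)[OF t] \<psi>(1)[OF hd] is_repD[OF V(1) a] is_repD[OF V(2) a]
  have "\<psi> (head Q a) * rmap W a = \<psi> (head Q a) * (rmap W a * (\<phi> (tail Q a) * \<psi> (tail Q a)))"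
    using d by (simp add: \<psi>(2)[OF t] mat_one_right)
  also have "rmap W a * (\<phi> (tail Q a) * \<psi> (tail Q a)) = \<phi> (head Q a) * rmap V a * \<psi> (tail Q a)"
    by (rule mat_assoc_eq) (use rep_homD(2)[OF h a] d in auto)
  also have "\<psi> (head Q a) * (\<phi> (head Q a) * rmap V a * \<psi> (tail Q a)) = rmap V a * \<psi> (tail Q a)"
    using d by (simp add: mat_assoc mat_assoc_eq[OF \<psi>(3)[OF hd]] mat_one_left)
  finally show "\<psi> (head Q a) * rmap W a = rmap V a * \<psi> (tail Q a)" .
qed (use \<psi>(1) in blast)

text \<open>The complement is the image of the idempotent \<open>1 - i1 * p1\<close>.\<close>

lemma split_mono_biproduct:
  assumes Y: "is_rep Q Y" and X: "is_rep Q X" and i: "rep_hom Q X Y i1" and p: "rep_hom Q Y X p1"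
    and pi: "\<And>x. x \<in> verts Q \<Longrightarrow> p1 x * i1 x = 1\<^sub>m (rdim X x)"
  shows "\<exists>Y1 i2 p2. is_rep Q Y1 \<and> biproduct Q Y X Y1 i1 p1 i2 p2"
proof -
  let ?E = "\<lambda>x. 1\<^sub>m (rdim Y x) - i1 x * p1 x"
  have c: "i1 x \<in> carrier_mat (rdim Y x) (rdim X x)" "p1 x \<in> carrier_mat (rdim X x) (rdim Y x)" if "x \<in> verts Q" for x
    using rep_homD(1)[OF i that] rep_homD(1)[OF p that] by auto
  have E: "rep_hom Q Y Y ?E"
    unfolding rep_hom_def
  proof (intro conjI ballI)
    fix x assume x: "x \<in> verts Q"
    show "?E x \<in> carrier_mat (rdim Y x) (rdim Y x)" using c[OF x] by auto
  next
    fix a assume a: "a \<in> arcs Q"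
    note d = c[OF tail_in_verts[OF a]] c[OF head_in_verts[OF a]] is_repD[OF Y a]
    have "i1 (head Q a) * p1 (head Q a) * rmap Y a = rmap Y a * (i1 (tail Q a) * p1 (tail Q a))"
      using rep_homD(2)[OF rep_hom_comp[OF Y X Y p i] a] .
    then show "?E (head Q a) * rmap Y a = rmap Y a * ?E (tail Q a)"
      using d by (simp add: mat_diff_left mat_diff_right mat_one_left mat_one_right)
  qed
  obtain Y1 p2 q2 C Z where *: "is_rep Q Y1" "rep_hom Q Y Y1 p2" "rep_hom Q Y1 Y q2"
    "\<And>x. x \<in> verts Q \<Longrightarrow> q2 x * p2 x = ?E x" "\<And>x. x \<in> verts Q \<Longrightarrow> p2 x = C x * ?E x"
    "\<And>x. x \<in> verts Q \<Longrightarrow> C x \<in> carrier_mat (rdim Y1 x) (rdim Y x)"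
    "\<And>x. x \<in> verts Q \<Longrightarrow> C x * q2 x = 1\<^sub>m (rdim Y1 x)"
    "\<And>x. x \<in> verts Q \<Longrightarrow> Z x \<in> carrier_mat (rdim Y x) (rdim Y1 x)" "\<And>x. x \<in> verts Q \<Longrightarrow> q2 x = ?E x * Z x"
    by (rule rep_image[OF Y E]) (rule that; assumption)
  have "biproduct Q Y X Y1 i1 p1 q2 p2"
    unfolding biproduct_def
  proof (intro conjI ballI i p *(2,3))
    fix x assume x: "x \<in> verts Q"
    note d = c[OF x] *(6,8)[OF x]
    have Ei: "?E x * i1 x = 0\<^sub>m (rdim Y x) (rdim X x)"
      using d by (simp add: mat_diff_right mat_one_left mat_assoc pi[OF x] mat_one_right mat_diff_self)
    have pE: "p1 x * ?E x = 0\<^sub>m (rdim X x) (rdim Y x)"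
      using d by (simp add: mat_diff_left mat_one_right mat_assoc_eq[OF pi[OF x]] mat_one_left mat_diff_self)
    have EE: "?E x * ?E x = ?E x"
    proof -
      have "?E x * ?E x = ?E x * 1\<^sub>m (rdim Y x) - ?E x * (i1 x * p1 x)" using d by (intro mat_diff_left) auto
      also have "?E x * (i1 x * p1 x) = 0\<^sub>m (rdim Y x) (rdim Y x)"
        using mat_assoc_eq[OF Ei, of "p1 x"] d by (simp add: mat_zero_left)
      finally show ?thesis using d by (simp add: mat_one_right mat_diff_zero)
    qed
    show "p1 x * i1 x = 1\<^sub>m (rdim X x)" by (rule pi[OF x])
    have "?E x * (?E x * Z x) = ?E x * Z x" by (rule mat_assoc_eq[OF EE]) (use d in auto)
    then have "C x * (?E x * (?E x * Z x)) = C x * (?E x * Z x)" by simp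
    moreover have "C x * ?E x * (?E x * Z x) = C x * (?E x * (?E x * Z x))" using d by (intro mat_assoc) auto
    ultimately show "p2 x * q2 x = 1\<^sub>m (rdim Y1 x)" using *(7)[OF x] unfolding *(5)[OF x] *(9)[OF x] by simp
    show "p1 x * q2 x = 0\<^sub>m (rdim X x) (rdim Y1 x)"
      unfolding *(9)[OF x] using mat_assoc_eq[OF pE, of "Z x"] d by (simp add: mat_zero_left)
    have "C x * ?E x * i1 x = C x * (?E x * i1 x)" using d by (intro mat_assoc) auto
    then show "p2 x * i1 x = 0\<^sub>m (rdim Y1 x) (rdim X x)"
      unfolding *(5)[OF x] Ei using d by (simp add: mat_zero_right)
    show "i1 x * p1 x + q2 x * p2 x = 1\<^sub>m (rdim Y x)"
      unfolding *(4)[OF x] using d by (intro eq_matI) (auto simp del: index_mult_mat(1))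
  qed
  then show ?thesis using *(1) by blast
qed

end

section \<open>Supports and representations of least dimension\<close>

lemma exists_min_nat: "P x \<Longrightarrow> \<exists>y. P y \<and> (\<forall>z. P z \<longrightarrow> (f y :: nat) \<le> f z)"
  using ex_has_least_nat[of P x f] by blast

context rtree
begin

definition supp :: "('a, 'b, 'k::field) rep \<Rightarrow> ('a \<times> 'b lat_elem) set" where
  "supp V = {(x, M). x \<in> verts Q \<and> M \<in> L x \<and> (\<exists>u. rk Q V x M u \<and> u \<noteq> 0\<^sub>m (rdim V x) 1)}"

lemma not_supp: "x \<in> verts Q \<Longrightarrow> M \<in> L x \<Longrightarrow> (x, M) \<notin> supp V \<Longrightarrow> rk Q V x M u \<Longrightarrow> u = 0\<^sub>m (rdim V x) 1"
  by (auto simp: supp_def)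

lemma supp_iff_rkdim:
  "is_rep Q V \<Longrightarrow> x \<in> verts Q \<Longrightarrow> M \<in> L x \<Longrightarrow> (x, M) \<in> supp V \<longleftrightarrow> rkdim Q V x M \<noteq> 0"
  unfolding supp_def by (simp add: rkdim_eq_0_iff L_lat_at)

lemma supp_subrep:
  assumes W: "is_rep Q W" and V: "is_rep Q V" and q: "rep_hom Q W V q"
    and C: "\<And>x. x \<in> verts Q \<Longrightarrow> C x \<in> carrier_mat (rdim W x) (rdim V x)"
    and Cq: "\<And>x. x \<in> verts Q \<Longrightarrow> C x * q x = 1\<^sub>m (rdim W x)"
  shows "supp W \<subseteq> supp V"
proof
  fix p assume "p \<in> supp W"
  then obtain x M u where p: "p = (x, M)" "x \<in> verts Q" "M \<in> L x" "rk Q W x M u" "u \<noteq> 0\<^sub>m (rdim W x) 1"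
    by (auto simp: supp_def)
  note uc = rk_carrier[OF p(4)]
  have r: "rk Q V x M (q x * u)" by (rule rk_hom[OF W V q L_lat_at[OF p(2,3)] p(2,4)])
  have "C x * (q x * u) = u"
    using C[OF p(2)] rep_homD(1)[OF q p(2)] uc by (simp add: mat_assoc_eq[OF Cq[OF p(2)]] mat_one_left)
  then have "q x * u \<noteq> 0\<^sub>m (rdim V x) 1" using p(5) C[OF p(2)] by (auto simp: mat_zero_right)
  then show "p \<in> supp V" using p(1-3) r by (auto simp: supp_def)
qed

text \<open>The rank space of the bottom element is the whole space at \<open>y\<close>.\<close>

lemma rdim_zero_of_supp:
  fixes V :: "('a, 'b, 'k::field) rep"
  assumes y: "y \<in> verts Q" and s: "\<And>M. (y, M) \<notin> supp V"
  shows "rdim V y = 0"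
proof (rule ccontr)
  assume n: "rdim V y \<noteq> 0"
  let ?u = "mat (rdim V y) 1 (\<lambda>_. 1) :: 'k mat"
  have "?u = 0\<^sub>m (rdim V y) 1"
    by (rule not_supp[OF y L_bot[OF y] s]) (simp add: rk_bot)
  then have "?u $$ (0, 0) = 0\<^sub>m (rdim V y) 1 $$ (0, 0)" by (rule arg_cong)
  then show False using n by simp
qed

text \<open>Among the representations with a paired vector and functional for \<open>M\<close>, take one of least
  total dimension: its endomorphisms with root component \<open>u g\<close> cannot factor through a proper image.\<close>

definition typed :: "'a \<Rightarrow> 'b lat_elem \<Rightarrow> ('a, 'b, 'k::field) rep \<Rightarrow> bool" where
  "typed x M X \<longleftrightarrow> is_rep Q X \<and> (\<exists>u g. rk Q X x M u \<and> cork Q X x M g \<and> g * u = 1\<^sub>m 1)"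

definition total_dim :: "('a, 'b, 'k::field) rep \<Rightarrow> nat" where
  "total_dim X = (\<Sum>y\<in>verts Q. rdim X y)"

text \<open>Write \<open>e = q * p\<close> through its image \<open>X'\<close>. The pair
  \<open>p * u\<close>, \<open>g * q\<close> on \<open>X'\<close> has value
  \<open>(g * u) * (g * u) = 1\<close>, so \<open>X'\<close> again carries a paired vector and
  functional. By minimality it has the same total dimension, hence the same dimension at every
  vertex, and \<open>e\<close> is invertible.\<close>

lemma minimal_endo_invertible:
  fixes X :: "('a, 'b, 'k::field) rep"
  assumes X: "is_rep Q X" and x: "x \<in> verts Q" and M: "M \<in> L x"
    and u: "rk Q X x M u" and g: "cork Q X x M g" and gu: "g * u = 1\<^sub>m 1"
    and min: "\<And>X' :: ('a, 'b, 'k) rep. typed x M X' \<Longrightarrow> supp X' \<subseteq> supp X \<Longrightarrow> total_dim X \<le> total_dim X'"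
    and e: "rep_hom Q X X e" and ex: "e x = u * g"
  shows "\<exists>d. rep_hom Q X X d \<and> (\<forall>y\<in>verts Q. e y * d y = 1\<^sub>m (rdim X y))"
proof -
  obtain X' p q C Z where *: "is_rep Q X'" "rep_hom Q X X' p" "rep_hom Q X' X q"
    "\<And>x. x \<in> verts Q \<Longrightarrow> q x * p x = e x" "\<And>x. x \<in> verts Q \<Longrightarrow> p x = C x * e x"
    "\<And>x. x \<in> verts Q \<Longrightarrow> C x \<in> carrier_mat (rdim X' x) (rdim X x)"
    "\<And>x. x \<in> verts Q \<Longrightarrow> C x * q x = 1\<^sub>m (rdim X' x)"
    "\<And>x. x \<in> verts Q \<Longrightarrow> Z x \<in> carrier_mat (rdim X x) (rdim X' x)" "\<And>x. x \<in> verts Q \<Longrightarrow> q x = e x * Z x"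
    by (rule rep_image[OF X e]) (rule that; assumption)
  note uc = rk_carrier[OF u] and gc = corkD(1)[OF g]
  note pc = rep_homD(1)[OF *(2) x] and qc = rep_homD(1)[OF *(3) x]
  have u': "rk Q X' x M (p x * u)" by (rule rk_hom[OF X *(1,2) L_lat_at[OF x M] x u])
  have g': "cork Q X' x M (g * q x)" by (rule cork_hom(1)[OF *(1) X *(3) g x])
  have "g * q x * (p x * u) = g * (q x * (p x * u))" using gc qc pc uc by (simp add: mat_assoc)
  also have "q x * (p x * u) = u * g * u" using mat_assoc_eq[OF *(4)[OF x], of u] qc pc uc by (simp add: ex)
  also have "g * (u * g * u) = g * u * (g * u)" using gc uc by (simp add: mat_assoc)
  also have "\<dots> = 1\<^sub>m 1" by (simp add: gu mat_one_left)
  finally have t: "typed x M X'" unfolding typed_def using *(1) u' g' by blast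
  have s: "supp X' \<subseteq> supp X" by (rule supp_subrep[OF *(1) X *(3) *(6,7)])
  have le: "rdim X' y \<le> rdim X y" if y: "y \<in> verts Q" for y
    by (rule left_inverse_dim_le[OF rep_homD(1)[OF *(3) y] *(6)[OF y] *(7)[OF y]])
  have "total_dim X' \<le> total_dim X" unfolding total_dim_def by (rule sum_mono) (rule le)
  then have tot: "(\<Sum>y\<in>verts Q. rdim X' y) = (\<Sum>y\<in>verts Q. rdim X y)"
    using min[OF t s] unfolding total_dim_def by simp
  have eq: "rdim X' y = rdim X y" if y: "y \<in> verts Q" for y
    by (rule sum_mono_inv[OF tot le y fin_verts])
  let ?d = "\<lambda>y. Z y * C y"
  have dc: "?d y \<in> carrier_mat (rdim X y) (rdim X y)" if y: "y \<in> verts Q" for y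
    using *(6)[OF y] *(8)[OF y] by auto
  have r: "e y * ?d y = 1\<^sub>m (rdim X y)" if y: "y \<in> verts Q" for y
  proof -
    have "q y * C y = 1\<^sub>m (rdim X y)"
    proof (rule mat_mult_left_right_inverse)
      show "C y \<in> carrier_mat (rdim X y) (rdim X y)" "q y \<in> carrier_mat (rdim X y) (rdim X y)"
        using *(6)[OF y] rep_homD(1)[OF *(3) y] eq[OF y] by auto
      show "C y * q y = 1\<^sub>m (rdim X y)" using *(7)[OF y] eq[OF y] by simp
    qed
    moreover have "e y * (Z y * C y) = q y * C y"
      by (rule mat_assoc_eq[OF *(9)[OF y, symmetric]]) (use *(6,8)[OF y] rep_homD(1)[OF e y] in auto)
    ultimately show ?thesis by simp
  qed
  have l: "?d y * e y = 1\<^sub>m (rdim X y)" if y: "y \<in> verts Q" for y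
    by (rule mat_mult_left_right_inverse[OF rep_homD(1)[OF e y] dc[OF y] r[OF y]])
  have "rep_hom Q X X ?d" by (rule rep_hom_inverse[OF X X e dc r l])
  then show ?thesis using r by blast
qed

text \<open>The two rank one pairings give morphisms \<open>a\<close> from \<open>X\<close> to
  \<open>Y\<close> and \<open>b\<close> back. At \<open>x\<close> their composite is
  \<open>u0 * (g * u) * g0 = u0 * g0\<close>, so it is invertible by minimality, and
  \<open>a\<close> followed by \<open>b\<close> can be corrected to a splitting.\<close>

lemma split_off:
  fixes X Y :: "('a, 'b, 'k::field) rep"
  assumes X: "is_rep Q X" and x: "x \<in> verts Q" and M: "M \<in> L x"
    and u0: "rk Q X x M u0" and g0: "cork Q X x M g0" and gu0: "g0 * u0 = 1\<^sub>m 1"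
    and min: "\<And>X' :: ('a, 'b, 'k) rep. typed x M X' \<Longrightarrow> supp X' \<subseteq> supp X \<Longrightarrow> total_dim X \<le> total_dim X'"
    and outX: "\<And>a. a \<in> arcs Q \<Longrightarrow> tail Q a = x \<Longrightarrow> rdim X (head Q a) = 0"
    and Y: "is_rep Q Y" and u: "rk Q Y x M u" and g: "cork Q Y x M g" and gu: "g * u = 1\<^sub>m 1"
    and outY: "\<And>a. a \<in> arcs Q \<Longrightarrow> tail Q a = x \<Longrightarrow> rdim Y (head Q a) = 0"
  shows "\<exists>Y1 i1 p1 i2 p2. is_rep Q Y1 \<and> biproduct Q Y X Y1 i1 p1 i2 p2"
proof -
  note MM = L_lat_at[OF x M]
  obtain a where a: "rep_hom Q X Y a" "a x = u * g0" using cork_rk_hom[OF X Y x MM g0 u outY] by blast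
  obtain b where b: "rep_hom Q Y X b" "b x = u0 * g" using cork_rk_hom[OF Y X x MM g u0 outX] by blast
  have e: "rep_hom Q X X (\<lambda>y. b y * a y)" by (rule rep_hom_comp[OF X Y X a(1) b(1)])
  have "u0 * g * (u * g0) = u0 * (g * (u * g0))"
    using rk_carrier[OF u0] corkD(1)[OF g] rk_carrier[OF u] corkD(1)[OF g0] by (simp add: mat_assoc)
  also have "g * (u * g0) = g0"
    using mat_assoc_eq[OF gu, of g0] rk_carrier[OF u] corkD(1)[OF g0] corkD(1)[OF g] by (simp add: mat_one_left)
  finally have ex: "b x * a x = u0 * g0" unfolding a(2) b(2) .
  obtain d where d: "rep_hom Q X X d" "\<And>y. y \<in> verts Q \<Longrightarrow> b y * a y * d y = 1\<^sub>m (rdim X y)"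
    using minimal_endo_invertible[OF X x M u0 g0 gu0 min e ex] by blast
  have i: "rep_hom Q X Y (\<lambda>y. a y * d y)" by (rule rep_hom_comp[OF X X Y d(1) a(1)])
  have "b y * (a y * d y) = 1\<^sub>m (rdim X y)" if y: "y \<in> verts Q" for y
    using d(2)[OF y] mat_assoc[of "b y" "a y" "d y"] rep_homD(1)[OF a(1) y] rep_homD(1)[OF b(1) y] rep_homD(1)[OF d(1) y]
    by auto
  from split_mono_biproduct[OF Y X i b(1) this] show ?thesis by blast
qed

text \<open>A vector of the summand is detected by a functional on \<open>Y\<close>, which restricts
  along the inclusion. This lets splitting be repeated.\<close>

lemma paired_summand:
  assumes Y: "is_rep Q Y" and Y1: "is_rep Q Y1" and b: "biproduct Q Y X Y1 i1 p1 i2 p2"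
    and x: "x \<in> verts Q" and M: "M \<in> L x" and s: "paired x M Y"
  shows "paired x M Y1"
  unfolding paired_def
proof (intro allI impI)
  fix u assume u: "rk Q Y1 x M u" and u0: "u \<noteq> 0\<^sub>m (rdim Y1 x) 1"
  have i: "rep_hom Q Y1 Y i2" and p: "rep_hom Q Y Y1 p2" and pi: "p2 x * i2 x = 1\<^sub>m (rdim Y1 x)"
    using b x by (auto simp: biproduct_def)
  note ic = rep_homD(1)[OF i x] and pc = rep_homD(1)[OF p x] and uc = rk_carrier[OF u]
  have r: "rk Q Y x M (i2 x * u)" by (rule rk_hom[OF Y1 Y i L_lat_at[OF x M] x u])
  have "p2 x * (i2 x * u) = u" using ic pc uc by (simp add: mat_assoc_eq[OF pi] mat_one_left)
  then have "i2 x * u \<noteq> 0\<^sub>m (rdim Y x) 1" using u0 pc by (auto simp: mat_zero_right)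
  then obtain g where g: "cork Q Y x M g" "g * (i2 x * u) \<noteq> 0\<^sub>m 1 1" using s r unfolding paired_def by blast
  have "cork Q Y1 x M (g * i2 x)" by (rule cork_hom(1)[OF Y1 Y i g(1) x])
  moreover have "g * i2 x * u = g * (i2 x * u)" using corkD(1)[OF g(1)] ic uc by (simp add: mat_assoc)
  ultimately show "\<exists>g. cork Q Y1 x M g \<and> g * u \<noteq> 0\<^sub>m 1 1" using g(2) by metis
qed

lemma paired_typed:
  assumes Y: "is_rep Q Y" and x: "x \<in> verts Q" and M: "M \<in> L x" and s: "paired x M Y" and n: "(x, M) \<in> supp Y"
  obtains u g where "rk Q Y x M u" "cork Q Y x M g" "g * u = 1\<^sub>m 1"
proof -
  obtain u where u: "rk Q Y x M u" "u \<noteq> 0\<^sub>m (rdim Y x) 1" using n by (auto simp: supp_def)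
  obtain g where g: "cork Q Y x M g" "g * u \<noteq> 0\<^sub>m 1 1" using s u unfolding paired_def by blast
  obtain c where c: "g * (c \<cdot>\<^sub>m u) = 1\<^sub>m 1" using scale_to_one[OF corkD(1)[OF g(1)] rk_carrier[OF u(1)] g(2)] by blast
  have "rk Q Y x M (c \<cdot>\<^sub>m u)" using rk_subspace[OF Y L_lat_at[OF x M]] u(1) by (auto simp: mat_subspace_def)
  then show ?thesis using that g(1) c by blast
qed

end

section \<open>Nilpotency of the common kernel\<close>

locale rtree_over = rtree Q L + quiver_over Q K
  for Q :: "('a, 'b) pre_digraph" and L and K :: "'k::field itself"
begin

text \<open>Copies of \<open>X\<close> are split off as long as the rank at \<open>(x, M)\<close> is
  nonzero. Each copy lowers it, because \<open>g0 * u0 = 1\<close> makes the rank of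
  \<open>X\<close> there positive.\<close>

lemma split_all:
  fixes X Y :: "('a, 'b, 'k) rep"
  assumes X: "is_rep Q X" and x: "x \<in> verts Q" and M: "M \<in> L x"
    and u0: "rk Q X x M u0" and g0: "cork Q X x M g0" and gu0: "g0 * u0 = 1\<^sub>m 1"
    and min: "\<And>X' :: ('a, 'b, 'k) rep. typed x M X' \<Longrightarrow> supp X' \<subseteq> supp X \<Longrightarrow> total_dim X \<le> total_dim X'"
    and outX: "\<And>a. a \<in> arcs Q \<Longrightarrow> tail Q a = x \<Longrightarrow> rdim X (head Q a) = 0"
    and outD: "\<And>a N. a \<in> arcs Q \<Longrightarrow> tail Q a = x \<Longrightarrow> (head Q a, N) \<notin> D"
    and Y: "is_rep Q Y" and s: "paired x M Y" and D: "supp Y \<subseteq> D"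
  shows "\<exists>m Y'. is_rep Q Y' \<and> supp Y' \<subseteq> D - {(x, M)} \<and> cls Y - (frag_cmul (int m) (cls X) + cls Y') \<in> Rel"
  using Y s D
proof (induction "rkdim Q Y x M" arbitrary: Y rule: less_induct)
  case less
  show ?case
  proof (cases "(x, M) \<in> supp Y")
    case False
    show ?thesis
      by (rule exI[of _ 0], rule exI[of _ Y]) (use less.prems False in \<open>auto simp: Rel_closed\<close>)
  next
    case True
    obtain u g where u: "rk Q Y x M u" "cork Q Y x M g" "g * u = 1\<^sub>m 1"
      by (rule paired_typed[OF less.prems(1) x M less.prems(2) True])
    have outY: "rdim Y (head Q a) = 0" if "a \<in> arcs Q" "tail Q a = x" for a
      by (rule rdim_zero_of_supp[OF head_in_verts[OF that(1)]]) (use outD[OF that] less.prems(3) in blast)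
    obtain Y1 i1 p1 i2 p2 where Y1: "is_rep Q Y1" and b: "biproduct Q Y X Y1 i1 p1 i2 p2"
      using split_off[OF X x M u0 g0 gu0 min outX less.prems(1) u outY] by blast
    have rel: "cls X + cls Y1 - cls Y \<in> Rel" by (rule biproduct_Rel[OF less.prems(1) X Y1 b])
    have i2: "rep_hom Q Y1 Y i2" and p2: "rep_hom Q Y Y1 p2" and pi: "\<And>y. y \<in> verts Q \<Longrightarrow> p2 y * i2 y = 1\<^sub>m (rdim Y1 y)"
      using b by (auto simp: biproduct_def)
    have sY1: "supp Y1 \<subseteq> supp Y" by (rule supp_subrep[OF Y1 less.prems(1) i2 rep_homD(1)[OF p2] pi])
    have "u0 \<noteq> 0\<^sub>m (rdim X x) 1"
    proof
      assume "u0 = 0\<^sub>m (rdim X x) 1"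
      then have "g0 * u0 = 0\<^sub>m 1 1" using corkD(1)[OF g0] by (simp add: mat_zero_right)
      then have "(1\<^sub>m 1 :: 'k mat) $$ (0, 0) = 0\<^sub>m 1 1 $$ (0, 0)" using gu0 by metis
      then show False by simp
    qed
    then have "(x, M) \<in> supp X" using x M u0 by (auto simp: supp_def)
    then have "rkdim Q X x M \<noteq> 0" using supp_iff_rkdim[OF X x M] by simp
    then have "rkdim Q Y1 x M < rkdim Q Y x M"
      using rkdim_biproduct[OF less.prems(1) X Y1 b L_lat_at[OF x M] x] by simp
    from less.hyps[OF this Y1 paired_summand[OF less.prems(1) Y1 b x M less.prems(2)] order_trans[OF sY1 less.prems(3)]]
    obtain m Y' where Y': "is_rep Q Y'" "supp Y' \<subseteq> D - {(x, M)}"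
      "cls Y1 - (frag_cmul (int m) (cls X) + cls Y') \<in> Rel" by blast
    have "frag_cmul (int (Suc m)) (cls X) = cls X + frag_cmul (int m) (cls X)"
      using frag_cmul_distrib[of 1 "int m" "cls X"] by (simp only: of_nat_Suc frag_cmul_one)
    then have "cls Y - (frag_cmul (int (Suc m)) (cls X) + cls Y') =
      (cls Y1 - (frag_cmul (int m) (cls X) + cls Y')) - (cls X + cls Y1 - cls Y)"
      by (simp only:) (simp only: algebra_simps)
    then have "cls Y - (frag_cmul (int (Suc m)) (cls X) + cls Y') \<in> Rel"
      using Rel_diff[OF Y'(3) rel] by metis
    then show ?thesis using Y'(1,2) by blast
  qed
qed

inductive_set Span :: "('a, 'b, 'k) rep set \<Rightarrow> (('a, 'b, 'k) rep set \<Rightarrow>\<^sub>0 int) set" for G where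
  rel: "f \<in> Rel \<Longrightarrow> f \<in> Span G"
| gen: "V \<in> G \<Longrightarrow> cls V \<in> Span G"
| diff: "f \<in> Span G \<Longrightarrow> g \<in> Span G \<Longrightarrow> f - g \<in> Span G"

lemma Span_closed: "f \<in> Span G \<Longrightarrow> (\<And>V. V \<in> G \<Longrightarrow> is_rep Q V) \<Longrightarrow> f \<in> carrier F"
  by (induction rule: Span.induct) (auto intro: Rel_closed(4) cls_closed F_closed)

lemma Span_zero: "0 \<in> Span G"
  by (rule Span.rel[OF Rel_closed(2)])

lemma Span_add: assumes "f \<in> Span G" "g \<in> Span G" shows "f + g \<in> Span G"
  using Span.diff[OF assms(1) Span.diff[OF Span_zero assms(2)]] by simp

lemma Span_cmul_nat: "f \<in> Span G \<Longrightarrow> frag_cmul (int n) f \<in> Span G"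
  by (induction n) (auto simp: Span_zero frag_cmul_distrib intro: Span_add)

lemma Span_insert:
  assumes "f \<in> Span (insert X G)"
  shows "\<exists>m. f - frag_cmul m (cls X) \<in> Span G"
  using assms
proof (induction rule: Span.induct)
  case (rel f)
  then show ?case using Span.rel[of f G] by (intro exI[of _ 0]) simp
next
  case (gen V)
  show ?case
  proof (cases "V = X")
    case True
    then show ?thesis using Span_zero by (intro exI[of _ 1]) simp
  next
    case False
    then show ?thesis using gen Span.gen[of V G] by (intro exI[of _ 0]) simp
  qed
next
  case (diff f g)
  then obtain m n where mn: "f - frag_cmul m (cls X) \<in> Span G" "g - frag_cmul n (cls X) \<in> Span G" by blast
  have "f - g - frag_cmul (m - n) (cls X) = (f - frag_cmul m (cls X)) - (g - frag_cmul n (cls X))"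
    by (simp add: frag_cmul_diff_distrib)
  then show ?case using Span.diff[OF mn] by metis
qed

text \<open>The power is expanded multilinearly: products of \<open>n\<close> generators are classes
  of tensor products, and every term with a factor in \<open>Rel\<close> lies in
  \<open>Rel\<close>.\<close>

lemma product_in:
  assumes G: "\<And>V. V \<in> G \<Longrightarrow> is_rep Q V" and f: "f \<in> Span G"
    and diff: "\<And>f g. f \<in> T \<Longrightarrow> g \<in> T \<Longrightarrow> f - g \<in> T" and rel: "Rel \<subseteq> T"
    and gens: "\<And>Vs. length Vs = n \<Longrightarrow> set Vs \<subseteq> G \<Longrightarrow> cls (tensors Vs) \<in> T"
  shows "f [^]\<^bsub>F\<^esub> n \<in> T"
  using diff rel gens
proof (induction n arbitrary: T)
  case 0
  have "cls (tensors []) \<in> T" by (rule 0(3)) simp_all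
  then show ?case by (simp add: F_simps)
next
  case (Suc n)
  have fc: "f \<in> carrier F" by (rule Span_closed[OF f G])
  have pc: "f [^]\<^bsub>F\<^esub> n \<in> carrier F" by (rule F.nat_pow_closed[OF fc])
  have V: "cls V \<otimes>\<^bsub>F\<^esub> f [^]\<^bsub>F\<^esub> n \<in> T" if V: "V \<in> G" for V
  proof -
    \<comment> \<open>Multiplication by a fixed generator is absorbed into the target set, so that
      the induction hypothesis handles the remaining factors.\<close>
    let ?T = "{k. cls V \<otimes>\<^bsub>F\<^esub> k \<in> T}"
    have "f [^]\<^bsub>F\<^esub> n \<in> ?T"
    proof (rule Suc.IH)
      show "f - g \<in> ?T" if "f \<in> ?T" "g \<in> ?T" for f g
        using that unfolding mem_Collect_eq F_mult_diff_right by (rule Suc.prems(1))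
      show "Rel \<subseteq> ?T"
      proof
        fix h assume "h \<in> Rel"
        then have "cls V \<otimes>\<^bsub>F\<^esub> h \<in> Rel" by (rule Rel_mult[OF _ cls_closed[OF G[OF V]]])
        then show "h \<in> ?T" unfolding mem_Collect_eq by (rule subsetD[OF Suc.prems(2)])
      qed
      fix Vs :: "('a, 'b, 'k) rep list" assume Vs: "length Vs = n" "set Vs \<subseteq> G"
      have "is_rep Q (tensors Vs)" using Vs(2) G by (intro is_rep_tensors) (auto simp: list_all_iff)
      then have "cls V \<otimes>\<^bsub>F\<^esub> cls (tensors Vs) = cls (tensors (V # Vs))" by (simp add: F_mult_cls G[OF V])
      moreover have "cls (tensors (V # Vs)) \<in> T" by (rule Suc.prems(3)) (use Vs V in auto)
      ultimately show "cls (tensors Vs) \<in> ?T" by (simp del: tensors_simps)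
    qed
    then show ?thesis by simp
  qed
  have "k \<otimes>\<^bsub>F\<^esub> f [^]\<^bsub>F\<^esub> n \<in> T" if k: "k \<in> Span G" for k using k
  proof (induction k rule: Span.induct)
    case (rel h)
    have "h \<otimes>\<^bsub>F\<^esub> f [^]\<^bsub>F\<^esub> n \<in> Rel"
      unfolding F_mult_comm[OF Rel_closed(4)[OF rel] pc] by (rule Rel_mult[OF rel pc])
    then show ?case by (rule subsetD[OF Suc.prems(2)])
  next
    case (gen V)
    then show ?case by (rule V)
  next
    case (diff h k)
    then show ?case unfolding F_mult_diff_left by (intro Suc.prems(1))
  qed
  from this[OF f] show ?case unfolding F_pow_Suc F_mult_comm[OF pc fc] .
qed

definition Lq :: "('a \<times> 'b lat_elem) set" where "Lq = Sigma (verts Q) L"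

lemma finite_Lq: "finite Lq"
  unfolding Lq_def using fin_verts L_finite by auto

lemma supp_Lq: "supp V \<subseteq> Lq"
  by (auto simp: supp_def Lq_def)

abbreviation evr :: "'a \<times> 'b lat_elem \<Rightarrow> (('a, 'b, 'k) rep set \<Rightarrow>\<^sub>0 int) \<Rightarrow> int" where
  "evr p \<equiv> ev (\<lambda>V. rkdim Q V (fst p) (snd p))"

lemma evr_cls: "p \<in> Lq \<Longrightarrow> is_rep Q V \<Longrightarrow> evr p (cls V) = int (rkdim Q V (fst p) (snd p))"
  by (rule ev_cls) (auto simp: Lq_def intro!: rkdim_iso L_lat_at)

lemma evr_Rel:
  assumes "p \<in> Lq" "f \<in> Rel"
  shows "evr p f = 0"
  using assms(2)
proof (induction rule: Rel_induct)
  case (relator V W)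
  have "lat_at Q (fst p) (snd p)" "fst p \<in> verts Q" using assms(1) by (auto simp: Lq_def intro: L_lat_at)
  then show ?case using relator assms(1) by (simp add: ev_diff ev_add evr_cls is_rep_dsum rkdim_dsum)
qed (simp_all add: ev_zero ev_add ev_uminus)

lemma evr_cmul: "evr p (frag_cmul m f) = m * evr p f"
  unfolding ev_def by (simp add: frag_extend_cmul)

lemma evr_mult:
  assumes p: "p \<in> Lq" and fg: "f \<in> carrier F" "g \<in> carrier F"
  shows "evr p (f \<otimes>\<^bsub>F\<^esub> g) = evr p f * evr p g"
  using fg(1)
proof (induction f rule: F_induct)
  case (cls V)
  have M: "lat_at Q (fst p) (snd p)" using p by (auto simp: Lq_def intro: L_lat_at)
  show ?case using fg(2)
    by (induction g rule: F_induct)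
      (simp_all add: F_mult_zero ev_zero F_mult_cls evr_cls p cls rkdim_tensor[OF _ _ M] is_rep_tensor F_mult_diff_right ev_diff right_diff_distrib)
qed (simp_all add: F_mult_zero ev_zero F_mult_diff_left ev_diff left_diff_distrib)

definition below :: "('a \<times> 'b lat_elem) set \<Rightarrow> ('a, 'b, 'k) rep set" where
  "below D = {V. is_rep Q V \<and> supp V \<subseteq> D}"

lemma Span_power_step:
  assumes D: "D \<subseteq> Lq" "finite D" "D \<noteq> {}"
  obtains n :: nat and p X where "0 < n" "p \<in> D" "is_rep Q X" "rkdim Q X (fst p) (snd p) \<noteq> 0"
    "\<And>f. f \<in> Span (below D) \<Longrightarrow> f [^]\<^bsub>F\<^esub> n \<in> Span (insert X (below (D - {p})))"
proof -
  \<comment> \<open>Well-foundedness of the converse of \<open>par\<close> selects a vertex of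
    \<open>D\<close> whose neighbour towards the root is not in \<open>D\<close>.\<close>
  obtain x where x: "x \<in> fst ` D" "\<And>z. (z, x) \<in> par\<inverse> \<Longrightarrow> z \<notin> fst ` D"
  proof -
    have "wf (par\<inverse>)"
    proof (rule finite_acyclic_wf_converse)
      have "par = (\<lambda>a. (tail Q a, head Q a)) ` arcs Q" by (auto simp: par_def)
      then show "finite par" using fin_arcs by simp
      show "acyclic par" using acyc by (simp add: par_def)
    qed
    then show ?thesis using that D(3) by (metis image_is_empty wf_eq_minimal ex_in_conv)
  qed
  let ?Dx = "{M. (x, M) \<in> D}"
  have xv: "x \<in> verts Q" using x(1) D(1) by (auto simp: Lq_def)
  have "finite ?Dx"
  proof (rule finite_subset)
    show "?Dx \<subseteq> snd ` D" by force
  qed (use D(2) in simp)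
  moreover have "?Dx \<noteq> {}" using x(1) by auto
  moreover have "asymp_on ?Dx (\<lambda>M N. lat_le M N \<and> M \<noteq> N)" by (rule asymp_onI) (use lat_le_antisym in blast)
  moreover have "transp_on ?Dx (\<lambda>M N. lat_le M N \<and> M \<noteq> N)"
    by (rule transp_onI) (use lat_le_trans lat_le_antisym in blast)
  ultimately obtain M where M: "(x, M) \<in> D" "\<And>N. (x, N) \<in> D \<Longrightarrow> lat_le M N \<Longrightarrow> N = M"
    using Finite_Set.bex_max_element[of ?Dx "\<lambda>M N. lat_le M N \<and> M \<noteq> N"] by auto
  have Mx: "M \<in> L x" using M(1) D(1) by (auto simp: Lq_def)
  have outD: "(head Q a, N) \<notin> D" if "a \<in> arcs Q" "tail Q a = x" for a N
    using x(2)[of "head Q a"] parI[OF that(1)] that(2) by force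
  obtain n where n: "0 < n" "\<And>Vs :: ('a, 'b, 'k) rep list. length Vs = n \<Longrightarrow> list_all (is_rep Q) Vs \<Longrightarrow>
    (\<forall>V \<in> set Vs. \<forall>S \<in> L x. \<not> lat_le S M \<longrightarrow> (\<forall>u. rk Q V x S u \<longrightarrow> rk Q V x M u \<longrightarrow> u = 0\<^sub>m (rdim V x) 1)) \<Longrightarrow>
    paired x M (tensors Vs)"
    using tensors_paired[OF xv Mx] by blast
  \<comment> \<open>Ranks multiply, so a nonzero rank of the product forces a nonzero rank of its
    first factor; this is where the list must be nonempty.\<close>
  have supp_tensors: "supp (tensors Vs) \<subseteq> D" if "Vs \<noteq> []" "set Vs \<subseteq> below D" for Vs
  proof -
    obtain V Vs' where Vs: "Vs = V # Vs'" using \<open>Vs \<noteq> []\<close> by (cases Vs) auto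
    have V: "is_rep Q V" "supp V \<subseteq> D" using that Vs by (auto simp: below_def)
    have W: "is_rep Q (tensors Vs')" using that Vs by (intro is_rep_tensors) (auto simp: list_all_iff below_def)
    show ?thesis
    proof
      fix p assume p: "p \<in> supp (tensors Vs)"
      then obtain y N where y: "p = (y, N)" "y \<in> verts Q" "N \<in> L y" by (auto simp: supp_def)
      have "rkdim Q (tensors Vs) y N \<noteq> 0" using p y(1) supp_iff_rkdim[OF is_rep_tensor[OF V(1) W] y(2,3)] Vs by simp
      then have "rkdim Q V y N \<noteq> 0" using rkdim_tensor[OF V(1) W L_lat_at[OF y(2,3)]] Vs by simp
      then show "p \<in> D" using supp_iff_rkdim[OF V(1) y(2,3)] V(2) y(1) by blast
    qed
  qed
  have pair: "paired x M (tensors Vs)" if Vs: "length Vs = n" "set Vs \<subseteq> below D" for Vs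
  proof (rule n(2)[OF Vs(1)])
    show "list_all (is_rep Q) Vs" using Vs(2) by (auto simp: list_all_iff below_def)
    show "\<forall>V \<in> set Vs. \<forall>S \<in> L x. \<not> lat_le S M \<longrightarrow> (\<forall>u. rk Q V x S u \<longrightarrow> rk Q V x M u \<longrightarrow> u = 0\<^sub>m (rdim V x) 1)"
    proof (intro ballI allI impI)
      fix V S u assume V: "V \<in> set Vs" and S: "S \<in> L x" "\<not> lat_le S M" and u: "rk Q V x S u" "rk Q V x M u"
      \<comment> \<open>A vector in both rank spaces lies in the rank space of the join. The join is
        strictly above \<open>M\<close>, hence outside \<open>D\<close> by maximality, so the vector
        vanishes.\<close>
      have le: "lat_le M (lat_join M S)" "lat_le S (lat_join M S)" by (auto simp: lat_le_def lat_join_def)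
      have "lat_join M S \<noteq> M" using le(2) S(2) by metis
      then have "(x, lat_join M S) \<notin> D" using M(2) le(1) by blast
      then have "(x, lat_join M S) \<notin> supp V" using V Vs(2) by (auto simp: below_def)
      moreover have "rk Q V x (lat_join M S) u" using u by (simp add: rk_join)
      ultimately show "u = 0\<^sub>m (rdim V x) 1" using not_supp[OF xv L_join[OF xv Mx S(1)]] by blast
    qed
  qed
  have repG: "is_rep Q V" if "V \<in> below D" for V using that by (simp add: below_def)
  have main: "\<exists>X. is_rep Q X \<and> rkdim Q X x M \<noteq> 0 \<and>
    (\<forall>Y. is_rep Q Y \<longrightarrow> supp Y \<subseteq> D \<longrightarrow> paired x M Y \<longrightarrow> cls Y \<in> Span (insert X (below (D - {(x, M)}))))"
  proof (cases "\<exists>X :: ('a, 'b, 'k) rep. typed x M X \<and> supp X \<subseteq> D")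
    case False
    \<comment> \<open>Without a typed representation supported on \<open>D\<close>, a paired product
      has rank 0 at \<open>(x, M)\<close> and nothing has to be split off. \<open>unit_rep\<close>
      can serve as \<open>X\<close> since all its ranks are 1.\<close>
    have "cls Y \<in> Span (insert unit_rep (below (D - {(x, M)})))" if Y: "is_rep Q Y" "supp Y \<subseteq> D" "paired x M Y" for Y
    proof -
      have "(x, M) \<notin> supp Y"
      proof
        assume "(x, M) \<in> supp Y"
        then obtain u g where "rk Q Y x M u" "cork Q Y x M g" "g * u = 1\<^sub>m 1"
          by (rule paired_typed[OF Y(1) xv Mx Y(3)])
        then show False using False Y(1,2) unfolding typed_def by blast
      qed
      then have "Y \<in> below (D - {(x, M)})" using Y(1,2) by (auto simp: below_def)
      then show ?thesis by (intro Span.gen) simp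
    qed
    moreover have "rkdim Q (unit_rep :: ('a, 'b, 'k) rep) x M \<noteq> 0" by (simp add: rkdim_unit[OF L_lat_at[OF xv Mx]])
    ultimately show ?thesis using is_rep_unit by blast
  next
    case True
    then obtain X0 :: "('a, 'b, 'k) rep" where X0: "typed x M X0 \<and> supp X0 \<subseteq> D" by blast
    obtain X :: "('a, 'b, 'k) rep" where X: "typed x M X \<and> supp X \<subseteq> D"
      and min0: "\<And>X' :: ('a, 'b, 'k) rep. typed x M X' \<and> supp X' \<subseteq> D \<Longrightarrow> total_dim X \<le> total_dim X'"
      using exists_min_nat[of "\<lambda>X. typed x M X \<and> supp X \<subseteq> D" X0 total_dim] X0 by blast
    have rX: "is_rep Q X" and sX: "supp X \<subseteq> D" using X by (auto simp: typed_def)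
    obtain u0 g0 where u0: "rk Q X x M u0" "cork Q X x M g0" "g0 * u0 = 1\<^sub>m 1" using X by (auto simp: typed_def)
    have min: "total_dim X \<le> total_dim X'" if "typed x M X'" "supp X' \<subseteq> supp X" for X' :: "('a, 'b, 'k) rep"
      by (rule min0) (use that sX in blast)
    have outX: "rdim X (head Q a) = 0" if "a \<in> arcs Q" "tail Q a = x" for a
      by (rule rdim_zero_of_supp[OF head_in_verts[OF that(1)]]) (use outD[OF that] sX in blast)
    have "u0 \<noteq> 0\<^sub>m (rdim X x) 1"
    proof
      assume "u0 = 0\<^sub>m (rdim X x) 1"
      then have "g0 * u0 = 0\<^sub>m 1 1" using corkD(1)[OF u0(2)] by (simp add: mat_zero_right)
      then have "(1\<^sub>m 1 :: 'k mat) $$ (0, 0) = 0\<^sub>m 1 1 $$ (0, 0)" using u0(3) by metis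
      then show False by simp
    qed
    then have "(x, M) \<in> supp X" using xv Mx u0(1) by (auto simp: supp_def)
    then have nz: "rkdim Q X x M \<noteq> 0" using supp_iff_rkdim[OF rX xv Mx] by simp
    have "cls Y \<in> Span (insert X (below (D - {(x, M)})))" if Y: "is_rep Q Y" "supp Y \<subseteq> D" "paired x M Y" for Y
    proof -
      obtain m Y' where Y': "is_rep Q Y'" "supp Y' \<subseteq> D - {(x, M)}"
        "cls Y - (frag_cmul (int m) (cls X) + cls Y') \<in> Rel"
        using split_all[OF rX xv Mx u0 min outX outD Y(1,3,2)] by blast
      have 1: "cls X \<in> Span (insert X (below (D - {(x, M)})))" by (rule Span.gen) simp
      have 2: "cls Y' \<in> Span (insert X (below (D - {(x, M)})))" by (rule Span.gen) (use Y' in \<open>simp add: below_def\<close>)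
      have "cls Y = (cls Y - (frag_cmul (int m) (cls X) + cls Y')) + (frag_cmul (int m) (cls X) + cls Y')" by simp
      then show ?thesis using Span_add[OF Span.rel[OF Y'(3)] Span_add[OF Span_cmul_nat[OF 1, of m] 2]] by metis
    qed
    then show ?thesis using rX nz by blast
  qed
  then obtain X where X: "is_rep Q X" "rkdim Q X x M \<noteq> 0"
    "\<And>Y. is_rep Q Y \<Longrightarrow> supp Y \<subseteq> D \<Longrightarrow> paired x M Y \<Longrightarrow> cls Y \<in> Span (insert X (below (D - {(x, M)})))" by blast
  show ?thesis
  proof (rule that[of n "(x, M)" X])
    fix f assume f: "f \<in> Span (below D)"
    show "f [^]\<^bsub>F\<^esub> n \<in> Span (insert X (below (D - {(x, M)})))"
    proof (rule product_in[OF repG f])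
      fix Vs :: "('a, 'b, 'k) rep list" assume Vs: "length Vs = n" "set Vs \<subseteq> below D"
      have "is_rep Q (tensors Vs)" using Vs(2) repG by (intro is_rep_tensors) (auto simp: list_all_iff)
      moreover have "supp (tensors Vs) \<subseteq> D" by (rule supp_tensors) (use Vs n(1) in auto)
      ultimately show "cls (tensors Vs) \<in> Span (insert X (below (D - {(x, M)})))" using X(3) pair[OF Vs] by blast
    qed (auto intro: Span.intros)
  qed (use n(1) M(1) X in auto)
qed

lemma kernel_nilpotent:
  assumes "finite D" "D \<subseteq> Lq" "f \<in> Span (below D)" "\<And>p. p \<in> Lq \<Longrightarrow> evr p f = 0"
  shows "\<exists>n::nat. f [^]\<^bsub>F\<^esub> n \<in> Rel"
  using assms
proof (induction "card D" arbitrary: D f rule: less_induct)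
  case less
  have fc: "f \<in> carrier F" by (rule Span_closed[OF less.prems(3)]) (simp add: below_def)
  show ?case
  proof (cases "D = {}")
    \<comment> \<open>A representation with empty support is zero at every vertex, and its class is
      a relation. So \<open>f\<close> itself lies in \<open>Rel\<close>.\<close>
    case True
    have "f \<in> Rel" using less.prems(3)
    proof (induction rule: Span.induct)
      case (gen V)
      then have V: "is_rep Q V" "supp V = {}" using True by (auto simp: below_def)
      show ?case by (rule zero_rep_Rel[OF V(1)], rule rdim_zero_of_supp) (use V(2) in auto)
    qed (auto intro: Rel_diff)
    then have "f [^]\<^bsub>F\<^esub> (1::nat) \<in> Rel" using fc by simp
    then show ?thesis by blast
  next
    case False
    obtain n :: nat and p X where n: "0 < n" "p \<in> D" "is_rep Q X" "rkdim Q X (fst p) (snd p) \<noteq> 0"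
      "\<And>f. f \<in> Span (below D) \<Longrightarrow> f [^]\<^bsub>F\<^esub> n \<in> Span (insert X (below (D - {p})))"
      by (rule Span_power_step[OF less.prems(2,1) False]) (rule that; assumption)
    have pL: "p \<in> Lq" using n(2) less.prems(2) by blast
    obtain n' where n': "n = Suc n'" using n(1) by (cases n) auto
    have ev0: "evr q (f [^]\<^bsub>F\<^esub> n) = 0" if q: "q \<in> Lq" for q
      unfolding n' F_pow_Suc using evr_mult[OF q F.nat_pow_closed[OF fc] fc] less.prems(4)[OF q] by simp
    obtain m where m: "f [^]\<^bsub>F\<^esub> n - frag_cmul m (cls X) \<in> Span (below (D - {p}))"
      using Span_insert[OF n(5)[OF less.prems(3)]] by blast
    have evz: "evr p g = 0" if "g \<in> Span (below (D - {p}))" for g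
      using that
    proof (induction rule: Span.induct)
      case (rel f)
      then show ?case by (rule evr_Rel[OF pL])
    next
      case (gen V)
      then have V: "is_rep Q V" "p \<notin> supp V" by (auto simp: below_def)
      have "fst p \<in> verts Q" "snd p \<in> L (fst p)" using pL by (auto simp: Lq_def)
      then have "rkdim Q V (fst p) (snd p) = 0" using supp_iff_rkdim[OF V(1), of "fst p" "snd p"] V(2) by simp
      then show ?case using evr_cls[OF pL V(1)] by simp
    next
      case (diff f g)
      then show ?case by (simp add: ev_diff)
    qed
    have "m * int (rkdim Q X (fst p) (snd p)) = 0"
      using evz[OF m] ev0[OF pL] by (simp add: ev_diff evr_cmul evr_cls[OF pL n(3)])
    then have "m = 0" using n(4) by simp
    then have fn: "f [^]\<^bsub>F\<^esub> n \<in> Span (below (D - {p}))" using m by simp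
    have "card (D - {p}) < card D" by (rule psubset_card_mono) (use less.prems(1) n(2) in auto)
    from less.hyps[OF this _ _ fn ev0] less.prems(1,2)
    obtain k :: nat where "(f [^]\<^bsub>F\<^esub> n) [^]\<^bsub>F\<^esub> k \<in> Rel" by blast
    then have "f [^]\<^bsub>F\<^esub> (n * k) \<in> Rel" by (simp add: F.nat_pow_pow[OF fc])
    then show ?thesis by blast
  qed
qed

lemma F_Span: "f \<in> carrier F \<Longrightarrow> f \<in> Span (below Lq)"
proof (induction rule: F_induct)
  case (cls V)
  then show ?case by (intro Span.gen) (simp add: below_def supp_Lq)
qed (auto intro: Span_zero Span.diff)

lemma evr_kernel_nilpotent:
  "f \<in> carrier F \<Longrightarrow> (\<And>p. p \<in> Lq \<Longrightarrow> evr p f = 0) \<Longrightarrow> \<exists>n::nat. f [^]\<^bsub>F\<^esub> n \<in> Rel"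
  by (rule kernel_nilpotent[OF finite_Lq order_refl F_Span])

end

section \<open>Indecomposables attached to lattice elements\<close>

context rtree
begin

text \<open>The recursion for a vertex strictly on the far side of \<open>x\<close> from the root
  never meets \<open>x\<close> or an arrow touching it.\<close>

lemma rk_off_root:
  assumes "\<And>y. y \<noteq> x \<Longrightarrow> rdim W y = rdim V y"
    "\<And>a. a \<in> arcs Q \<Longrightarrow> head Q a \<noteq> x \<Longrightarrow> tail Q a \<noteq> x \<Longrightarrow> rmap W a = rmap V a"
  shows "lat_at Q y M \<Longrightarrow> (y, x) \<in> par\<^sup>+ \<Longrightarrow> rk Q V y M u \<Longrightarrow> rk Q W y M u"
proof (induction y M arbitrary: u rule: lat_at.induct)
  case (lat_atI M y)
  have y: "y \<noteq> x" using lat_atI.prems(1) par_acyclic by metis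
  show ?case
  proof (rule rkI, goal_cases)
    case 1
    show ?case using rk_carrier[OF lat_atI.prems(2)] assms(1)[OF y] by simp
  next
    case 2
    show ?case
    proof (intro allI impI)
      fix \<alpha> S assume S: "S |\<in>| component M \<alpha>"
      have a: "\<alpha> \<in> arcs Q" "head Q \<alpha> = y" using in_arcsD[OF lat_atI.hyps(1)[OF S]] by auto
      have p: "(tail Q \<alpha>, x) \<in> par\<^sup>+" using parI[OF a(1)] lat_atI.prems(1) unfolding a(2) by (rule trancl_into_trancl2)
      then have "tail Q \<alpha> \<noteq> x" using par_acyclic by metis
      then have e: "rmap W \<alpha> = rmap V \<alpha>" using assms(2)[OF a(1)] a(2) y by simp
      obtain v where "rk Q V (tail Q \<alpha>) S v" "u = rmap V \<alpha> * v" using rkD[OF lat_atI.prems(2) S] by blast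
      then show "\<exists>v. rk Q W (tail Q \<alpha>) S v \<and> u = rmap W \<alpha> * v" using lat_atI.IH[OF S p] e by auto
    qed
  qed
qed

text \<open>Only the pairing data are recorded: the generator of the line at \<open>x\<close>
  belongs to the rank space, and the coordinate functional to \<open>cork\<close>. Indecomposability
  itself is not part of the definition.\<close>

definition indec :: "'a \<Rightarrow> 'b lat_elem \<Rightarrow> ('a, 'b, 'k::field) rep \<Rightarrow> bool" where
  "indec x M X \<longleftrightarrow> is_rep Q X \<and> rdim X x = 1 \<and> (\<forall>y. (y, x) \<notin> par\<^sup>* \<longrightarrow> rdim X y = 0) \<and>
    rk Q X x M (1\<^sub>m 1) \<and> cork Q X x M (1\<^sub>m 1)"

text \<open>What remains of the representation to be built after the line at \<open>x\<close> is
  removed: \<open>Y\<close> is the part strictly beyond \<open>x\<close>, and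
  \<open>h \<alpha>\<close> will be the map into the line along \<open>\<alpha>\<close>.\<close>

definition radical :: "'a \<Rightarrow> ('b \<times> 'b lat_elem) set \<Rightarrow> ('a, 'b, 'k::field) rep \<Rightarrow> ('b \<Rightarrow> 'k mat) \<Rightarrow> bool" where
  "radical x A Y h \<longleftrightarrow> is_rep Q Y \<and> (\<forall>y. (y, x) \<notin> par\<^sup>+ \<longrightarrow> rdim Y y = 0) \<and>
    (\<forall>\<alpha> \<in> in_arcs Q x. sumcork Q Y (tail Q \<alpha>) {S. (\<alpha>, S) \<in> A} (h \<alpha>)) \<and>
    (\<forall>(\<alpha>, S) \<in> A. \<exists>u. rk Q Y (tail Q \<alpha>) S u \<and> h \<alpha> * u = 1\<^sub>m 1)"

text \<open>\<open>Y\<close> is the direct sum of one representation for each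
  \<open>(\<alpha>, S)\<close> in \<open>A\<close>, and \<open>h \<alpha>\<close> is the sum of the
  projections onto the lines of the summands belonging to \<open>\<alpha>\<close>. The vector for
  \<open>(\<alpha>, S)\<close> is the generator of the line of its own summand.\<close>

lemma radical_exists:
  assumes "finite A"
    "\<And>\<alpha> S. (\<alpha>, S) \<in> A \<Longrightarrow> \<alpha> \<in> in_arcs Q x \<and> lat_at Q (tail Q \<alpha>) S \<and> (\<exists>X :: ('a, 'b, 'k::field) rep. indec (tail Q \<alpha>) S X)"
  shows "\<exists>(Y :: ('a, 'b, 'k) rep) h. radical x A Y h"
  using assms
proof (induction A rule: finite_induct)
  case empty
  let ?Y = "\<lparr>rdim = \<lambda>_. 0, rmap = \<lambda>_. 0\<^sub>m 0 0\<rparr> :: ('a, 'b, 'k) rep"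
  have "sumcork Q ?Y y {} (0\<^sub>m 1 0)" for y using sumcork_zero[of Q ?Y y "{}"] by simp
  then have "radical x {} ?Y (\<lambda>_. 0\<^sub>m 1 0)" by (simp add: radical_def is_rep_def)
  then show ?case by blast
next
  case (insert p A)
  obtain \<beta> T where p: "p = (\<beta>, T)" by (cases p)
  obtain Y :: "('a, 'b, 'k) rep" and h where Y: "radical x A Y h" using insert.IH insert.prems by blast
  obtain X :: "('a, 'b, 'k) rep" where X: "indec (tail Q \<beta>) T X" and b: "\<beta> \<in> in_arcs Q x" and T: "lat_at Q (tail Q \<beta>) T"
    using insert.prems[of \<beta> T] p by blast
  have b': "\<beta> \<in> arcs Q" "head Q \<beta> = x" "tail Q \<beta> \<in> verts Q" using in_arcsD[OF b] by auto
  have rX: "is_rep Q X" "rdim X (tail Q \<beta>) = 1" "rk Q X (tail Q \<beta>) T (1\<^sub>m 1)" "cork Q X (tail Q \<beta>) T (1\<^sub>m 1)"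
    and zX: "\<And>y. (y, tail Q \<beta>) \<notin> par\<^sup>* \<Longrightarrow> rdim X y = 0" using X unfolding indec_def by blast+
  have rY: "is_rep Q Y" and zY: "\<And>y. (y, x) \<notin> par\<^sup>+ \<Longrightarrow> rdim Y y = 0"
    and sY: "\<And>\<alpha>. \<alpha> \<in> in_arcs Q x \<Longrightarrow> sumcork Q Y (tail Q \<alpha>) {S. (\<alpha>, S) \<in> A} (h \<alpha>)"
    and uY: "\<And>\<alpha> S. (\<alpha>, S) \<in> A \<Longrightarrow> \<exists>u. rk Q Y (tail Q \<alpha>) S u \<and> h \<alpha> * u = 1\<^sub>m 1"
    using Y unfolding radical_def by blast+
  let ?Z = "dsum_rep X Y"
  have rZ: "is_rep Q ?Z" by (rule is_rep_dsum[OF rX(1) rY])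
  obtain i1 p1 i2 p2 where bp: "biproduct Q ?Z X Y i1 p1 i2 p2" using dsum_biproduct[OF rX(1) rY] by blast
  note bp' = bp[unfolded biproduct_def]
  have hm: "rep_hom Q X ?Z i1" "rep_hom Q ?Z X p1" "rep_hom Q Y ?Z i2" "rep_hom Q ?Z Y p2" using bp' by auto
  have c: "i1 y \<in> carrier_mat (rdim ?Z y) (rdim X y)" "i2 y \<in> carrier_mat (rdim ?Z y) (rdim Y y)"
    "p1 y \<in> carrier_mat (rdim X y) (rdim ?Z y)" "p2 y \<in> carrier_mat (rdim Y y) (rdim ?Z y)" if "y \<in> verts Q" for y
    using hm that by (auto dest: rep_homD(1))
  have e: "p1 y * i1 y = 1\<^sub>m (rdim X y)" "p2 y * i2 y = 1\<^sub>m (rdim Y y)"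
    "p1 y * i2 y = 0\<^sub>m (rdim X y) (rdim Y y)" "p2 y * i1 y = 0\<^sub>m (rdim Y y) (rdim X y)" if "y \<in> verts Q" for y
    using bp' that by auto
  \<comment> \<open>The contribution of the new summand: its projection to the line for its own
    arrow, zero for all others.\<close>
  define k where "k \<alpha> = (if \<alpha> = \<beta> then p1 (tail Q \<beta>) else 0\<^sub>m 1 (rdim ?Z (tail Q \<alpha>)))" for \<alpha>
  define h' where "h' \<alpha> = k \<alpha> + h \<alpha> * p2 (tail Q \<alpha>)" for \<alpha>
  have kc: "k \<alpha> \<in> carrier_mat 1 (rdim ?Z (tail Q \<alpha>))" if "\<alpha> \<in> in_arcs Q x" for \<alpha>
    using c(3)[OF b'(3)] rX(2) by (auto simp: k_def)
  have hc: "h \<alpha> \<in> carrier_mat 1 (rdim Y (tail Q \<alpha>))" if "\<alpha> \<in> in_arcs Q x" for \<alpha>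
    by (rule sumcork_carrier[OF sY[OF that]])
  have "radical x (insert p A) ?Z h'"
    unfolding radical_def
  proof (intro conjI allI ballI impI)
    fix y assume y: "(y, x) \<notin> par\<^sup>+"
    have "(y, tail Q \<beta>) \<notin> par\<^sup>*"
    proof
      assume "(y, tail Q \<beta>) \<in> par\<^sup>*"
      then have "(y, x) \<in> par\<^sup>+" using parI[OF b'(1)] b'(2) rtrancl_into_trancl1 by metis
      then show False using y by blast
    qed
    then show "rdim ?Z y = 0" using zX zY[OF y] by (simp add: dsum_rep_def)
  next
    fix \<alpha> assume a: "\<alpha> \<in> in_arcs Q x"
    have t: "tail Q \<alpha> \<in> verts Q" using in_arcsD[OF a] by blast
    let ?S = "{S. (\<alpha>, S) \<in> insert p A}"
    have "sumcork Q ?Z (tail Q \<alpha>) {S. (\<alpha>, S) \<in> A} (h \<alpha> * p2 (tail Q \<alpha>))"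
      by (rule cork_hom(2)[OF rZ rY hm(4) sY[OF a] t])
    then have 1: "sumcork Q ?Z (tail Q \<alpha>) ?S (h \<alpha> * p2 (tail Q \<alpha>))" by (rule sumcork_mono) blast
    have 2: "sumcork Q ?Z (tail Q \<alpha>) ?S (k \<alpha>)"
    proof (cases "\<alpha> = \<beta>")
      case True
      have "cork Q ?Z (tail Q \<beta>) T (1\<^sub>m 1 * p1 (tail Q \<beta>))" by (rule cork_hom(1)[OF rZ rX(1) hm(2) rX(4) b'(3)])
      moreover have "1\<^sub>m 1 * p1 (tail Q \<beta>) = k \<alpha>" using c(3)[OF b'(3)] rX(2) True by (simp add: k_def mat_one_left)
      ultimately have "cork Q ?Z (tail Q \<alpha>) T (k \<alpha>)" using True by simp
      moreover have "T \<in> ?S" using p True by simp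
      ultimately show ?thesis by (rule sumcork_single[rotated])
    next
      case False
      then show ?thesis using sumcork_zero[of Q ?Z "tail Q \<alpha>" ?S] by (simp add: k_def)
    qed
    show "sumcork Q ?Z (tail Q \<alpha>) ?S (h' \<alpha>)" unfolding h'_def by (rule sumcork_plus[OF 2 1])
  next
    fix q assume q: "q \<in> insert p A"
    obtain \<alpha> S where qe: "q = (\<alpha>, S)" by (cases q)
    have a: "\<alpha> \<in> in_arcs Q x" and S: "lat_at Q (tail Q \<alpha>) S" using insert.prems[of \<alpha> S] q qe by blast+
    have t: "tail Q \<alpha> \<in> verts Q" using in_arcsD[OF a] by blast
    have "\<exists>u. rk Q ?Z (tail Q \<alpha>) S u \<and> h' \<alpha> * u = 1\<^sub>m 1"
    proof (cases "q = p")
      case True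
      then have ab: "\<alpha> = \<beta>" "S = T" using p qe by auto
      have c1: "(1\<^sub>m 1 :: 'k mat) \<in> carrier_mat (rdim X (tail Q \<beta>)) 1" using rX(2) by simp
      have "rk Q ?Z (tail Q \<beta>) T (i1 (tail Q \<beta>) * 1\<^sub>m 1)" by (rule rk_hom[OF rX(1) rZ hm(1) T b'(3) rX(3)])
      moreover have "h' \<beta> * (i1 (tail Q \<beta>) * 1\<^sub>m 1) = 1\<^sub>m 1"
      proof -
        have "h' \<beta> * (i1 (tail Q \<beta>) * 1\<^sub>m 1) = p1 (tail Q \<beta>) * (i1 (tail Q \<beta>) * 1\<^sub>m 1) + h \<beta> * (p2 (tail Q \<beta>) * (i1 (tail Q \<beta>) * 1\<^sub>m 1))"
          unfolding h'_def k_def using c[OF b'(3)] hc[OF b] c1 rX(2) by (simp add: mat_assoc mat_distrib_right)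
        then show ?thesis using c[OF b'(3)] hc[OF b] c1 rX(2)
          by (simp add: e(1,4)[OF b'(3)] mat_assoc_eq[OF e(1)[OF b'(3)]] mat_assoc_eq[OF e(4)[OF b'(3)]] mat_zero_left mat_zero_right mat_one_left mat_add_zero_right)
      qed
      ultimately show ?thesis using ab by blast
    next
      case False
      then obtain u where u: "rk Q Y (tail Q \<alpha>) S u" "h \<alpha> * u = 1\<^sub>m 1" using uY[of \<alpha> S] q qe by blast
      note uc = rk_carrier[OF u(1)]
      have "rk Q ?Z (tail Q \<alpha>) S (i2 (tail Q \<alpha>) * u)" by (rule rk_hom[OF rY rZ hm(3) S t u(1)])
      moreover have "h' \<alpha> * (i2 (tail Q \<alpha>) * u) = 1\<^sub>m 1"
      proof -
        have k0: "k \<alpha> * (i2 (tail Q \<alpha>) * u) = 0\<^sub>m 1 1"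
        proof (cases "\<alpha> = \<beta>")
          case True
          then show ?thesis using c[OF t] uc rX(2) by (simp add: k_def mat_assoc_eq[OF e(3)[OF b'(3)]] mat_zero_left)
        next
          case False
          then show ?thesis using c[OF t] uc by (simp add: k_def mat_zero_left)
        qed
        have "h' \<alpha> * (i2 (tail Q \<alpha>) * u) = k \<alpha> * (i2 (tail Q \<alpha>) * u) + h \<alpha> * (p2 (tail Q \<alpha>) * (i2 (tail Q \<alpha>) * u))"
          unfolding h'_def using c[OF t] hc[OF a] kc[OF a] uc by (simp add: mat_assoc mat_distrib_right)
        then show ?thesis using c[OF t] hc[OF a] uc u(2)
          by (simp add: k0 mat_assoc_eq[OF e(2)[OF t]] mat_one_left mat_add_zero_left)
      qed
      ultimately show ?thesis by blast
    qed
    then show "case q of (\<alpha>, S) \<Rightarrow> \<exists>u. rk Q ?Z (tail Q \<alpha>) S u \<and> h' \<alpha> * u = 1\<^sub>m 1" using qe by simp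
  qed (rule rZ)
  then show ?case by blast
qed

text \<open>A line is attached at \<open>x\<close>, with \<open>h\<close> as the incoming maps and
  zero as the outgoing one. The vectors with \<open>h \<alpha> * u = 1\<close> lift its generator,
  and the functionals \<open>h \<alpha>\<close> are sums of corank functionals by
  assumption.\<close>

lemma indec_step:
  fixes Y :: "('a, 'b, 'k::field) rep"
  assumes x: "x \<in> verts Q" and M: "lat_at Q x M" and Y: "radical x {(\<alpha>, S). S |\<in>| component M \<alpha>} Y h"
  shows "\<exists>X :: ('a, 'b, 'k) rep. indec x M X"
proof -
  let ?A = "{(\<alpha>, S). S |\<in>| component M \<alpha>}"
  have rY: "is_rep Q Y" and zY: "\<And>y. (y, x) \<notin> par\<^sup>+ \<Longrightarrow> rdim Y y = 0"
    and sY: "\<And>\<alpha>. \<alpha> \<in> in_arcs Q x \<Longrightarrow> sumcork Q Y (tail Q \<alpha>) {S. (\<alpha>, S) \<in> ?A} (h \<alpha>)"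
    and uY: "\<And>\<alpha> S. (\<alpha>, S) \<in> ?A \<Longrightarrow> \<exists>u. rk Q Y (tail Q \<alpha>) S u \<and> h \<alpha> * u = 1\<^sub>m 1"
    using Y unfolding radical_def by blast+
  define X :: "('a, 'b, 'k) rep" where "X = \<lparr>rdim = (rdim Y)(x := 1),
    rmap = (\<lambda>a. if head Q a = x then h a else if tail Q a = x then 0\<^sub>m (rdim Y (head Q a)) 1 else rmap Y a)\<rparr>"
  have nl: "head Q a \<noteq> tail Q a" if "a \<in> arcs Q" for a using not_below_head[OF that] by auto
  have hc: "h a \<in> carrier_mat 1 (rdim Y (tail Q a))" if "a \<in> arcs Q" "head Q a = x" for a
    by (rule sumcork_carrier[OF sY]) (use that in \<open>simp add: in_arcs_def\<close>)
  have Yx: "rdim Y x = 0" by (rule zY[OF par_acyclic])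
  have out: "rdim Y (head Q a) = 0" if "a \<in> arcs Q" "tail Q a = x" for a
  proof (rule zY)
    show "(head Q a, x) \<notin> par\<^sup>+" using not_below_head[OF that(1)] that(2) trancl_into_rtrancl by metis
  qed
  have rX: "is_rep Q X"
    unfolding is_rep_def
  proof
    fix a assume a: "a \<in> arcs Q"
    show "rmap X a \<in> carrier_mat (rdim X (head Q a)) (rdim X (tail Q a))"
      using hc[OF a] is_repD[OF rY a] nl[OF a] by (auto simp: X_def)
  qed
  \<comment> \<open>The line at \<open>x\<close> is a subrepresentation and \<open>Y\<close> is the
    quotient by it. Functionals pull back along this quotient map; rank vectors cannot be moved this
    way and are handled by \<open>rk_off_root\<close>.\<close>
  define q :: "'a \<Rightarrow> 'k mat" where "q y = (if y = x then 0\<^sub>m 0 1 else 1\<^sub>m (rdim Y y))" for y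
  have hq: "rep_hom Q X Y q"
    unfolding rep_hom_def
  proof (intro conjI ballI)
    fix a assume a: "a \<in> arcs Q"
    note r = is_repD[OF rY a]
    show "q (head Q a) * rmap X a = rmap Y a * q (tail Q a)"
    proof (cases "head Q a = x \<or> tail Q a = x")
      case True
      then show ?thesis
      proof
        assume h: "head Q a = x"
        have "rmap Y a \<in> carrier_mat 0 (rdim Y (tail Q a))" using r h Yx by simp
        then show ?thesis using h nl[OF a] hc[OF a h] by (intro eq_matI) (auto simp: q_def X_def)
      next
        assume t: "tail Q a = x"
        then show ?thesis using nl[OF a] r out[OF a t] by (intro eq_matI) (auto simp: q_def X_def)
      qed
    next
      case False
      then show ?thesis using r by (simp add: q_def X_def mat_one_left mat_one_right)
    qed
  qed (auto simp: q_def X_def Yx)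
  have "rk Q X x M (1\<^sub>m 1)"
  proof (rule rkI, goal_cases)
    case 1
    show ?case by (simp add: X_def)
  next
    case 2
    show ?case
    proof (intro allI impI)
      fix \<alpha> S assume S: "S |\<in>| component M \<alpha>"
      have "\<alpha> \<in> in_arcs Q x \<and> lat_at Q (tail Q \<alpha>) S" by (rule lat_at.cases[OF M]) (use S in blast)
      then have a: "\<alpha> \<in> in_arcs Q x" "lat_at Q (tail Q \<alpha>) S" by blast+
      have a': "\<alpha> \<in> arcs Q" "head Q \<alpha> = x" using in_arcsD[OF a(1)] by auto
      obtain u where u: "rk Q Y (tail Q \<alpha>) S u" "h \<alpha> * u = 1\<^sub>m 1" using uY[of \<alpha> S] S by blast
      have "rk Q X (tail Q \<alpha>) S u"
        by (rule rk_off_root[OF _ _ a(2) _ u(1), where x = x]) (use parI[OF a'(1)] a'(2) in \<open>auto simp: X_def\<close>)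
      then show "\<exists>v. rk Q X (tail Q \<alpha>) S v \<and> 1\<^sub>m 1 = rmap X \<alpha> * v" using u(2) a'(2) by (auto simp: X_def)
    qed
  qed
  moreover have "cork Q X x M (1\<^sub>m 1)"
  proof (rule corkI)
    show "\<forall>\<alpha> \<in> in_arcs Q x. sumcork Q X (tail Q \<alpha>) (fset (component M \<alpha>)) (1\<^sub>m 1 * rmap X \<alpha>)"
    proof
      fix \<alpha> assume a: "\<alpha> \<in> in_arcs Q x"
      have a': "\<alpha> \<in> arcs Q" "head Q \<alpha> = x" "tail Q \<alpha> \<in> verts Q" using in_arcsD[OF a] by auto
      have "sumcork Q X (tail Q \<alpha>) {S. (\<alpha>, S) \<in> ?A} (h \<alpha> * q (tail Q \<alpha>))"
        by (rule cork_hom(2)[OF rX rY hq sY[OF a] a'(3)])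
      moreover have "h \<alpha> * q (tail Q \<alpha>) = 1\<^sub>m 1 * rmap X \<alpha>"
        using hc[OF a'(1,2)] nl[OF a'(1)] a'(2) by (simp add: q_def X_def mat_one_left mat_one_right)
      ultimately show "sumcork Q X (tail Q \<alpha>) (fset (component M \<alpha>)) (1\<^sub>m 1 * rmap X \<alpha>)" by simp
    qed
  qed (simp add: X_def)
  moreover have "rdim X y = 0" if "(y, x) \<notin> par\<^sup>*" for y
    using that zY[of y] trancl_into_rtrancl[of y x par] by (auto simp: X_def)
  ultimately have "indec x M X" using rX by (simp add: indec_def X_def)
  then show ?thesis by blast
qed

lemma indec_exists: "x \<in> verts Q \<Longrightarrow> M \<in> L x \<Longrightarrow> \<exists>X :: ('a, 'b, 'k::field) rep. indec x M X"
proof (induction x arbitrary: M rule: vertex_induct)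
  case (step x)
  let ?A = "{(\<alpha>, S). S |\<in>| component M \<alpha>}"
  note m = L_component_mem[OF step.prems]
  have "finite (Sigma (in_arcs Q x) (\<lambda>\<alpha>. fset (component M \<alpha>)))" using finite_in_arcs by simp
  then have "finite ?A" by (rule finite_subset[rotated]) (use m(1) in auto)
  moreover have "\<alpha> \<in> in_arcs Q x \<and> lat_at Q (tail Q \<alpha>) S \<and> (\<exists>X :: ('a, 'b, 'k) rep. indec (tail Q \<alpha>) S X)"
    if "(\<alpha>, S) \<in> ?A" for \<alpha> S
  proof -
    have S: "S |\<in>| component M \<alpha>" using that by simp
    show ?thesis using m(1)[OF S] L_lat_at[OF m(3,2)[OF S]] step.IH[OF m(1,3,2)[OF S]] by blast
  qed
  ultimately obtain Y :: "('a, 'b, 'k) rep" and h where "radical x ?A Y h" using radical_exists by blast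
  then show ?case by (rule indec_step[OF step.prems(1) L_lat_at[OF step.prems]])
qed

text \<open>Let \<open>S\<close> be in a component of \<open>N\<close> and \<open>v\<close> a
  preimage of \<open>u\<close> for it. Since \<open>g * rmap V \<alpha>\<close> is nonzero on
  \<open>v\<close>, so is one of its summands, in \<open>cork\<close> of some \<open>T\<close> in
  the component of \<open>M\<close>. By induction \<open>S\<close> is below \<open>T\<close>, and
  components of \<open>M\<close> are order ideals.\<close>

lemma cork_rk_le:
  assumes V: "is_rep Q V"
  shows "x \<in> verts Q \<Longrightarrow> M \<in> L x \<Longrightarrow> N \<in> L x \<Longrightarrow> cork Q V x M g \<Longrightarrow> rk Q V x N u \<Longrightarrow> g * u \<noteq> 0\<^sub>m 1 1 \<Longrightarrow> lat_le N M"
proof (induction x arbitrary: M N g u rule: vertex_induct)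
  case (step x)
  show ?case
    unfolding lat_le_def
  proof (intro allI fsubsetI)
    fix \<alpha> S assume S: "S |\<in>| component N \<alpha>"
    note m = L_component_mem[OF step.prems(1,3) S]
    have a: "\<alpha> \<in> arcs Q" "head Q \<alpha> = x" using in_arcsD[OF m(1)] by auto
    obtain v where v: "rk Q V (tail Q \<alpha>) S v" "u = rmap V \<alpha> * v" using rkD[OF step.prems(5) S] by blast
    note vc = rk_carrier[OF v(1)]
    have "g * rmap V \<alpha> * v = g * u"
      using is_repD[OF V a(1)] a(2) corkD(1)[OF step.prems(4)] vc v(2) by (simp add: mat_assoc)
    then have "g * rmap V \<alpha> * v \<noteq> 0\<^sub>m 1 1" using step.prems(6) by simp
    then obtain T l where T: "T \<in> fset (component M \<alpha>)" "cork Q V (tail Q \<alpha>) T l" "l * v \<noteq> 0\<^sub>m 1 1"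
      using sumcork_pairing[OF corkD(2)[OF step.prems(4) m(1)] vc] by blast
    have T': "T \<in> L (tail Q \<alpha>)" using L_component_mem(2)[OF step.prems(1,2)] T(1) by blast
    have "lat_le S T" by (rule step.IH[OF m(1,3) T' m(2) T(2) v(1) T(3)])
    then show "S |\<in>| component M \<alpha>"
      using L_component(1)[OF step.prems(1,2) m(1)] T(1) m(2) unfolding order_ideals_def by blast
  qed
qed

text \<open>The rows of the unitriangular matrix: the diagonal entry is 1, and nonzero entries occur
  only on the branch of \<open>x\<close>, at \<open>x\<close> itself only for \<open>N\<close> below
  \<open>M\<close>. The last part is \<open>cork_rk_le\<close> for the identity functional.\<close>

lemma rkdim_indec:
  fixes X :: "('a, 'b, 'k::field) rep"
  assumes x: "x \<in> verts Q" and M: "M \<in> L x" and X: "indec x M X"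
  shows "rkdim Q X x M = 1"
    and "y \<in> verts Q \<Longrightarrow> N \<in> L y \<Longrightarrow> rkdim Q X y N \<noteq> 0 \<Longrightarrow> (y, x) \<in> par\<^sup>+ \<or> y = x \<and> lat_le N M"
proof -
  have r: "is_rep Q X" "rdim X x = 1" "rk Q X x M (1\<^sub>m 1)" "cork Q X x M (1\<^sub>m 1)"
    and z: "\<And>y. (y, x) \<notin> par\<^sup>* \<Longrightarrow> rdim X y = 0" using X unfolding indec_def by blast+
  have all: "rk Q X x M u" if u: "u \<in> carrier_mat 1 1" for u
  proof -
    have "rk Q X x M (u $$ (0, 0) \<cdot>\<^sub>m 1\<^sub>m 1)"
      using rk_subspace[OF r(1) L_lat_at[OF x M]] r(3) by (simp add: mat_subspace_def)
    moreover have "u $$ (0, 0) \<cdot>\<^sub>m 1\<^sub>m 1 = u" using u by (intro eq_matI) auto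
    ultimately show ?thesis by simp
  qed
  have "frame (rdim X x) {u. rk Q X x M u} 1 (1\<^sub>m 1) (1\<^sub>m 1)"
  proof -
    have "{u. rk Q X x M u} = carrier_mat 1 1" using all rk_carrier[of Q X x M] r(2) by auto
    moreover have "(\<lambda>z. 1\<^sub>m 1 * z) ` carrier_mat 1 1 = (carrier_mat 1 1 :: 'k mat set)" proof -
      have "1\<^sub>m 1 * z = z" if "z \<in> carrier_mat 1 1" for z :: "'k mat" using that by (simp add: mat_one_left)
      then have "(\<lambda>z. 1\<^sub>m 1 * z) ` carrier_mat 1 1 = (\<lambda>z :: 'k mat. z) ` carrier_mat 1 1" by (rule image_cong[OF refl])
      then show ?thesis by (simp only: image_ident)
    qed
    ultimately show ?thesis using r(2) by (simp add: frame_def mat_one_left)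
  qed
  then show "rkdim Q X x M = 1" by (rule rkdim_eqI)
  show "(y, x) \<in> par\<^sup>+ \<or> y = x \<and> lat_le N M" if y: "y \<in> verts Q" "N \<in> L y" "rkdim Q X y N \<noteq> 0"
  proof -
    obtain u where u: "rk Q X y N u" "u \<noteq> 0\<^sub>m (rdim X y) 1"
      using y(3) unfolding rkdim_eq_0_iff[OF r(1) L_lat_at[OF y(1,2)]] by blast
    note uc = rk_carrier[OF u(1)]
    have "(y, x) \<in> par\<^sup>*"
    proof (rule ccontr)
      assume "(y, x) \<notin> par\<^sup>*"
      then have "rdim X y = 0" by (rule z)
      then have "u = 0\<^sub>m (rdim X y) 1" using uc by (intro eq_matI) auto
      then show False using u(2) by blast
    qed
    moreover have "lat_le N M" if "y = x"
    proof (rule cork_rk_le[OF r(1) x M _ r(4)])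
      show "N \<in> L x" "rk Q X x N u" using y(2) u(1) that by simp_all
      show "1\<^sub>m 1 * u \<noteq> 0\<^sub>m 1 1" using uc u(2) that r(2) by (simp add: mat_one_left)
    qed
    ultimately show ?thesis by (auto simp: rtrancl_eq_or_trancl)
  qed
qed

end

section \<open>Surjectivity by back substitution\<close>

context rtree_over
begin

lemma evr_combination:
  assumes "finite A" "\<And>q. q \<in> A \<Longrightarrow> f q \<in> carrier F"
  shows "\<exists>g \<in> carrier F. \<forall>r. evr r g = (\<Sum>q\<in>A. c q * evr r (f q))"
  using assms
proof (induction A rule: finite_induct)
  case empty
  show ?case by (rule bexI[of _ "0"]) (simp_all add: ev_zero F_carrier)
next
  case (insert q A)
  obtain g where g: "g \<in> carrier F" "\<And>r. evr r g = (\<Sum>q\<in>A. c q * evr r (f q))"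
    using insert.IH insert.prems by blast
  have "frag_cmul (c q) (f q) \<in> carrier F"
    using insert.prems[of q] keys_cmul[of "c q" "f q"] by (auto simp: F_carrier)
  then have "frag_cmul (c q) (f q) + g \<in> carrier F" using g(1) by (rule F_closed(1))
  moreover have "evr r (frag_cmul (c q) (f q) + g) = (\<Sum>q\<in>insert q A. c q * evr r (f q))" for r
    using insert.hyps by (simp add: ev_add evr_cmul g(2))
  ultimately show ?case by blast
qed

text \<open>From the class of the representation for \<open>p\<close>, the other nonzero entries of
  its row are subtracted with the help of the indicator elements already constructed.\<close>

lemma evr_delta:
  "p \<in> Lq \<Longrightarrow> \<exists>f \<in> carrier F. \<forall>q \<in> Lq. evr q f = (if q = p then 1 else 0)"
proof -
  \<comment> \<open>The triangular order: first the position in the tree, then, at the same vertex,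
    the number of lattice elements below \<open>M\<close>, which turns the lattice order into a
    well-founded one.\<close>
  let ?m = "\<lambda>p :: 'a \<times> 'b lat_elem. (fst p, card {N \<in> L (fst p). lat_le N (snd p)})"
  have "wf (inv_image (par\<^sup>+ <*lex*> less_than) ?m)"
    by (intro wf_inv_image wf_lex_prod wf_trancl par_wf wf_less_than)
  then show "p \<in> Lq \<Longrightarrow> \<exists>f \<in> carrier F. \<forall>q \<in> Lq. evr q f = (if q = p then 1 else 0)"
  proof (induction p rule: wf_induct_rule)
    case (less p)
    obtain x M where p: "p = (x, M)" by (cases p)
    have x: "x \<in> verts Q" "M \<in> L x" using less.prems p by (auto simp: Lq_def)
    obtain X :: "('a, 'b, 'k) rep" where X: "indec x M X" using indec_exists[OF x] by blast
    have rX: "is_rep Q X" using X unfolding indec_def by blast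
    note d = rkdim_indec[OF x X]
    let ?c = "\<lambda>q. int (rkdim Q X (fst q) (snd q))"
    let ?D = "{q \<in> Lq. q \<noteq> p \<and> ?c q \<noteq> 0}"
    have "\<forall>q \<in> ?D. \<exists>f. f \<in> carrier F \<and> (\<forall>r \<in> Lq. evr r f = (if r = q then 1 else 0))"
    proof (rule ballI, unfold Bex_def[symmetric], rule less.IH)
      fix q assume q: "q \<in> ?D"
      obtain y N where qe: "q = (y, N)" by (cases q)
      have y: "y \<in> verts Q" "N \<in> L y" "rkdim Q X y N \<noteq> 0" using q qe by (auto simp: Lq_def)
      show "(q, p) \<in> inv_image (par\<^sup>+ <*lex*> less_than) ?m"
        using d(2)[OF y]
      proof
        assume "y = x \<and> lat_le N M"
        then have e: "y = x" "lat_le N M" by auto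
        have ne: "N \<noteq> M" using q qe p e(1) by auto
        have "{P \<in> L x. lat_le P N} \<subset> {P \<in> L x. lat_le P M}"
          using e(2) ne x(2) lat_le_trans lat_le_refl lat_le_antisym by blast
        then have "card {P \<in> L x. lat_le P N} < card {P \<in> L x. lat_le P M}"
          by (rule psubset_card_mono[rotated]) (simp add: L_finite[OF x(1)])
        then show ?thesis using qe p e(1) by simp
      qed (simp add: qe p)
    qed simp
    from bchoice[OF this] obtain f where f: "\<And>q. q \<in> ?D \<Longrightarrow> f q \<in> carrier F"
      "\<And>q r. q \<in> ?D \<Longrightarrow> r \<in> Lq \<Longrightarrow> evr r (f q) = (if r = q then 1 else 0)" by blast
    have fD: "finite ?D" using finite_Lq by simp
    have "\<exists>g \<in> carrier F. \<forall>r. evr r g = (\<Sum>q\<in>?D. ?c q * evr r (f q))"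
      by (rule evr_combination[OF fD]) (rule f(1))
    then obtain g where g: "g \<in> carrier F" "\<And>r. evr r g = (\<Sum>q\<in>?D. ?c q * evr r (f q))" by (elim bexE) (rule that, assumption, erule spec)
    have gr: "evr r g = (if r \<noteq> p then ?c r else 0)" if r: "r \<in> Lq" for r
    proof -
      have "evr r g = (\<Sum>q\<in>?D. if r = q then ?c q else 0)" unfolding g(2)
      proof (rule sum.cong[OF refl])
        fix q assume q: "q \<in> ?D"
        show "?c q * evr r (f q) = (if r = q then ?c q else 0)" unfolding f(2)[OF q r] by simp
      qed
      then show ?thesis using r by (simp only: sum.delta'[OF fD]) simp
    qed
    have "cls X - g \<in> carrier F" using cls_closed[OF rX] g(1) by (rule F_closed(2))
    moreover have "evr r (cls X - g) = (if r = p then 1 else 0)" if "r \<in> Lq" for r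
      using gr[OF that] d(1) by (auto simp: ev_diff evr_cls[OF that rX] p)
    ultimately show ?case by blast
  qed
qed

lemma evr_surj: "\<exists>f \<in> carrier F. \<forall>p \<in> Lq. evr p f = h p"
proof -
  have "\<forall>p \<in> Lq. \<exists>f. f \<in> carrier F \<and> (\<forall>q \<in> Lq. evr q f = (if q = p then 1 else 0))"
    unfolding Bex_def[symmetric] by (rule ballI) (rule evr_delta)
  from bchoice[OF this] obtain f where f: "\<And>p. p \<in> Lq \<Longrightarrow> f p \<in> carrier F"
    "\<And>p q. p \<in> Lq \<Longrightarrow> q \<in> Lq \<Longrightarrow> evr q (f p) = (if q = p then 1 else 0)" by blast
  have "\<exists>g \<in> carrier F. \<forall>r. evr r g = (\<Sum>q\<in>Lq. h q * evr r (f q))"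
    by (rule evr_combination[OF finite_Lq]) (rule f(1))
  then obtain g where g: "g \<in> carrier F" "\<And>r. evr r g = (\<Sum>q\<in>Lq. h q * evr r (f q))" by (elim bexE) (rule that, assumption, erule spec)
  have "evr r g = h r" if r: "r \<in> Lq" for r
  proof -
    have "evr r g = (\<Sum>q\<in>Lq. if r = q then h q else 0)" unfolding g(2)
    proof (rule sum.cong[OF refl])
      fix q assume q: "q \<in> Lq"
      show "h q * evr r (f q) = (if r = q then h q else 0)" unfolding f(2)[OF q r] by simp
    qed
    then show ?thesis using r by (simp add: sum.delta'[OF finite_Lq])
  qed
  then show ?thesis using g(1) by blast
qed

end

section \<open>Rooted trees\<close>

lemma doubled_simps [simp]:
  "verts (doubled Q) = verts Q" "arcs (doubled Q) = arcs Q \<times> UNIV"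
  "tail (doubled Q) (a, f) = (if f then tail Q a else head Q a)"
  "head (doubled Q) (a, f) = (if f then head Q a else tail Q a)"
  by (simp_all add: doubled_def)

lemma doubled_forward:
  "pre_digraph.awalk (doubled Q) u (map (\<lambda>a. (a, True)) p) v \<longleftrightarrow> pre_digraph.awalk Q u p v"
  "pre_digraph.awalk_verts (doubled Q) u (map (\<lambda>a. (a, True)) p) = pre_digraph.awalk_verts Q u p"
proof -
  have "pre_digraph.cas (doubled Q) u (map (\<lambda>a. (a, True)) p) v = pre_digraph.cas Q u p v"
    by (induction p arbitrary: u) (simp_all add: pre_digraph.cas.simps)
  then show "pre_digraph.awalk (doubled Q) u (map (\<lambda>a. (a, True)) p) v \<longleftrightarrow> pre_digraph.awalk Q u p v"
    by (auto simp: pre_digraph.awalk_def)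
  show "pre_digraph.awalk_verts (doubled Q) u (map (\<lambda>a. (a, True)) p) = pre_digraph.awalk_verts Q u p"
    by (induction p arbitrary: u) (simp_all add: pre_digraph.awalk_verts.simps)
qed

context fin_digraph
begin

lemma doubled_wf: "wf_digraph (doubled G)"
  by unfold_locales (auto split: if_splits)

text \<open>Together with \<open>doubled_forward\<close> this allows a directed walk to be followed
  by the reverse of another one, which is how undirected cycles will arise.\<close>

lemma doubled_backward:
  assumes "awalk u p v"
  shows "pre_digraph.awalk (doubled G) v (rev (map (\<lambda>a. (a, False)) p)) u"
    "pre_digraph.awalk_verts (doubled G) v (rev (map (\<lambda>a. (a, False)) p)) = rev (awalk_verts u p)"
proof -
  interpret D: wf_digraph "doubled G" by (rule doubled_wf)
  have "D.awalk v (rev (map (\<lambda>a. (a, False)) p)) u \<and> D.awalk_verts v (rev (map (\<lambda>a. (a, False)) p)) = rev (awalk_verts u p)"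
    using assms
  proof (induction p arbitrary: u)
    case Nil
    then show ?case by (auto simp: awalk_Nil_iff D.awalk_Nil_iff)
  next
    case (Cons e p)
    have e: "e \<in> arcs G" "u = tail G e" and w: "awalk (head G e) p v" using Cons.prems by (auto simp: awalk_Cons_iff)
    have 1: "D.awalk v (rev (map (\<lambda>a. (a, False)) p)) (head G e)"
      and 2: "D.awalk_verts v (rev (map (\<lambda>a. (a, False)) p)) = rev (awalk_verts (head G e) p)"
      using Cons.IH[OF w] by blast+
    have 3: "D.awalk (head G e) [(e, False)] u" using e D.arc_implies_awalk[of "(e, False)"] by (auto simp: arc_def D.awalk_Cons_iff D.awalk_Nil_iff)
    have "D.awalk v (rev (map (\<lambda>a. (a, False)) p) @ [(e, False)]) u" by (rule D.awalk_appendI[OF 1 3])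
    moreover have "D.awalk_verts v (rev (map (\<lambda>a. (a, False)) p) @ [(e, False)]) = rev (awalk_verts (head G e) p) @ [tail G e]"
      using D.awalk_verts_append[OF calculation] 2 by simp
    ultimately show ?case by simp
  qed
  then show "D.awalk v (rev (map (\<lambda>a. (a, False)) p)) u"
    "D.awalk_verts v (rev (map (\<lambda>a. (a, False)) p)) = rev (awalk_verts u p)" by blast+
qed

end

section \<open>The forest structure of a rooted tree quiver\<close>

locale rooted =
  fixes Q :: "('a, 'b) pre_digraph" and \<sigma> :: 'a
  assumes rooted: "rooted_tree Q \<sigma>"
begin

sublocale fin_digraph Q
  using rooted by (simp add: rooted_tree_def)

lemma no_cycle: "pre_digraph.cycle (doubled Q) p \<Longrightarrow> \<not> distinct (map fst p)"
  using rooted by (auto simp: rooted_tree_def underlying_tree_def)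

text \<open>A nonempty closed directed walk contains a directed cycle, and its forward copy is a
  cycle of the doubled quiver that uses no arrow twice.\<close>

lemma not_closed: "awalk u p u \<Longrightarrow> p = []"
proof (rule ccontr)
  assume "awalk u p u" "p \<noteq> []"
  then obtain c where "cycle c" using closed_w_imp_cycle by (auto simp: closed_w_def)
  then obtain u where c: "awalk u c u" "distinct (tl (awalk_verts u c))" "distinct c" "c \<noteq> []"
    unfolding cycle_conv by blast
  have "pre_digraph.cycle (doubled Q) (map (\<lambda>a. (a, True)) c)"
    unfolding pre_digraph.cycle_def by (rule exI[of _ u]) (simp add: doubled_forward c)
  moreover have "map fst (map (\<lambda>a. (a, True)) c) = c" by (simp add: comp_def)
  ultimately show False using no_cycle c(3) by metis
qed

lemma not_closed_reachable: "(x, x) \<notin> (arcs_ends Q)\<^sup>+"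
  using reachable1_awalk[of x x] not_closed by blast

lemma distinct_awalk: "awalk u p v \<Longrightarrow> distinct (awalk_verts u p)"
  using awalk_not_distinct_decomp not_closed by blast

text \<open>Following outgoing arrows must stop, as there are no directed cycles and finitely many
  arrows, and it can stop only at the unique sink.\<close>

lemma reachable_root: "x \<in> verts Q \<Longrightarrow> x \<rightarrow>\<^sup>*\<^bsub>Q\<^esub> \<sigma>"
proof -
  have "acyclic (arcs_ends Q)" using not_closed_reachable by (simp add: acyclic_def)
  moreover have "finite (arcs_ends Q)" by (simp add: arcs_ends_conv)
  ultimately have "wf ((arcs_ends Q)\<inverse>)" by (intro finite_acyclic_wf_converse)
  then show "x \<in> verts Q \<Longrightarrow> x \<rightarrow>\<^sup>*\<^bsub>Q\<^esub> \<sigma>"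
  proof (induction x rule: wf_induct_rule)
    case (less x)
    show ?case
    proof (cases "x = \<sigma>")
      case True
      then show ?thesis using less.prems by simp
    next
      case False
      then have "x \<notin> sinks Q" using rooted by (simp add: rooted_tree_def)
      then obtain a where a: "a \<in> arcs Q" "tail Q a = x" using less.prems by (auto simp: sinks_def out_arcs_def)
      then have d: "x \<rightarrow>\<^bsub>Q\<^esub> head Q a" by (auto simp: arcs_ends_conv)
      then have "head Q a \<rightarrow>\<^sup>*\<^bsub>Q\<^esub> \<sigma>" using less.IH a(1) by auto
      then show ?thesis by (rule adj_reachable_trans[OF d])
    qed
  qed
qed

text \<open>
  Two arrows out of a vertex, continued along shortest directed walks to a common vertex, would
  close up to an undirected cycle.
\<close>

lemma out_arc_unique:
  assumes ab: "a \<in> arcs Q" "b \<in> arcs Q" "tail Q a = tail Q b"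
  shows "a = b"
proof (rule ccontr)
  assume ne: "a \<noteq> b"
  define P where "P n \<longleftrightarrow> (\<exists>p q z. awalk (head Q a) p z \<and> awalk (head Q b) q z \<and> length p + length q = n)" for n
  obtain p0 q0 where "awalk (head Q a) p0 \<sigma>" "awalk (head Q b) q0 \<sigma>"
    using reachable_root[of "head Q a"] reachable_root[of "head Q b"] ab(1,2) by (auto simp: reachable_awalk)
  then have "P (length p0 + length q0)" unfolding P_def by blast
  then have "P (Least P)" by (rule LeastI)
  then obtain p q z where pz: "awalk (head Q a) p z" and qz: "awalk (head Q b) q z" and len: "length p + length q = Least P"
    unfolding P_def[of "Least P"] by blast
  have min: "length p + length q \<le> length p' + length q'" if "awalk (head Q a) p' z'" "awalk (head Q b) q' z'" for p' q' z'
    unfolding len by (rule Least_le) (use that in \<open>auto simp: P_def\<close>)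
  let ?vp = "awalk_verts (head Q a) p" and ?vq = "awalk_verts (head Q b) q"
  \<comment> \<open>The two walks have least total length, so cutting both at a common vertex cannot
    shorten them: they meet only at their end \<open>z\<close>.\<close>
  have common: "w = z" if w: "w \<in> set ?vp" "w \<in> set ?vq" for w
  proof -
    obtain p1 p2 where p: "p = p1 @ p2" "awalk (head Q a) p1 w" "awalk w p2 z" using awalk_decomp[OF pz w(1)] by blast
    obtain q1 q2 where q: "q = q1 @ q2" "awalk (head Q b) q1 w" "awalk w q2 z" using awalk_decomp[OF qz w(2)] by blast
    have "p2 = []" using min[OF p(2) q(2)] p(1) q(1) by simp
    then show ?thesis using p(3) by (simp add: awalk_Nil_iff)
  qed
  let ?x = "tail Q a"
  have A: "awalk ?x (a # p) z" "awalk ?x (b # q) z" using ab pz qz by (auto simp: awalk_Cons_iff)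
  have dp: "distinct (?x # ?vp)" and dq: "distinct (?x # ?vq)" using distinct_awalk[OF A(1)] distinct_awalk[OF A(2)] ab(3) by auto
  interpret D: wf_digraph "doubled Q" by (rule doubled_wf)
  let ?F = "map (\<lambda>a. (a, True)) (a # p)" and ?B = "rev (map (\<lambda>a. (a, False)) (b # q))"
  have W: "D.awalk ?x (?F @ ?B) ?x"
    by (rule D.awalk_appendI[OF iffD2[OF doubled_forward(1) A(1)] doubled_backward(1)[OF A(2)]])
  have lz: "last ?vq = z" using qz by simp
  have vq: "?vq = butlast ?vq @ [z]" using append_butlast_last_id[of ?vq] lz by simp
  have rq: "rev (?x # ?vq) = z # (rev (butlast ?vq) @ [?x])" by (subst vq) simp
  have V: "D.awalk_verts ?x (?F @ ?B) = ?x # ?vp @ rev (butlast ?vq) @ [?x]"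
  proof -
    have "D.awalk_verts ?x (?F @ ?B) = D.awalk_verts ?x ?F @ tl (D.awalk_verts (last (D.awalk_verts ?x ?F)) ?B)"
      by (rule D.awalk_verts_append[OF W])
    moreover have "D.awalk_verts ?x ?F = ?x # ?vp" using doubled_forward(2)[of Q ?x "a # p"] by simp
    moreover have "last (?x # ?vp) = z" using pz by simp
    moreover have "D.awalk_verts z ?B = rev (?x # ?vq)" using doubled_backward(2)[OF A(2)] ab(3) by simp
    ultimately show ?thesis unfolding rq by simp
  qed
  have zb: "z \<notin> set (butlast ?vq)"
  proof -
    have "distinct (butlast ?vq @ [z])" using dq vq by (metis distinct.simps(2))
    then show ?thesis by simp
  qed
  have dis: "set ?vp \<inter> set (butlast ?vq) = {}" using common zb by (auto dest: in_set_butlastD)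
  have "distinct (tl (D.awalk_verts ?x (?F @ ?B)))"
    unfolding V using dp dq dis by (auto dest: in_set_butlastD intro: distinct_butlast)
  then have "D.cycle (?F @ ?B)" unfolding D.cycle_def using W by (intro exI[of _ ?x]) auto
  moreover have "distinct (map fst (?F @ ?B))"
  proof -
    have "map fst (?F @ ?B) = (a # p) @ rev (b # q)" by (simp add: comp_def rev_map)
    moreover have "distinct (a # p)" "distinct (b # q)"
      using distinct_verts_imp_distinct[OF A(1) distinct_awalk[OF A(1)]] distinct_verts_imp_distinct[OF A(2) distinct_awalk[OF A(2)]] by blast+
    moreover have "a \<notin> set q" using awalk_verts_arc1[of a q "head Q b"] dq by auto
    moreover have "b \<notin> set p" using awalk_verts_arc1[of b p "head Q a"] dp ab(3) by auto
    \<comment> \<open>A shared arrow would have both ends equal to \<open>z\<close>, the only common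
      vertex, and would be a loop.\<close>
    moreover have "e \<notin> set q" if e: "e \<in> set p" for e
    proof
      assume e': "e \<in> set q"
      have "tail Q e = z" by (rule common) (use awalk_verts_arc1 e e' in auto)
      moreover have "head Q e = z" by (rule common) (use awalk_verts_arc2[OF pz e] awalk_verts_arc2[OF qz e'] in auto)
      moreover have "e \<in> arcs Q" using pz e by (auto simp: awalk_def)
      ultimately have "awalk z [e] z" by (auto simp: awalk_Cons_iff awalk_Nil_iff)
      then show False using not_closed by blast
    qed
    ultimately show ?thesis using ne by auto
  qed
  ultimately show False using no_cycle by blast
qed

lemma verts_to: "verts (subquiver_to Q x) = {y \<in> verts Q. y \<rightarrow>\<^sup>*\<^bsub>Q\<^esub> x}"
  by (simp add: subquiver_to_def)

lemma sub_reachable: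
  assumes "y \<rightarrow>\<^sup>*\<^bsub>Q\<^esub> z" "z \<rightarrow>\<^sup>*\<^bsub>Q\<^esub> x"
  shows "y \<rightarrow>\<^sup>*\<^bsub>subquiver_to Q x\<^esub> z"
proof -
  have w: "wf_digraph (subquiver_to Q x)" unfolding subquiver_to_def by (rule wellformed_induce_subgraph)
  interpret S: wf_digraph "subquiver_to Q x" by (rule w)
  show ?thesis
    using assms(1)
  proof (induction rule: converse_reachable_induct)
    case base
    then show ?case using assms(2) by (intro S.reachable_refl) (simp add: verts_to)
  next
    case (step u v)
    obtain e where e: "e \<in> arcs Q" "tail Q e = u" "head Q e = v" using step(1) by (auto simp: arcs_ends_conv)
    have v: "v \<rightarrow>\<^sup>*\<^bsub>Q\<^esub> x" by (rule reachable_trans[OF step(2) assms(2)])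
    have "u \<rightarrow>\<^sup>*\<^bsub>Q\<^esub> x" by (rule adj_reachable_trans[OF step(1) v])
    then have "e \<in> arcs (subquiver_to Q x)" using e v by (auto simp: subquiver_to_def)
    then have "u \<rightarrow>\<^bsub>subquiver_to Q x\<^esub> v" using e by (auto simp: arcs_ends_conv subquiver_to_def)
    then show ?case using step(3) by (rule S.adj_reachable_trans)
  qed
qed

text \<open>Every vertex has a path to \<open>x\<close> that stays inside, which gives connectedness
  and excludes other sinks; undirected cycles would survive in \<open>Q\<close>, and an arrow
  leaving \<open>x\<close> would close a directed cycle.\<close>

lemma rooted_sub:
  assumes x: "x \<in> verts Q"
  shows "rooted_tree (subquiver_to Q x) x"
proof -
  let ?S = "subquiver_to Q x"
  have sg: "subgraph ?S Q" unfolding subquiver_to_def by (rule subgraphI) (simp_all add: compatible_def wellformed_induce_subgraph wf_digraph_axioms subset_iff)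
  have fd: "fin_digraph ?S"
  proof (intro fin_digraph.intro fin_digraph_axioms.intro)
    show "wf_digraph ?S" unfolding subquiver_to_def by (rule wellformed_induce_subgraph)
  qed (simp_all add: subquiver_to_def)
  interpret S: fin_digraph ?S by (rule fd)
  have rx: "y \<rightarrow>\<^sup>*\<^bsub>?S\<^esub> x" if "y \<in> verts ?S" for y
    using that x by (intro sub_reachable) (auto simp: verts_to)
  have "Digraph_Component.connected ?S"
    unfolding connected_def strongly_connected_def
  proof (intro conjI ballI)
    show "verts (with_proj (mk_symmetric ?S)) \<noteq> {}" using x by (auto simp: verts_to)
    fix u v assume "u \<in> verts (with_proj (mk_symmetric ?S))" "v \<in> verts (with_proj (mk_symmetric ?S))"
    then have "u \<rightarrow>\<^sup>*\<^bsub>with_proj (mk_symmetric ?S)\<^esub> x" "v \<rightarrow>\<^sup>*\<^bsub>with_proj (mk_symmetric ?S)\<^esub> x"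
      using S.reachable_mk_symmetricI[OF rx] by auto
    moreover have "x \<rightarrow>\<^sup>*\<^bsub>with_proj (mk_symmetric ?S)\<^esub> v"
      by (rule symmetric_reachable[OF symmetric_mk_symmetric calculation(2)])
    moreover have "wf_digraph (with_proj (mk_symmetric ?S))"
    proof -
      interpret P: pair_wf_digraph "mk_symmetric ?S" by (rule S.wellformed_mk_symmetric)
      show ?thesis by (rule P.wf_digraph_axioms)
    qed
    ultimately show "u \<rightarrow>\<^sup>*\<^bsub>with_proj (mk_symmetric ?S)\<^esub> v" by (metis wf_digraph.reachable_trans)
  qed
  moreover have "\<not> (\<exists>p. pre_digraph.cycle (doubled ?S) p \<and> distinct (map fst p))"
  proof
    assume "\<exists>p. pre_digraph.cycle (doubled ?S) p \<and> distinct (map fst p)"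
    then obtain p where p: "pre_digraph.cycle (doubled ?S) p" "distinct (map fst p)" by blast
    interpret D: wf_digraph "doubled Q" by (rule doubled_wf)
    have "subgraph (doubled ?S) (doubled Q)"
    proof (rule subgraphI)
      show "compatible (doubled Q) (doubled ?S)"
        unfolding compatible_def doubled_def subquiver_to_def induce_subgraph_tail induce_subgraph_head by simp
      show "wf_digraph (doubled ?S)" by (rule S.doubled_wf)
    qed (use D.wf_digraph_axioms in \<open>auto simp: subquiver_to_def\<close>)
    then have "pre_digraph.cycle (doubled Q) p" using D.subgraph_cycle p(1) by blast
    then show False using no_cycle p(2) by blast
  qed
  moreover have "sinks ?S = {x}"
  proof (intro equalityI subsetI)
    fix y assume y: "y \<in> sinks ?S"
    then have yS: "y \<in> verts ?S" and no: "out_arcs ?S y = {}" by (auto simp: sinks_def)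
    show "y \<in> {x}"
    proof (rule ccontr)
      assume "y \<notin> {x}"
      then have "(y, x) \<in> (arcs_ends ?S)\<^sup>+" using rx[OF yS] S.reachable_neq_reachable1 by blast
      then obtain z where "(y, z) \<in> arcs_ends ?S" by (meson tranclD)
      then show False using no by (auto simp: arcs_ends_conv out_arcs_def)
    qed
  next
    fix y assume "y \<in> {x}"
    then have y: "y = x" by simp
    have "out_arcs ?S x = {}"
    proof (rule ccontr)
      assume "out_arcs ?S x \<noteq> {}"
      then obtain e where "e \<in> arcs Q" "tail Q e = x" "head Q e \<rightarrow>\<^sup>*\<^bsub>Q\<^esub> x"
        by (auto simp: out_arcs_def subquiver_to_def)
      then have "(x, head Q e) \<in> arcs_ends Q" "(head Q e, x) \<in> (arcs_ends Q)\<^sup>*"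
        by (auto simp: arcs_ends_conv intro: reachable_rtranclI)
      then show False using not_closed_reachable rtrancl_into_trancl2 by metis
    qed
    then show "y \<in> sinks ?S" using y x by (simp add: sinks_def verts_to)
  qed
  ultimately show ?thesis using fd by (simp add: rooted_tree_def underlying_tree_def)
qed

lemma sub_sub:
  assumes "y \<rightarrow>\<^sup>*\<^bsub>Q\<^esub> x"
  shows "subquiver_to (subquiver_to Q x) y = subquiver_to Q y"
proof -
  let ?S = "subquiver_to Q x"
  have w: "subgraph ?S Q" unfolding subquiver_to_def by (rule subgraphI) (simp_all add: compatible_def wellformed_induce_subgraph wf_digraph_axioms subset_iff)
  have v: "{z \<in> verts ?S. z \<rightarrow>\<^sup>*\<^bsub>?S\<^esub> y} = {z \<in> verts Q. z \<rightarrow>\<^sup>*\<^bsub>Q\<^esub> y}"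
  proof (intro equalityI subsetI)
    fix z assume "z \<in> {z \<in> verts ?S. z \<rightarrow>\<^sup>*\<^bsub>?S\<^esub> y}"
    then show "z \<in> {z \<in> verts Q. z \<rightarrow>\<^sup>*\<^bsub>Q\<^esub> y}" using pre_digraph.reachable_mono[OF _ w] by (auto simp: verts_to)
  next
    fix z assume "z \<in> {z \<in> verts Q. z \<rightarrow>\<^sup>*\<^bsub>Q\<^esub> y}"
    then show "z \<in> {z \<in> verts ?S. z \<rightarrow>\<^sup>*\<^bsub>?S\<^esub> y}"
      using sub_reachable[OF _ assms, of z] reachable_trans[OF _ assms, of z] by (auto simp: verts_to)
  qed
  have sub: "z \<rightarrow>\<^sup>*\<^bsub>Q\<^esub> x" if "z \<rightarrow>\<^sup>*\<^bsub>Q\<^esub> y" for z by (rule reachable_trans[OF that assms])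
  show ?thesis
    unfolding subquiver_to_def[of ?S y] v unfolding subquiver_to_def induce_subgraph_def using sub by auto
qed

text \<open>By \<open>sub_sub\<close> the branch at a tail is the same whether it is formed in
  \<open>Q\<close> or in the branch at \<open>x\<close>, so the recursion can be stated without
  changing the quiver.\<close>

lemma vertex_lattice_rec:
  assumes x: "x \<in> verts Q"
  shows "vertex_lattice Q x = {Fam M | M. \<forall>\<alpha>. if \<alpha> \<in> in_arcs Q x
      then fset (M \<alpha>) \<in> order_ideals lat_le (vertex_lattice Q (tail Q \<alpha>)) else M \<alpha> = {||}}"
proof -
  let ?S = "subquiver_to Q x"
  have t: "tail Q \<alpha> \<rightarrow>\<^sup>*\<^bsub>Q\<^esub> x" if "\<alpha> \<in> in_arcs Q x" for \<alpha>
    using that by (intro reachable_adjI) (auto simp: in_arcs_def arcs_ends_conv)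
  have a: "in_arcs ?S x = in_arcs Q x"
    using t x by (auto simp: in_arcs_def subquiver_to_def)
  have tS: "tail ?S = tail Q" by (simp add: subquiver_to_def)
  have s: "subquiver_to ?S (tail Q \<alpha>) = subquiver_to Q (tail Q \<alpha>)" if "\<alpha> \<in> in_arcs Q x" for \<alpha>
    by (rule sub_sub[OF t[OF that]])
  have e: "(if \<alpha> \<in> in_arcs Q x
      then fset (M \<alpha>) \<in> order_ideals lat_le (root_lattice (subquiver_to ?S (tail ?S \<alpha>)) (tail ?S \<alpha>)) else M \<alpha> = {||}) =
    (if \<alpha> \<in> in_arcs Q x
      then fset (M \<alpha>) \<in> order_ideals lat_le (root_lattice (subquiver_to Q (tail Q \<alpha>)) (tail Q \<alpha>)) else M \<alpha> = {||})" for M \<alpha>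
    unfolding tS by (rule if_cong[OF refl]) (simp_all only: s)
  show ?thesis
    unfolding vertex_lattice_def root_lattice.simps[of ?S x] if_P[OF rooted_sub[OF x]] a e ..
qed

sublocale rtree Q "vertex_lattice Q"
proof
  show "acyclic {(tail Q a, head Q a) |a. a \<in> arcs Q}"
  proof -
    have "{(tail Q a, head Q a) |a. a \<in> arcs Q} = arcs_ends Q" by (auto simp: arcs_ends_conv)
    then show ?thesis using not_closed_reachable by (simp add: acyclic_def)
  qed
  show "a = b" if "a \<in> arcs Q" "b \<in> arcs Q" "tail Q a = tail Q b" for a b using that by (rule out_arc_unique)
  show "vertex_lattice Q x = {Fam M | M. \<forall>\<alpha>. if \<alpha> \<in> in_arcs Q x
      then fset (M \<alpha>) \<in> order_ideals lat_le (vertex_lattice Q (tail Q \<alpha>)) else M \<alpha> = {||}}" if "x \<in> verts Q" for x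
    using that by (rule vertex_lattice_rec)
qed simp_all

end

section \<open>Rank functions of reduced quivers\<close>

text \<open>Connects the vectors used for rank spaces in the statement with the one-column matrices
  used throughout the proof.\<close>

definition col_mat :: "'k :: field vec \<Rightarrow> 'k mat" where
  "col_mat v = mat (dim_vec v) 1 (\<lambda>(i, j). v $ i)"

lemma col_mat_carrier: "col_mat v \<in> carrier_mat n 1 \<longleftrightarrow> v \<in> carrier_vec n"
  by (auto simp: col_mat_def)

lemma col_mat_mult: "A \<in> carrier_mat m n \<Longrightarrow> v \<in> carrier_vec n \<Longrightarrow> col_mat (A *\<^sub>v v) = A * col_mat v"
  by (intro eq_matI) (auto simp: col_mat_def scalar_prod_def)

lemma col_mat_add: "u \<in> carrier_vec n \<Longrightarrow> v \<in> carrier_vec n \<Longrightarrow> col_mat (u + v) = col_mat u + col_mat v"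
  by (intro eq_matI) (auto simp: col_mat_def)

lemma col_mat_smult: "col_mat (c \<cdot>\<^sub>v v) = c \<cdot>\<^sub>m col_mat v"
  by (intro eq_matI) (auto simp: col_mat_def)

lemma col_mat_zero: "col_mat (0\<^sub>v n) = 0\<^sub>m n 1"
  by (intro eq_matI) (auto simp: col_mat_def)

lemma col_mat_inject: "col_mat u = col_mat v \<longleftrightarrow> u = v"
proof
  assume e: "col_mat u = col_mat v"
  have d: "dim_vec u = dim_vec v" using arg_cong[OF e, of dim_row] by (simp add: col_mat_def)
  show "u = v"
  proof (rule eq_vecI[OF _ d])
    fix i assume "i < dim_vec v"
    then show "u $ i = v $ i" using arg_cong[OF e, of "\<lambda>A. A $$ (i, 0)"] d by (simp add: col_mat_def)
  qed
qed simp

lemma col_mat_surj: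
  assumes "A \<in> carrier_mat n 1"
  obtains v where "v \<in> carrier_vec n" "col_mat v = A"
proof (rule that[of "col A 0"])
  show "col_mat (col A 0) = A" using assms by (intro eq_matI) (auto simp: col_mat_def)
qed (use assms in auto)

lemma vec_subspaceI:
  fixes U :: "'k::field vec set"
  assumes "mat_subspace n A"
  shows "VectorSpace.subspace class_ring {v. col_mat v \<in> A} (module_vec TYPE('k) n)"
proof -
  note a = assms[unfolded mat_subspace_def]
  have c: "v \<in> carrier_vec n" if "col_mat v \<in> A" for v using a that col_mat_carrier by blast
  have "submodule class_ring {v. col_mat v \<in> A} (module_vec TYPE('k) n)"
  proof (rule submodule.intro)
    show "module class_ring (module_vec TYPE('k) n)" by (rule vec_module)
  qed (use a c in \<open>auto simp: module_vec_simps col_mat_add[of _ n] col_mat_smult col_mat_zero class_ring_simps\<close>)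
  then show ?thesis by (intro subspace.intro vec_vs)
qed

text \<open>Multiplication by \<open>B\<close> is a linear bijection from the coordinate space of
  dimension \<open>r\<close>, with inverse given by \<open>C\<close>.\<close>

lemma dim_frame:
  fixes A :: "'k::field mat set"
  assumes f: "frame n A r B C" and s: "mat_subspace n A"
  shows "vectorspace.dim class_ring ((module_vec TYPE('k) n)\<lparr>carrier := {v. col_mat v \<in> A}\<rparr>) = r"
proof -
  note b = frameD[OF f]
  let ?V = "module_vec TYPE('k) r" and ?W = "(module_vec TYPE('k) n)\<lparr>carrier := {v. col_mat v \<in> A}\<rparr>"
  have W: "vectorspace class_ring ?W" by (rule vectorspace.subspace_is_vs[OF vec_vs vec_subspaceI[OF s]])
  have into: "col_mat (B *\<^sub>v z) \<in> A" if "z \<in> carrier_vec r" for z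
    unfolding col_mat_mult[OF b(1) that] b(4) by (rule imageI) (simp only: col_mat_carrier that)
  have "(\<lambda>z. B *\<^sub>v z) \<in> module_hom class_ring ?V ?W"
    using b(1) into by (auto simp: module_hom_def module_vec_simps mult_add_distrib_mat_vec mult_mat_vec)
  then interpret linear_map class_ring ?V ?W "\<lambda>z. B *\<^sub>v z"
    by (intro linear_map.intro mod_hom.intro mod_hom_axioms.intro vec_vs W vec_module vectorspace.axioms(1)[OF W])
  have inj: "inj_on (\<lambda>z. B *\<^sub>v z) (carrier ?V)"
  proof (rule inj_onI)
    fix z w assume "z \<in> carrier ?V" "w \<in> carrier ?V" and e: "B *\<^sub>v z = B *\<^sub>v w"
    then have z: "z \<in> carrier_vec r" "w \<in> carrier_vec r" by (simp_all add: module_vec_simps)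
    have "C *\<^sub>v (B *\<^sub>v v) = v" if "v \<in> carrier_vec r" for v
      using assoc_mult_mat_vec[OF b(2,1) that] b(3) that by simp
    then show "z = w" using e z by metis
  qed
  have surj: "(\<lambda>z. B *\<^sub>v z) ` carrier ?V = carrier ?W"
  proof (intro equalityI subsetI)
    fix v assume "v \<in> carrier ?W"
    then have v: "col_mat v \<in> A" by simp
    then obtain Z where Z: "Z \<in> carrier_mat r 1" "col_mat v = B * Z" using f by (auto simp: frame_def)
    obtain z where z: "z \<in> carrier_vec r" "col_mat z = Z" by (rule col_mat_surj[OF Z(1)])
    have "v = B *\<^sub>v z" using col_mat_mult[OF b(1) z(1)] Z(2) z(2) col_mat_inject by metis
    then show "v \<in> (\<lambda>z. B *\<^sub>v z) ` carrier ?V" using z(1) by (simp add: module_vec_simps)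
  qed (use into in \<open>auto simp: module_vec_simps\<close>)
  have fd: "vectorspace.fin_dim class_ring ?V" by (rule vec_space.fin_dim)
  have "vectorspace.dim class_ring ?V = vectorspace.dim class_ring ?W" by (rule dim_eq[OF fd inj surj])
  then show ?thesis using vec_space.dim_is_n[of r, where 'a = 'k] by metis
qed

section \<open>The greatest subrepresentation with surjective maps on a reduced quiver\<close>

text \<open>A direct description of the vertices of the reduced quiver. Lists grow at the end when
  one moves away from the root, hence the inductions from the right below.\<close>

fun chain :: "'b lat_elem \<Rightarrow> 'b red_path \<Rightarrow> bool" where
  "chain M [] \<longleftrightarrow> True"
| "chain M ((\<alpha>, S) # p) \<longleftrightarrow> S \<in> maximal_elements lat_le (fset (component M \<alpha>)) \<and> chain S p"

text \<open>The lattice element governing the reduced quiver beyond the vertex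
  \<open>p\<close>.\<close>

definition end_lat :: "'b lat_elem \<Rightarrow> 'b red_path \<Rightarrow> 'b lat_elem" where
  "end_lat M p = (if p = [] then M else snd (last p))"

lemma end_lat_simps [simp]: "end_lat M [] = M" "end_lat M (p @ [(\<alpha>, S)]) = S"
  by (simp_all add: end_lat_def)

lemma chain_snoc:
  "chain M (p @ [(\<alpha>, S)]) \<longleftrightarrow> chain M p \<and> S \<in> maximal_elements lat_le (fset (component (end_lat M p) \<alpha>))"
proof (induction M p rule: chain.induct)
  case (2 M \<beta> T p)
  have "end_lat M ((\<beta>, T) # p) = end_lat T p" by (simp add: end_lat_def)
  then show ?case using 2 by simp
qed simp

lemma red_quiver_verts: "verts (red_quiver M) = {p. chain M p}"
proof -
  have "p \<in> verts (red_quiver M) \<longleftrightarrow> chain M p" for p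
  proof (induction M p rule: chain.induct)
    case (1 M)
    then show ?case by (subst red_quiver.simps) (simp add: Let_def)
  next
    case (2 M \<alpha> S p)
    then show ?case by (subst red_quiver.simps) (auto simp: Let_def)
  qed
  then show ?thesis by auto
qed

lemma red_quiver_arcs: "arcs (red_quiver M) = {p. chain M p \<and> p \<noteq> []}"
proof -
  have "p \<in> arcs (red_quiver M) \<longleftrightarrow> chain M p \<and> p \<noteq> []" for p
  proof (induction M p rule: chain.induct)
    case (1 M)
    then show ?case by (subst red_quiver.simps) (auto simp: Let_def)
  next
    case (2 M \<alpha> S p)
    have "(\<alpha>, S) # p \<in> arcs (red_quiver M) \<longleftrightarrow> S \<in> maximal_elements lat_le (fset (component M \<alpha>)) \<and>
      (p = [] \<or> p \<in> arcs (red_quiver S))"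
      by (subst red_quiver.simps) (auto simp: Let_def)
    then show ?case using 2 by auto
  qed
  then show ?thesis by auto
qed

lemma red_quiver_ends [simp]: "tail (red_quiver M) p = p" "head (red_quiver M) p = butlast p"
  by (subst red_quiver.simps, simp add: Let_def)+

lemma struct_simps [simp]:
  "struct_vert Q x [] = x" "struct_vert Q x (p @ [(\<alpha>, S)]) = tail Q \<alpha>" "struct_arc (p @ [(\<alpha>, S)]) = \<alpha>"
  by (simp_all add: struct_vert_def struct_arc_def)

lemma pullback_simps [simp]: "rdim (pullback c d V) p = rdim V (c p)" "rmap (pullback c d V) p = rmap V (d p)"
  by (simp_all add: pullback_def)

lemma maximal_above:
  assumes "finite I" "S \<in> I"
  obtains T where "T \<in> maximal_elements lat_le I" "lat_le S T"
proof -
  have "asymp_on {T \<in> I. lat_le S T} (\<lambda>M N. lat_le M N \<and> M \<noteq> N)"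
    by (rule asymp_onI) (use lat_le_antisym in blast)
  moreover have "transp_on {T \<in> I. lat_le S T} (\<lambda>M N. lat_le M N \<and> M \<noteq> N)"
    by (rule transp_onI) (use lat_le_trans lat_le_antisym in blast)
  moreover have "finite {T \<in> I. lat_le S T}" "{T \<in> I. lat_le S T} \<noteq> {}" using assms lat_le_refl by auto
  ultimately obtain T where "T \<in> I" "lat_le S T" "\<And>N. N \<in> I \<Longrightarrow> lat_le S N \<Longrightarrow> lat_le T N \<Longrightarrow> N = T"
    using Finite_Set.bex_max_element[of "{T \<in> I. lat_le S T}" "\<lambda>M N. lat_le M N \<and> M \<noteq> N"] by auto
  then show ?thesis using that[of T] lat_le_trans by (auto simp: maximal_elements_def)
qed

text \<open>At each vertex, the greatest subrepresentation with surjective arrow maps.\<close>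

inductive red_max :: "('a, 'b) pre_digraph \<Rightarrow> ('a, 'b, 'k :: field) rep \<Rightarrow> 'a \<Rightarrow> 'b lat_elem \<Rightarrow> 'b red_path \<Rightarrow> 'k vec \<Rightarrow> bool"
  for Q V x M where
  "rk Q V x M (col_mat v) \<Longrightarrow> red_max Q V x M [] v"
| "rk Q V (tail Q \<alpha>) S (col_mat v) \<Longrightarrow> red_max Q V x M p (rmap V \<alpha> *\<^sub>v v) \<Longrightarrow> red_max Q V x M (p @ [(\<alpha>, S)]) v"

lemma red_max_Nil: "red_max Q V x M [] v \<longleftrightarrow> rk Q V x M (col_mat v)"
  by (subst red_max.simps) auto

lemma red_max_snoc: "red_max Q V x M (p @ [(\<alpha>, S)]) v \<longleftrightarrow>
    rk Q V (tail Q \<alpha>) S (col_mat v) \<and> red_max Q V x M p (rmap V \<alpha> *\<^sub>v v)"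
  by (subst red_max.simps) auto

lemma red_max_rk: "red_max Q V x M p v \<Longrightarrow> rk Q V (struct_vert Q x p) (end_lat M p) (col_mat v)"
  by (erule red_max.cases) auto

context quiver
begin

lemma chain_end:
  assumes M: "lat_at Q x M" and x: "x \<in> verts Q"
  shows "chain M p \<Longrightarrow> lat_at Q (struct_vert Q x p) (end_lat M p) \<and> struct_vert Q x p \<in> verts Q"
proof (induction p rule: rev_induct)
  case (snoc b p)
  obtain \<alpha> S where b: "b = (\<alpha>, S)" by (cases b)
  have c: "chain M p" "S |\<in>| component (end_lat M p) \<alpha>"
    using snoc.prems unfolding b chain_snoc by (auto simp: maximal_elements_def)
  have "lat_at Q (struct_vert Q x p) (end_lat M p)" using snoc.IH[OF c(1)] by blast
  then have a: "\<alpha> \<in> in_arcs Q (struct_vert Q x p) \<and> lat_at Q (tail Q \<alpha>) S" by (rule lat_at.cases) (use c(2) in blast)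
  show ?case using a in_arcsD[OF conjunct1[OF a]] by (simp add: b)
qed (use assms in simp)

lemma chain_arc:
  assumes M: "lat_at Q x M" and x: "x \<in> verts Q" and c: "chain M (p @ [(\<alpha>, S)])"
  shows "S |\<in>| component (end_lat M p) \<alpha>" "\<alpha> \<in> arcs Q" "head Q \<alpha> = struct_vert Q x p" "tail Q \<alpha> \<in> verts Q"
proof -
  have p: "chain M p" and S: "S |\<in>| component (end_lat M p) \<alpha>" using c by (auto simp: chain_snoc maximal_elements_def)
  have "lat_at Q (struct_vert Q x p) (end_lat M p)" using chain_end[OF M x p] by blast
  then have a: "\<alpha> \<in> in_arcs Q (struct_vert Q x p)" by (rule lat_at.cases) (use S in blast)
  show "\<alpha> \<in> arcs Q" "head Q \<alpha> = struct_vert Q x p" "tail Q \<alpha> \<in> verts Q" using in_arcsD[OF a] by simp_all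
  show "S |\<in>| component (end_lat M p) \<alpha>" by (rule S)
qed

lemma red_max_subspace:
  fixes V :: "('a, 'b, 'k::field) rep"
  assumes V: "is_rep Q V" and M: "lat_at Q x M" and x: "x \<in> verts Q"
  shows "chain M p \<Longrightarrow> mat_subspace (rdim V (struct_vert Q x p)) (col_mat ` {v. red_max Q V x M p v})"
proof (induction p rule: rev_induct)
  case Nil
  have "col_mat ` {v. red_max Q V x M [] v} = {u. rk Q V x M u}"
  proof (intro equalityI subsetI)
    fix u assume "u \<in> {u. rk Q V x M u}"
    then have u: "rk Q V x M u" by simp
    obtain v where "col_mat v = u" by (rule col_mat_surj[OF rk_carrier[OF u]])
    then show "u \<in> col_mat ` {v. red_max Q V x M [] v}" using u by (auto simp: red_max_Nil)
  qed (auto simp: red_max_Nil)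
  then show ?case using rk_subspace[OF V M] by simp
next
  case (snoc b p)
  obtain \<alpha> S where b: "b = (\<alpha>, S)" by (cases b)
  have c: "chain M (p @ [(\<alpha>, S)])" using snoc.prems b by simp
  then have p: "chain M p" by (simp add: chain_snoc)
  note a = chain_arc[OF M x c]
  have r: "rmap V \<alpha> \<in> carrier_mat (rdim V (struct_vert Q x p)) (rdim V (tail Q \<alpha>))" using is_repD[OF V a(2)] a(3) by simp
  have S: "mat_subspace (rdim V (tail Q \<alpha>)) {u. rk Q V (tail Q \<alpha>) S u}"
    by (rule rk_subspace[OF V]) (use chain_end[OF M x c] in simp)
  have eq: "col_mat ` {v. red_max Q V x M (p @ [(\<alpha>, S)]) v} =
    {u. rk Q V (tail Q \<alpha>) S u \<and> rmap V \<alpha> * u \<in> col_mat ` {v. red_max Q V x M p v}}"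
  proof (intro equalityI subsetI)
    fix u assume "u \<in> col_mat ` {v. red_max Q V x M (p @ [(\<alpha>, S)]) v}"
    then obtain v where v: "u = col_mat v" "rk Q V (tail Q \<alpha>) S (col_mat v)" "red_max Q V x M p (rmap V \<alpha> *\<^sub>v v)"
      by (auto simp: red_max_snoc)
    have "v \<in> carrier_vec (rdim V (tail Q \<alpha>))" using rk_carrier[OF v(2)] by (simp only: col_mat_carrier)
    then have "rmap V \<alpha> * u = col_mat (rmap V \<alpha> *\<^sub>v v)" using col_mat_mult[OF r] v(1) by simp
    then show "u \<in> {u. rk Q V (tail Q \<alpha>) S u \<and> rmap V \<alpha> * u \<in> col_mat ` {v. red_max Q V x M p v}}" using v by blast
  next
    fix u assume "u \<in> {u. rk Q V (tail Q \<alpha>) S u \<and> rmap V \<alpha> * u \<in> col_mat ` {v. red_max Q V x M p v}}"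
    then obtain w where u: "rk Q V (tail Q \<alpha>) S u" "rmap V \<alpha> * u = col_mat w" "red_max Q V x M p w" by blast
    obtain v where v: "v \<in> carrier_vec (rdim V (tail Q \<alpha>))" "col_mat v = u" by (rule col_mat_surj[OF rk_carrier[OF u(1)]])
    have "rmap V \<alpha> *\<^sub>v v = w" using col_mat_mult[OF r v(1)] u(2) v(2) col_mat_inject by metis
    then show "u \<in> col_mat ` {v. red_max Q V x M (p @ [(\<alpha>, S)]) v}" using u v(2) by (auto simp: red_max_snoc)
  qed
  note s1 = S[unfolded mat_subspace_def] and s2 = snoc.IH[OF p, unfolded mat_subspace_def]
  have add: "rmap V \<alpha> * (u + v) = rmap V \<alpha> * u + rmap V \<alpha> * v" if "rk Q V (tail Q \<alpha>) S u" "rk Q V (tail Q \<alpha>) S v" for u v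
    by (rule mat_distrib_left) (use rk_carrier[OF that(1)] rk_carrier[OF that(2)] r in auto)
  have sm: "rmap V \<alpha> * (k \<cdot>\<^sub>m u) = k \<cdot>\<^sub>m (rmap V \<alpha> * u)" if "rk Q V (tail Q \<alpha>) S u" for k u
    by (rule mat_smult_right) (use rk_carrier[OF that] r in auto)
  have ze: "rmap V \<alpha> * 0\<^sub>m (rdim V (tail Q \<alpha>)) 1 = 0\<^sub>m (rdim V (struct_vert Q x p)) 1" using r by (simp add: mat_zero_right)
  show ?case
    unfolding b eq struct_simps mat_subspace_def
  proof (intro conjI subsetI ballI allI)
    fix u v assume "u \<in> {u. rk Q V (tail Q \<alpha>) S u \<and> rmap V \<alpha> * u \<in> col_mat ` {v. red_max Q V x M p v}}"
      "v \<in> {u. rk Q V (tail Q \<alpha>) S u \<and> rmap V \<alpha> * u \<in> col_mat ` {v. red_max Q V x M p v}}"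
    then have u: "rk Q V (tail Q \<alpha>) S u" "rmap V \<alpha> * u \<in> col_mat ` {v. red_max Q V x M p v}"
      and v: "rk Q V (tail Q \<alpha>) S v" "rmap V \<alpha> * v \<in> col_mat ` {v. red_max Q V x M p v}" by blast+
    have "rk Q V (tail Q \<alpha>) S (u + v)" using s1 u(1) v(1) by blast
    moreover have "rmap V \<alpha> * (u + v) \<in> col_mat ` {v. red_max Q V x M p v}" unfolding add[OF u(1) v(1)] using s2 u(2) v(2) by blast
    ultimately show "u + v \<in> {u. rk Q V (tail Q \<alpha>) S u \<and> rmap V \<alpha> * u \<in> col_mat ` {v. red_max Q V x M p v}}" by blast
  next
    fix k u assume "u \<in> {u. rk Q V (tail Q \<alpha>) S u \<and> rmap V \<alpha> * u \<in> col_mat ` {v. red_max Q V x M p v}}"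
    then have u: "rk Q V (tail Q \<alpha>) S u" "rmap V \<alpha> * u \<in> col_mat ` {v. red_max Q V x M p v}" by blast+
    have "rk Q V (tail Q \<alpha>) S (k \<cdot>\<^sub>m u)" using s1 u(1) by blast
    moreover have "rmap V \<alpha> * (k \<cdot>\<^sub>m u) \<in> col_mat ` {v. red_max Q V x M p v}" unfolding sm[OF u(1)] using s2 u(2) by blast
    ultimately show "k \<cdot>\<^sub>m u \<in> {u. rk Q V (tail Q \<alpha>) S u \<and> rmap V \<alpha> * u \<in> col_mat ` {v. red_max Q V x M p v}}" by blast
  next
    fix u assume "u \<in> {u. rk Q V (tail Q \<alpha>) S u \<and> rmap V \<alpha> * u \<in> col_mat ` {v. red_max Q V x M p v}}"
    then have "rk Q V (tail Q \<alpha>) S u" by blast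
    then show "u \<in> carrier_mat (rdim V (tail Q \<alpha>)) 1" by (rule rk_carrier)
  next
    have "rk Q V (tail Q \<alpha>) S (0\<^sub>m (rdim V (tail Q \<alpha>)) 1)" using s1 by blast
    moreover have "rmap V \<alpha> * 0\<^sub>m (rdim V (tail Q \<alpha>)) 1 \<in> col_mat ` {v. red_max Q V x M p v}" unfolding ze using s2 by blast
    ultimately show "0\<^sub>m (rdim V (tail Q \<alpha>)) 1 \<in> {u. rk Q V (tail Q \<alpha>) S u \<and> rmap V \<alpha> * u \<in> col_mat ` {v. red_max Q V x M p v}}" by blast
  qed
qed

text \<open>Membership in \<open>red_max\<close> combines two conditions: liftability away from the
  root, which follows from surjectivity of the arrow maps, and control of the images towards the
  root, which follows from closure under them.\<close>

lemma epi_subrep_le: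
  fixes V :: "('a, 'b, 'k::field) rep"
  assumes V: "is_rep Q V" and M: "lat_at Q x M" and x: "x \<in> verts Q"
    and U: "epi_subrep (red_quiver M) (pullback (struct_vert Q x) struct_arc V) U"
  shows "chain M p \<Longrightarrow> U p \<subseteq> {v. red_max Q V x M p v}"
proof -
  let ?W = "pullback (struct_vert Q x) struct_arc V"
  have sub: "VectorSpace.subspace class_ring (U p) (module_vec TYPE('k) (rdim V (struct_vert Q x p)))" if "chain M p" for p
    using U that by (simp add: epi_subrep_def subrep_def red_quiver_verts)
  have im: "(\<lambda>v. rmap V \<alpha> *\<^sub>v v) ` U (p @ [(\<alpha>, S)]) = U p" if "chain M (p @ [(\<alpha>, S)])" for p \<alpha> S
  proof -
    have "\<forall>a \<in> arcs (red_quiver M). (\<lambda>v. rmap ?W a *\<^sub>v v) ` U (tail (red_quiver M) a) = U (head (red_quiver M) a)"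
      using U by (simp add: epi_subrep_def)
    then have "(\<lambda>v. rmap ?W (p @ [(\<alpha>, S)]) *\<^sub>v v) ` U (tail (red_quiver M) (p @ [(\<alpha>, S)])) = U (head (red_quiver M) (p @ [(\<alpha>, S)]))"
      by (rule bspec) (use that in \<open>simp add: red_quiver_arcs\<close>)
    then show ?thesis by simp
  qed
  have car: "U p \<subseteq> carrier_vec (rdim V (struct_vert Q x p))" if "chain M p" for p
    using sub[OF that] by (auto simp: subspace_def submodule_def module_vec_simps)
  \<comment> \<open>The quiver has arrows only for maximal elements \<open>T'\<close> of a
    component, so an arbitrary \<open>T\<close> is placed below some \<open>T'\<close>; a lift into
    the rank space of \<open>T'\<close> also lies in that of \<open>T\<close>.\<close>
  have rk: "rk Q V (struct_vert Q x p) S (col_mat v)" if "chain M p" "v \<in> U p" "end_lat M p = S" for p v S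
    using wf_lat_sub that
  proof (induction S arbitrary: p v rule: wf_induct_rule)
    case (less S)
    have vc: "v \<in> carrier_vec (rdim V (struct_vert Q x p))" using car less.prems(1,2) by blast
    show ?case
    proof (rule rkI, goal_cases)
      case 1
      show ?case using vc by (simp only: col_mat_carrier)
    next
      case 2
      show ?case
      proof (intro allI impI)
        fix \<alpha> T assume T: "T |\<in>| component S \<alpha>"
        then obtain T' where T': "T' \<in> maximal_elements lat_le (fset (component S \<alpha>))" "lat_le T T'"
          using maximal_above[of "fset (component S \<alpha>)" T] by auto
        have c: "chain M (p @ [(\<alpha>, T')])" using less.prems(1,3) T'(1) by (simp add: chain_snoc)
        obtain w where w: "w \<in> U (p @ [(\<alpha>, T')])" "v = rmap V \<alpha> *\<^sub>v w" using im[OF c] less.prems(2) by blast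
        have "(T', S) \<in> lat_sub" using T'(1) by (auto simp: lat_sub_def maximal_elements_def)
        from less.IH[OF this c w(1)] have "rk Q V (tail Q \<alpha>) T' (col_mat w)" by simp
        then have "rk Q V (tail Q \<alpha>) T (col_mat w)" by (rule rk_antimono[OF T'(2)])
        moreover have "col_mat v = rmap V \<alpha> * col_mat w"
          unfolding w(2)
        proof (rule col_mat_mult)
          show "rmap V \<alpha> \<in> carrier_mat (rdim V (struct_vert Q x p)) (rdim V (tail Q \<alpha>))"
            using is_repD[OF V chain_arc(2)[OF M x c]] chain_arc(3)[OF M x c] by simp
          show "w \<in> carrier_vec (rdim V (tail Q \<alpha>))" using car[OF c] w(1) by auto
        qed
        ultimately show "\<exists>u. rk Q V (tail Q \<alpha>) T u \<and> col_mat v = rmap V \<alpha> * u" by blast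
      qed
    qed
  qed
  show "chain M p \<Longrightarrow> U p \<subseteq> {v. red_max Q V x M p v}"
  proof (induction p rule: rev_induct)
    case Nil
    show ?case using rk[OF Nil _ refl] by (auto simp: red_max_Nil)
  next
    case (snoc b p)
    obtain \<alpha> S where b: "b = (\<alpha>, S)" by (cases b)
    have c: "chain M (p @ [(\<alpha>, S)])" using snoc.prems b by simp
    have p: "chain M p" using c by (simp add: chain_snoc)
    show ?case
    proof
      fix v assume v: "v \<in> U (p @ [b])"
      have "rk Q V (tail Q \<alpha>) S (col_mat v)" using rk[OF c _ refl, of v] v b by simp
      moreover have "rmap V \<alpha> *\<^sub>v v \<in> U p" using im[OF c] v b by blast
      ultimately show "v \<in> {v. red_max Q V x M (p @ [b]) v}" using snoc.IH[OF p] by (auto simp: b red_max_snoc)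
    qed
  qed
qed

text \<open>\<open>red_max\<close> is itself surjective along arrows: a vector at \<open>p\<close>
  lies in the rank space of \<open>end_lat M p\<close>, so it has a preimage in the rank space for
  the next step, and that preimage satisfies both conditions of \<open>red_max_snoc\<close>.\<close>

lemma max_epi_subrep_red:
  fixes V :: "('a, 'b, 'k::field) rep"
  assumes V: "is_rep Q V" and M: "lat_at Q x M" and x: "x \<in> verts Q"
  shows "max_epi_subrep (red_quiver M) (pullback (struct_vert Q x) struct_arc V) =
    (\<lambda>p \<in> verts (red_quiver M). {v. red_max Q V x M p v})"
  unfolding max_epi_subrep_def
proof (rule Greatest_equality)
  let ?W = "pullback (struct_vert Q x) struct_arc V"
  let ?E = "\<lambda>p \<in> verts (red_quiver M). {v. red_max Q V x M p v}"
  have Ev: "?E p = {v. red_max Q V x M p v}" if "chain M p" for p using that by (simp add: red_quiver_verts)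
  have sub: "VectorSpace.subspace class_ring {v. red_max Q V x M p v} (module_vec TYPE('k) (rdim V (struct_vert Q x p)))"
    if "chain M p" for p
  proof -
    have "{v. col_mat v \<in> col_mat ` {v. red_max Q V x M p v}} = {v. red_max Q V x M p v}"
      by (auto simp: col_mat_inject)
    then show ?thesis using vec_subspaceI[OF red_max_subspace[OF V M x that]] by simp
  qed
  have im: "(\<lambda>v. rmap V \<alpha> *\<^sub>v v) ` {v. red_max Q V x M (p @ [(\<alpha>, S)]) v} = {v. red_max Q V x M p v}"
    if c: "chain M (p @ [(\<alpha>, S)])" for p \<alpha> S
  proof (intro equalityI subsetI)
    note a = chain_arc[OF M x c]
    have r: "rmap V \<alpha> \<in> carrier_mat (rdim V (struct_vert Q x p)) (rdim V (tail Q \<alpha>))" using is_repD[OF V a(2)] a(3) by simp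
    fix v assume "v \<in> {v. red_max Q V x M p v}"
    then have v: "red_max Q V x M p v" by simp
    obtain u where u: "rk Q V (tail Q \<alpha>) S u" "col_mat v = rmap V \<alpha> * u" using rkD[OF red_max_rk[OF v] a(1)] by blast
    obtain w where w: "w \<in> carrier_vec (rdim V (tail Q \<alpha>))" "col_mat w = u" by (rule col_mat_surj[OF rk_carrier[OF u(1)]])
    have e: "rmap V \<alpha> *\<^sub>v w = v" using col_mat_mult[OF r w(1)] u(2) w(2) col_mat_inject by metis
    then have "red_max Q V x M (p @ [(\<alpha>, S)]) w" using v u(1) w(2) by (simp add: red_max_snoc)
    then show "v \<in> (\<lambda>v. rmap V \<alpha> *\<^sub>v v) ` {v. red_max Q V x M (p @ [(\<alpha>, S)]) v}" using e by blast
  qed (auto simp: red_max_snoc)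
  have arc: "(\<lambda>v. rmap ?W a *\<^sub>v v) ` ?E (tail (red_quiver M) a) = ?E (head (red_quiver M) a)" if "a \<in> arcs (red_quiver M)" for a
  proof -
    have a: "chain M a" "a \<noteq> []" using that by (auto simp: red_quiver_arcs)
    then obtain p \<alpha> S where e: "a = p @ [(\<alpha>, S)]" by (metis rev_exhaust surj_pair)
    have c: "chain M (p @ [(\<alpha>, S)])" using a e by simp
    have p: "chain M p" using c by (simp add: chain_snoc)
    show ?thesis using im[OF c] Ev[OF c] Ev[OF p] by (simp add: e)
  qed
  show "epi_subrep (red_quiver M) ?W ?E"
    unfolding epi_subrep_def subrep_def
  proof (intro conjI ballI)
    fix p assume "p \<in> verts (red_quiver M)"
    then have c: "chain M p" by (simp add: red_quiver_verts)
    show "VectorSpace.subspace class_ring (?E p) (module_vec TYPE('k) (rdim ?W p))"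
      unfolding Ev[OF c] pullback_simps by (rule sub[OF c])
  next
    fix a assume a: "a \<in> arcs (red_quiver M)"
    show "(\<lambda>v. rmap ?W a *\<^sub>v v) ` ?E (tail (red_quiver M) a) \<subseteq> ?E (head (red_quiver M) a)" unfolding arc[OF a] ..
    show "(\<lambda>v. rmap ?W a *\<^sub>v v) ` ?E (tail (red_quiver M) a) = ?E (head (red_quiver M) a)" by (rule arc[OF a])
  qed (rule restrict_extensional)
  fix U assume U: "epi_subrep (red_quiver M) ?W U"
  show "U \<le> ?E"
  proof (rule le_funI)
    fix p
    show "U p \<le> ?E p"
    proof (cases "p \<in> verts (red_quiver M)")
      case True
      then have c: "chain M p" by (simp add: red_quiver_verts)
      show ?thesis unfolding Ev[OF c] by (rule epi_subrep_le[OF V M x U c])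
    next
      \<comment> \<open>Off the vertices both families take the value \<open>undefined\<close> by
        extensionality, so the pointwise comparison holds there as well.\<close>
      case False
      have "U \<in> extensional (verts (red_quiver M))" using U by (simp add: epi_subrep_def subrep_def)
      then have "U p = undefined" using False by (rule extensional_arb)
      then show ?thesis using False by (simp add: restrict_def)
    qed
  qed
qed

lemma red_rank_eq_rkdim:
  fixes V :: "('a, 'b, 'k::field) rep"
  assumes V: "is_rep Q V" and M: "lat_at Q x M" and x: "x \<in> verts Q"
  shows "red_rank Q (x, M) V = rkdim Q V x M"
proof -
  have "red_rank_space Q (x, M) V = {v. col_mat v \<in> {u. rk Q V x M u}}"
    unfolding red_rank_space_def rank_space_def prod.case max_epi_subrep_red[OF V M x]
    by (auto simp: red_quiver_verts red_max_Nil)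
  moreover obtain B C where f: "frame (rdim V x) {u. rk Q V x M u} (rkdim Q V x M) B C" by (rule rkdim_frame[OF V M])
  ultimately show ?thesis
    unfolding red_rank_def prod.case using dim_frame[OF f rk_subspace[OF V M]] by simp
qed

end

theorem corollary50:
  fixes K :: "'k :: field itself"
    and Q :: "('a, 'b) pre_digraph"
    and \<sigma> :: 'a
  assumes "rooted_tree Q \<sigma>"
  shows "cring (rep_ring_red K Q) \<and>
    (\<exists>\<Phi> \<in> ring_iso (rep_ring_red K Q) (int_product_ring (lattice_coprod Q)).
      \<forall>V \<in> reps K Q.
        \<Phi> (rep_ring_red_class K Q V) = (\<lambda>M \<in> lattice_coprod Q. int (red_rank Q M V))) \<and>
    (\<exists>B. finite B \<and> B \<subseteq> carrier (rep_ring_red K Q) \<and>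
      generate (add_monoid (rep_ring_red K Q)) B = carrier (rep_ring_red K Q))"
proof -
  interpret rooted Q \<sigma> by (rule rooted.intro[OF assms])
  interpret rtree_over Q "vertex_lattice Q" K by unfold_locales
  have I: "lattice_coprod Q = Lq" by (simp add: lattice_coprod_def Lq_def)
  have at: "lat_at Q (fst p) (snd p)" "fst p \<in> verts Q" if "p \<in> Lq" for p
    using that by (auto simp: Lq_def intro!: L_lat_at)
  have "cring (rep_ring_red K Q) \<and>
    (\<exists>\<Phi> \<in> ring_iso (rep_ring_red K Q) (int_product_ring Lq).
      \<forall>V \<in> reps K Q. \<Phi> (rep_ring_red_class K Q V) = (\<lambda>p \<in> Lq. int (rkdim Q V (fst p) (snd p)))) \<and>
    (\<exists>B. finite B \<and> B \<subseteq> carrier (rep_ring_red K Q) \<and>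
      generate (add_monoid (rep_ring_red K Q)) B = carrier (rep_ring_red K Q))"
    by (rule rep_ring_red_iso[OF finite_Lq rkdim_iso[OF _ at] rkdim_dsum[OF _ _ at] rkdim_tensor[OF _ _ at(1)]
      rkdim_unit[OF at(1)] evr_kernel_nilpotent evr_surj])
  moreover have "(\<lambda>M \<in> Lq. int (red_rank Q M V)) = (\<lambda>p \<in> Lq. int (rkdim Q V (fst p) (snd p)))"
    if V: "V \<in> reps K Q" for V
  proof (rule restrict_ext)
    fix p assume p: "p \<in> Lq"
    have "is_rep Q V" using V by (simp add: reps_def)
    from red_rank_eq_rkdim[OF this at[OF p]] show "int (red_rank Q p V) = int (rkdim Q V (fst p) (snd p))" by simp
  qed
  ultimately show ?thesis unfolding I by simp
qed

end
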